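(* The operator $A$ has the following spectral properties: (i) $\sigma(A)=\bigcup_{t\in[-\pi,\pi]}\sigma(A(t))=\bigcup_{t\in[0,\pi]}\sigma(A(t))=\{\lambda\in\mathbb C: D(\lambda)\in[-2,2]\}$. (ii) $\sigma(A)=\sigma_c(A)$, i.e. the spectrum of $A$ is purely continuous. (iii) $\sigma(A)$ contains neither interior nor isolated points. (iv) $\sigma(A)$ consists of closures of analytic curves. (v) $\rho(A)$ does not have bounded connected components. (vi) If the weight function $w$ is indefinite, then the real spectrum $\sigma(A)\cap\mathbb R$ of $A$ is neither bounded from above nor from below.
   Context: Setting. Let $a>0$ and let $w,p,q:\mathbb R\to\mathbb R$ be measurable and $a$-periodic, with $w,q,p^{-1}$ integrable over $(0,a)$, $w\neq0$ a.e. and $p>0$ a.e. The weight $w$ is called indefinite if neither $w>0$ a.e. nor $w<0$ a.e. on $(0,a)$. Put $\mathfrak a(f):=\frac1w\big(-(pf')'+qf\big)$. $L^2_{|w|}(\mathbb R)$ has scalar product $(f,g)=\int_{\mathbb R}f\overline g|w|\,dx$. The maximal operator $A$ is $Af:=\mathfrak a(f)$, $\operatorname{dom}A=\{f\in L^2_{|w|}(\mathbb R): f,pf'\in AC_{\rm loc}(\mathbb R),\ \mathfrak a(f)\in L^2_{|w|}(\mathbb R)\}$. Let $\mathcal H_a:=L^2_{|w|}(0,a)$ (scalar product $\int_0^af\overline g|w|\,dx$), and for $t\in\mathbb R$ let $A(t)f:=\mathfrak a(f)$ with $\operatorname{dom}A(t)=\{f\in\mathcal H_a: f,pf'\in AC([0,a]),\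 \mathfrak a(f)\in\mathcal H_a,\ f(a)=e^{it}f(0),\ (pf')(a)=e^{it}(pf')(0)\}$. For $\lambda\in\mathbb C$, $\varphi_\lambda,\psi_\lambda$ are the solutions of $\mathfrak a(u)=\lambda u$ with $\varphi_\lambda(0)=1$, $(p\varphi_\lambda')(0)=0$, $\psi_\lambda(0)=0$, $(p\psi_\lambda')(0)=1$, and the Floquet discriminant is $D(\lambda)=\varphi_\lambda(a)+(p\psi_\lambda')(a)$. A curve is a continuous map $\gamma:\mathcal J\to\mathbb C$ on a real (bounded or unbounded) interval $\mathcal J$, identified with its image; it is called analytic if it is injective and analytic at each point of the interior of $\mathcal J$. *)

theory Defs
  imports "HOL-Analysis.Analysis"
begin

section \<open>Unbounded operators in L2 spaces\<close>

text \<open>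
  Elements of the complex space $L^2(M)$ are handled through representatives, equality in the
  Hilbert space being equality almost everywhere. A (linear, in general unbounded) operator is
  given by the set \<open>D\<close> of representatives of the elements of its domain together with its
  action \<open>T\<close>.
\<close>

definition L2_space :: "'a measure \<Rightarrow> ('a \<Rightarrow> complex) set" where
  "L2_space M = {f \<in> borel_measurable M. integrable M (\<lambda>x. (norm (f x))\<^sup>2)}"

definition L2_norm :: "'a measure \<Rightarrow> ('a \<Rightarrow> complex) \<Rightarrow> real" where
  "L2_norm M f = sqrt (\<integral>x. (norm (f x))\<^sup>2 \<partial>M)"

definition op_shift ::
    "(('a \<Rightarrow> complex) \<Rightarrow> ('a \<Rightarrow> complex)) \<Rightarrow> complex \<Rightarrow> ('a \<Rightarrow> complex) \<Rightarrow> ('a \<Rightarrow> complex)" where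
  "op_shift T l f = (\<lambda>x. T f x - l * f x)"

definition op_injective ::
    "'a measure \<Rightarrow> ('a \<Rightarrow> complex) set \<Rightarrow> (('a \<Rightarrow> complex) \<Rightarrow> ('a \<Rightarrow> complex)) \<Rightarrow> bool" where
  "op_injective M D T \<longleftrightarrow>
     (\<forall>f\<in>D. \<forall>g\<in>D. (AE x in M. T f x = T g x) \<longrightarrow> (AE x in M. f x = g x))"

definition op_surjective ::
    "'a measure \<Rightarrow> ('a \<Rightarrow> complex) set \<Rightarrow> (('a \<Rightarrow> complex) \<Rightarrow> ('a \<Rightarrow> complex)) \<Rightarrow> bool" where
  "op_surjective M D T \<longleftrightarrow> (\<forall>h\<in>L2_space M. \<exists>f\<in>D. AE x in M. T f x = h x)"

definition op_dense_range ::
    "'a measure \<Rightarrow> ('a \<Rightarrow> complex) set \<Rightarrow> (('a \<Rightarrow> complex) \<Rightarrow> ('a \<Rightarrow> complex)) \<Rightarrow> bool" where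
  "op_dense_range M D T \<longleftrightarrow>
     (\<forall>h\<in>L2_space M. \<forall>\<epsilon>>0. \<exists>f\<in>D. L2_norm M (\<lambda>x. T f x - h x) < \<epsilon>)"

text \<open>For injective \<open>T\<close> this is boundedness of the inverse on the range of \<open>T\<close>.\<close>

definition op_bounded_inverse ::
    "'a measure \<Rightarrow> ('a \<Rightarrow> complex) set \<Rightarrow> (('a \<Rightarrow> complex) \<Rightarrow> ('a \<Rightarrow> complex)) \<Rightarrow> bool" where
  "op_bounded_inverse M D T \<longleftrightarrow> (\<exists>C. \<forall>f\<in>D. L2_norm M f \<le> C * L2_norm M (T f))"

definition resolvent_set ::
    "'a measure \<Rightarrow> ('a \<Rightarrow> complex) set \<Rightarrow> (('a \<Rightarrow> complex) \<Rightarrow> ('a \<Rightarrow> complex)) \<Rightarrow> complex set" where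
  "resolvent_set M D T =
     {l. op_injective M D (op_shift T l) \<and> op_surjective M D (op_shift T l)
         \<and> op_bounded_inverse M D (op_shift T l)}"

definition op_spectrum ::
    "'a measure \<Rightarrow> ('a \<Rightarrow> complex) set \<Rightarrow> (('a \<Rightarrow> complex) \<Rightarrow> ('a \<Rightarrow> complex)) \<Rightarrow> complex set" where
  "op_spectrum M D T = - resolvent_set M D T"

definition continuous_spectrum ::
    "'a measure \<Rightarrow> ('a \<Rightarrow> complex) set \<Rightarrow> (('a \<Rightarrow> complex) \<Rightarrow> ('a \<Rightarrow> complex)) \<Rightarrow> complex set" where
  "continuous_spectrum M D T =
     {l \<in> op_spectrum M D T. op_injective M D (op_shift T l) \<and> op_dense_range M D (op_shift T l)}"


section \<open>Sturm-Liouville expressions\<close>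

definition AC_Icc :: "real \<Rightarrow> real \<Rightarrow> (real \<Rightarrow> complex) \<Rightarrow> bool" where
  "AC_Icc c d f \<longleftrightarrow>
     (\<forall>\<epsilon>>0. \<exists>\<delta>>0. \<forall>(n::nat) x y.
        (\<forall>i<n. c \<le> x i \<and> x i \<le> y i \<and> y i \<le> d) \<and>
        (\<forall>i<n. \<forall>j<n. i \<noteq> j \<longrightarrow> {x i<..<y i} \<inter> {x j<..<y j} = {}) \<and>
        (\<Sum>i<n. y i - x i) < \<delta>
        \<longrightarrow> (\<Sum>i<n. norm (f (y i) - f (x i))) < \<epsilon>)"

text \<open>
  For a compact interval \<open>I\<close> this is absolute continuity on \<open>I\<close>; for \<open>I = UNIV\<close> it is
  membership in $AC_{loc}(R)$.
\<close>

definition AC_loc :: "real set \<Rightarrow> (real \<Rightarrow> complex) \<Rightarrow> bool" where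
  "AC_loc I f \<longleftrightarrow> (\<forall>c d. c \<le> d \<and> {c..d} \<subseteq> I \<longrightarrow> AC_Icc c d f)"

text \<open>
  The product $p f'$ is only defined almost everywhere; that it is absolutely continuous means
  that it has an absolutely continuous representative \<open>h\<close>. On \<open>I\<close> this \<open>h\<close> is unique, and it is
  the function that is evaluated in initial and boundary conditions.
\<close>

definition is_quasi_deriv ::
    "(real \<Rightarrow> real) \<Rightarrow> real set \<Rightarrow> (real \<Rightarrow> complex) \<Rightarrow> (real \<Rightarrow> complex) \<Rightarrow> bool" where
  "is_quasi_deriv p I f h \<longleftrightarrow>
     AC_loc I h \<and>
     (AE x in lebesgue_on I. h x = of_real (p x) * vector_derivative f (at x within I))"

definition quasi_deriv ::
    "(real \<Rightarrow> real) \<Rightarrow> real set \<Rightarrow> (real \<Rightarrow> complex) \<Rightarrow> (real \<Rightarrow> complex)" where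
  "quasi_deriv p I f = (SOME h. is_quasi_deriv p I f h)"

definition sl_regular :: "(real \<Rightarrow> real) \<Rightarrow> real set \<Rightarrow> (real \<Rightarrow> complex) \<Rightarrow> bool" where
  "sl_regular p I f \<longleftrightarrow> AC_loc I f \<and> (\<exists>h. is_quasi_deriv p I f h)"

definition sl_expr ::
    "(real \<Rightarrow> real) \<Rightarrow> (real \<Rightarrow> real) \<Rightarrow> (real \<Rightarrow> real) \<Rightarrow> real set
      \<Rightarrow> (real \<Rightarrow> complex) \<Rightarrow> (real \<Rightarrow> complex)" where
  "sl_expr w p q I f = (\<lambda>x.
     (- vector_derivative (quasi_deriv p I f) (at x within I) + of_real (q x) * f x)
       / of_real (w x))"

definition weight_measure :: "(real \<Rightarrow> real) \<Rightarrow> real set \<Rightarrow> real measure" where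
  "weight_measure w I = density (lebesgue_on I) (\<lambda>x. ennreal \<bar>w x\<bar>)"

definition sl_max_dom ::
    "(real \<Rightarrow> real) \<Rightarrow> (real \<Rightarrow> real) \<Rightarrow> (real \<Rightarrow> real) \<Rightarrow> real set \<Rightarrow> (real \<Rightarrow> complex) set" where
  "sl_max_dom w p q I =
     {f \<in> L2_space (weight_measure w I).
        sl_regular p I f \<and> sl_expr w p q I f \<in> L2_space (weight_measure w I)}"

definition floquet_dom ::
    "(real \<Rightarrow> real) \<Rightarrow> (real \<Rightarrow> real) \<Rightarrow> (real \<Rightarrow> real) \<Rightarrow> real \<Rightarrow> real \<Rightarrow> (real \<Rightarrow> complex) set" where
  "floquet_dom w p q a t =
     {f \<in> sl_max_dom w p q {0..a}.
        f a = exp (\<i> * of_real t) * f 0 \<and>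
        quasi_deriv p {0..a} f a = exp (\<i> * of_real t) * quasi_deriv p {0..a} f 0}"

definition rho_A :: "(real \<Rightarrow> real) \<Rightarrow> (real \<Rightarrow> real) \<Rightarrow> (real \<Rightarrow> real) \<Rightarrow> complex set" where
  "rho_A w p q =
     resolvent_set (weight_measure w UNIV) (sl_max_dom w p q UNIV) (sl_expr w p q UNIV)"

definition sigma_A :: "(real \<Rightarrow> real) \<Rightarrow> (real \<Rightarrow> real) \<Rightarrow> (real \<Rightarrow> real) \<Rightarrow> complex set" where
  "sigma_A w p q =
     op_spectrum (weight_measure w UNIV) (sl_max_dom w p q UNIV) (sl_expr w p q UNIV)"

definition sigma_c_A :: "(real \<Rightarrow> real) \<Rightarrow> (real \<Rightarrow> real) \<Rightarrow> (real \<Rightarrow> real) \<Rightarrow> complex set" where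
  "sigma_c_A w p q =
     continuous_spectrum (weight_measure w UNIV) (sl_max_dom w p q UNIV) (sl_expr w p q UNIV)"

definition sigma_At ::
    "(real \<Rightarrow> real) \<Rightarrow> (real \<Rightarrow> real) \<Rightarrow> (real \<Rightarrow> real) \<Rightarrow> real \<Rightarrow> real \<Rightarrow> complex set" where
  "sigma_At w p q a t =
     op_spectrum (weight_measure w {0..a}) (floquet_dom w p q a t) (sl_expr w p q {0..a})"


section \<open>Floquet discriminant\<close>

definition sl_solution ::
    "(real \<Rightarrow> real) \<Rightarrow> (real \<Rightarrow> real) \<Rightarrow> (real \<Rightarrow> real) \<Rightarrow> complex \<Rightarrow> (real \<Rightarrow> complex) \<Rightarrow> bool" where
  "sl_solution w p q l u \<longleftrightarrow>
     sl_regular p UNIV u \<and> (AE x in lebesgue. sl_expr w p q UNIV u x = l * u x)"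

definition sl_ivp ::
    "(real \<Rightarrow> real) \<Rightarrow> (real \<Rightarrow> real) \<Rightarrow> (real \<Rightarrow> real) \<Rightarrow> complex \<Rightarrow> complex \<Rightarrow> complex
      \<Rightarrow> (real \<Rightarrow> complex)" where
  "sl_ivp w p q l c d =
     (THE u. sl_solution w p q l u \<and> u 0 = c \<and> quasi_deriv p UNIV u 0 = d)"

definition sl_phi ::
    "(real \<Rightarrow> real) \<Rightarrow> (real \<Rightarrow> real) \<Rightarrow> (real \<Rightarrow> real) \<Rightarrow> complex \<Rightarrow> (real \<Rightarrow> complex)" where
  "sl_phi w p q l = sl_ivp w p q l 1 0"

definition sl_psi ::
    "(real \<Rightarrow> real) \<Rightarrow> (real \<Rightarrow> real) \<Rightarrow> (real \<Rightarrow> real) \<Rightarrow> complex \<Rightarrow> (real \<Rightarrow> complex)" where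
  "sl_psi w p q l = sl_ivp w p q l 0 1"

definition floquet_discriminant ::
    "(real \<Rightarrow> real) \<Rightarrow> (real \<Rightarrow> real) \<Rightarrow> (real \<Rightarrow> real) \<Rightarrow> real \<Rightarrow> complex \<Rightarrow> complex" where
  "floquet_discriminant w p q a l =
     sl_phi w p q l a + quasi_deriv p UNIV (sl_psi w p q l) a"


section \<open>Weights and analytic curves\<close>

definition indefinite_weight :: "real \<Rightarrow> (real \<Rightarrow> real) \<Rightarrow> bool" where
  "indefinite_weight a w \<longleftrightarrow>
     \<not> (AE x in lebesgue_on {0<..<a}. w x > 0) \<and> \<not> (AE x in lebesgue_on {0<..<a}. w x < 0)"

definition real_analytic_at :: "(real \<Rightarrow> complex) \<Rightarrow> real \<Rightarrow> bool" where
  "real_analytic_at g t \<longleftrightarrow>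
     (\<exists>r>0. \<exists>c :: nat \<Rightarrow> complex. \<forall>s. \<bar>s - t\<bar> < r \<longrightarrow> (\<lambda>n. c n * of_real (s - t) ^ n) sums g s)"

text \<open>
  The parameter interval \<open>J\<close> must not degenerate to a point: otherwise singletons would be
  analytic curves and every set would be a union of such curves.
\<close>

definition is_analytic_curve :: "complex set \<Rightarrow> bool" where
  "is_analytic_curve S \<longleftrightarrow>
     (\<exists>J g. is_interval J \<and> interior J \<noteq> {} \<and> continuous_on J g \<and> inj_on g J
        \<and> (\<forall>t\<in>interior J. real_analytic_at g t) \<and> S = g ` J)"

end

theory Submission
  imports Defs "HOL-Complex_Analysis.Complex_Analysis"
begin

text \<open>
  Every solution \<open>u\<close> of the differential equation satisfies \<open>u(x + 2a) = D(\<lambda>) u(x + a) - u(x)\<close>, so everything is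
  governed by the entire function \<open>D\<close>. The boundary value problem for \<open>A(t)\<close> has determinant
  \<open>2 cos t - D(\<lambda>)\<close> up to a nonzero factor. If \<open>D(\<lambda>)\<close> is not in \<open>[-2, 2]\<close>, the exponentially decaying
  Floquet solutions give a Green function that is bounded on \<open>L\<^sup>2\<close> by the Schur test. If
  \<open>D(\<lambda>) = 2 cos t\<close>, truncations of a Floquet solution of modulus one show that the inverse is
  unbounded; the recursion excludes eigenfunctions; and the range is dense, because a compactly
  supported \<open>h\<close> can be corrected by a sum \<open>k\<close> of translates of \<open>h\<close> of small norm that has the same
  moments against all solutions, so that \<open>h - k\<close> is the image of a compactly supported function.

  A Pruefer angle of \<open>\<psi>\<^sub>\<lambda>\<close> passes the levels \<open>\<pi>/2 + k\<pi>\<close> only downwards, and Picone's identity forces zeros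
  of \<open>\<psi>\<^sub>\<lambda>\<close> into every interval on which \<open>w\<close> has positive integral once \<open>\<lambda>\<close> is large. Hence if \<open>w > 0\<close> on a
  set of positive measure, then by continuity \<open>\<psi>\<^sub>\<lambda>(a) = 0\<close> for arbitrarily large real \<open>\<lambda>\<close>, where
  \<open>D(\<lambda>) = \<rho> + 1/\<rho>\<close> with \<open>\<rho>\<close> of alternating sign, so \<open>D\<close> crosses \<open>[-2, 2]\<close>; replacing \<open>w\<close> by \<open>-w\<close> replaces
  \<open>\<lambda>\<close> by \<open>-\<lambda>\<close>. In particular \<open>D\<close> is not constant, and the remaining claims are function theory: the open
  mapping theorem, local coordinates in which \<open>D\<close> is \<open>d + \<zeta>\<^sup>n\<close>, and the maximum principle for
  \<open>exp(\<plusminus>iD)\<close>.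
\<close>

section \<open>Lebesgue differentiation\<close>

text \<open>The weight may change sign, so the operators need not be symmetric in L2(|w|): no
  spectral theorem and no adjoint argument is at hand, and inverses, dense ranges and approximate
  eigenfunctions are all built explicitly from solutions. The coefficients are merely locally
  integrable, so p f' exists only through a representative; every operator statement is therefore
  translated into the integral form of a first-order system for the pair (f, p f'). That translation
  rests on the equivalence of epsilon-delta absolute continuity with being a primitive. At D = 2 or
  D = -2 the monodromy matrix need not be diagonalizable. The symmetric sums u(x + n a) + u(x - n a)
  = c_n u(x) with c_n = rho^n + rho^(-n) avoid this case distinction, and since c_(2n) = c_n^2 - 2,
  infinitely many c_n have modulus at least 1. Both the absence of eigenfunctions and the smallness
  of the correction k come from these n. Nonconstancy of D is a by-product of the oscillation
  argument: as w is nonzero almost everywhere, w or -w is positive on a set of positive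
  measure.\<close>

lemma nn_density_small_open:
  fixes h :: "real \<Rightarrow> real"
  assumes h: "integrable lebesgue h" and "0 < \<eta>"
  obtains U where "open U" "{x. h x \<le> 0} \<subseteq> U" "emeasure (density lebesgue (\<lambda>x. ennreal (h x))) U < ennreal \<eta>"
proof -
  let ?\<nu> = "density lebesgue (\<lambda>x. ennreal (h x))"
  define E where "E = {x. h x \<le> 0}"
  have mh[measurable]: "h \<in> borel_measurable lebesgue"
    using h by auto
  have E: "E \<in> sets lebesgue"
  proof -
    have "{x \<in> space lebesgue. h x \<le> 0} \<in> sets lebesgue" by measurable
    then show ?thesis by (simp add: E_def)
  qed
  \<comment> \<open>Outer regularity controls Lebesgue measure only. The limit of the decreasing
    \<open>V n\<close> exceeds \<open>E\<close> by a null set, and on \<open>E\<close> the density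
    vanishes because \<open>ennreal\<close> truncates negative values; continuity from above
    transfers this to \<open>?\<nu>\<close>.\<close>
  have "\<exists>T. open T \<and> E \<subseteq> T \<and> emeasure lebesgue (T - E) < ennreal ((1/2)^n)" for n
  proof -
    have "(0::real) < (1/2)^n" by simp
    from sets_lebesgue_outer_open[OF E this] show ?thesis by blast
  qed
  then obtain T where T: "\<And>n. open (T n)" "\<And>n. E \<subseteq> T n" "\<And>n. emeasure lebesgue (T n - E) < ennreal ((1/2)^n)"
    by metis
  define V where "V n = (\<Inter>k\<le>n. T k)" for n
  have V: "open (V n)" "E \<subseteq> V n" "V n \<subseteq> T n" for n
    using T unfolding V_def by (auto intro!: open_INT)
  have decV: "decseq V"
    unfolding V_def decseq_def by (auto)
  have fin: "emeasure ?\<nu> UNIV \<noteq> \<infinity>"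
  proof -
    have "emeasure ?\<nu> UNIV = (\<integral>\<^sup>+ x. ennreal (h x) \<partial>lebesgue)"
      by (subst emeasure_density) auto
    also have "\<dots> \<le> (\<integral>\<^sup>+ x. ennreal (norm (h x)) \<partial>lebesgue)"
      by (intro nn_integral_mono) (auto intro!: ennreal_leI)
    also have "\<dots> < \<infinity>"
      using h unfolding integrable_iff_bounded by simp
    finally show ?thesis by simp
  qed
  have finV: "emeasure ?\<nu> (V n) \<noteq> \<infinity>" for n
  proof -
    have "emeasure ?\<nu> (V n) \<le> emeasure ?\<nu> UNIV"
      using V(1)[of n] by (intro emeasure_mono) auto
    then show ?thesis using fin by (auto simp: top_unique)
  qed
  have lim: "(\<lambda>n. emeasure ?\<nu> (V n)) \<longlonglongrightarrow> emeasure ?\<nu> (\<Inter>n. V n)"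
    using decV finV V(1) by (intro Lim_emeasure_decseq) (auto)
  have nullset: "(\<Inter>n. V n) - E \<in> null_sets lebesgue"
  proof (rule null_setsI)
    show mm: "(\<Inter>n. V n) - E \<in> sets lebesgue"
      using V(1) E by (intro sets.Diff sets.countable_INT) auto
    have "emeasure lebesgue ((\<Inter>n. V n) - E) \<le> ennreal ((1/2)^n)" for n
    proof -
      have "emeasure lebesgue ((\<Inter>n. V n) - E) \<le> emeasure lebesgue (T n - E)"
        using V(3) T(1)[of n] E by (intro emeasure_mono) auto
      then show ?thesis using T(3)[of n] by simp
    qed
    moreover have "(\<lambda>n. ennreal ((1/2)^n)) \<longlonglongrightarrow> ennreal 0"
      by (intro tendsto_ennrealI LIMSEQ_realpow_zero) auto
    ultimately show "emeasure lebesgue ((\<Inter>n. V n) - E) = 0"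
      by (metis LIMSEQ_le_const ennreal_0 le_zero_eq)
  qed
  have "emeasure ?\<nu> (\<Inter>n. V n) = 0"
  proof -
    have "(\<Inter>n. V n) \<in> null_sets ?\<nu>"
    proof (subst null_sets_density_iff)
      have "AE x in lebesgue. x \<notin> (\<Inter>n. V n) - E"
        using nullset by (rule AE_not_in)
      then have "AE x in lebesgue. x \<in> (\<Inter>n. V n) \<longrightarrow> ennreal (h x) = 0"
        by eventually_elim (auto simp: E_def ennreal_eq_0_iff)
      then show "(\<Inter>n. V n) \<in> sets lebesgue \<and> (AE x in lebesgue. x \<in> (\<Inter>n. V n) \<longrightarrow> ennreal (h x) = 0)"
        using V(1) by (auto intro!: sets.countable_INT)
    qed auto
    then show ?thesis by auto
  qed
  then have "\<forall>\<^sub>F n in sequentially. emeasure ?\<nu> (V n) < ennreal \<eta>"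
    using lim order_tendstoD(2)[OF lim, of "ennreal \<eta>"] \<open>0 < \<eta>\<close> by simp
  then obtain n where "emeasure ?\<nu> (V n) < ennreal \<eta>"
    by (auto simp: eventually_sequentially)
  with V[of n] show thesis by (intro that[of "V n"]) (auto simp: E_def)
qed

text \<open>Vitali covering: the exceptional zeros of \<open>h\<close> are covered, up to a null
  set, by disjoint balls on which the mass of h dx is large compared with the length. All balls lie
  in an open set of tiny mass, so their total length is tiny.\<close>

lemma AE_average_zero:
  fixes h :: "real \<Rightarrow> real"
  assumes h: "integrable lebesgue h" and h0: "\<And>x. 0 \<le> h x" and e: "0 < e"
  shows "AE x in lebesgue. h x = 0 \<longrightarrow>
           (\<exists>d>0. \<forall>r. 0 < r \<and> r < d \<longrightarrow> (LINT y:cball x r|lebesgue. h y) \<le> e * r)"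
proof -
  let ?\<nu> = "density lebesgue (\<lambda>x. ennreal (h x))"
  define B where "B = {x. h x = 0 \<and> (\<forall>d>0. \<exists>r. 0 < r \<and> r < d \<and> (LINT y:cball x r|lebesgue. h y) > e * r)}"
  have mh[measurable]: "h \<in> borel_measurable lebesgue"
    using h by auto
  have nu: "emeasure ?\<nu> (cball x r) = ennreal (LINT y:cball x r|lebesgue. h y)" for x r
  proof -
    have "emeasure ?\<nu> (cball x r) = (\<integral>\<^sup>+ y. ennreal (indicator (cball x r) y * h y) \<partial>lebesgue)"
      by (subst emeasure_density) (auto intro!: nn_integral_cong simp: indicator_def)
    also have "\<dots> = ennreal (\<integral>y. indicator (cball x r) y * h y \<partial>lebesgue)"
      using h h0 integrable_mult_indicator[of "cball x r" lebesgue h] by (intro nn_integral_eq_integral) auto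
    finally show ?thesis by (simp add: set_lebesgue_integral_def)
  qed
  have "negligible B"
    unfolding negligible_outer_le
  proof (intro allI impI)
    fix \<eta> :: real assume "0 < \<eta>"
    \<comment> \<open>A ball of radius r has length 2 r and mass above e r, so the selected disjoint
      balls have total length at most 2/e times the mass of \<open>U\<close>.\<close>
    define \<eta>' where "\<eta>' = \<eta> * e / 2"
    have "\<eta>' > 0" using \<open>0<\<eta>\<close> e by (simp add: \<eta>'_def)
    obtain U where U: "open U" "{x. h x \<le> 0} \<subseteq> U" "emeasure ?\<nu> U < ennreal \<eta>'"
      using nn_density_small_open[OF h \<open>\<eta>' > 0\<close>] by blast
    define K where "K = {(x, r). x \<in> B \<and> 0 < r \<and> cball x r \<subseteq> U \<and> (LINT y:cball x r|lebesgue. h y) > e * r}"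
    have Kr: "0 < snd i" if "i \<in> K" for i
      using that by (auto simp: K_def)
    have Kc: "\<exists>i. i \<in> K \<and> x \<in> cball (fst i) (snd i) \<and> snd i < d" if "x \<in> B" "0 < d" for x d
    proof -
      have "x \<in> U" using that U(2) by (auto simp: B_def)
      then obtain d' where d': "d' > 0" "cball x d' \<subseteq> U"
        using U(1) open_contains_cball by blast
      obtain r where r: "0 < r" "r < min d d'" "(LINT y:cball x r|lebesgue. h y) > e * r"
      proof -
        have "min d d' > 0" using \<open>0 < d\<close> d'(1) by simp
        then show ?thesis using \<open>x \<in> B\<close> that unfolding B_def by blast
      qed
      have "cball x r \<subseteq> cball x d'" using r(2) by (intro subset_cball) auto
      then have "cball x r \<subseteq> U" using d'(2) by blast
      then show ?thesis using r that by (intro exI[of _ "(x, r)"]) (auto simp: K_def)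
    qed
    obtain C where C: "countable C" "C \<subseteq> K"
     "pairwise (\<lambda>i j. disjnt (cball (fst i) (snd i)) (cball (fst j) (snd j))) C"
     "negligible (B - (\<Union>i \<in> C. cball (fst i) (snd i)))"
      using Vitali_covering_theorem_cballs[of K snd B fst] Kr Kc by blast
    let ?X = "\<lambda>i::real\<times>real. cball (fst i) (snd i)"
    define W where "W = (\<Union>i \<in> C. ?X i)"
    have disj: "disjoint_family_on ?X C"
      using C(3) by (auto simp: disjoint_family_on_def pairwise_def disjnt_def)
    have Wm: "W \<in> sets lebesgue"
      unfolding W_def using C(1) by (intro sets.countable_UN') auto
    have "ennreal e * emeasure lebesgue W = ennreal e * (\<integral>\<^sup>+ i. emeasure lebesgue (?X i) \<partial>count_space C)"
      unfolding W_def using C(1) disj by (subst emeasure_UN_countable) auto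
    also have "\<dots> = (\<integral>\<^sup>+ i. ennreal e * emeasure lebesgue (?X i) \<partial>count_space C)"
      by (rule nn_integral_cmult[symmetric]) auto
    also have "\<dots> \<le> (\<integral>\<^sup>+ i. 2 * emeasure ?\<nu> (?X i) \<partial>count_space C)"
    proof (rule nn_integral_mono)
      fix i assume "i \<in> space (count_space C)"
      then have "i \<in> K" using C(2) by auto
      then have i: "0 < snd i" "(LINT y:?X i|lebesgue. h y) > e * snd i"
        by (auto simp: K_def)
      have "ennreal e * emeasure lebesgue (?X i) = ennreal (2 * (e * snd i))"
        using i(1) e by (simp add: cball_eq_atLeastAtMost ennreal_mult[symmetric] algebra_simps)
      also have "\<dots> \<le> ennreal (2 * (LINT y:?X i|lebesgue. h y))"
        using i by (intro ennreal_leI) auto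
      also have "\<dots> = 2 * emeasure ?\<nu> (?X i)"
        unfolding nu using less_trans[OF mult_pos_pos[OF e i(1)] i(2)] by (subst ennreal_mult) auto
      finally show "ennreal e * emeasure lebesgue (?X i) \<le> 2 * emeasure ?\<nu> (?X i)" .
    qed
    also have "\<dots> = 2 * (\<integral>\<^sup>+ i. emeasure ?\<nu> (?X i) \<partial>count_space C)"
      by (rule nn_integral_cmult) auto
    also have "\<dots> = 2 * emeasure ?\<nu> W"
      unfolding W_def using C(1) disj by (subst emeasure_UN_countable) auto
    also have "\<dots> \<le> 2 * emeasure ?\<nu> U"
          proof -
      have "W \<subseteq> U" using C(2) unfolding W_def K_def by fastforce
      then show ?thesis using U(1) by (intro mult_left_mono emeasure_mono) auto
    qed
    also have "\<dots> \<le> 2 * ennreal \<eta>'"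
      using U(3) by (intro mult_left_mono) auto
    also have "\<dots> = ennreal e * ennreal \<eta>"
      using e \<open>0 < \<eta>\<close> by (simp add: \<eta>'_def ennreal_mult[symmetric] flip: ennreal_numeral)
    finally have "emeasure lebesgue W \<le> ennreal \<eta>"
      using e by (subst (asm) ennreal_mult_le_mult_iff) auto
    then have W: "W \<in> lmeasurable" "measure lebesgue W \<le> \<eta>"
      using Wm \<open>0<\<eta>\<close> by (auto simp: fmeasurable_def measure_def enn2real_leI le_less_trans[OF _ ennreal_less_top])
    have N: "negligible (B - W)" using C(4) by (simp add: W_def)
    show "\<exists>T. B \<subseteq> T \<and> T \<in> lmeasurable \<and> measure lebesgue T \<le> \<eta>"
    proof (intro exI[of _ "W \<union> (B - W)"] conjI)
      show "W \<union> (B - W) \<in> lmeasurable"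
        using W(1) negligible_imp_measurable[OF N] by (rule fmeasurable.Un)
      have "measure lebesgue (W \<union> (B - W)) = measure lebesgue W"
        unfolding measure_def using Wm N by (subst emeasure_Un_null_set) (auto simp: negligible_iff_null_sets)
      then show "measure lebesgue (W \<union> (B - W)) \<le> \<eta>" using W by simp
    qed auto
  qed
  then have "B \<in> null_sets lebesgue" by (simp add: negligible_iff_null_sets)
  from AE_not_in[OF this] show ?thesis
    by eventually_elim (unfold B_def, clarsimp, meson not_less)
qed

text \<open>For a rational \<alpha> slightly above g(x), the positive part of g - \<alpha> vanishes
  at x, so its averages are small there by the previous lemma, and g is at most \<alpha> plus this
  positive part. Countably many \<alpha>, cutoffs N and tolerances n share one null set.\<close>

lemma AE_upper_average:
  fixes g :: "real \<Rightarrow> real"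
  assumes g: "\<And>c d. set_integrable lebesgue {c..d} g"
  shows "AE x in lebesgue. \<forall>e>0. \<exists>\<delta>>0. \<forall>c d. c \<le> x \<and> x \<le> d \<and> c < d \<and> d - c < \<delta> \<longrightarrow>
           (LINT y:{c..d}|lebesgue. g y) \<le> (g x + e) * (d - c)"
proof -
  define h where "h N \<alpha> x = indicator {- real N..real N} x * max 0 (g x - of_rat \<alpha>)" for N :: nat and \<alpha> :: rat and x
  have hint: "integrable lebesgue (h N \<alpha>)" for N \<alpha>
  proof -
    have "set_integrable lebesgue {- real N..real N} (\<lambda>x. g x - of_rat \<alpha>)"
      by (intro set_integral_diff g) (auto simp: set_integrable_def)
    then have "integrable lebesgue (\<lambda>x. max 0 (indicator {- real N..real N} x *\<^sub>R (g x - of_rat \<alpha>)))"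
      unfolding set_integrable_def by (intro integrable_max) auto
    moreover have "(\<lambda>x. max 0 (indicator {- real N..real N} x *\<^sub>R (g x - of_rat \<alpha>))) = h N \<alpha>"
      by (auto simp: h_def indicator_def)
    ultimately show ?thesis by simp
  qed
  have "AE x in lebesgue. \<forall>N \<alpha> n. h N \<alpha> x = 0 \<longrightarrow>
           (\<exists>d>0. \<forall>r. 0 < r \<and> r < d \<longrightarrow> (LINT y:cball x r|lebesgue. h N \<alpha> y) \<le> (1 / real (Suc n)) * r)"
    unfolding AE_all_countable by (intro allI AE_average_zero hint) (auto simp: h_def)
  then show ?thesis
  proof (eventually_elim, intro allI impI)
    fix x e :: real
    assume A: "\<forall>N \<alpha> n. h N \<alpha> x = 0 \<longrightarrow>
           (\<exists>d>0. \<forall>r. 0 < r \<and> r < d \<longrightarrow> (LINT y:cball x r|lebesgue. h N \<alpha> y) \<le> (1 / real (Suc n)) * r)"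
    assume "0 < e"
    obtain n where n: "1 / real (Suc n) < e / 2"
      using \<open>0 < e\<close> by (metis nat_approx_posE half_gt_zero)
    obtain \<alpha> where \<alpha>: "g x < of_rat \<alpha>" "of_rat \<alpha> < g x + e / 2"
      using of_rat_dense[of "g x" "g x + e / 2"] \<open>0 < e\<close> by auto
    obtain N where N: "\<bar>x\<bar> + 1 < real N" using reals_Archimedean2 by blast
    have "h N \<alpha> x = 0" using \<alpha> by (simp add: h_def)
    with A obtain d where d: "d > 0" "\<And>r. 0 < r \<Longrightarrow> r < d \<Longrightarrow> (LINT y:cball x r|lebesgue. h N \<alpha> y) \<le> (1 / real (Suc n)) * r"
      by meson
    show "\<exists>\<delta>>0. \<forall>c d. c \<le> x \<and> x \<le> d \<and> c < d \<and> d - c < \<delta> \<longrightarrow>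
           (LINT y:{c..d}|lebesgue. g y) \<le> (g x + e) * (d - c)"
    proof (intro exI[of _ "min d 1"] conjI allI impI)
      show "min d 1 > 0" using d by simp
      fix c b assume cb: "c \<le> x \<and> x \<le> b \<and> c < b \<and> b - c < min d 1"
      \<comment> \<open>The interval only has to contain x; passing to the centred ball of radius b
        - c doubles the length, which the small tolerance of the positive part absorbs.\<close>
      have sub: "{c..b} \<subseteq> cball x (b - c)" "{c..b} \<subseteq> {- real N..real N}"
        using cb N by (auto simp: dist_real_def)
      have si: "set_integrable lebesgue A (h N \<alpha>)" if "A \<in> sets lebesgue" for A
        using hint that unfolding set_integrable_def by (intro integrable_mult_indicator) auto
      have "(LINT y:{c..b}|lebesgue. g y) \<le> (LINT y:{c..b}|lebesgue. of_rat \<alpha> + h N \<alpha> y)"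
        using sub by (intro set_integral_mono g set_integral_add si) (auto simp: h_def)
      also have "\<dots> = (LINT y:{c..b}|lebesgue. of_rat \<alpha>) + (LINT y:{c..b}|lebesgue. h N \<alpha> y)"
        by (intro set_integral_add si) auto
      also have "(LINT y:{c..b}|lebesgue. of_rat \<alpha> :: real) = of_rat \<alpha> * (b - c)"
        using cb by (simp add: set_lebesgue_integral_def)
      also have "(LINT y:{c..b}|lebesgue. h N \<alpha> y) \<le> (LINT y:cball x (b-c)|lebesgue. h N \<alpha> y)"
        using sub si[of "{c..b}"] si[of "cball x (b - c)"] unfolding set_lebesgue_integral_def set_integrable_def
        by (intro integral_mono) (auto simp: h_def indicator_def)
      also have "\<dots> \<le> (1 / real (Suc n)) * (b - c)"
        using cb by (intro d(2)) auto
      also have "\<dots> \<le> (e/2) * (b - c)"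
        using cb n by (intro mult_right_mono) auto
      also have "of_rat \<alpha> * (b - c) + (e/2) * (b - c) = (of_rat \<alpha> + e/2) * (b - c)"
        by (simp add: algebra_simps)
      also have "\<dots> \<le> (g x + e) * (b - c)"
        using \<alpha> cb by (intro mult_right_mono) auto
      finally show "(LINT y:{c..b}|lebesgue. g y) \<le> (g x + e) * (b - c)" by simp
    qed
  qed
qed

lemma AE_average:
  fixes g :: "real \<Rightarrow> real"
  assumes g: "\<And>c d. set_integrable lebesgue {c..d} g"
  shows "AE x in lebesgue. \<forall>e>0. \<exists>\<delta>>0. \<forall>c d. c \<le> x \<and> x \<le> d \<and> c < d \<and> d - c < \<delta> \<longrightarrow>
           \<bar>(LINT y:{c..d}|lebesgue. g y) - g x * (d - c)\<bar> \<le> e * (d - c)"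
proof -
  have "AE x in lebesgue. \<forall>e>0. \<exists>\<delta>>0. \<forall>c d. c \<le> x \<and> x \<le> d \<and> c < d \<and> d - c < \<delta> \<longrightarrow>
           (LINT y:{c..d}|lebesgue. - g y) \<le> (- g x + e) * (d - c)"
    using g by (intro AE_upper_average) (simp add: set_integrable_def)
  with AE_upper_average[OF g] show ?thesis
  proof (eventually_elim, intro allI impI)
    fix x e :: real
    assume A: "\<forall>e>0. \<exists>\<delta>>0. \<forall>c d. c \<le> x \<and> x \<le> d \<and> c < d \<and> d - c < \<delta> \<longrightarrow> (LINT y:{c..d}|lebesgue. g y) \<le> (g x + e) * (d - c)"
      and B: "\<forall>e>0. \<exists>\<delta>>0. \<forall>c d. c \<le> x \<and> x \<le> d \<and> c < d \<and> d - c < \<delta> \<longrightarrow> (LINT y:{c..d}|lebesgue. - g y) \<le> (- g x + e) * (d - c)"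
      and "0 < e"
    from A \<open>0 < e\<close> obtain \<delta>1 where 1: "\<delta>1>0" "\<And>c d. c \<le> x \<and> x \<le> d \<and> c < d \<and> d - c < \<delta>1 \<Longrightarrow> (LINT y:{c..d}|lebesgue. g y) \<le> (g x + e) * (d - c)"
      by meson
    from B \<open>0 < e\<close> obtain \<delta>2 where 2: "\<delta>2>0" "\<And>c d. c \<le> x \<and> x \<le> d \<and> c < d \<and> d - c < \<delta>2 \<Longrightarrow> (LINT y:{c..d}|lebesgue. - g y) \<le> (- g x + e) * (d - c)"
      by meson
    show "\<exists>\<delta>>0. \<forall>c d. c \<le> x \<and> x \<le> d \<and> c < d \<and> d - c < \<delta> \<longrightarrow>
           \<bar>(LINT y:{c..d}|lebesgue. g y) - g x * (d - c)\<bar> \<le> e * (d - c)"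
    proof (intro exI[of _ "min \<delta>1 \<delta>2"] conjI allI impI)
      fix c d assume cd: "c \<le> x \<and> x \<le> d \<and> c < d \<and> d - c < min \<delta>1 \<delta>2"
      have "(LINT y:{c..d}|lebesgue. - g y) = - (LINT y:{c..d}|lebesgue. g y)"
        by (simp add: set_lebesgue_integral_def)
      with 1(2)[of c d] 2(2)[of c d] cd show "\<bar>(LINT y:{c..d}|lebesgue. g y) - g x * (d - c)\<bar> \<le> e * (d - c)"
        by (auto simp: abs_le_iff algebra_simps)
    qed (use 1 2 in auto)
  qed
qed

text \<open>Absolute continuity in integral form, with \<open>g\<close> as a density. All later
  arguments use this form, since \<open>g\<close> matters only up to null sets and inequalities for
  increments are inequalities for integrals.\<close>

definition AC_deriv :: "real set \<Rightarrow> (real \<Rightarrow> complex) \<Rightarrow> (real \<Rightarrow> complex) \<Rightarrow> bool" where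
  "AC_deriv I f g \<longleftrightarrow> (\<forall>x y. x \<le> y \<and> {x..y} \<subseteq> I \<longrightarrow>
     set_integrable lebesgue {x..y} g \<and> (LINT t:{x..y}|lebesgue. g t) = f y - f x)"

lemma AE_lebesgue_on_iff:
  assumes "I \<in> sets lebesgue"
  shows "(AE x in lebesgue_on I. P x) \<longleftrightarrow> (AE x in lebesgue. x \<in> I \<longrightarrow> P x)"
  using assms by (subst AE_restrict_space_iff) auto

lemma AE_has_vector_derivative_integral:
  fixes f g :: "real \<Rightarrow> complex"
  assumes g: "\<And>c d. set_integrable lebesgue {c..d} g"
    and I: "is_interval I"
    and f: "\<And>x y. x \<in> I \<Longrightarrow> y \<in> I \<Longrightarrow> x \<le> y \<Longrightarrow> f y - f x = (LINT t:{x..y}|lebesgue. g t)"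
  shows "AE x in lebesgue. x \<in> I \<longrightarrow> (f has_vector_derivative g x) (at x within I)"
proof -
  have R: "set_integrable lebesgue {c..d} (\<lambda>x. Re (g x))" "set_integrable lebesgue {c..d} (\<lambda>x. Im (g x))" for c d
  proof -
    have "integrable lebesgue (\<lambda>x. Re (indicator {c..d} x *\<^sub>R g x))" "integrable lebesgue (\<lambda>x. Im (indicator {c..d} x *\<^sub>R g x))"
      using g[of c d] unfolding set_integrable_def by (rule integrable_Re integrable_Im)+
    then show "set_integrable lebesgue {c..d} (\<lambda>x. Re (g x))" "set_integrable lebesgue {c..d} (\<lambda>x. Im (g x))"
      by (simp_all add: set_integrable_def)
  qed
  have RI: "Re (LINT t:{c..d}|lebesgue. g t) = (LINT t:{c..d}|lebesgue. Re (g t))"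
           "Im (LINT t:{c..d}|lebesgue. g t) = (LINT t:{c..d}|lebesgue. Im (g t))" for c d
    using integral_Re[OF g[of c d, unfolded set_integrable_def]] integral_Im[OF g[of c d, unfolded set_integrable_def]]
    unfolding set_lebesgue_integral_def by simp_all
  show ?thesis
    using AE_average[OF R(1)] AE_average[OF R(2)]
  proof (eventually_elim, intro impI)
    fix x
    assume A: "\<forall>e>0. \<exists>\<delta>>0. \<forall>c d. c \<le> x \<and> x \<le> d \<and> c < d \<and> d - c < \<delta> \<longrightarrow>
           \<bar>(LINT y:{c..d}|lebesgue. Re (g y)) - Re (g x) * (d - c)\<bar> \<le> e * (d - c)"
      and B: "\<forall>e>0. \<exists>\<delta>>0. \<forall>c d. c \<le> x \<and> x \<le> d \<and> c < d \<and> d - c < \<delta> \<longrightarrow>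
           \<bar>(LINT y:{c..d}|lebesgue. Im (g y)) - Im (g x) * (d - c)\<bar> \<le> e * (d - c)"
      and x: "x \<in> I"
    show "(f has_vector_derivative g x) (at x within I)"
      unfolding has_vector_derivative_def has_derivative_within_alt
    proof (intro conjI allI impI bounded_linear_scaleR_left)
      fix e :: real assume "0 < e"
      then have e2: "e / 2 > 0" by simp
      from A e2 obtain \<delta>1 where 1: "\<delta>1>0" "\<And>c d. c \<le> x \<and> x \<le> d \<and> c < d \<and> d - c < \<delta>1 \<Longrightarrow>
          \<bar>(LINT y:{c..d}|lebesgue. Re (g y)) - Re (g x) * (d - c)\<bar> \<le> e/2 * (d - c)" by meson
      from B e2 obtain \<delta>2 where 2: "\<delta>2>0" "\<And>c d. c \<le> x \<and> x \<le> d \<and> c < d \<and> d - c < \<delta>2 \<Longrightarrow>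
          \<bar>(LINT y:{c..d}|lebesgue. Im (g y)) - Im (g x) * (d - c)\<bar> \<le> e/2 * (d - c)" by meson
      have key: "norm (f d - f c - (d - c) *\<^sub>R g x) \<le> e * (d - c)"
        if "c \<in> I" "d \<in> I" "c \<le> x \<and> x \<le> d \<and> c < d \<and> d - c < min \<delta>1 \<delta>2" for c d
      proof -
        let ?z = "f d - f c - (d - c) *\<^sub>R g x"
        have "f d - f c = (LINT t:{c..d}|lebesgue. g t)" using f[of c d] that by simp
        then have "Re ?z = (LINT y:{c..d}|lebesgue. Re (g y)) - Re (g x) * (d - c)"
           "Im ?z = (LINT y:{c..d}|lebesgue. Im (g y)) - Im (g x) * (d - c)"
          using RI[of c d] by (simp_all add: algebra_simps)
        then have "\<bar>Re ?z\<bar> \<le> e/2 * (d - c)" "\<bar>Im ?z\<bar> \<le> e/2 * (d - c)"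
          using 1(2)[of c d] 2(2)[of c d] that by (simp_all only: conj_absorb min_less_iff_conj)
        then show ?thesis using cmod_le[of ?z] by (simp add: algebra_simps)
      qed
      show "\<exists>d>0. \<forall>y\<in>I. norm (y - x) < d \<longrightarrow> norm (f y - f x - (y - x) *\<^sub>R g x) \<le> e * norm (y - x)"
      proof (intro exI[of _ "min \<delta>1 \<delta>2"] conjI ballI impI)
        fix y assume y: "y \<in> I" "norm (y - x) < min \<delta>1 \<delta>2"
        consider "y < x" | "y = x" | "y > x" by linarith
        then show "norm (f y - f x - (y - x) *\<^sub>R g x) \<le> e * norm (y - x)"
        proof cases
          case 1
          then have "norm (f x - f y - (x - y) *\<^sub>R g x) \<le> e * (x - y)"
            using x y by (intro key) auto
          moreover have "f y - f x - (y - x) *\<^sub>R g x = - (f x - f y - (x - y) *\<^sub>R g x)"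
            by (simp add: algebra_simps)
          ultimately show ?thesis using 1 by (simp only: norm_minus_cancel) auto
        next
          case 3
          then have "norm (f y - f x - (y - x) *\<^sub>R g x) \<le> e * (y - x)"
            using x y by (intro key) auto
          then show ?thesis using 3 by auto
        qed auto
      qed (use 1 2 in auto)
    qed
  qed
qed
text \<open>Split \<open>h\<close> at height n: the part above has integral below e/2 for large n by
  dominated convergence, and the part below contributes at most n times the measure of the
  set.\<close>

lemma integral_small_on_small_sets:
  fixes h :: "real \<Rightarrow> real"
  assumes h: "integrable lebesgue h" and h0: "\<And>x. 0 \<le> h x" and e: "0 < e"
  obtains \<delta> where "\<delta> > 0"
    "\<And>A. A \<in> sets lebesgue \<Longrightarrow> emeasure lebesgue A < ennreal \<delta> \<Longrightarrow> (LINT x:A|lebesgue. h x) < e"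
proof -
  have [measurable]: "h \<in> borel_measurable lebesgue" using h by auto
  have "(\<lambda>n::nat. \<integral>x. min (h x) (real n) \<partial>lebesgue) \<longlonglongrightarrow> (\<integral>x. h x \<partial>lebesgue)"
  proof (rule integral_dominated_convergence)
    show "AE x in lebesgue. (\<lambda>n. min (h x) (real n)) \<longlonglongrightarrow> h x"
    proof (rule AE_I2)
      fix x
      have "\<forall>\<^sub>F n in sequentially. h x \<le> real n"
        using filterlim_real_sequentially by (simp add: filterlim_at_top)
      then have "\<forall>\<^sub>F n in sequentially. min (h x) (real n) = h x"
        by eventually_elim auto
      then show "(\<lambda>n. min (h x) (real n)) \<longlonglongrightarrow> h x"
        by (rule tendsto_eventually)
    qed
    show "AE x in lebesgue. norm (min (h x) (real n)) \<le> h x" for n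
      using h0 by (auto simp: abs_le_iff min_def intro!: AE_I2 order.trans[OF _ h0])
  qed (use h in auto)
  then have "\<forall>\<^sub>F n in sequentially. (\<integral>x. h x \<partial>lebesgue) - e / 2 < (\<integral>x. min (h x) (real n) \<partial>lebesgue)"
    using e by (intro order_tendstoD(1)) auto
  then obtain n where n: "(\<integral>x. h x \<partial>lebesgue) - e / 2 < (\<integral>x. min (h x) (real n) \<partial>lebesgue)"
    by (auto simp: eventually_sequentially)
  have mi: "integrable lebesgue (\<lambda>x. min (h x) (real n))"
    by (rule Bochner_Integration.integrable_bound[OF h]) (use h0 in auto)
  show thesis
  proof (rule that)
    show "e / (2 * (real n + 1)) > 0" using e by simp
    fix A :: "real set" assume A[measurable]: "A \<in> sets lebesgue" and small: "emeasure lebesgue A < ennreal (e / (2 * (real n + 1)))"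
    have Am: "A \<in> lmeasurable" using A small by (auto simp: fmeasurable_def less_trans[OF _ ennreal_less_top])
    have mA: "measure lebesgue A < e / (2 * (real n + 1))"
      using small Am e by (simp add: emeasure_eq_measure2 ennreal_less_iff)
    have Ai: "integrable lebesgue (\<lambda>x. indicator A x * real n)"
      using Am by (intro integrable_mult_left) (auto simp: fmeasurable_def integrable_indicator_iff)
    have "(LINT x:A|lebesgue. h x) \<le> (\<integral>x. (h x - min (h x) (real n)) + indicator A x * real n \<partial>lebesgue)"
      unfolding set_lebesgue_integral_def using integrable_mult_indicator[OF A h] h mi Ai h0
      by (intro integral_mono Bochner_Integration.integrable_add Bochner_Integration.integrable_diff) (auto simp: indicator_def)
    also have "\<dots> = (\<integral>x. h x \<partial>lebesgue) - (\<integral>x. min (h x) (real n) \<partial>lebesgue) + (\<integral>x. indicator A x * real n \<partial>lebesgue)"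
      using h mi Ai by simp
    also have "(\<integral>x. indicator A x * real n \<partial>lebesgue) = measure lebesgue A * real n"
      using A by simp
    also have "\<dots> \<le> (e / (2 * (real n + 1))) * real n"
      using mA by (intro mult_right_mono) auto
    also have "\<dots> \<le> e / 2" using e by (simp add: field_simps)
    finally show "(LINT x:A|lebesgue. h x) < e" using n by simp
  qed
qed

lemma set_integral_Icc_Ioo:
  fixes g :: "real \<Rightarrow> 'a::{banach,second_countable_topology}"
  assumes "set_integrable lebesgue {x..y} g"
  shows "(LINT t:{x..y}|lebesgue. g t) = (LINT t:{x<..<y}|lebesgue. g t)"
proof -
  have "set_integrable lebesgue {x<..<y} g"
    using assms by (rule set_integrable_subset) auto
  moreover have "AE t in lebesgue. t \<notin> {x, y}"
    by (intro AE_not_in negligible_iff_null_sets[THEN iffD1]) auto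
  then have "AE t in lebesgue. indicator {x..y} t *\<^sub>R g t = indicator {x<..<y} t *\<^sub>R g t"
    by eventually_elim (auto simp: indicator_def)
  ultimately show ?thesis
    using assms unfolding set_lebesgue_integral_def set_integrable_def
    by (intro integral_cong_AE) auto
qed

text \<open>The index type is left free, unlike in \<open>AC_Icc\<close>, so that unions and
  refinements of families can be indexed by Boolean or dependent pairs;
  \<open>AC_family_enum\<close> returns to natural numbers.\<close>

definition AC_family :: "'i set \<Rightarrow> ('i \<Rightarrow> real) \<Rightarrow> ('i \<Rightarrow> real) \<Rightarrow> real \<Rightarrow> real \<Rightarrow> bool" where
  "AC_family J x y c d \<longleftrightarrow> finite J \<and> (\<forall>i\<in>J. c \<le> x i \<and> x i \<le> y i \<and> y i \<le> d) \<and>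
     (\<forall>i\<in>J. \<forall>j\<in>J. i \<noteq> j \<longrightarrow> {x i<..<y i} \<inter> {x j<..<y j} = {})"

lemma AC_family_reindex:
  assumes "AC_family J x y c d" and b: "bij_betw h K J"
  shows "AC_family K (x \<circ> h) (y \<circ> h) c d" "(\<Sum>k\<in>K. F (x (h k)) (y (h k))) = (\<Sum>i\<in>J. F (x i) (y i))"
proof -
  have "finite K" using assms by (auto simp: AC_family_def bij_betw_finite)
  moreover have "h k \<in> J" if "k \<in> K" for k using b that by (rule bij_betwE[rule_format])
  moreover have "h k \<noteq> h l" if "k \<in> K" "l \<in> K" "k \<noteq> l" for k l
    using b that by (meson bij_betw_def inj_onD)
  ultimately show "AC_family K (x \<circ> h) (y \<circ> h) c d"
    using assms(1) unfolding AC_family_def o_def by (intro conjI ballI impI) (blast, blast, blast, blast, metis)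
  show "(\<Sum>k\<in>K. F (x (h k)) (y (h k))) = (\<Sum>i\<in>J. F (x i) (y i))"
    using b by (rule sum.reindex_bij_betw)
qed

lemma AC_IccE:
  assumes "AC_Icc c d f" "0 < e"
  obtains \<delta> where "\<delta> > 0"
    "\<And>(n::nat) x y. AC_family {..<n} x y c d \<Longrightarrow> (\<Sum>i<n. y i - x i) < \<delta> \<Longrightarrow> (\<Sum>i<n. norm (f (y i) - f (x i))) < e"
proof -
  from assms obtain \<delta> where \<delta>: "\<delta> > 0" "\<forall>(n::nat) x y.
        (\<forall>i<n. c \<le> x i \<and> x i \<le> y i \<and> y i \<le> d) \<and>
        (\<forall>i<n. \<forall>j<n. i \<noteq> j \<longrightarrow> {x i<..<y i} \<inter> {x j<..<y j} = {}) \<and>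
        (\<Sum>i<n. y i - x i) < \<delta>
        \<longrightarrow> (\<Sum>i<n. norm (f (y i) - f (x i))) < e"
    unfolding AC_Icc_def by blast
  show thesis
  proof (rule that[OF \<delta>(1)])
    fix n :: nat and x y assume "AC_family {..<n} x y c d" "(\<Sum>i<n. y i - x i) < \<delta>"
    with \<delta>(2)[rule_format, of n x y] show "(\<Sum>i<n. norm (f (y i) - f (x i))) < e"
      unfolding AC_family_def by blast
  qed
qed

lemma AC_IccI:
  assumes "\<And>e. 0 < e \<Longrightarrow> \<exists>\<delta>>0. \<forall>(n::nat) x y. AC_family {..<n} x y c d \<and> (\<Sum>i<n. y i - x i) < \<delta> \<longrightarrow> (\<Sum>i<n. norm (f (y i) - f (x i))) < e"
  shows "AC_Icc c d f"
  using assms unfolding AC_Icc_def AC_family_def by (simp add: Ball_def)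

lemma AC_family_enum:
  assumes "AC_family J x y c d"
  obtains n :: nat and X Y where "AC_family {..<n} X Y c d"
    "\<And>F. (\<Sum>k<n. F (X k) (Y k)) = (\<Sum>i\<in>J. (F (x i) (y i) :: real))"
proof -
  have "finite J" using assms by (simp add: AC_family_def)
  then obtain h where h: "bij_betw h {..<card J} J"
    using ex_bij_betw_nat_finite[of J] by (auto simp: lessThan_atLeast0)
  from AC_family_reindex[OF assms h] show thesis
    by (intro that[of "card J" "x \<circ> h" "y \<circ> h"]) auto
qed

lemma AC_deriv_imp_AC_loc:
  assumes "AC_deriv I f g"
  shows "AC_loc I f"
  unfolding AC_loc_def
proof (intro allI impI AC_IccI)
  fix c d e :: real assume cd: "c \<le> d \<and> {c..d} \<subseteq> I" and e: "0 < e"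
  define h where "h t = norm (indicator {c..d} t *\<^sub>R g t)" for t
  have gi: "set_integrable lebesgue {c..d} g" using assms cd by (auto simp: AC_deriv_def)
  then have h: "integrable lebesgue h" "\<And>t. 0 \<le> h t"
    unfolding set_integrable_def h_def[abs_def] by (auto dest: integrable_norm simp del: norm_scaleR)
  obtain \<delta> where \<delta>: "\<delta> > 0"
    "\<And>A. A \<in> sets lebesgue \<Longrightarrow> emeasure lebesgue A < ennreal \<delta> \<Longrightarrow> (LINT x:A|lebesgue. h x) < e"
    using integral_small_on_small_sets[OF h e] by blast
  show "\<exists>\<delta>>0. \<forall>(n::nat) x y. AC_family {..<n} x y c d \<and> (\<Sum>i<n. y i - x i) < \<delta> \<longrightarrow> (\<Sum>i<n. norm (f (y i) - f (x i))) < e"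
  proof (intro exI[of _ \<delta>] conjI allI impI \<delta>(1))
    fix n :: nat and x y :: "nat \<Rightarrow> real"
    assume A: "AC_family {..<n} x y c d \<and> (\<Sum>i<n. y i - x i) < \<delta>"
    \<comment> \<open>Only the open intervals are disjoint, hence their indicators, and not those of
      the closed intervals, add up to the indicator of the union.\<close>
    define U where "U = (\<Union>i<n. {x i<..<y i})"
    have hi: "integrable lebesgue (\<lambda>t. indicator S t *\<^sub>R h t)" if "S \<in> sets lebesgue" for S
      using h that by (intro integrable_mult_indicator)
    have "norm (f (y i) - f (x i)) \<le> (LINT t:{x i<..<y i}|lebesgue. h t)" if "i < n" for i
    proof -
      have i: "c \<le> x i" "x i \<le> y i" "y i \<le> d" using A that by (auto simp: AC_family_def)
      then have "set_integrable lebesgue {x i..y i} g \<and> (LINT t:{x i..y i}|lebesgue. g t) = f (y i) - f (x i)"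
        using assms cd unfolding AC_deriv_def by (metis atLeastatMost_subset_iff order.trans)
      then have "f (y i) - f (x i) = (LINT t:{x i<..<y i}|lebesgue. g t)"
        using set_integral_Icc_Ioo[of "x i" "y i" g] by simp
      also have "\<dots> = (LINT t|lebesgue. indicator {x i<..<y i} t *\<^sub>R (indicator {c..d} t *\<^sub>R g t))"
        unfolding set_lebesgue_integral_def using i by (intro Bochner_Integration.integral_cong) (auto simp: indicator_def)
      also have "norm \<dots> \<le> (LINT t|lebesgue. norm (indicator {x i<..<y i} t *\<^sub>R (indicator {c..d} t *\<^sub>R g t)))"
        by (rule integral_norm_bound)
      also have "\<dots> = (LINT t:{x i<..<y i}|lebesgue. h t)"
        unfolding set_lebesgue_integral_def by (intro Bochner_Integration.integral_cong) (auto simp: h_def indicator_def)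
      finally show ?thesis .
    qed
    then have "(\<Sum>i<n. norm (f (y i) - f (x i))) \<le> (\<Sum>i<n. (LINT t:{x i<..<y i}|lebesgue. h t))"
      by (intro sum_mono) auto
    also have "\<dots> = (LINT t|lebesgue. (\<Sum>i<n. indicator {x i<..<y i} t *\<^sub>R h t))"
      unfolding set_lebesgue_integral_def by (intro Bochner_Integration.integral_sum[symmetric] hi) auto
    also have "\<dots> = (LINT t:U|lebesgue. h t)"
    proof -
      have "indicator U t = (\<Sum>i<n. indicator {x i<..<y i} t :: real)" for t
        unfolding U_def using A by (subst indicator_UN_disjoint) (auto simp: disjoint_family_on_def AC_family_def)
      then show ?thesis
        unfolding set_lebesgue_integral_def by (simp add: sum_distrib_right)
    qed
    also have "\<dots> < e"
    proof (rule \<delta>(2))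
      have "emeasure lebesgue U \<le> (\<Sum>i<n. emeasure lebesgue {x i<..<y i})"
        unfolding U_def by (intro emeasure_subadditive_finite) auto
      also have "\<dots> = (\<Sum>i<n. ennreal (y i - x i))"
        using A by (intro sum.cong) (auto simp: AC_family_def)
      also have "\<dots> = ennreal (\<Sum>i<n. y i - x i)"
        using A by (intro sum_ennreal) (auto simp: AC_family_def)
      also have "\<dots> < ennreal \<delta>" using A \<delta>(1) by (intro ennreal_lessI) auto
      finally show "emeasure lebesgue U < ennreal \<delta>" .
    qed (auto simp: U_def)
    finally show "(\<Sum>i<n. norm (f (y i) - f (x i))) < e" .
  qed
qed

section \<open>Functions of bounded variation and absolute continuity\<close>

text \<open>One domination criterion serves for differences, products and reciprocals of absolutely
  continuous functions.\<close>

lemma AC_Icc_bound: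
  assumes f: "AC_Icc c d f" and g: "AC_Icc c d g" and K: "K > 0"
    and b: "\<And>x y. c \<le> x \<Longrightarrow> x \<le> y \<Longrightarrow> y \<le> d \<Longrightarrow> norm (h y - h x) \<le> K * (norm (f y - f x) + norm (g y - g x))"
  shows "AC_Icc c d h"
proof (rule AC_IccI)
  fix e :: real assume e: "0 < e"
  then have "0 < e / (2 * K)" using K by simp
  from AC_IccE[OF f this] obtain \<delta>1 where 1: "\<delta>1 > 0" "\<And>(n::nat) x y. AC_family {..<n} x y c d \<Longrightarrow> (\<Sum>i<n. y i - x i) < \<delta>1 \<Longrightarrow> (\<Sum>i<n. norm (f (y i) - f (x i))) < e / (2 * K)"
    by blast
  from AC_IccE[OF g \<open>0 < e / (2 * K)\<close>] obtain \<delta>2 where 2: "\<delta>2 > 0" "\<And>(n::nat) x y. AC_family {..<n} x y c d \<Longrightarrow> (\<Sum>i<n. y i - x i) < \<delta>2 \<Longrightarrow> (\<Sum>i<n. norm (g (y i) - g (x i))) < e / (2 * K)"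
    by blast
  show "\<exists>\<delta>>0. \<forall>(n::nat) x y. AC_family {..<n} x y c d \<and> (\<Sum>i<n. y i - x i) < \<delta> \<longrightarrow> (\<Sum>i<n. norm (h (y i) - h (x i))) < e"
  proof (intro exI[of _ "min \<delta>1 \<delta>2"] conjI allI impI)
    fix n :: nat and x y :: "nat \<Rightarrow> real" assume A: "AC_family {..<n} x y c d \<and> (\<Sum>i<n. y i - x i) < min \<delta>1 \<delta>2"
    have "(\<Sum>i<n. norm (h (y i) - h (x i))) \<le> (\<Sum>i<n. K * (norm (f (y i) - f (x i)) + norm (g (y i) - g (x i))))"
      using A by (intro sum_mono b) (auto simp: AC_family_def)
    also have "\<dots> = K * ((\<Sum>i<n. norm (f (y i) - f (x i))) + (\<Sum>i<n. norm (g (y i) - g (x i))))"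
      by (simp flip: sum.distrib sum_distrib_left)
    also have "\<dots> < K * (e / (2 * K) + e / (2 * K))"
      using A 1(2)[of n x y] 2(2)[of n x y] K by (intro mult_strict_left_mono add_strict_mono) auto
    also have "\<dots> = e" using K by simp
    finally show "(\<Sum>i<n. norm (h (y i) - h (x i))) < e" .
  qed (use 1 2 in auto)
qed

lemma AC_family_total:
  assumes "AC_family J x y c d" "c \<le> d"
  shows "(\<Sum>i\<in>J. y i - x i) \<le> d - c"
proof -
  have "ennreal (\<Sum>i\<in>J. y i - x i) = (\<Sum>i\<in>J. ennreal (y i - x i))"
    using assms by (intro sum_ennreal[symmetric]) (auto simp: AC_family_def)
  also have "\<dots> = (\<Sum>i\<in>J. emeasure lborel {x i<..<y i})"
    using assms by (intro sum.cong) (auto simp: AC_family_def)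
  also have "\<dots> = emeasure lborel (\<Union>i\<in>J. {x i<..<y i})"
    using assms by (intro sum_emeasure) (auto simp: AC_family_def disjoint_family_on_def simp del: Int_greaterThanLessThan)
  also have "\<dots> \<le> emeasure lborel {c..d}"
    using assms by (intro emeasure_mono) (fastforce simp: AC_family_def)+
  also have "\<dots> = ennreal (d - c)" using assms by simp
  finally show ?thesis using assms by (subst (asm) ennreal_le_iff) auto
qed

lemma AC_family_Sigma:
  assumes J: "AC_family J x y c d" and K: "\<And>i. i \<in> J \<Longrightarrow> AC_family (K i) (X i) (Y i) (x i) (y i)"
  shows "AC_family (Sigma J K) (\<lambda>(i, k). X i k) (\<lambda>(i, k). Y i k) c d"
  unfolding AC_family_def
proof (intro conjI ballI impI)
  show "finite (Sigma J K)" using J K by (auto simp: AC_family_def)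
  fix p assume "p \<in> Sigma J K"
  then obtain i k where p: "p = (i, k)" "i \<in> J" "k \<in> K i" by auto
  have i: "c \<le> x i" "y i \<le> d" using J p by (auto simp: AC_family_def)
  have k: "x i \<le> X i k" "X i k \<le> Y i k" "Y i k \<le> y i" using K[OF p(2)] p by (auto simp: AC_family_def)
  show "c \<le> (case p of (i, k) \<Rightarrow> X i k)" "(case p of (i, k) \<Rightarrow> X i k) \<le> (case p of (i, k) \<Rightarrow> Y i k)"
       "(case p of (i, k) \<Rightarrow> Y i k) \<le> d"
    using i k p by auto
  fix q assume "q \<in> Sigma J K" "p \<noteq> q"
  then obtain j l where q: "q = (j, l)" "j \<in> J" "l \<in> K j" by auto
  have l: "x j \<le> X j l" "Y j l \<le> y j" using K[OF q(2)] q by (auto simp: AC_family_def)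
  show "{case p of (i, k) \<Rightarrow> X i k<..<case p of (i, k) \<Rightarrow> Y i k} \<inter> {case q of (i, k) \<Rightarrow> X i k<..<case q of (i, k) \<Rightarrow> Y i k} = {}"
  proof (cases "i = j")
    case True
    then have "k \<noteq> l" using \<open>p \<noteq> q\<close> p q by auto
    then have "{X i k<..<Y i k} \<inter> {X i l<..<Y i l} = {}"
      using K[OF p(2)] p q True unfolding AC_family_def by metis
    then show ?thesis using p q True by simp
  next
    case False
    then have "{x i<..<y i} \<inter> {x j<..<y j} = {}"
      using J p q unfolding AC_family_def by metis
    moreover have "{X i k<..<Y i k} \<subseteq> {x i<..<y i}" "{X j l<..<Y j l} \<subseteq> {x j<..<y j}"
      using k l by auto
    ultimately have "{X i k<..<Y i k} \<inter> {X j l<..<Y j l} = {}" by blast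
    then show ?thesis using p q by simp
  qed
qed

definition variation_sums :: "(real \<Rightarrow> complex) \<Rightarrow> real \<Rightarrow> real \<Rightarrow> real set" where
  "variation_sums f c d = {(\<Sum>i<n. norm (f (y i) - f (x i))) | (n::nat) x y. AC_family {..<n} x y c d}"

lemma variation_sumsI:
  assumes "AC_family J x y c d"
  shows "(\<Sum>i\<in>J. norm (f (y i) - f (x i))) \<in> variation_sums f c d"
proof -
  obtain n :: nat and X Y where A: "AC_family {..<n} X Y c d"
    and B: "\<And>F. (\<Sum>k<n. F (X k) (Y k)) = (\<Sum>i\<in>J. (F (x i) (y i) :: real))"
    using AC_family_enum[OF assms] by blast
  show ?thesis
    unfolding variation_sums_def using A B[of "\<lambda>x y. norm (f y - f x)"] by force
qed

lemma zero_in_variation_sums: "0 \<in> variation_sums f c d"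
  using variation_sumsI[of "{}::nat set" _ _ c d f] by (simp add: AC_family_def)

lemma AC_family_single: "c \<le> x \<Longrightarrow> x \<le> y \<Longrightarrow> y \<le> d \<Longrightarrow> AC_family {()} (\<lambda>_. x) (\<lambda>_. y) c d"
  by (simp add: AC_family_def)

lemma norm_in_variation_sums: "c \<le> d \<Longrightarrow> norm (f d - f c) \<in> variation_sums f c d"
  using variation_sumsI[OF AC_family_single[of c c d d], of f] by simp

lemma variation_sums_add:
  assumes "r \<in> variation_sums f c m" "s \<in> variation_sums f m d" "c \<le> m" "m \<le> d"
  shows "r + s \<in> variation_sums f c d"
proof -
  obtain n1 x1 y1 where 1: "AC_family {..<n1::nat} x1 y1 c m" "r = (\<Sum>i<n1. norm (f (y1 i) - f (x1 i)))"
    using assms(1) by (auto simp: variation_sums_def)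
  obtain n2 x2 y2 where 2: "AC_family {..<n2::nat} x2 y2 m d" "s = (\<Sum>i<n2. norm (f (y2 i) - f (x2 i)))"
    using assms(2) by (auto simp: variation_sums_def)
  \<comment> \<open>A Boolean index tells the two halves apart, so the concatenated family is an
    instance of \<open>AC_family_Sigma\<close>.\<close>
  let ?K = "\<lambda>b. if b then {..<n1} else {..<n2}" and ?X = "\<lambda>b. if b then x1 else x2" and ?Y = "\<lambda>b. if b then y1 else y2"
  have "AC_family UNIV (\<lambda>b. if b then c else m) (\<lambda>b. if b then m else d) c d"
    using assms(3,4) by (auto simp: AC_family_def)
  then have "AC_family (Sigma UNIV ?K) (\<lambda>(i, k). ?X i k) (\<lambda>(i, k). ?Y i k) c d"
    using 1 2 by (intro AC_family_Sigma) auto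
  from variation_sumsI[OF this, of f]
  have "(\<Sum>i\<in>Sigma UNIV ?K. case i of (i, k) \<Rightarrow> norm (f (?Y i k) - f (?X i k))) \<in> variation_sums f c d"
    by (simp add: case_prod_beta)
  also have "(\<Sum>i\<in>Sigma UNIV ?K. case i of (i, k) \<Rightarrow> norm (f (?Y i k) - f (?X i k))) = (\<Sum>i\<in>UNIV. \<Sum>k\<in>?K i. norm (f (?Y i k) - f (?X i k)))"
    by (rule sum.Sigma[symmetric]) auto
  also have "\<dots> = r + s" by (simp add: UNIV_bool 1 2 add.commute)
  finally show ?thesis .
qed

text \<open>Clipping every interval at \<open>m\<close> from both sides makes the intervals on the
  wrong side degenerate and splits the one that straddles \<open>m\<close>; the triangle inequality
  then only increases the sum.\<close>

lemma variation_sums_cut: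
  assumes "t \<in> variation_sums f c d" "c \<le> m" "m \<le> d"
  obtains r s where "r \<in> variation_sums f c m" "s \<in> variation_sums f m d" "t \<le> r + s"
proof -
  obtain n x y where A: "AC_family {..<n::nat} x y c d" "t = (\<Sum>i<n. norm (f (y i) - f (x i)))"
    using assms(1) by (auto simp: variation_sums_def)
  have sub: "{min (x i) m<..<min (y i) m} \<subseteq> {x i<..<y i}" "{max (x i) m<..<max (y i) m} \<subseteq> {x i<..<y i}" for i
    by auto
  have disj: "{x i<..<y i} \<inter> {x j<..<y j} = {}" if "i < n" "j < n" "i \<noteq> j" for i j
    using A(1) that unfolding AC_family_def by simp
  have xy: "c \<le> min (x i) m \<and> min (x i) m \<le> min (y i) m \<and> min (y i) m \<le> m"
    "m \<le> max (x i) m \<and> max (x i) m \<le> max (y i) m \<and> max (y i) m \<le> d" if "i < n" for i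
  proof -
    have "c \<le> x i" "x i \<le> y i" "y i \<le> d" using A(1) that by (auto simp: AC_family_def)
    then show "c \<le> min (x i) m \<and> min (x i) m \<le> min (y i) m \<and> min (y i) m \<le> m"
      "m \<le> max (x i) m \<and> max (x i) m \<le> max (y i) m \<and> max (y i) m \<le> d" using assms by auto
  qed
  have B: "AC_family {..<n} (\<lambda>i. min (x i) m) (\<lambda>i. min (y i) m) c m"
    unfolding AC_family_def
  proof (intro conjI ballI impI)
    fix i j assume "i \<in> {..<n}" "j \<in> {..<n}" "i \<noteq> j"
    then show "{min (x i) m<..<min (y i) m} \<inter> {min (x j) m<..<min (y j) m} = {}"
      using sub(1)[of i] sub(1)[of j] disj[of i j] by (metis Int_mono lessThan_iff subset_empty)
  qed (use xy in \<open>simp_all only: lessThan_iff finite_lessThan\<close>)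
  have C: "AC_family {..<n} (\<lambda>i. max (x i) m) (\<lambda>i. max (y i) m) m d"
    unfolding AC_family_def
  proof (intro conjI ballI impI)
    fix i j assume "i \<in> {..<n}" "j \<in> {..<n}" "i \<noteq> j"
    then show "{max (x i) m<..<max (y i) m} \<inter> {max (x j) m<..<max (y j) m} = {}"
      using sub(2)[of i] sub(2)[of j] disj[of i j] by (metis Int_mono lessThan_iff subset_empty)
  qed (use xy in \<open>simp_all only: lessThan_iff finite_lessThan\<close>)
  have "t \<le> (\<Sum>i<n. norm (f (min (y i) m) - f (min (x i) m)) + norm (f (max (y i) m) - f (max (x i) m)))"
    unfolding A(2)
  proof (intro sum_mono)
    fix i assume "i \<in> {..<n}"
    then have "x i \<le> y i" using A by (auto simp: AC_family_def)
    then consider "m \<le> x i" | "y i \<le> m" | "x i < m" "m < y i" by linarith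
    then show "norm (f (y i) - f (x i)) \<le> norm (f (min (y i) m) - f (min (x i) m)) + norm (f (max (y i) m) - f (max (x i) m))"
    proof cases
      case 3
      then show ?thesis using norm_triangle_ineq[of "f m - f (x i)" "f (y i) - f m"] by (simp add: min_def max_def)
    qed (use \<open>x i \<le> y i\<close> in \<open>auto simp: min_def max_def\<close>)
  qed
  also have "\<dots> = (\<Sum>i<n. norm (f (min (y i) m) - f (min (x i) m))) + (\<Sum>i<n. norm (f (max (y i) m) - f (max (x i) m)))"
    by (simp add: sum.distrib)
  finally show thesis by (rule that[OF variation_sumsI[OF B, of f] variation_sumsI[OF C, of f]])
qed

text \<open>The total variation of \<open>f\<close> on [c, x]. It is used only where the sums are
  bounded, so that \<open>Sup\<close> is the true supremum.\<close>

definition variation_fun :: "(real \<Rightarrow> complex) \<Rightarrow> real \<Rightarrow> real \<Rightarrow> real" where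
  "variation_fun f c x = Sup (variation_sums f c x)"

lemma variation_fun_add:
  \<comment> \<open>The bound 1 is what epsilon = 1 in the definition of absolute continuity gives
    on intervals shorter than the corresponding delta.\<close>
  assumes B: "\<And>s. s \<in> variation_sums f c d \<Longrightarrow> s \<le> 1"
    and "c \<le> x" "x \<le> y" "y \<le> d" and s: "s \<in> variation_sums f x y"
  shows "variation_fun f c x + s \<le> variation_fun f c y"
proof -
  have "t \<le> 1" if "t \<in> variation_sums f c y" for t
    using B[OF variation_sums_add[OF that zero_in_variation_sums[of f y d]]] assms by simp
  then have bdd: "bdd_above (variation_sums f c y)" by (auto simp: bdd_above_def)
  have "variation_fun f c x \<le> variation_fun f c y - s"
    unfolding variation_fun_def
  proof (rule cSup_least)
    fix r assume "r \<in> variation_sums f c x"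
    then have "r + s \<in> variation_sums f c y" using s assms by (intro variation_sums_add) auto
    then show "r \<le> Sup (variation_sums f c y) - s" using cSup_upper[OF _ bdd, of "r + s"] by simp
  qed (use zero_in_variation_sums in blast)
  then show ?thesis by simp
qed

lemma variation_fun_diff:
  assumes B: "\<And>s. s \<in> variation_sums f c d \<Longrightarrow> s \<le> 1"
    and "c \<le> x" "x \<le> y" "y \<le> d" and e: "0 < e"
  shows "\<exists>s\<in>variation_sums f x y. variation_fun f c y - variation_fun f c x - e < s"
proof -
  have "t \<le> 1" if "t \<in> variation_sums f c x" for t
    using B[OF variation_sums_add[OF that zero_in_variation_sums[of f x d]]] assms by simp
  then have bdd: "bdd_above (variation_sums f c x)" by (auto simp: bdd_above_def)
  have "\<exists>t\<in>variation_sums f c y. variation_fun f c y - e < t"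
    unfolding variation_fun_def using e zero_in_variation_sums by (intro less_cSupD) auto
  then obtain t where t: "t \<in> variation_sums f c y" "variation_fun f c y - e < t" by blast
  obtain r s where "r \<in> variation_sums f c x" "s \<in> variation_sums f x y" "t \<le> r + s"
    using variation_sums_cut[OF t(1)] assms by blast
  moreover have "r \<le> variation_fun f c x" unfolding variation_fun_def using calculation bdd by (intro cSup_upper) auto
  ultimately show ?thesis using t by (intro bexI[of _ s]) auto
qed

text \<open>The increments of the variation over a family are nearly attained by sums over
  refinements. The union of all refinements is again one family of no larger total length, so the
  delta of \<open>f\<close> also works for its variation.\<close>

lemma variation_fun_AC:
  assumes f: "AC_Icc c d f" and B: "\<And>s. s \<in> variation_sums f c d \<Longrightarrow> s \<le> 1"
  shows "AC_Icc c d (\<lambda>x. complex_of_real (variation_fun f c x))"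
proof (rule AC_IccI)
  fix e :: real assume e: "0 < e"
  let ?v = "variation_fun f c"
  have "0 < e / 2" using e by simp
  from AC_IccE[OF f this] obtain \<delta> where \<delta>: "\<delta> > 0" "\<And>(n::nat) x y. AC_family {..<n} x y c d \<Longrightarrow> (\<Sum>i<n. y i - x i) < \<delta> \<Longrightarrow> (\<Sum>i<n. norm (f (y i) - f (x i))) < e / 2"
    by blast
  show "\<exists>\<delta>>0. \<forall>(n::nat) x y. AC_family {..<n} x y c d \<and> (\<Sum>i<n. y i - x i) < \<delta> \<longrightarrow>
      (\<Sum>i<n. norm (complex_of_real (?v (y i)) - complex_of_real (?v (x i)))) < e"
  proof (intro exI[of _ \<delta>] conjI allI impI \<delta>(1))
    fix n :: nat and x y :: "nat \<Rightarrow> real" assume A: "AC_family {..<n} x y c d \<and> (\<Sum>i<n. y i - x i) < \<delta>"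
    then have xy: "c \<le> x i" "x i \<le> y i" "y i \<le> d" if "i < n" for i
      using that by (auto simp: AC_family_def)
    \<comment> \<open>The n approximation errors together cost at most e/2; the other half comes
      from the delta of \<open>f\<close>.\<close>
    define \<eta> where "\<eta> = e / (2 * (real n + 1))"
    have \<eta>: "\<eta> > 0" using e by (simp add: \<eta>_def)
    have ex: "\<exists>m X Y. AC_family {..<m::nat} X Y (x i) (y i) \<and> ?v (y i) - ?v (x i) - \<eta> < (\<Sum>k<m. norm (f (Y k) - f (X k)))" if "i < n" for i
      using variation_fun_diff[OF B xy[OF that] \<eta>] unfolding variation_sums_def by blast
    obtain m X Y where M: "\<And>i. i < n \<Longrightarrow> AC_family {..<m i::nat} (X i) (Y i) (x i) (y i)"
      "\<And>i. i < n \<Longrightarrow> ?v (y i) - ?v (x i) - \<eta> < (\<Sum>k<m i. norm (f (Y i k) - f (X i k)))"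
    proof -
      assume that: "\<And>m X Y. \<lbrakk>\<And>i. i < n \<Longrightarrow> AC_family {..<m i::nat} (X i) (Y i) (x i) (y i);
         \<And>i. i < n \<Longrightarrow> ?v (y i) - ?v (x i) - \<eta> < (\<Sum>k<m i. norm (f (Y i k) - f (X i k)))\<rbrakk> \<Longrightarrow> thesis"
      have "\<forall>i. \<exists>m X Y. i < n \<longrightarrow> AC_family {..<m::nat} X Y (x i) (y i) \<and> ?v (y i) - ?v (x i) - \<eta> < (\<Sum>k<m. norm (f (Y k) - f (X k)))"
        using ex by blast
      then obtain m X Y where "\<forall>i. i < n \<longrightarrow> AC_family {..<m i::nat} (X i) (Y i) (x i) (y i) \<and> ?v (y i) - ?v (x i) - \<eta> < (\<Sum>k<m i. norm (f (Y i k) - f (X i k)))"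
        unfolding choice_iff by blast
      then show thesis by (intro that[of m X Y]) auto
    qed
    let ?S = "Sigma {..<n} (\<lambda>i. {..<m i})"
    have S: "AC_family ?S (\<lambda>(i, k). X i k) (\<lambda>(i, k). Y i k) c d"
      using A M by (intro AC_family_Sigma[of _ x y]) auto
    obtain N :: nat and X' Y' where N: "AC_family {..<N} X' Y' c d"
       "\<And>F. (\<Sum>k<N. F (X' k) (Y' k)) = (\<Sum>p\<in>?S. (F (case p of (i, k) \<Rightarrow> X i k) (case p of (i, k) \<Rightarrow> Y i k) :: real))"
      by (rule AC_family_enum[OF S]) (rule that)
    have N2: "(\<Sum>k<N. F (X' k) (Y' k)) = (\<Sum>i<n. \<Sum>k<m i. (F (X i k) (Y i k) :: real))" for F
      unfolding N(2) by (subst sum.Sigma) (auto simp: case_prod_beta)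
    have "(\<Sum>i<N. Y' i - X' i) = (\<Sum>i<n. \<Sum>k<m i. Y i k - X i k)"
      using N2[of "\<lambda>x y. y - x"] by simp
    also have "\<dots> \<le> (\<Sum>i<n. y i - x i)"
      using M(1) xy by (intro sum_mono AC_family_total) auto
    finally have len: "(\<Sum>i<N. Y' i - X' i) < \<delta>" using A by simp
    have "(\<Sum>i<n. norm (complex_of_real (?v (y i)) - complex_of_real (?v (x i)))) = (\<Sum>i<n. ?v (y i) - ?v (x i))"
    proof (intro sum.cong refl)
      fix i assume "i \<in> {..<n}"
      then have "?v (x i) + 0 \<le> ?v (y i)"
        using xy B by (intro variation_fun_add[of f c d] zero_in_variation_sums) auto
      then show "norm (complex_of_real (?v (y i)) - complex_of_real (?v (x i))) = ?v (y i) - ?v (x i)"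
        by (simp flip: of_real_diff)
    qed
    also have "\<dots> \<le> (\<Sum>i<n. (\<Sum>k<m i. norm (f (Y i k) - f (X i k))) + \<eta>)"
      using M(2) by (intro sum_mono) (auto simp: algebra_simps intro: less_imp_le)
    also have "\<dots> = (\<Sum>k<N. norm (f (Y' k) - f (X' k))) + real n * \<eta>"
      using N2[of "\<lambda>x y. norm (f y - f x)"] by (simp add: sum.distrib)
    also have "\<dots> < e / 2 + real n * \<eta>"
      using \<delta>(2)[OF N(1) len] by simp
    also have "real n * \<eta> \<le> e / 2" using e by (simp add: \<eta>_def field_simps)
    finally show "(\<Sum>i<n. norm (complex_of_real (?v (y i)) - complex_of_real (?v (x i)))) < e" by simp
  qed
qed
lemma AC_Icc_uniform:
  assumes "AC_Icc c d f" "0 < e"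
  obtains \<delta> where "\<delta> > 0" "\<And>x y. c \<le> x \<Longrightarrow> x \<le> d \<Longrightarrow> c \<le> y \<Longrightarrow> y \<le> d \<Longrightarrow> \<bar>y - x\<bar> < \<delta> \<Longrightarrow> norm (f y - f x) < e"
proof -
  obtain \<delta> where \<delta>: "\<delta> > 0" "\<And>(n::nat) x y. AC_family {..<n} x y c d \<Longrightarrow> (\<Sum>i<n. y i - x i) < \<delta> \<Longrightarrow> (\<Sum>i<n. norm (f (y i) - f (x i))) < e"
    by (rule AC_IccE[OF assms]) (rule that)
  have 1: "norm (f y - f x) < e" if "c \<le> x" "x \<le> y" "y \<le> d" "y - x < \<delta>" for x y
    using \<delta>(2)[of 1 "\<lambda>_. x" "\<lambda>_. y"] that by (simp add: AC_family_def)
  show thesis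
  proof (rule that[OF \<delta>(1)])
    fix x y assume "c \<le> x" "x \<le> d" "c \<le> y" "y \<le> d" "\<bar>y - x\<bar> < \<delta>"
    then show "norm (f y - f x) < e"
      using 1[of x y] 1[of y x] by (cases "x \<le> y") (auto simp: norm_minus_commute)
  qed
qed

lemma AC_Icc_imp_continuous_on: "AC_Icc c d f \<Longrightarrow> continuous_on {c..d} f"
  unfolding continuous_on_iff dist_norm
proof (intro ballI allI impI)
  fix x e :: real assume A: "AC_Icc c d f" "x \<in> {c..d}" "0 < e"
  from AC_Icc_uniform[OF A(1,3)] obtain \<delta> where "\<delta> > 0"
    "\<And>x y. c \<le> x \<Longrightarrow> x \<le> d \<Longrightarrow> c \<le> y \<Longrightarrow> y \<le> d \<Longrightarrow> \<bar>y - x\<bar> < \<delta> \<Longrightarrow> norm (f y - f x) < e"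
    by blast
  with A(2) show "\<exists>d'>0. \<forall>x'\<in>{c..d}. norm (x' - x) < d' \<longrightarrow> norm (f x' - f x) < e"
    by (intro exI[of _ \<delta>]) auto
qed

text \<open>The Stieltjes measure of a monotone absolutely continuous function does not charge
  Lebesgue null sets, so the density is supplied by Radon-Nikodym.\<close>

lemma mono_AC_integral:
  fixes F :: "real \<Rightarrow> real"
  assumes cd: "c \<le> d" and mono: "\<And>x y. c \<le> x \<Longrightarrow> x \<le> y \<Longrightarrow> y \<le> d \<Longrightarrow> F x \<le> F y"
    and AC: "AC_Icc c d (\<lambda>x. complex_of_real (F x))"
  obtains g :: "real \<Rightarrow> real" where
    "\<And>x y. c \<le> x \<Longrightarrow> x \<le> y \<Longrightarrow> y \<le> d \<Longrightarrow> set_integrable lebesgue {x..y} g \<and> (LINT t:{x..y}|lebesgue. g t) = F y - F x"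
proof -
  \<comment> \<open>Clamping to [c, d] extends \<open>F\<close> by constants to a monotone
    continuous function on the line, as \<open>interval_measure\<close> requires.\<close>
  define cl where "cl x = max c (min d x)" for x
  have cl: "c \<le> cl x" "cl x \<le> d" for x using cd by (auto simp: cl_def)
  have cl_mono: "cl x \<le> cl y" if "x \<le> y" for x y using that by (auto simp: cl_def)
  have cl_lip: "\<bar>cl y - cl x\<bar> \<le> \<bar>y - x\<bar>" for x y by (auto simp: cl_def)
  have cl_id: "cl x = x" if "c \<le> x" "x \<le> d" for x using that by (auto simp: cl_def)
  define G where "G x = F (cl x)" for x
  have G_mono: "G x \<le> G y" if "x \<le> y" for x y
    unfolding G_def using cl cl_mono[OF that] by (intro mono) auto
  have G_cont: "continuous_on UNIV G"
  proof -
    have "continuous_on {c..d} (\<lambda>x. Re (complex_of_real (F x)))"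
      by (rule continuous_on_Re[OF AC_Icc_imp_continuous_on[OF AC]])
    then have "continuous_on {c..d} F" by (simp only: Re_complex_of_real)
    moreover have "continuous_on UNIV cl" unfolding cl_def by (intro continuous_intros)
    ultimately have "continuous_on UNIV (F \<circ> cl)"
      using cl by (intro continuous_on_compose) (auto intro: continuous_on_subset)
    then show ?thesis by (simp add: G_def[abs_def] o_def)
  qed
  define \<mu> where "\<mu> = interval_measure G"
  have cont_r: "continuous (at_right a) G" for a
    using G_cont continuous_on_eq_continuous_at[OF open_UNIV, of G] continuous_at_imp_continuous_at_within by blast
  have sets_mu[simp]: "sets \<mu> = sets borel" by (simp add: \<mu>_def)
  have mu_Ioc: "emeasure \<mu> {x<..y} = ennreal (G y - G x)" if "x \<le> y" for x y
    unfolding \<mu>_def using that by (intro emeasure_interval_measure_Ioc G_mono cont_r)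
  have mu_Icc: "emeasure \<mu> {x..y} = ennreal (G y - G x)" if "x \<le> y" for x y
    unfolding \<mu>_def using that by (intro emeasure_interval_measure_Icc G_mono G_cont)
  have "absolutely_continuous lborel \<mu>"
    unfolding absolutely_continuous_def
  proof
    fix N :: "real set" assume N: "N \<in> null_sets lborel"
    have "emeasure \<mu> N \<le> 0"
    proof (rule ennreal_le_epsilon)
      fix e :: real assume e: "0 < e"
      obtain \<delta> where \<delta>: "\<delta> > 0" "\<And>(n::nat) x y. AC_family {..<n} x y c d \<Longrightarrow> (\<Sum>i<n. y i - x i) < \<delta> \<Longrightarrow>
         (\<Sum>i<n. norm (complex_of_real (F (y i)) - complex_of_real (F (x i)))) < e"
        by (rule AC_IccE[OF AC e]) (rule that)
      have "N \<in> sets borel" using N by auto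
      from outer_regular_lborel[OF this \<delta>(1)] obtain U where U: "open U" "N \<subseteq> U" "emeasure lborel (U - N) < ennreal \<delta>"
        by blast
      have "emeasure lborel U = emeasure lborel (U - N)"
        using N U by (metis emeasure_Diff_null_set borel_open sets_lborel)
      then have U\<delta>: "emeasure lborel U < ennreal \<delta>" using U by simp
      \<comment> \<open>Absolute continuity speaks of finite families only, so the open set is
        approximated from inside by finitely many grid cells of mesh 1/(n+1). The grids for
        different n are not nested; therefore the increasing sets \<open>V n\<close>, the
        intersections of all later \<open>W m\<close>, carry the limit.\<close>
      define lo hi where "lo n k = of_int k / real (Suc n)" and "hi n k = (of_int k + 1) / real (Suc n)" for n and k :: int
      have lohi: "lo n k \<le> hi n k" for n k by (simp add: lo_def hi_def divide_right_mono)
      have hilo: "hi n k \<le> lo n l" if "k < l" for n k l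
      proof -
        have "of_int k + 1 \<le> (of_int l :: real)" using that by linarith
        then show ?thesis unfolding lo_def hi_def by (intro divide_right_mono) auto
      qed
      \<comment> \<open>With mesh 1/(n+1), indices up to (n+1)^2 in modulus reach points of modulus
        about n+1, so every fixed point is eventually in range.\<close>
      define J where "J n = {k \<in> {- (int (Suc n))\<^sup>2 .. (int (Suc n))\<^sup>2}. {lo n k..hi n k} \<subseteq> U}" for n
      define W where "W n = (\<Union>k\<in>J n. {lo n k<..hi n k})" for n
      have finJ: "finite (J n)" for n unfolding J_def by (rule finite_subset[of _ "{- (int (Suc n))\<^sup>2 .. (int (Suc n))\<^sup>2}"]) auto
      have disjJ: "disjoint_family_on (\<lambda>k. {lo n k<..hi n k}) (J n)" for n
        unfolding disjoint_family_on_def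
      proof (intro ballI impI)
        fix k l assume "k \<in> J n" "l \<in> J n" "k \<noteq> l"
        then consider "k < l" | "l < k" by linarith
        then show "{lo n k<..hi n k} \<inter> {lo n l<..hi n l} = {}"
          by cases (use hilo[of k l n] hilo[of l k n] in auto)
      qed
      have WU: "W n \<subseteq> U" for n unfolding W_def J_def by fastforce
      have len: "(\<Sum>k\<in>J n. hi n k - lo n k) < \<delta>" for n
      proof -
        have "ennreal (\<Sum>k\<in>J n. hi n k - lo n k) = (\<Sum>k\<in>J n. emeasure lborel {lo n k<..hi n k})"
          using lohi by (subst sum_ennreal[symmetric]) auto
        also have "\<dots> = emeasure lborel (W n)"
          unfolding W_def using disjJ finJ by (intro sum_emeasure) auto
        also have "\<dots> \<le> emeasure lborel U"
          using WU U by (intro emeasure_mono) auto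
        finally have "ennreal (\<Sum>k\<in>J n. hi n k - lo n k) < ennreal \<delta>" using U\<delta> by simp
        then show ?thesis using lohi by (subst (asm) ennreal_less_iff) (auto intro: sum_nonneg)
      qed
      have muW: "emeasure \<mu> (W n) \<le> ennreal e" for n
      proof -
        have fam: "AC_family (J n) (\<lambda>k. cl (lo n k)) (\<lambda>k. cl (hi n k)) c d"
          unfolding AC_family_def
        proof (intro conjI ballI impI)
          fix k l assume kl: "k \<in> J n" "l \<in> J n" "k \<noteq> l"
          have "{cl (lo n k)<..<cl (hi n k)} \<subseteq> {lo n k<..hi n k}" for k
            by (auto simp: cl_def)
          moreover have "{lo n k<..hi n k} \<inter> {lo n l<..hi n l} = {}"
            using disjJ kl unfolding disjoint_family_on_def by metis
          ultimately show "{cl (lo n k)<..<cl (hi n k)} \<inter> {cl (lo n l)<..<cl (hi n l)} = {}"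
            by (metis Int_mono subset_empty)
        qed (use finJ cl cl_mono lohi in auto)
        obtain m :: nat and X Y where m: "AC_family {..<m} X Y c d"
           "\<And>F. (\<Sum>k<m. F (X k) (Y k)) = (\<Sum>k\<in>J n. (F (cl (lo n k)) (cl (hi n k)) :: real))"
          by (rule AC_family_enum[OF fam]) (rule that)
        have "(\<Sum>i<m. Y i - X i) = (\<Sum>k\<in>J n. cl (hi n k) - cl (lo n k))"
          using m(2)[of "\<lambda>x y. y - x"] .
        also have "\<dots> \<le> (\<Sum>k\<in>J n. hi n k - lo n k)"
        proof (rule sum_mono)
          fix k show "cl (hi n k) - cl (lo n k) \<le> hi n k - lo n k"
            using cl_lip[of "hi n k" "lo n k"] cl_mono[OF lohi] lohi[of n k] by (smt (verit))
        qed
        finally have "(\<Sum>i<m. Y i - X i) < \<delta>" using len[of n] by simp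
        from \<delta>(2)[OF m(1) this] have "(\<Sum>k\<in>J n. norm (complex_of_real (F (cl (hi n k))) - complex_of_real (F (cl (lo n k))))) < e"
          using m(2)[of "\<lambda>x y. norm (complex_of_real (F y) - complex_of_real (F x))"] by simp
        moreover have "norm (complex_of_real (F (cl (hi n k))) - complex_of_real (F (cl (lo n k)))) = G (hi n k) - G (lo n k)" for k
          using G_mono[OF lohi[of n k]] by (simp add: G_def flip: of_real_diff)
        ultimately have le: "(\<Sum>k\<in>J n. G (hi n k) - G (lo n k)) < e" by simp
        have "emeasure \<mu> (W n) \<le> (\<Sum>k\<in>J n. emeasure \<mu> {lo n k<..hi n k})"
          unfolding W_def using finJ by (intro emeasure_subadditive_finite) auto
        also have "\<dots> = ennreal (\<Sum>k\<in>J n. G (hi n k) - G (lo n k))"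
          using mu_Ioc[OF lohi] G_mono[OF lohi] by (simp add: sum_ennreal)
        also have "\<dots> \<le> ennreal e" using le by (intro ennreal_leI) auto
        finally show ?thesis .
      qed
      define V where "V n = (\<Inter>m\<in>{n..}. W m)" for n
      have Wb: "W n \<in> sets borel" for n unfolding W_def using finJ by (intro sets.finite_UN) auto
      have Vb: "V n \<in> sets borel" for n unfolding V_def using Wb by (intro sets.countable_INT') auto
      have "incseq V" unfolding V_def incseq_def by auto
      have "N \<subseteq> (\<Union>n. V n)"
      proof
        fix x assume "x \<in> N"
        then obtain r where r: "r > 0" "cball x r \<subseteq> U" using U open_contains_cball by blast
        obtain n0 :: nat where n0: "max (1 / r) (\<bar>x\<bar> + 1) < real n0" using reals_Archimedean2 by blast
        have "x \<in> W n" if "n \<ge> n0" for n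
        proof -
          define k where "k = \<lceil>x * real (Suc n)\<rceil> - 1"
          have n1: "1 / r < real (Suc n)" "\<bar>x\<bar> + 1 < real (Suc n)" using n0 that by auto
          have k1: "of_int k < x * real (Suc n)" "x * real (Suc n) \<le> of_int k + 1"
            unfolding k_def by linarith+
          have x: "lo n k < x" "x \<le> hi n k"
            using k1 unfolding lo_def hi_def by (simp_all add: field_simps)
          have "hi n k - lo n k = 1 / real (Suc n)" by (simp add: hi_def lo_def diff_divide_distrib[symmetric])
          also have "\<dots> < r" using n1 r by (simp add: field_simps)
          finally have "{lo n k..hi n k} \<subseteq> cball x r" using x by (auto simp: dist_real_def)
          then have 1: "{lo n k..hi n k} \<subseteq> U" using r by blast
          have "\<bar>x * real (Suc n)\<bar> \<le> (real (Suc n) - 1) * real (Suc n)"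
            unfolding abs_mult using n1 by (intro mult_mono) auto
          then have "\<bar>x * real (Suc n)\<bar> \<le> (real (Suc n))\<^sup>2 - real (Suc n)"
            by (simp add: power2_eq_square algebra_simps)
          then have "\<bar>real_of_int k\<bar> \<le> (real (Suc n))\<^sup>2" using k1 by (simp del: of_nat_Suc)
          then have "\<bar>real_of_int k\<bar> \<le> real_of_int ((int (Suc n))\<^sup>2)" by simp
          then have "\<bar>k\<bar> \<le> (int (Suc n))\<^sup>2" by linarith
          then have "k \<in> J n" using 1 unfolding J_def by auto
          then show "x \<in> W n" using x unfolding W_def by auto
        qed
        then show "x \<in> (\<Union>n. V n)" unfolding V_def by auto
      qed
      then have "emeasure \<mu> N \<le> emeasure \<mu> (\<Union>n. V n)" using Vb by (intro emeasure_mono) auto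
      also have "\<dots> = (SUP n. emeasure \<mu> (V n))"
        using Vb \<open>incseq V\<close> by (intro SUP_emeasure_incseq[symmetric]) auto
      also have "\<dots> \<le> ennreal e"
      proof (rule SUP_least)
        fix n
        have "emeasure \<mu> (V n) \<le> emeasure \<mu> (W n)" using Wb by (intro emeasure_mono) (auto simp: V_def)
        with muW[of n] show "emeasure \<mu> (V n) \<le> ennreal e" by simp
      qed
      finally show "emeasure \<mu> N \<le> 0 + ennreal e" by simp
    qed
    then show "N \<in> null_sets \<mu>" using N by (intro null_setsI) auto
  qed
  then obtain g0 where g0[measurable]: "g0 \<in> borel_measurable lborel" and dens: "density lborel g0 = \<mu>"
    using sigma_finite_measure.Radon_Nikodym[OF sigma_finite_lborel, of \<mu>] by auto
  define g where "g x = enn2real (g0 x)" for x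
  have gm[measurable]: "g \<in> borel_measurable lborel" unfolding g_def by measurable
  show thesis
  proof (rule that)
    fix x y assume xy: "c \<le> x" "x \<le> y" "y \<le> d"
    have eq: "(\<integral>\<^sup>+ t. g0 t * indicator {x..y} t \<partial>lborel) = ennreal (F y - F x)"
      using mu_Icc[OF xy(2)] xy unfolding dens[symmetric] by (subst (asm) emeasure_density) (auto simp: G_def cl_id)
    then have "AE t in lborel. g0 t * indicator {x..y} t \<noteq> \<infinity>"
      by (intro nn_integral_noteq_infinite) auto
    then have "AE t in lborel. ennreal (indicator {x..y} t * g t) = g0 t * indicator {x..y} t"
      by eventually_elim (auto simp: g_def indicator_def top.not_eq_extremum)
    then have "(\<integral>\<^sup>+ t. ennreal (indicator {x..y} t * g t) \<partial>lborel) = ennreal (F y - F x)"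
      using eq nn_integral_cong_AE by metis
    then have "has_bochner_integral lborel (\<lambda>t. indicator {x..y} t * g t) (F y - F x)"
      using mono[OF xy] by (intro has_bochner_integral_nn_integral) (auto simp: g_def)
    then have "integrable lborel (\<lambda>t. indicator {x..y} t * g t)" "(\<integral>t. indicator {x..y} t * g t \<partial>lborel) = F y - F x"
      by (auto simp: has_bochner_integral_iff)
    then show "set_integrable lebesgue {x..y} g \<and> (LINT t:{x..y}|lebesgue. g t) = F y - F x"
      unfolding set_integrable_def set_lebesgue_integral_def
      by (simp add: integrable_completion integral_completion)
  qed
qed

section \<open>From epsilon-delta absolute continuity to primitives, and the calculus of
  primitives\<close>

lemma AC_derivD:
  assumes "AC_deriv I f g" "x \<le> y" "{x..y} \<subseteq> I"
  shows "set_integrable lebesgue {x..y} g" "(LINT t:{x..y}|lebesgue. g t) = f y - f x"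
  using assms by (auto simp: AC_deriv_def)

lemma AC_deriv_subset: "AC_deriv I f g \<Longrightarrow> J \<subseteq> I \<Longrightarrow> AC_deriv J f g"
  unfolding AC_deriv_def by blast

lemma AC_deriv_cong_AE:
  assumes f: "AC_deriv I f g" and AE: "AE x in lebesgue. x \<in> I \<longrightarrow> g x = g' x"
    and eq: "\<And>x. x \<in> I \<Longrightarrow> f x = f' x"
  shows "AC_deriv I f' g'"
  unfolding AC_deriv_def
proof (intro allI impI)
  fix x y assume xy: "x \<le> y \<and> {x..y} \<subseteq> I"
  obtain N where N: "N \<in> null_sets lebesgue" "{x. \<not> (x \<in> I \<longrightarrow> g x = g' x)} \<subseteq> N"
    using AE unfolding eventually_ae_filter by auto
  then have neg: "negligible N" by (simp add: negligible_iff_null_sets)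
  have g: "set_integrable lebesgue {x..y} g" "(LINT t:{x..y}|lebesgue. g t) = f y - f x"
    using AC_derivD[OF f] xy by blast+
  have eqN: "g' t = g t" if "t \<in> {x..y} - N" for t
  proof -
    have "t \<in> I" using that xy by blast
    moreover have "t \<notin> {x. \<not> (x \<in> I \<longrightarrow> g x = g' x)}" using that N(2) by blast
    ultimately show ?thesis by simp
  qed
  have g': "set_integrable lebesgue {x..y} g'"
    by (rule absolutely_integrable_spike[OF g(1) neg eqN])
  have "integral {x..y} g = integral {x..y} g'"
    by (rule integral_spike[OF neg eqN])
  then have "(LINT t:{x..y}|lebesgue. g' t) = (LINT t:{x..y}|lebesgue. g t)"
    using set_lebesgue_integral_eq_integral(2)[OF g(1)] set_lebesgue_integral_eq_integral(2)[OF g'] by simp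
  moreover have "f x = f' x" "f y = f' y" using xy by (auto intro!: eq)
  ultimately show "set_integrable lebesgue {x..y} g' \<and> (LINT t:{x..y}|lebesgue. g' t) = f' y - f' x"
    using g g' by simp
qed

lemma set_integral_Icc_combine:
  fixes g :: "real \<Rightarrow> 'a::euclidean_space"
  assumes "x \<le> m" "m \<le> y" "set_integrable lebesgue {x..m} g" "set_integrable lebesgue {m..y} g"
  shows "set_integrable lebesgue {x..y} g"
    "(LINT t:{x..y}|lebesgue. g t) = (LINT t:{x..m}|lebesgue. g t) + (LINT t:{m..y}|lebesgue. g t)"
proof -
  have "{x..y} = {x..m} \<union> {m..y}" using assms by auto
  then show 1: "set_integrable lebesgue {x..y} g" using assms by (auto intro: set_integrable_Un)
  have "integral {x..m} g + integral {m..y} g = integral {x..y} g"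
    using assms 1 set_lebesgue_integral_eq_integral(1) by (intro Henstock_Kurzweil_Integration.integral_combine) auto
  then show "(LINT t:{x..y}|lebesgue. g t) = (LINT t:{x..m}|lebesgue. g t) + (LINT t:{m..y}|lebesgue. g t)"
    using set_lebesgue_integral_eq_integral(2)[OF assms(3)] set_lebesgue_integral_eq_integral(2)[OF assms(4)]
     set_lebesgue_integral_eq_integral(2)[OF 1] by simp
qed

lemma AC_deriv_glue:
  assumes 1: "AC_deriv {c..m} f g" and 2: "AC_deriv {m..d} f g"
  shows "AC_deriv {c..d} f g"
  unfolding AC_deriv_def
proof (intro allI impI)
  fix x y assume xy: "x \<le> y \<and> {x..y} \<subseteq> {c..d}"
  consider "y \<le> m" | "m \<le> x" | "x < m" "m < y" by linarith
  then show "set_integrable lebesgue {x..y} g \<and> (LINT t:{x..y}|lebesgue. g t) = f y - f x"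
  proof cases
    case 1
    then show ?thesis using AC_derivD[OF assms(1), of x y] xy by auto
  next
    case 2
    then show ?thesis using AC_derivD[OF assms(2), of x y] xy by auto
  next
    case 3
    have l: "set_integrable lebesgue {x..m} g" "(LINT t:{x..m}|lebesgue. g t) = f m - f x"
      using AC_derivD[OF assms(1), of x m] xy 3 by auto
    have r: "set_integrable lebesgue {m..y} g" "(LINT t:{m..y}|lebesgue. g t) = f y - f m"
      using AC_derivD[OF assms(2), of m y] xy 3 by auto
    show ?thesis using set_integral_Icc_combine[of x m y g] l r 3 by simp
  qed
qed

lemma set_integral_complex_of_real':
  fixes g :: "real \<Rightarrow> real"
  assumes "set_integrable lebesgue A g"
  shows "set_integrable lebesgue A (\<lambda>x. complex_of_real (g x))"
    "(LINT t:A|lebesgue. complex_of_real (g t)) = complex_of_real (LINT t:A|lebesgue. g t)"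
proof -
  have e: "(\<lambda>x. indicator A x *\<^sub>R complex_of_real (g x)) = (\<lambda>x. complex_of_real (indicator A x *\<^sub>R g x))"
    by (auto simp: indicator_def)
  show "set_integrable lebesgue A (\<lambda>x. complex_of_real (g x))"
    using assms unfolding set_integrable_def e by (rule integrable_of_real)
  show "(LINT t:A|lebesgue. complex_of_real (g t)) = complex_of_real (LINT t:A|lebesgue. g t)"
    using assms unfolding set_lebesgue_integral_def e set_integrable_def by (intro integral_of_real)
qed

text \<open>Jordan decomposition: with v the variation function, v, v - Re f and v - Im f are
  monotone and absolutely continuous, and the density of \<open>f\<close> is assembled from their
  densities.\<close>

lemma AC_deriv_of_bounded_variation_sums:
  assumes f: "AC_Icc c d f" and cd: "c \<le> d" and B: "\<And>s. s \<in> variation_sums f c d \<Longrightarrow> s \<le> 1"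
  shows "\<exists>g. AC_deriv {c..d} f g"
proof -
  let ?v = "variation_fun f c"
  have v: "AC_Icc c d (\<lambda>x. complex_of_real (?v x))" by (rule variation_fun_AC[OF f B])
  have inc: "norm (f y - f x) \<le> ?v y - ?v x" if "c \<le> x" "x \<le> y" "y \<le> d" for x y
    using variation_fun_add[of f c d x y, OF B that norm_in_variation_sums[OF that(2)]] by simp
  have gen: "\<exists>g. \<forall>x y. c \<le> x \<and> x \<le> y \<and> y \<le> d \<longrightarrow> set_integrable lebesgue {x..y} g \<and> (LINT t:{x..y}|lebesgue. g t) = (?v y - F y) - (?v x - F x)"
    if F: "\<And>x y. \<bar>F y - F x\<bar> \<le> norm (f y - f x)" for F :: "real \<Rightarrow> real"
  proof -
    have "AC_Icc c d (\<lambda>x. complex_of_real (?v x - F x))"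
    proof (rule AC_Icc_bound[OF v f])
      fix x y assume "c \<le> x" "x \<le> y" "y \<le> d"
      have "norm (complex_of_real (?v y - F y) - complex_of_real (?v x - F x)) = \<bar>(?v y - ?v x) - (F y - F x)\<bar>"
        by (simp add: algebra_simps flip: of_real_diff)
      also have "\<dots> \<le> \<bar>?v y - ?v x\<bar> + \<bar>F y - F x\<bar>" by linarith
      also have "\<dots> \<le> norm (complex_of_real (?v y) - complex_of_real (?v x)) + norm (f y - f x)"
        using F[of y x] by (simp flip: of_real_diff)
      finally show "norm (complex_of_real (?v y - F y) - complex_of_real (?v x - F x)) \<le>
         1 * (norm (complex_of_real (?v y) - complex_of_real (?v x)) + norm (f y - f x))" by simp
    qed auto
    moreover have "?v x - F x \<le> ?v y - F y" if "c \<le> x" "x \<le> y" "y \<le> d" for x y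
      using inc[OF that] F[of y x] by linarith
    ultimately obtain g where "\<And>x y. c \<le> x \<Longrightarrow> x \<le> y \<Longrightarrow> y \<le> d \<Longrightarrow> set_integrable lebesgue {x..y} g \<and> (LINT t:{x..y}|lebesgue. g t) = (?v y - F y) - (?v x - F x)"
      using mono_AC_integral[OF cd, of "\<lambda>x. ?v x - F x"] by blast
    then show ?thesis by blast
  qed
  obtain g0 where g0: "\<And>x y. c \<le> x \<Longrightarrow> x \<le> y \<Longrightarrow> y \<le> d \<Longrightarrow> set_integrable lebesgue {x..y} g0 \<and> (LINT t:{x..y}|lebesgue. g0 t) = ?v y - ?v x"
    using gen[of "\<lambda>_. 0"] by auto
  have "\<bar>Re (f y) - Re (f x)\<bar> \<le> norm (f y - f x)" for x y using abs_Re_le_cmod[of "f y - f x"] by simp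
  from gen[OF this] obtain g1 where g1: "\<And>x y. c \<le> x \<Longrightarrow> x \<le> y \<Longrightarrow> y \<le> d \<Longrightarrow> set_integrable lebesgue {x..y} g1 \<and> (LINT t:{x..y}|lebesgue. g1 t) = (?v y - Re (f y)) - (?v x - Re (f x))"
    by blast
  have "\<bar>Im (f y) - Im (f x)\<bar> \<le> norm (f y - f x)" for x y using abs_Im_le_cmod[of "f y - f x"] by simp
  from gen[OF this] obtain g2 where g2: "\<And>x y. c \<le> x \<Longrightarrow> x \<le> y \<Longrightarrow> y \<le> d \<Longrightarrow> set_integrable lebesgue {x..y} g2 \<and> (LINT t:{x..y}|lebesgue. g2 t) = (?v y - Im (f y)) - (?v x - Im (f x))"
    by blast
  have "AC_deriv {c..d} f (\<lambda>x. complex_of_real (g0 x - g1 x) + \<i> * complex_of_real (g0 x - g2 x))"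
    unfolding AC_deriv_def
  proof (intro allI impI)
    fix x y assume "x \<le> y \<and> {x..y} \<subseteq> {c..d}"
    then have xy: "c \<le> x" "x \<le> y" "y \<le> d" by auto
    note g = g0[OF xy] g1[OF xy] g2[OF xy]
    have i1: "set_integrable lebesgue {x..y} (\<lambda>x. g0 x - g1 x)" "set_integrable lebesgue {x..y} (\<lambda>x. g0 x - g2 x)"
      using g by (auto intro: set_integral_diff)
    note c = set_integral_complex_of_real'[OF i1(1)] set_integral_complex_of_real'[OF i1(2)]
    have m: "set_integrable lebesgue {x..y} (\<lambda>x. \<i> * complex_of_real (g0 x - g2 x))"
      using c(3) by (rule set_integrable_mult_right)
    have "(LINT t:{x..y}|lebesgue. complex_of_real (g0 t - g1 t) + \<i> * complex_of_real (g0 t - g2 t)) =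
      complex_of_real (LINT t:{x..y}|lebesgue. g0 t - g1 t) + \<i> * complex_of_real (LINT t:{x..y}|lebesgue. g0 t - g2 t)"
      using c m by (subst set_integral_add) auto
    also have "(LINT t:{x..y}|lebesgue. g0 t - g1 t) = Re (f y) - Re (f x)"
      using g by (subst set_integral_diff) auto
    also have "(LINT t:{x..y}|lebesgue. g0 t - g2 t) = Im (f y) - Im (f x)"
      using g by (subst set_integral_diff) auto
    also have "complex_of_real (Re (f y) - Re (f x)) + \<i> * complex_of_real (Im (f y) - Im (f x)) = f y - f x"
      by (simp add: complex_eq_iff)
    finally show "set_integrable lebesgue {x..y} (\<lambda>x. complex_of_real (g0 x - g1 x) + \<i> * complex_of_real (g0 x - g2 x)) \<and>
       (LINT t:{x..y}|lebesgue. complex_of_real (g0 t - g1 t) + \<i> * complex_of_real (g0 t - g2 t)) = f y - f x"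
      using c m by (auto intro: set_integral_add)
  qed
  then show ?thesis by blast
qed

lemma AC_family_subset: "AC_family J x y c' d' \<Longrightarrow> c \<le> c' \<Longrightarrow> d' \<le> d \<Longrightarrow> AC_family J x y c d"
  unfolding AC_family_def by force

lemma AC_Icc_subset:
  assumes f: "AC_Icc c d f" and "c \<le> c'" "d' \<le> d"
  shows "AC_Icc c' d' f"
proof (rule AC_IccI)
  fix e :: real assume "0 < e"
  from AC_IccE[OF f this] obtain \<delta> where \<delta>: "\<delta> > 0"
    "\<And>(n::nat) x y. AC_family {..<n} x y c d \<Longrightarrow> (\<Sum>i<n. y i - x i) < \<delta> \<Longrightarrow> (\<Sum>i<n. norm (f (y i) - f (x i))) < e"
    by blast
  show "\<exists>\<delta>>0. \<forall>(n::nat) x y. AC_family {..<n} x y c' d' \<and> (\<Sum>i<n. y i - x i) < \<delta> \<longrightarrow> (\<Sum>i<n. norm (f (y i) - f (x i))) < e"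
    by (intro exI[of _ \<delta>] conjI allI impI \<delta>) (use assms in \<open>auto intro: AC_family_subset\<close>)
qed

lemma AC_Icc_imp_AC_deriv:
  assumes f: "AC_Icc c d f" and cd: "c \<le> d"
  shows "\<exists>g. AC_deriv {c..d} f g"
proof -
  obtain \<delta> where \<delta>: "\<delta> > 0" "\<And>(n::nat) x y. AC_family {..<n} x y c d \<Longrightarrow> (\<Sum>i<n. y i - x i) < \<delta> \<Longrightarrow> (\<Sum>i<n. norm (f (y i) - f (x i))) < 1"
    by (rule AC_IccE[OF f zero_less_one]) (rule that)
  have loc: "\<exists>g. AC_deriv {c'..d'} f g" if "c \<le> c'" "c' \<le> d'" "d' \<le> d" "d' - c' < \<delta>" for c' d'
  proof (rule AC_deriv_of_bounded_variation_sums)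
    show "AC_Icc c' d' f" using AC_Icc_subset[OF f] that by simp
    fix s assume "s \<in> variation_sums f c' d'"
    then obtain n x y where s: "AC_family {..<n::nat} x y c' d'" "s = (\<Sum>i<n. norm (f (y i) - f (x i)))"
      by (auto simp: variation_sums_def)
    have "(\<Sum>i<n. y i - x i) < \<delta>" using AC_family_total[OF s(1)] that by simp
    with \<delta>(2)[OF AC_family_subset[OF s(1) that(1,3)]] s(2) show "s \<le> 1" by simp
  qed (use that in auto)
  \<comment> \<open>Steps of length \<delta>/2 keep each new piece strictly shorter than \<delta>,
    where the variation is at most 1; the pieces are glued from left to right.\<close>
  have "\<forall>d'. c \<le> d' \<and> d' \<le> d \<and> d' - c \<le> real n * (\<delta> / 2) \<longrightarrow> (\<exists>g. AC_deriv {c..d'} f g)" for n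
  proof (induction n)
    case 0
    then show ?case using loc[of c] \<delta>(1) by auto
  next
    case (Suc n)
    show ?case
    proof (intro allI impI)
      fix d' assume d': "c \<le> d' \<and> d' \<le> d \<and> d' - c \<le> real (Suc n) * (\<delta> / 2)"
      define m where "m = max c (d' - \<delta> / 2)"
      have m: "c \<le> m" "m \<le> d'" "d' - m < \<delta>" "m - c \<le> real n * (\<delta> / 2)"
        using d' \<delta>(1) by (auto simp: m_def max_def algebra_simps)
      obtain g1 where g1: "AC_deriv {c..m} f g1" using Suc m d' by (meson order.trans)
      obtain g2 where g2: "AC_deriv {m..d'} f g2" using loc[of m d'] m d' by auto
      define g where "g x = (if x < m then g1 x else g2 x)" for x
      have "AE x in lebesgue. x \<notin> {m}" by (intro AE_not_in negligible_iff_null_sets[THEN iffD1]) auto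
      then have "AE x in lebesgue. x \<in> {c..m} \<longrightarrow> g1 x = g x" by eventually_elim (auto simp: g_def)
      then have "AC_deriv {c..m} f g" by (rule AC_deriv_cong_AE[OF g1]) simp
      moreover have "AC_deriv {m..d'} f g" by (rule AC_deriv_cong_AE[OF g2]) (auto simp: g_def)
      ultimately show "\<exists>g. AC_deriv {c..d'} f g" using AC_deriv_glue by blast
    qed
  qed
  moreover obtain n :: nat where "(d - c) / (\<delta> / 2) < real n" using reals_Archimedean2 by blast
  then have "d - c \<le> real n * (\<delta> / 2)" using \<delta>(1) by (simp add: field_simps)
  ultimately show ?thesis using cd by blast
qed

text \<open>These are the domains of the two kinds of operators, the line and a compact period.
  Nondegeneracy makes the derivative within the interval unique and lets continuous functions that
  agree almost everywhere agree everywhere.\<close>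

definition admissible_interval :: "real set \<Rightarrow> bool" where
  "admissible_interval I \<longleftrightarrow> I = UNIV \<or> (\<exists>c d. c < d \<and> I = {c..d})"

lemma admissible_interval_UNIV [simp]: "admissible_interval UNIV"
  by (simp add: admissible_interval_def)

lemma admissible_interval_Icc [simp]: "c < d \<Longrightarrow> admissible_interval {c..d}"
  by (auto simp: admissible_interval_def)

lemma admissible_interval_props:
  assumes "admissible_interval I"
  shows "is_interval I" "closed I" "I \<in> sets lebesgue"
  using assms by (auto simp: admissible_interval_def is_interval_cc)

lemma AC_deriv_AE_Icc:
  assumes f: "AC_deriv {c..d} f g"
  shows "AE x in lebesgue. x \<in> {c..d} \<longrightarrow> (f has_vector_derivative g x) (at x within {c..d})"
proof (cases "c \<le> d")
  case True
  have gi: "set_integrable lebesgue {c..d} g" using AC_derivD[OF f True] by simp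
  define g' where "g' x = indicator {c..d} x *\<^sub>R g x" for x
  have "integrable lebesgue g'" using gi unfolding set_integrable_def g'_def .
  then have g': "set_integrable lebesgue {x..y} g'" for x y
    unfolding set_integrable_def by (intro integrable_mult_indicator) auto
  have int: "f y - f x = (LINT t:{x..y}|lebesgue. g' t)" if "x \<in> {c..d}" "y \<in> {c..d}" "x \<le> y" for x y
  proof -
    have "(LINT t:{x..y}|lebesgue. g' t) = (LINT t:{x..y}|lebesgue. g t)"
      using that unfolding set_lebesgue_integral_def g'_def by (intro Bochner_Integration.integral_cong) (auto simp: indicator_def)
    then show ?thesis using AC_derivD(2)[OF f, of x y] that by auto
  qed
  have "AE x in lebesgue. x \<in> {c..d} \<longrightarrow> (f has_vector_derivative g' x) (at x within {c..d})"
    using AE_has_vector_derivative_integral[OF g' is_interval_cc, of c d f] int by blast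
  then show ?thesis by eventually_elim (auto simp: g'_def)
qed auto

lemma AC_deriv_AE:
  assumes f: "AC_deriv I f g" and I: "admissible_interval I"
  shows "AE x in lebesgue. x \<in> I \<longrightarrow> (f has_vector_derivative g x) (at x within I)"
proof -
  consider "I = UNIV" | c d where "I = {c..d}" using I by (auto simp: admissible_interval_def)
  then show ?thesis
  proof cases
    case 1
    have "AE x in lebesgue. \<forall>n::nat. x \<in> {- real n..real n} \<longrightarrow> (f has_vector_derivative g x) (at x within {- real n..real n})"
      unfolding AE_all_countable using f 1 by (intro allI AC_deriv_AE_Icc) (auto intro: AC_deriv_subset)
    then show ?thesis
    proof eventually_elim
      case (elim x)
      obtain n :: nat where "\<bar>x\<bar> < real n" using reals_Archimedean2 by blast
      then have x: "x \<in> {- real n<..<real n}" by auto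
      then have "(f has_vector_derivative g x) (at x within {- real n..real n})" using elim by auto
      moreover have "at x within {- real n..real n} = at x"
        using x by (intro at_within_interior) (simp add: interior_atLeastAtMost_real)
      ultimately show ?case using 1 by simp
    qed
  next
    case 2
    then show ?thesis using f AC_deriv_AE_Icc by simp
  qed
qed

lemma admissible_interval_at_neq_bot:
  assumes "admissible_interval I" "x \<in> I"
  shows "at x within I \<noteq> bot"
  using assms by (auto simp: admissible_interval_def trivial_limit_within islimpt_Icc)

lemma AC_deriv_vector_derivative:
  assumes f: "AC_deriv I f g" and I: "admissible_interval I"
  shows "AE x in lebesgue. x \<in> I \<longrightarrow> vector_derivative f (at x within I) = g x"
  using AC_deriv_AE[OF assms]
  by eventually_elim (use vector_derivative_within[OF admissible_interval_at_neq_bot[OF I]] in blast)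

text \<open>The link to the operator definitions, which are phrased with
  \<open>vector_derivative\<close>: by Lebesgue differentiation any density agrees with it almost
  everywhere.\<close>

lemma AC_loc_imp_AC_deriv:
  assumes f: "AC_loc I f" and I: "admissible_interval I"
  shows "AC_deriv I f (\<lambda>x. vector_derivative f (at x within I))"
proof -
  consider "I = UNIV" | c d where "I = {c..d}" "c < d" using I by (auto simp: admissible_interval_def)
  then show ?thesis
  proof cases
    case 2
    then obtain g where g: "AC_deriv I f g" using f AC_Icc_imp_AC_deriv[of c d f] by (auto simp: AC_loc_def)
    have "AE x in lebesgue. x \<in> I \<longrightarrow> g x = vector_derivative f (at x within I)"
      using AC_deriv_vector_derivative[OF g I] by eventually_elim auto
    then show ?thesis by (rule AC_deriv_cong_AE[OF g]) simp
  next
    case 1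
    have *: "AC_deriv {c..d} f (\<lambda>x. vector_derivative f (at x))" if cd: "c < d" for c d
    proof -
      obtain g where g: "AC_deriv {c..d} f g" using f 1 cd AC_Icc_imp_AC_deriv[of c d f] by (auto simp: AC_loc_def)
      have "AE x in lebesgue. x \<notin> {c, d}" by (intro AE_not_in negligible_iff_null_sets[THEN iffD1]) auto
      with AC_deriv_vector_derivative[OF g admissible_interval_Icc[OF cd]] have "AE x in lebesgue. x \<in> {c..d} \<longrightarrow> g x = vector_derivative f (at x)"
      proof (eventually_elim, intro impI)
        fix x assume x: "x \<in> {c..d}" "x \<notin> {c, d}"
          and A: "x \<in> {c..d} \<longrightarrow> vector_derivative f (at x within {c..d}) = g x"
        have "at x within {c..d} = at x"
          using x by (intro at_within_interior) (simp add: interior_atLeastAtMost_real)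
        then show "g x = vector_derivative f (at x)" using A x by auto
      qed
      then show ?thesis by (rule AC_deriv_cong_AE[OF g]) simp
    qed
    show ?thesis unfolding AC_deriv_def 1
    proof (intro allI impI)
      fix x y :: real assume "x \<le> y \<and> {x..y} \<subseteq> UNIV"
      then show "set_integrable lebesgue {x..y} (\<lambda>x. vector_derivative f (at x)) \<and> (LINT t:{x..y}|lebesgue. vector_derivative f (at t)) = f y - f x"
        \<comment> \<open>Enlarging the interval to y + 1 keeps it nondegenerate when x = y.\<close>
        using AC_derivD[OF *[of x "y + 1"], of x y] by auto
    qed
  qed
qed

text \<open>Boundedness on compact intervals makes the product absolutely continuous, so it has some
  density; the pointwise product rule, valid almost everywhere, identifies it.\<close>

lemma AC_deriv_mult:
  assumes f: "AC_deriv I f f'" and g: "AC_deriv I g g'"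
  shows "AC_deriv I (\<lambda>x. f x * g x) (\<lambda>x. f' x * g x + f x * g' x)"
proof -
  have Icc: "AC_deriv {c..d} (\<lambda>x. f x * g x) (\<lambda>x. f' x * g x + f x * g' x)"
    if f: "AC_deriv {c..d} f f'" and g: "AC_deriv {c..d} g g'" and cd: "c < d" for c d
  proof -
    have ac: "AC_Icc c d f" "AC_Icc c d g"
      using AC_deriv_imp_AC_loc[OF f] AC_deriv_imp_AC_loc[OF g] cd by (auto simp: AC_loc_def)
    have "compact (f ` {c..d})" "compact (g ` {c..d})"
      using ac by (auto intro!: compact_continuous_image AC_Icc_imp_continuous_on)
    then have "bounded (f ` {c..d})" "bounded (g ` {c..d})" by (auto intro: compact_imp_bounded)
    then obtain K1 K2 where K: "\<And>x. x \<in> {c..d} \<Longrightarrow> norm (f x) \<le> K1" "\<And>x. x \<in> {c..d} \<Longrightarrow> norm (g x) \<le> K2"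
      unfolding bounded_iff by blast
    define K where "K = \<bar>K1\<bar> + \<bar>K2\<bar> + 1"
    have "AC_Icc c d (\<lambda>x. f x * g x)"
    proof (rule AC_Icc_bound[OF ac])
      show "0 < K" by (simp add: K_def)
      fix x y assume xy: "c \<le> x" "x \<le> y" "y \<le> d"
      have "f y * g y - f x * g x = (f y - f x) * g y + f x * (g y - g x)" by (simp add: algebra_simps)
      also have "norm \<dots> \<le> norm (f y - f x) * norm (g y) + norm (f x) * norm (g y - g x)"
        by (metis norm_mult norm_triangle_ineq)
      also have "\<dots> \<le> norm (f y - f x) * K + K * norm (g y - g x)"
        using K[of x] K[of y] xy by (intro add_mono mult_left_mono mult_right_mono) (auto simp: K_def)
      finally show "norm (f y * g y - f x * g x) \<le> K * (norm (f y - f x) + norm (g y - g x))"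
        by (simp add: algebra_simps)
    qed
    moreover have "AC_loc {c..d} h" if "AC_Icc c d h" for h
      using AC_Icc_subset[OF that] by (auto simp: AC_loc_def)
    ultimately have A: "AC_deriv {c..d} (\<lambda>x. f x * g x) (\<lambda>x. vector_derivative (\<lambda>x. f x * g x) (at x within {c..d}))"
      using cd by (intro AC_loc_imp_AC_deriv) auto
    have "AE x in lebesgue. x \<in> {c..d} \<longrightarrow> vector_derivative (\<lambda>x. f x * g x) (at x within {c..d}) = f' x * g x + f x * g' x"
      using AC_deriv_AE[OF f admissible_interval_Icc[OF cd]] AC_deriv_AE[OF g admissible_interval_Icc[OF cd]]
    proof (eventually_elim, intro impI)
      fix x assume "x \<in> {c..d} \<longrightarrow> (f has_vector_derivative f' x) (at x within {c..d})"
        "x \<in> {c..d} \<longrightarrow> (g has_vector_derivative g' x) (at x within {c..d})" "x \<in> {c..d}"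
      then have "((\<lambda>x. f x * g x) has_vector_derivative (f x * g' x + f' x * g x)) (at x within {c..d})"
        by (intro has_vector_derivative_mult) auto
      then show "vector_derivative (\<lambda>x. f x * g x) (at x within {c..d}) = f' x * g x + f x * g' x"
        using \<open>x \<in> {c..d}\<close> cd by (subst vector_derivative_within[OF admissible_interval_at_neq_bot]) (auto simp: add.commute)
    qed
    then show ?thesis by (rule AC_deriv_cong_AE[OF A]) simp
  qed
  show ?thesis
    unfolding AC_deriv_def
  proof (intro allI impI)
    fix x y assume xy: "x \<le> y \<and> {x..y} \<subseteq> I"
    show "set_integrable lebesgue {x..y} (\<lambda>x. f' x * g x + f x * g' x) \<and>
        (LINT t:{x..y}|lebesgue. f' t * g t + f t * g' t) = f y * g y - f x * g x"
    proof (cases "x = y")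
      case True
      have "negligible {y}" by simp
      then have "set_integrable lebesgue {y} (\<lambda>x. f' x * g x + f x * g' x)"
        by (rule absolutely_integrable_negligible)
      then show ?thesis using True by (simp add: set_lebesgue_integral_eq_integral)
    next
      case False
      then show ?thesis using AC_derivD[OF Icc[of x y], of x y] xy f g AC_deriv_subset by auto
    qed
  qed
qed

section \<open>Linear systems with integrable coefficients\<close>

definition loc_integrable :: "(real \<Rightarrow> complex) \<Rightarrow> bool" where
  "loc_integrable g \<longleftrightarrow> (\<forall>c d. set_integrable lebesgue {c..d} g)"

lemma set_integrable_mult_continuous:
  fixes g f :: "real \<Rightarrow> complex"
  assumes g: "set_integrable lebesgue {c..d} g" and f: "continuous_on {c..d} f"
  shows "set_integrable lebesgue {c..d} (\<lambda>x. g x * f x)"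
proof -
  have "bounded (f ` {c..d})" using f by (intro compact_imp_bounded compact_continuous_image) auto
  then obtain K where K: "\<And>x. x \<in> {c..d} \<Longrightarrow> norm (f x) \<le> K" unfolding bounded_iff by blast
  define f' where "f' x = indicator {c..d} x *\<^sub>R f x" for x
  have fm: "f' \<in> borel_measurable lebesgue"
    unfolding f'_def using borel_measurable_continuous_on_indicator[OF _ f]
    by (intro measurable_completion) (simp add: measurable_lborel1)
  have "integrable lebesgue (\<lambda>x. (indicator {c..d} x *\<^sub>R g x) * f' x)"
  proof (rule Bochner_Integration.integrable_bound)
    show "integrable lebesgue (\<lambda>x. \<bar>K\<bar> * norm (indicator {c..d} x *\<^sub>R g x))"
      using g unfolding set_integrable_def by (intro integrable_mult_right integrable_norm)
    show "AE x in lebesgue. norm ((indicator {c..d} x *\<^sub>R g x) * f' x) \<le> norm (\<bar>K\<bar> * norm (indicator {c..d} x *\<^sub>R g x))"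
    proof (rule AE_I2)
      fix x
      have "norm (g x) * norm (f x) \<le> norm (g x) * \<bar>K\<bar>" if "x \<in> {c..d}"
        using K[OF that] by (intro mult_left_mono) auto
      then show "norm ((indicator {c..d} x *\<^sub>R g x) * f' x) \<le> norm (\<bar>K\<bar> * norm (indicator {c..d} x *\<^sub>R g x))"
        by (auto simp: f'_def indicator_def norm_mult mult.commute)
    qed
  next
    show "(\<lambda>x. (indicator {c..d} x *\<^sub>R g x) * f' x) \<in> borel_measurable lebesgue"
      using borel_measurable_times[OF borel_measurable_integrable[OF g[unfolded set_integrable_def]] fm] .
  qed
  then show ?thesis
    unfolding set_integrable_def by (rule Bochner_Integration.integrable_cong[THEN iffD1, rotated -1]) (auto simp: f'_def indicator_def)
qed

lemma loc_integrable_mult_continuous: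
  "loc_integrable g \<Longrightarrow> continuous_on UNIV f \<Longrightarrow> loc_integrable (\<lambda>x. g x * f x)"
  unfolding loc_integrable_def
  by (intro allI set_integrable_mult_continuous) (auto elim: continuous_on_subset)

text \<open>The primitive that vanishes at 0, with the usual sign convention to the left of
  0.\<close>

definition oint :: "(real \<Rightarrow> complex) \<Rightarrow> real \<Rightarrow> complex" where
  "oint g x = (if 0 \<le> x then (LINT t:{0..x}|lebesgue. g t) else - (LINT t:{x..0}|lebesgue. g t))"

lemma set_integral_singleton [simp]: "(LINT t:{x}|lebesgue. (g t :: 'a::euclidean_space)) = 0" for x :: real
proof -
  have "set_integrable lebesgue {x} g" by (rule absolutely_integrable_negligible) simp
  then show ?thesis by (simp add: set_lebesgue_integral_eq_integral)
qed

lemma oint_0 [simp]: "oint g 0 = 0"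
  by (simp add: oint_def)

lemma AC_deriv_oint:
  assumes "loc_integrable g"
  shows "AC_deriv UNIV (oint g) g"
  unfolding AC_deriv_def
proof (intro allI impI)
  fix x y :: real assume xy: "x \<le> y \<and> {x..y} \<subseteq> UNIV"
  have i: "set_integrable lebesgue {c..d} g" for c d using assms by (simp add: loc_integrable_def)
  consider "0 \<le> x" | "x < 0" "0 \<le> y" | "x < 0" "y < 0" by linarith
  then have "(LINT t:{x..y}|lebesgue. g t) = oint g y - oint g x"
  proof cases
    case 1
    then show ?thesis using set_integral_Icc_combine(2)[of 0 x y g] xy i by (simp add: oint_def)
  next
    case 2
    then show ?thesis using set_integral_Icc_combine(2)[of x 0 y g] xy i by (simp add: oint_def)
  next
    case 3
    then show ?thesis using set_integral_Icc_combine(2)[of x y 0 g] xy i by (simp add: oint_def)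
  qed
  with i show "set_integrable lebesgue {x..y} g \<and> (LINT t:{x..y}|lebesgue. g t) = oint g y - oint g x" by simp
qed

lemma AC_deriv_loc_integrable: "AC_deriv UNIV f g \<Longrightarrow> loc_integrable g"
  unfolding loc_integrable_def
proof (intro allI)
  fix c d :: real assume "AC_deriv UNIV f g"
  then show "set_integrable lebesgue {c..d} g"
    by (cases "c \<le> d") (auto dest: AC_derivD(1)[of UNIV f g c d] simp: set_integrable_def)
qed

lemma AC_deriv_continuous_on:
  assumes "AC_deriv I f g" "admissible_interval I"
  shows "continuous_on I f"
proof -
  have loc: "AC_loc I f" using assms by (intro AC_deriv_imp_AC_loc)
  consider "I = UNIV" | c d where "c < d" "I = {c..d}" using assms by (auto simp: admissible_interval_def)
  then show ?thesis
  proof cases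
    case 1
    have "continuous_on {x - 1..x + 1} f" for x
      using loc 1 by (intro AC_Icc_imp_continuous_on) (auto simp: AC_loc_def)
    then have "isCont f x" for x
      using continuous_on_interior[of "{x - 1..x + 1}" f x] by (simp add: interior_atLeastAtMost_real)
    then show ?thesis using 1 by (simp add: continuous_at_imp_continuous_on)
  next
    case 2
    then show ?thesis using loc AC_Icc_imp_continuous_on[of c d f] by (auto simp: AC_loc_def)
  qed
qed

lemma AC_deriv_const: "AC_deriv I (\<lambda>_. c) (\<lambda>_. 0)"
  by (simp add: AC_deriv_def set_integrable_def set_lebesgue_integral_def)

lemma AC_deriv_add:
  "AC_deriv I f f' \<Longrightarrow> AC_deriv I g g' \<Longrightarrow> AC_deriv I (\<lambda>x. f x + g x) (\<lambda>x. f' x + g' x)"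
  unfolding AC_deriv_def by (auto simp: set_integral_add)

lemma AC_deriv_diff:
  "AC_deriv I f f' \<Longrightarrow> AC_deriv I g g' \<Longrightarrow> AC_deriv I (\<lambda>x. f x - g x) (\<lambda>x. f' x - g' x)"
  unfolding AC_deriv_def by (auto simp: set_integral_diff)

lemma AC_deriv_cmult:
  "AC_deriv I f f' \<Longrightarrow> AC_deriv I (\<lambda>x. c * f x) (\<lambda>x. c * f' x)"
  unfolding AC_deriv_def by (auto simp: right_diff_distrib[symmetric])

lemma AC_deriv_cong:
  "AC_deriv I f g \<Longrightarrow> (\<And>x. x \<in> I \<Longrightarrow> f x = f' x) \<Longrightarrow> (\<And>x. x \<in> I \<Longrightarrow> g x = g' x) \<Longrightarrow> AC_deriv I f' g'"
  by (erule AC_deriv_cong_AE) auto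

lemma AC_deriv_zero_imp_const:
  assumes "AC_deriv I f (\<lambda>_. 0)" "is_interval I" "x \<in> I" "y \<in> I"
  shows "f x = f y"
proof -
  have *: "f y = f x" if "x \<le> y" "x \<in> I" "y \<in> I" for x y
  proof -
    have "{x..y} \<subseteq> I" using that mem_is_interval_1_I[OF assms(2)] by (meson atLeastAtMost_iff subsetI)
    from AC_derivD(2)[OF assms(1) that(1) this] show ?thesis by (simp add: set_lebesgue_integral_def)
  qed
  show ?thesis using *[of x y] *[of y x] assms by (cases "x \<le> y") auto
qed

lemma AC_deriv_unique_oint:
  assumes "AC_deriv UNIV f g"
  shows "f x = f 0 + oint g x"
proof -
  have "AC_deriv UNIV (\<lambda>x. f x - oint g x) (\<lambda>x. g x - g x)"
    using assms by (intro AC_deriv_diff AC_deriv_oint AC_deriv_loc_integrable)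
  then have "AC_deriv UNIV (\<lambda>x. f x - oint g x) (\<lambda>x. 0)" by simp
  from AC_deriv_zero_imp_const[OF this, of x 0] show ?thesis by (simp add: algebra_simps)
qed

text \<open>With \<alpha> = 1/p, \<beta> = q - l w and \<gamma> = w g this is the equation
  "expression minus l, applied to f, equals g" for the pair (f, p f'). All operator statements are
  reduced to this system.\<close>

definition lin_sys :: "real set \<Rightarrow> (real \<Rightarrow> complex) \<Rightarrow> (real \<Rightarrow> complex) \<Rightarrow> (real \<Rightarrow> complex) \<Rightarrow>
    (real \<Rightarrow> complex) \<Rightarrow> (real \<Rightarrow> complex) \<Rightarrow> bool" where
  "lin_sys I \<alpha> \<beta> \<gamma> f h \<longleftrightarrow> AC_deriv I f (\<lambda>x. \<alpha> x * h x) \<and> AC_deriv I h (\<lambda>x. \<beta> x * f x - \<gamma> x)"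

lemma lin_sys_subset: "lin_sys I \<alpha> \<beta> \<gamma> f h \<Longrightarrow> J \<subseteq> I \<Longrightarrow> lin_sys J \<alpha> \<beta> \<gamma> f h"
  by (auto simp: lin_sys_def intro: AC_deriv_subset)

text \<open>Lagrange's identity. It yields constancy of the Wronskian for \<gamma> = 0 and, for
  general \<gamma>, the derivatives of the coefficients in variation of constants.\<close>

lemma lin_sys_wronskian:
  assumes "lin_sys I \<alpha> \<beta> \<gamma> f h" "lin_sys I \<alpha> \<beta> (\<lambda>_. 0) u v"
  shows "AC_deriv I (\<lambda>x. f x * v x - h x * u x) (\<lambda>x. \<gamma> x * u x)"
proof -
  have "AC_deriv I (\<lambda>x. f x * v x - h x * u x)
     (\<lambda>x. ((\<alpha> x * h x) * v x + f x * (\<beta> x * u x - 0)) - ((\<beta> x * f x - \<gamma> x) * u x + h x * (\<alpha> x * v x)))"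
    using assms by (intro AC_deriv_diff AC_deriv_mult) (auto simp: lin_sys_def)
  then show ?thesis by (rule AC_deriv_cong) (auto simp: algebra_simps)
qed

lemma lin_sys_lincomb:
  assumes "lin_sys I \<alpha> \<beta> \<gamma> f h" "lin_sys I \<alpha> \<beta> \<gamma>' f' h'"
  shows "lin_sys I \<alpha> \<beta> (\<lambda>x. c * \<gamma> x + d * \<gamma>' x) (\<lambda>x. c * f x + d * f' x) (\<lambda>x. c * h x + d * h' x)"
  unfolding lin_sys_def
proof
  have "AC_deriv I (\<lambda>x. c * f x + d * f' x) (\<lambda>x. c * (\<alpha> x * h x) + d * (\<alpha> x * h' x))"
    using assms by (intro AC_deriv_add AC_deriv_cmult) (auto simp: lin_sys_def)
  then show "AC_deriv I (\<lambda>x. c * f x + d * f' x) (\<lambda>x. \<alpha> x * (c * h x + d * h' x))"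
    by (rule AC_deriv_cong) (auto simp: algebra_simps)
  have "AC_deriv I (\<lambda>x. c * h x + d * h' x) (\<lambda>x. c * (\<beta> x * f x - \<gamma> x) + d * (\<beta> x * f' x - \<gamma>' x))"
    using assms by (intro AC_deriv_add AC_deriv_cmult) (auto simp: lin_sys_def)
  then show "AC_deriv I (\<lambda>x. c * h x + d * h' x) (\<lambda>x. \<beta> x * (c * f x + d * f' x) - (c * \<gamma> x + d * \<gamma>' x))"
    by (rule AC_deriv_cong) (auto simp: algebra_simps)
qed

text \<open>The system is solved by Picard iteration; with \<open>S\<close> a primitive of
  \<open>\<bar>\<alpha>\<bar> + \<bar>\<beta>\<bar>\<close> the \<open>n\<close>-th increment is at most \<open>C \<bar>S\<bar>\<^sup>n / n!\<close>.\<close>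

lemma norm_oint_le:
  fixes g :: "real \<Rightarrow> complex" and k :: "real \<Rightarrow> real"
  assumes g: "loc_integrable g" and k: "loc_integrable (\<lambda>x. complex_of_real (k x))" and le: "\<And>t. norm (g t) \<le> k t"
  shows "norm (oint g x) \<le> norm (oint (\<lambda>x. complex_of_real (k x)) x)"
proof -
  have *: "norm (LINT t:{c..d}|lebesgue. g t) \<le> norm (LINT t:{c..d}|lebesgue. complex_of_real (k t))" for c d
  proof -
    have ki: "integrable lebesgue (\<lambda>t. Re (indicator {c..d} t *\<^sub>R complex_of_real (k t)))"
      using k unfolding loc_integrable_def set_integrable_def by (intro integrable_Re) blast
    have "norm (LINT t:{c..d}|lebesgue. g t) \<le> (\<integral>t. norm (indicator {c..d} t *\<^sub>R g t) \<partial>lebesgue)"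
      unfolding set_lebesgue_integral_def by (rule integral_norm_bound)
    also have "\<dots> \<le> (\<integral>t. Re (indicator {c..d} t *\<^sub>R complex_of_real (k t)) \<partial>lebesgue)"
      using g le ki unfolding loc_integrable_def set_integrable_def
      by (intro integral_mono integrable_norm) (auto simp: indicator_def)
    also have "\<dots> = Re (LINT t:{c..d}|lebesgue. complex_of_real (k t))"
      using k unfolding set_lebesgue_integral_def loc_integrable_def set_integrable_def by (intro integral_Re) blast
    also have "\<dots> \<le> norm (LINT t:{c..d}|lebesgue. complex_of_real (k t))" by (rule complex_Re_le_cmod)
    finally show ?thesis .
  qed
  show ?thesis using * by (simp add: oint_def)
qed

lemma AC_deriv_power:
  assumes "AC_deriv I f f'"
  shows "AC_deriv I (\<lambda>x. f x ^ Suc n) (\<lambda>x. of_nat (Suc n) * f x ^ n * f' x)"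
proof (induction n)
  case 0
  then show ?case using assms by simp
next
  case (Suc n)
  have "AC_deriv I (\<lambda>x. f x * f x ^ Suc n) (\<lambda>x. f' x * f x ^ Suc n + f x * (of_nat (Suc n) * f x ^ n * f' x))"
    by (rule AC_deriv_mult[OF assms Suc])
  then show ?case by (rule AC_deriv_cong) (auto simp: algebra_simps)
qed

lemma loc_integrable_norm: "loc_integrable g \<Longrightarrow> loc_integrable (\<lambda>x. complex_of_real (norm (g x)))"
  unfolding loc_integrable_def
  by (intro allI set_integral_complex_of_real'(1) set_integrable_norm) auto

lemma loc_integrable_add: "loc_integrable f \<Longrightarrow> loc_integrable g \<Longrightarrow> loc_integrable (\<lambda>x. f x + g x)"
  unfolding loc_integrable_def by (auto intro: set_integral_add)

lemma loc_integrable_cmult: "loc_integrable f \<Longrightarrow> loc_integrable (\<lambda>x. c * f x)"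
  unfolding loc_integrable_def by (auto intro: set_integrable_mult_right)

text \<open>One step of the Picard estimate: S^n k is the derivative of S^(n+1)/(n+1). Since S is
  real and has the sign of x, its modulus differs from S by a constant sign on each
  half-line.\<close>

lemma norm_oint_power_le:
  fixes k :: "real \<Rightarrow> real" and g :: "real \<Rightarrow> complex"
  defines "S \<equiv> oint (\<lambda>x. complex_of_real (k x))"
  assumes k: "loc_integrable (\<lambda>x. complex_of_real (k x))" and k0: "\<And>x. 0 \<le> k x" and g: "loc_integrable g"
    and le: "\<And>t. norm (g t) \<le> C * (norm (S t) ^ n * k t)"
  shows "norm (oint g x) \<le> C * (norm (S x) ^ Suc n / real (Suc n))"
proof -
  have Sd: "AC_deriv UNIV S (\<lambda>x. complex_of_real (k x))" unfolding S_def using k by (rule AC_deriv_oint)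
  have Sc: "continuous_on UNIV S" using AC_deriv_continuous_on[OF Sd] by simp
  have Sr: "S x = complex_of_real (Re (S x))" "(0 \<le> x \<longrightarrow> 0 \<le> Re (S x)) \<and> (x \<le> 0 \<longrightarrow> Re (S x) \<le> 0)" for x
  proof -
    have i: "set_integrable lebesgue {c..d} k" for c d
    proof -
      have "set_integrable lebesgue {c..d} (\<lambda>x. Re (complex_of_real (k x)))"
        using k integrable_Re[of lebesgue "\<lambda>x. indicator {c..d} x *\<^sub>R complex_of_real (k x)"]
        by (simp add: loc_integrable_def set_integrable_def)
      then show ?thesis by simp
    qed
    have "(LINT t:{c..d}|lebesgue. k t) \<ge> 0" for c d
      unfolding set_lebesgue_integral_def using k0 by (intro integral_nonneg_AE AE_I2) auto
    then show "S x = complex_of_real (Re (S x))" "(0 \<le> x \<longrightarrow> 0 \<le> Re (S x)) \<and> (x \<le> 0 \<longrightarrow> Re (S x) \<le> 0)"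
      unfolding S_def oint_def set_integral_complex_of_real'(2)[OF i] by auto
  qed
  define P where "P t = of_nat (Suc n) * S t ^ n * complex_of_real (k t)" for t
  have Pd: "AC_deriv UNIV (\<lambda>x. S x ^ Suc n) P"
    unfolding P_def by (rule AC_deriv_power[OF Sd])
  define K where "K t = C * (norm (S t) ^ n * k t)" for t
  have Kl: "loc_integrable (\<lambda>t. complex_of_real (K t))"
  proof -
    have "loc_integrable (\<lambda>t. complex_of_real (k t) * (complex_of_real C * complex_of_real (norm (S t)) ^ n))"
      using k Sc by (intro loc_integrable_mult_continuous continuous_intros) auto
    moreover have "(\<lambda>t. complex_of_real (k t) * (complex_of_real C * complex_of_real (norm (S t)) ^ n)) = (\<lambda>t. complex_of_real (K t))"
      by (auto simp: K_def)
    ultimately show ?thesis by simp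
  qed
  have C0: "0 \<le> K t" for t using le[of t] norm_ge_zero[of "g t"] unfolding K_def by linarith
  have "norm (oint g x) \<le> norm (oint (\<lambda>t. complex_of_real (K t)) x)"
    using g Kl le unfolding K_def by (intro norm_oint_le)
  also have "\<dots> = norm (oint (\<lambda>t. complex_of_real C / of_nat (Suc n) * P t) x)"
  proof -
    \<comment> \<open>Here s is the sign of S on the half-line under consideration, 1 to the right
      of 0 and -1 to the left.\<close>
    have e: "complex_of_real (K t) = s ^ n * (complex_of_real C / of_nat (Suc n) * P t)"
      if "(s = 1 \<and> 0 \<le> t) \<or> (s = -1 \<and> t \<le> 0)" for t and s :: complex
    proof -
      have "complex_of_real (norm (S t)) = s * S t"
      proof -
        have "norm (S t) = \<bar>Re (S t)\<bar>" by (subst Sr(1)) (simp only: norm_of_real)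
        then have "complex_of_real (norm (S t)) = (if 0 \<le> Re (S t) then 1 else -1) * complex_of_real (Re (S t))" by simp
        then show ?thesis using that Sr(2)[of t] Sr(1)[of t] by (auto split: if_splits)
      qed
      then have "complex_of_real (norm (S t)) ^ n = s ^ n * S t ^ n" by (simp add: power_mult_distrib)
      then show ?thesis by (simp add: K_def P_def del: of_nat_Suc)
    qed
    show ?thesis
    proof (cases "0 \<le> x")
      case True
      have "(LINT t:{0..x}|lebesgue. complex_of_real (K t)) = (LINT t:{0..x}|lebesgue. complex_of_real C / of_nat (Suc n) * P t)"
        using e[of 1] by (intro set_lebesgue_integral_cong) auto
      then show ?thesis using True by (simp add: oint_def)
    next
      case False
      have "(LINT t:{x..0}|lebesgue. complex_of_real (K t)) = (LINT t:{x..0}|lebesgue. (-1)^n * (complex_of_real C / of_nat (Suc n) * P t))"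
        using e[of "-1"] by (intro set_lebesgue_integral_cong) auto
      also have "\<dots> = (-1)^n * (LINT t:{x..0}|lebesgue. complex_of_real C / of_nat (Suc n) * P t)"
        by (rule set_integral_mult_right)
      finally show ?thesis using False by (simp add: oint_def norm_mult norm_power norm_divide)
    qed
  qed
  also have "oint (\<lambda>t. complex_of_real C / of_nat (Suc n) * P t) x = complex_of_real C / of_nat (Suc n) * S x ^ Suc n"
    using AC_deriv_unique_oint[OF AC_deriv_cmult[OF Pd], of "complex_of_real C / of_nat (Suc n)" x]
    by (simp add: S_def)
  also have "norm \<dots> = \<bar>C\<bar> * (norm (S x) ^ Suc n / real (Suc n))"
    by (simp add: norm_mult norm_divide norm_power del: of_nat_Suc)
  also have "\<dots> = C * (norm (S x) ^ Suc n / real (Suc n))"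
  proof (cases "C \<ge> 0")
    \<comment> \<open>For negative \<open>C\<close> the hypothesis forces |S|^n k to vanish
      identically, hence S = 0, and both sides are 0.\<close>
    case False
    have z: "norm (S t) ^ n * k t = 0" for t
    proof -
      have "norm (S t) ^ n * k t \<ge> 0" using k0[of t] by (intro mult_nonneg_nonneg) auto
      moreover have "0 \<le> C * (norm (S t) ^ n * k t)" using C0[of t] by (simp only: K_def)
      moreover have "C < 0" using False by simp
      ultimately show ?thesis using mult_neg_pos[of C "norm (S t) ^ n * k t"] by linarith
    qed
    have "S x ^ n * complex_of_real (k x) = 0" for x using z[of x] by auto
    then have "P = (\<lambda>_. 0)" unfolding P_def by (auto simp: fun_eq_iff)
    then have "S x ^ Suc n = S 0 ^ Suc n" using AC_deriv_zero_imp_const[of UNIV "\<lambda>x. S x ^ Suc n" x 0] Pd by simp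
    then have "S x = 0" by (auto simp: S_def)
    then show ?thesis by simp
  qed simp
  finally show ?thesis .
qed
lemma continuous_on_UNIV_Icc:
  fixes f :: "real \<Rightarrow> complex"
  assumes "\<And>R. continuous_on {-R..R} f"
  shows "continuous_on UNIV f"
proof (intro continuous_at_imp_continuous_on ballI)
  fix x :: real
  have "x \<in> interior {- (\<bar>x\<bar> + 1)..\<bar>x\<bar> + 1}"
    by (simp only: interior_atLeastAtMost_real greaterThanLessThan_iff) linarith
  then show "isCont f x" by (rule continuous_on_interior[OF assms])
qed

primrec picard :: "(real \<Rightarrow> complex) \<Rightarrow> (real \<Rightarrow> complex) \<Rightarrow> complex \<Rightarrow> complex \<Rightarrow> nat \<Rightarrow>
    (real \<Rightarrow> complex) \<times> (real \<Rightarrow> complex)" where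
  "picard \<alpha> \<beta> c d 0 = (\<lambda>_. c, \<lambda>_. d)"
| "picard \<alpha> \<beta> c d (Suc n) =
    (oint (\<lambda>x. \<alpha> x * snd (picard \<alpha> \<beta> c d n) x), oint (\<lambda>x. \<beta> x * fst (picard \<alpha> \<beta> c d n) x))"

lemma loc_integrable_measurable:
  "loc_integrable g \<Longrightarrow> (\<lambda>t. indicator {c..d} t *\<^sub>R g t) \<in> borel_measurable lebesgue"
  unfolding loc_integrable_def set_integrable_def by (blast intro: borel_measurable_integrable)

lemma oint_dominated_limit:
  fixes \<alpha> :: "real \<Rightarrow> complex"
  assumes \<alpha>: "loc_integrable \<alpha>" and H: "\<And>n::nat. continuous_on UNIV (H n)" and h: "continuous_on UNIV h"
    and lim: "\<And>t. (\<lambda>n. H n t) \<longlonglongrightarrow> h t" and bd: "\<And>n t. \<bar>t\<bar> \<le> \<bar>x\<bar> \<Longrightarrow> norm (H n t) \<le> K"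
  shows "(\<lambda>n. oint (\<lambda>t. \<alpha> t * H n t) x) \<longlonglongrightarrow> oint (\<lambda>t. \<alpha> t * h t) x"
proof -
  have *: "(\<lambda>n. LINT t:{c..d}|lebesgue. \<alpha> t * H n t) \<longlonglongrightarrow> (LINT t:{c..d}|lebesgue. \<alpha> t * h t)"
    if cd: "- \<bar>x\<bar> \<le> c" "d \<le> \<bar>x\<bar>" for c d
    unfolding set_lebesgue_integral_def
  proof (rule integral_dominated_convergence)
    show "(\<lambda>t. indicator {c..d} t *\<^sub>R (\<alpha> t * h t)) \<in> borel_measurable lebesgue"
      by (intro loc_integrable_measurable loc_integrable_mult_continuous \<alpha> h)
    show "(\<lambda>t. indicator {c..d} t *\<^sub>R (\<alpha> t * H n t)) \<in> borel_measurable lebesgue" for n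
      by (intro loc_integrable_measurable loc_integrable_mult_continuous \<alpha> H)
    show "integrable lebesgue (\<lambda>t. norm (indicator {c..d} t *\<^sub>R \<alpha> t) * \<bar>K\<bar>)"
      using \<alpha> by (auto simp: loc_integrable_def set_integrable_def simp del: norm_scaleR)
    show "AE t in lebesgue. (\<lambda>n. indicator {c..d} t *\<^sub>R (\<alpha> t * H n t)) \<longlonglongrightarrow> indicator {c..d} t *\<^sub>R (\<alpha> t * h t)"
      by (intro AE_I2 tendsto_intros lim)
    show "AE t in lebesgue. norm (indicator {c..d} t *\<^sub>R (\<alpha> t * H n t)) \<le> norm (indicator {c..d} t *\<^sub>R \<alpha> t) * \<bar>K\<bar>" for n
    proof (rule AE_I2)
      fix t
      have "norm (\<alpha> t) * norm (H n t) \<le> norm (\<alpha> t) * \<bar>K\<bar>" if "t \<in> {c..d}"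
      proof -
        have "\<bar>t\<bar> \<le> \<bar>x\<bar>" using that cd unfolding atLeastAtMost_iff by linarith
        then show ?thesis using bd[of t n] by (intro mult_left_mono) auto
      qed
      then show "norm (indicator {c..d} t *\<^sub>R (\<alpha> t * H n t)) \<le> norm (indicator {c..d} t *\<^sub>R \<alpha> t) * \<bar>K\<bar>"
        by (auto simp: indicator_def norm_mult)
    qed
  qed
  show ?thesis
  proof (cases "0 \<le> x")
    case True then show ?thesis using *[of 0 x] by (simp add: oint_def)
  next
    case False then show ?thesis using tendsto_minus[OF *[of x 0]] by (simp add: oint_def)
  qed
qed

lemma lin_sys_exists:
  assumes \<alpha>: "loc_integrable \<alpha>" and \<beta>: "loc_integrable \<beta>"
  shows "\<exists>f h. lin_sys UNIV \<alpha> \<beta> (\<lambda>_. 0) f h \<and> f 0 = c \<and> h 0 = d"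
proof -
  define u v where "u n = fst (picard \<alpha> \<beta> c d n)" and "v n = snd (picard \<alpha> \<beta> c d n)" for n
  have u0: "u 0 = (\<lambda>_. c)" "v 0 = (\<lambda>_. d)" by (simp_all add: u_def v_def)
  have uS: "u (Suc n) = oint (\<lambda>x. \<alpha> x * v n x)" "v (Suc n) = oint (\<lambda>x. \<beta> x * u n x)" for n
    by (simp_all add: u_def v_def)
  have cont: "continuous_on UNIV (u n) \<and> continuous_on UNIV (v n)" for n
  proof (induction n)
    case (Suc n)
    have "continuous_on UNIV (oint g)" if "loc_integrable g" for g
      using AC_deriv_continuous_on[OF AC_deriv_oint[OF that]] by simp
    then show ?case unfolding uS using Suc \<alpha> \<beta> by (auto intro: loc_integrable_mult_continuous)
  qed (simp add: u0)
  define k where "k x = norm (\<alpha> x) + norm (\<beta> x)" for x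
  define S where "S = oint (\<lambda>x. complex_of_real (k x))"
  have k: "loc_integrable (\<lambda>x. complex_of_real (k x))"
    using loc_integrable_add[OF loc_integrable_norm[OF \<alpha>] loc_integrable_norm[OF \<beta>]] by (simp add: k_def)
  have Sc: "continuous_on UNIV S" unfolding S_def using AC_deriv_continuous_on[OF AC_deriv_oint[OF k]] by simp
  define C where "C = norm c + norm d"
  have C0: "C \<ge> 0" by (simp add: C_def)
  have bound: "norm (u n x) \<le> C * (norm (S x) ^ n / fact n) \<and> norm (v n x) \<le> C * (norm (S x) ^ n / fact n)" for n x
  proof (induction n arbitrary: x)
    case 0
    then show ?case by (simp add: u0 C_def)
  next
    case (Suc n)
    have step: "norm (oint (\<lambda>x. a x * b x) x) \<le> C * (norm (S x) ^ Suc n / fact (Suc n))"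
      if a: "loc_integrable a" "\<And>x. norm (a x) \<le> k x" and b: "continuous_on UNIV b" "\<And>x. norm (b x) \<le> C * (norm (S x) ^ n / fact n)" for a b
    proof -
      have "norm (oint (\<lambda>x. a x * b x) x) \<le> (C / fact n) * (norm (S x) ^ Suc n / real (Suc n))"
        unfolding S_def
      proof (rule norm_oint_power_le[OF k])
        fix t
        have "norm (a t * b t) \<le> k t * (C * (norm (S t) ^ n / fact n))"
          unfolding norm_mult using a b order_trans[OF norm_ge_zero a(2)] by (intro mult_mono) auto
        then show "norm (a t * b t) \<le> C / fact n * (norm (oint (\<lambda>x. complex_of_real (k x)) t) ^ n * k t)"
          by (simp add: S_def algebra_simps)
      qed (use a b in \<open>auto simp: k_def intro: loc_integrable_mult_continuous\<close>)
      also have "\<dots> = C * (norm (S x) ^ Suc n / fact (Suc n))"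
        by (simp add: fact_Suc mult.commute del: of_nat_Suc)
      finally show ?thesis .
    qed
    show ?case unfolding uS using Suc cont[of n] \<alpha> \<beta> by (intro conjI step) (auto simp: k_def)
  qed
  \<comment> \<open>The supremum of |S| on [-R, R] turns the factorial bounds into a Weierstrass
    majorant C M^n / n! on compact sets and a uniform bound on partial sums for dominated
    convergence.\<close>
  define M where "M R = Sup ((\<lambda>x. norm (S x)) ` {-R..R})" for R
  have M: "norm (S x) \<le> M R" if "\<bar>x\<bar> \<le> R" for x R
  proof -
    have "compact ((\<lambda>x. norm (S x)) ` {-R..R})"
      by (intro compact_continuous_image continuous_on_norm continuous_on_subset[OF Sc]) auto
    then have "bdd_above ((\<lambda>x. norm (S x)) ` {-R..R})" by (intro bounded_imp_bdd_above compact_imp_bounded)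
    then show ?thesis unfolding M_def using that by (intro cSup_upper imageI) (auto simp: abs_le_iff)
  qed
  define f h where "f x = (\<Sum>n. u n x)" and "h x = (\<Sum>n. v n x)" for x
  have gen: "(\<lambda>n. b n x) sums (\<Sum>n. b n x)" "continuous_on UNIV (\<lambda>x. \<Sum>n. b n x)"
     "\<bar>x\<bar> \<le> R \<Longrightarrow> norm (\<Sum>n<N. b n x) \<le> C * exp (M R)"
    if b: "\<And>n. continuous_on UNIV (b n)" "\<And>n x. norm (b n x) \<le> C * (norm (S x) ^ n / fact n)" for b :: "nat \<Rightarrow> real \<Rightarrow> complex" and x R N
  proof -
    have bM: "norm (b n x) \<le> C * (M R ^ n / fact n)" if "\<bar>x\<bar> \<le> R" for x R n
      using M[OF that] C0 by (intro order.trans[OF b(2)] mult_left_mono divide_right_mono power_mono) auto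
    have sM: "(\<lambda>n. C * (M R ^ n / fact n)) sums (C * exp (M R))" for R
      using sums_mult[OF exp_converges[of "M R"], of C] by (simp add: divide_inverse mult.commute)
    have "summable (\<lambda>n. b n x)"
      using bM[of x "\<bar>x\<bar>"] by (intro summable_comparison_test'[OF sums_summable[OF sM[of "\<bar>x\<bar>"]], of 0]) auto
    then show "(\<lambda>n. b n x) sums (\<Sum>n. b n x)" by (rule summable_sums)
    show "continuous_on UNIV (\<lambda>x. \<Sum>n. b n x)"
    proof (rule continuous_on_UNIV_Icc)
      fix R
      have "uniform_limit {-R..R} (\<lambda>n x. \<Sum>i<n. b i x) (\<lambda>x. \<Sum>i. b i x) sequentially"
        by (rule Weierstrass_m_test[OF _ sums_summable[OF sM[of R]]]) (rule bM, auto simp: abs_le_iff)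
      then show "continuous_on {-R..R} (\<lambda>x. \<Sum>i. b i x)"
        by (rule uniform_limit_theorem[rotated])
          (auto intro!: always_eventually continuous_on_sum continuous_on_subset[OF b(1)])
    qed
    show "norm (\<Sum>n<N. b n x) \<le> C * exp (M R)" if "\<bar>x\<bar> \<le> R"
    proof -
      have "0 \<le> M R" using M[OF that] norm_ge_zero order_trans by blast
      have "norm (\<Sum>n<N. b n x) \<le> (\<Sum>n<N. C * (M R ^ n / fact n))"
        using bM[OF that] by (intro sum_norm_le)
      also have "\<dots> \<le> C * exp (M R)"
        using \<open>0 \<le> M R\<close> C0 sM[of R] by (subst sums_unique[OF sM]) (intro sum_le_suminf, auto simp: sums_iff)
      finally show ?thesis .
    qed
  qed
  have ub: "norm (u n x) \<le> C * (norm (S x) ^ n / fact n)" and vb: "norm (v n x) \<le> C * (norm (S x) ^ n / fact n)" for n x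
    using bound by auto
  note fu = gen[of u, OF conjunct1[OF cont] ub] and hv = gen[of v, OF conjunct2[OF cont] vb]
  have fc: "continuous_on UNIV f" "continuous_on UNIV h" using fu(2) hv(2) by (simp_all add: f_def[abs_def] h_def[abs_def])
  have lims: "(\<lambda>N. \<Sum>n<N. u n x) \<longlonglongrightarrow> f x" "(\<lambda>N. \<Sum>n<N. v n x) \<longlonglongrightarrow> h x" for x
    using fu(1)[of x] hv(1)[of x] by (simp_all add: sums_def f_def h_def)
  \<comment> \<open>Partial sums satisfy the integral equation with the index shifted by one, so
    both sides converge to the same equation for the limits.\<close>
  have partial: "(\<Sum>n<Suc N. oint_part n) = p0 + oint (\<lambda>t. a t * (\<Sum>n<N. b n t)) x"
    if "oint_part 0 = p0" "\<And>n. oint_part (Suc n) = oint (\<lambda>t. a t * b n t) x" "loc_integrable a" "\<And>n. continuous_on UNIV (b n)"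
    for oint_part :: "nat \<Rightarrow> complex" and p0 and a :: "real \<Rightarrow> complex" and b N x
  proof (induction N)
    case 0
    then show ?case using that(1) by (simp add: oint_def set_lebesgue_integral_def)
  next
    case (Suc N)
    have "AC_deriv UNIV (\<lambda>x. oint (\<lambda>t. a t * (\<Sum>n<N. b n t)) x + oint (\<lambda>t. a t * b N t) x) (\<lambda>t. a t * (\<Sum>n<N. b n t) + a t * b N t)"
      using that(3,4) by (intro AC_deriv_add AC_deriv_oint loc_integrable_mult_continuous continuous_on_sum) auto
    from AC_deriv_unique_oint[OF this, of x]
    have "oint (\<lambda>t. a t * (\<Sum>n<N. b n t)) x + oint (\<lambda>t. a t * b N t) x = oint (\<lambda>t. a t * (\<Sum>n<Suc N. b n t)) x"
      by (simp add: algebra_simps)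
    then show ?case using Suc that(2)[of N] by simp
  qed
  have main: "F = (\<lambda>x. p0 + oint (\<lambda>t. a t * G t) x)"
    if "\<And>x. B 0 x = p0" "\<And>n x. B (Suc n) x = oint (\<lambda>t. a t * b n t) x" "loc_integrable a" "\<And>n. continuous_on UNIV (b n)"
      "\<And>x. (\<lambda>N. \<Sum>n<N. B n x) \<longlonglongrightarrow> F x" "\<And>x. (\<lambda>N. \<Sum>n<N. b n x) \<longlonglongrightarrow> G x" "continuous_on UNIV G"
      "\<And>x R N. \<bar>x\<bar> \<le> R \<Longrightarrow> norm (\<Sum>n<N. b n x) \<le> C * exp (M R)"
    for B b :: "nat \<Rightarrow> real \<Rightarrow> complex" and F G a p0
  proof
    fix x
    have "(\<lambda>N. oint (\<lambda>t. a t * (\<Sum>n<N. b n t)) x) \<longlonglongrightarrow> oint (\<lambda>t. a t * G t) x"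
      using that by (intro oint_dominated_limit[where K = "C * exp (M \<bar>x\<bar>)"] continuous_on_sum) auto
    then have "(\<lambda>N. p0 + oint (\<lambda>t. a t * (\<Sum>n<N. b n t)) x) \<longlonglongrightarrow> p0 + oint (\<lambda>t. a t * G t) x"
      by (intro tendsto_intros)
    moreover have "(\<lambda>N. p0 + oint (\<lambda>t. a t * (\<Sum>n<N. b n t)) x) = (\<lambda>N. \<Sum>n<Suc N. B n x)"
      using partial[of "\<lambda>n. B n x" p0 a b x] that by simp
    moreover have "(\<lambda>N. \<Sum>n<Suc N. B n x) \<longlonglongrightarrow> F x"
      using that(5)[of x] by (rule LIMSEQ_Suc)
    ultimately show "F x = p0 + oint (\<lambda>t. a t * G t) x" using LIMSEQ_unique by metis
  qed
  have fe: "f = (\<lambda>x. c + oint (\<lambda>t. \<alpha> t * h t) x)"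
  proof (rule main[of u c \<alpha> v])
    show "u 0 x = c" for x by (simp add: u0)
    show "u (Suc n) x = oint (\<lambda>t. \<alpha> t * v n t) x" for n x by (simp add: uS)
    show "continuous_on UNIV (v n)" for n using cont by blast
  qed (fact \<alpha> lims fc hv(3))+
  have he: "h = (\<lambda>x. d + oint (\<lambda>t. \<beta> t * f t) x)"
  proof (rule main[of v d \<beta> u])
    show "v 0 x = d" for x by (simp add: u0)
    show "v (Suc n) x = oint (\<lambda>t. \<beta> t * u n t) x" for n x by (simp add: uS)
    show "continuous_on UNIV (u n)" for n using cont by blast
  qed (fact \<beta> lims fc fu(3))+
  have "AC_deriv UNIV (\<lambda>x. c + oint (\<lambda>t. \<alpha> t * h t) x) (\<lambda>t. 0 + \<alpha> t * h t)"
    using \<alpha> fc by (intro AC_deriv_add AC_deriv_const AC_deriv_oint loc_integrable_mult_continuous)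
  moreover have "AC_deriv UNIV (\<lambda>x. d + oint (\<lambda>t. \<beta> t * f t) x) (\<lambda>t. 0 + \<beta> t * f t)"
    using \<beta> fc by (intro AC_deriv_add AC_deriv_const AC_deriv_oint loc_integrable_mult_continuous)
  ultimately have "lin_sys UNIV \<alpha> \<beta> (\<lambda>_. 0) f h"
    unfolding lin_sys_def fe[symmetric] he[symmetric] by simp
  moreover have "f 0 = c" "h 0 = d" using fun_cong[OF fe, of 0] fun_cong[OF he, of 0] by simp_all
  ultimately show ?thesis by blast
qed

section \<open>Periodic Sturm-Liouville equations\<close>

lemma set_integrable_translate:
  fixes g :: "real \<Rightarrow> 'a::euclidean_space"
  assumes "set_integrable lebesgue {c..d} g"
  shows "set_integrable lebesgue {c - s..d - s} (\<lambda>x. g (x + s))"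
    "(LINT x:{c - s..d - s}|lebesgue. g (x + s)) = (LINT x:{c..d}|lebesgue. g x)"
proof -
  have e: "indicator {c..d} (s + x) *\<^sub>R g (s + x) = indicator {c - s..d - s} x *\<^sub>R g (x + s)" for x
    by (auto simp: indicator_def add.commute)
  show "set_integrable lebesgue {c - s..d - s} (\<lambda>x. g (x + s))"
    using lebesgue_integrable_real_affine[OF assms[unfolded set_integrable_def], of 1 s]
    by (simp add: e set_integrable_def)
  show "(LINT x:{c - s..d - s}|lebesgue. g (x + s)) = (LINT x:{c..d}|lebesgue. g x)"
    using lebesgue_integral_real_affine[of 1 "\<lambda>x. indicator {c..d} x *\<^sub>R g x" s]
    by (simp add: e set_lebesgue_integral_def)
qed

lemma loc_integrable_periodic:
  fixes g :: "real \<Rightarrow> complex"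
  assumes a: "a > 0" and per: "\<And>x. g (x + a) = g x" and i: "set_integrable lebesgue {0..a} g"
  shows "loc_integrable g"
proof -
  have n: "g (x + real n * a) = g x" for x and n :: nat
  proof (induction n)
    case (Suc n)
    then show ?case using per[of "x + real n * a"] by (simp add: algebra_simps)
  qed simp
  have cell: "set_integrable lebesgue {real n * a..real (Suc n) * a} g" for n
    using set_integrable_translate(1)[OF i, of "- (real n * a)"] n[of "_ - real n * a" n]
    by (simp add: algebra_simps)
  have right: "set_integrable lebesgue {0..real n * a} g" for n
  proof (induction n)
    case 0
    then show ?case by (simp add: absolutely_integrable_negligible)
  next
    case (Suc n)
    show ?case
      by (rule set_integral_Icc_combine(1)[OF _ _ Suc cell[of n]]) (use a in \<open>auto simp: algebra_simps\<close>)
  qed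
  have sym: "set_integrable lebesgue {- (real n * a)..real n * a} g" for n
  proof -
    have l: "set_integrable lebesgue {- (real n * a)..0} g"
      using set_integrable_translate(1)[OF right[of n], of "real n * a"] n by simp
    show ?thesis by (rule set_integral_Icc_combine(1)[OF _ _ l right[of n]]) (use a in auto)
  qed
  show ?thesis
    unfolding loc_integrable_def
  proof (intro allI)
    fix c d
    obtain n :: nat where "max \<bar>c\<bar> \<bar>d\<bar> / a < real n" using reals_Archimedean2 by blast
    then have "max \<bar>c\<bar> \<bar>d\<bar> < real n * a" using a by (simp add: divide_less_eq)
    then have "{c..d} \<subseteq> {- (real n * a)..real n * a}" by auto
    then show "set_integrable lebesgue {c..d} g"
      by (intro set_integrable_subset[OF sym[of n]]) auto
  qed
qed

lemma set_integrable_Ioo_imp_Icc: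
  fixes g :: "real \<Rightarrow> 'a::euclidean_space"
  assumes "set_integrable lebesgue {c<..<d} g"
  shows "set_integrable lebesgue {c..d} g"
proof -
  have "set_integrable lebesgue {c, d} g" by (rule absolutely_integrable_negligible) simp
  then have "set_integrable lebesgue ({c<..<d} \<union> {c, d}) g"
    using assms by (intro set_integrable_Un) auto
  then show ?thesis by (rule set_integrable_subset) auto
qed

lemma AC_deriv_translate:
  assumes f: "AC_deriv UNIV f g"
  shows "AC_deriv UNIV (\<lambda>x. f (x + s)) (\<lambda>x. g (x + s))"
  unfolding AC_deriv_def
proof (intro allI impI)
  fix x y :: real assume "x \<le> y \<and> {x..y} \<subseteq> UNIV"
  then show "set_integrable lebesgue {x..y} (\<lambda>x. g (x + s)) \<and> (LINT t:{x..y}|lebesgue. g (t + s)) = f (y + s) - f (x + s)"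
    using AC_derivD[OF f, of "x + s" "y + s"] set_integrable_translate[of "x + s" "y + s" g s] by simp
qed

text \<open>An open null set is empty, and the interval is the closure of its interior. This
  identifies \<open>quasi_deriv\<close>, a choice among representatives, with the second component
  of the system.\<close>

lemma continuous_AE_eq:
  fixes f g :: "real \<Rightarrow> complex"
  assumes I: "admissible_interval I" and f: "continuous_on I f" and g: "continuous_on I g"
    and ae: "AE x in lebesgue. x \<in> I \<longrightarrow> f x = g x" and x: "x \<in> I"
  shows "f x = g x"
proof -
  let ?U = "interior I \<inter> (\<lambda>x. f x - g x) -` (- {0})"
  have c: "continuous_on I (\<lambda>x. f x - g x)" using f g by (intro continuous_intros)
  have "open ?U"
    using continuous_on_subset[OF c interior_subset]
    by (rule continuous_open_preimage) auto
  moreover have "negligible ?U"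
  proof -
    obtain N where N: "N \<in> null_sets lebesgue" "{x. \<not> (x \<in> I \<longrightarrow> f x = g x)} \<subseteq> N"
      using ae unfolding eventually_ae_filter by auto
    have "?U \<subseteq> {x. \<not> (x \<in> I \<longrightarrow> f x = g x)}" using interior_subset[of I] by auto
    with N show ?thesis using negligible_iff_null_sets negligible_subset by (meson subset_trans)
  qed
  ultimately have "?U = {}" using open_not_negligible by blast
  then have z: "f x - g x = 0" if "x \<in> interior I" for x using that by auto
  have cl: "closure (interior I) = I"
    using I by (auto simp: admissible_interval_def interior_atLeastAtMost_real closure_greaterThanLessThan)
  show ?thesis
    using continuous_constant_on_closure[of "interior I" "\<lambda>x. f x - g x" 0 x] c z x cl by auto
qed

locale sl_periodic =
  fixes a :: real and w p q :: "real \<Rightarrow> real"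
  assumes a_pos: "a > 0"
    and w_meas: "w \<in> borel_measurable lebesgue"
    and p_meas: "p \<in> borel_measurable lebesgue"
    and q_meas: "q \<in> borel_measurable lebesgue"
    and w_per: "\<And>x. w (x + a) = w x"
    and p_per: "\<And>x. p (x + a) = p x"
    and q_per: "\<And>x. q (x + a) = q x"
    and w_int: "set_integrable lebesgue {0<..<a} w"
    and q_int: "set_integrable lebesgue {0<..<a} q"
    and p_int: "set_integrable lebesgue {0<..<a} (\<lambda>x. inverse (p x))"
    and w_nz: "AE x in lebesgue. w x \<noteq> 0"
    and p_pos: "AE x in lebesgue. p x > 0"
begin

definition \<alpha> :: "real \<Rightarrow> complex" where "\<alpha> x = of_real (inverse (p x))"
definition W :: "real \<Rightarrow> complex" where "W x = of_real (w x)"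
definition \<beta> :: "complex \<Rightarrow> real \<Rightarrow> complex" where "\<beta> l x = of_real (q x) - l * W x"

lemma loc_integrable_coeff:
  "loc_integrable \<alpha>" "loc_integrable W" "loc_integrable (\<beta> l)"
proof -
  show \<alpha>: "loc_integrable \<alpha>"
    using set_integral_complex_of_real'(1)[OF p_int] unfolding \<alpha>_def
    by (intro loc_integrable_periodic[OF a_pos] set_integrable_Ioo_imp_Icc) (auto simp: p_per)
  show W: "loc_integrable W"
    using set_integral_complex_of_real'(1)[OF w_int] unfolding W_def
    by (intro loc_integrable_periodic[OF a_pos] set_integrable_Ioo_imp_Icc) (auto simp: w_per)
  have "loc_integrable (\<lambda>x. of_real (q x))"
    using set_integral_complex_of_real'(1)[OF q_int]
    by (intro loc_integrable_periodic[OF a_pos] set_integrable_Ioo_imp_Icc) (auto simp: q_per)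
  from loc_integrable_add[OF this loc_integrable_cmult[OF W, of "-l"]]
  show "loc_integrable (\<beta> l)" by (simp add: \<beta>_def[abs_def])
qed

text \<open>Solving the almost-everywhere relations for the derivatives divides by p and multiplies
  by w; this is where positivity of p and w being nonzero enter. Taking the shifted expression as
  inhomogeneity makes the statement valid for every l.\<close>

lemma sl_regular_imp_lin_sys:
  assumes I: "admissible_interval I" and f: "sl_regular p I f"
  shows "lin_sys I \<alpha> (\<beta> l) (\<lambda>x. W x * op_shift (sl_expr w p q I) l f x) f (quasi_deriv p I f)"
proof -
  let ?h = "quasi_deriv p I f"
  have qd: "is_quasi_deriv p I f ?h"
    using f unfolding sl_regular_def quasi_deriv_def by (intro someI_ex[of "is_quasi_deriv p I f"]) blast
  have fd: "AC_deriv I f (\<lambda>x. vector_derivative f (at x within I))"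
    using f I by (intro AC_loc_imp_AC_deriv) (auto simp: sl_regular_def)
  have hd: "AC_deriv I ?h (\<lambda>x. vector_derivative ?h (at x within I))"
    using qd I by (intro AC_loc_imp_AC_deriv) (auto simp: is_quasi_deriv_def)
  have "AE x in lebesgue. x \<in> I \<longrightarrow> ?h x = of_real (p x) * vector_derivative f (at x within I)"
    using qd AE_lebesgue_on_iff[OF admissible_interval_props(3)[OF I]] by (simp add: is_quasi_deriv_def)
  then have "AE x in lebesgue. x \<in> I \<longrightarrow> vector_derivative f (at x within I) = \<alpha> x * ?h x"
    using p_pos by eventually_elim (auto simp: \<alpha>_def)
  then have 1: "AC_deriv I f (\<lambda>x. \<alpha> x * ?h x)"
    by (rule AC_deriv_cong_AE[OF fd]) simp
  have "AE x in lebesgue. x \<in> I \<longrightarrow> vector_derivative ?h (at x within I) = \<beta> l x * f x - W x * op_shift (sl_expr w p q I) l f x"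
    using w_nz by eventually_elim (auto simp: \<beta>_def W_def op_shift_def sl_expr_def field_simps)
  then have 2: "AC_deriv I ?h (\<lambda>x. \<beta> l x * f x - W x * op_shift (sl_expr w p q I) l f x)"
    by (rule AC_deriv_cong_AE[OF hd]) simp
  from 1 2 show ?thesis by (simp add: lin_sys_def)
qed

text \<open>The converse translation. The representative selected by \<open>SOME\<close> and the
  given \<open>h\<close> are continuous and agree almost everywhere, so boundary values may be read
  off from \<open>h\<close>.\<close>

lemma lin_sys_imp_sl_regular:
  assumes I: "admissible_interval I" and s: "lin_sys I \<alpha> (\<beta> l) (\<lambda>x. W x * g x) f h"
  shows "sl_regular p I f" "\<And>x. x \<in> I \<Longrightarrow> quasi_deriv p I f x = h x"
    "AE x in lebesgue. x \<in> I \<longrightarrow> op_shift (sl_expr w p q I) l f x = g x"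
proof -
  have fd: "AC_deriv I f (\<lambda>x. \<alpha> x * h x)" and hd: "AC_deriv I h (\<lambda>x. \<beta> l x * f x - W x * g x)"
    using s by (auto simp: lin_sys_def)
  have "AE x in lebesgue. x \<in> I \<longrightarrow> h x = of_real (p x) * vector_derivative f (at x within I)"
    using AC_deriv_vector_derivative[OF fd I] p_pos by eventually_elim (auto simp: \<alpha>_def)
  then have qh: "is_quasi_deriv p I f h"
    using AC_deriv_imp_AC_loc[OF hd] AE_lebesgue_on_iff[OF admissible_interval_props(3)[OF I]] by (simp add: is_quasi_deriv_def)
  then show reg: "sl_regular p I f"
    using AC_deriv_imp_AC_loc[OF fd] by (auto simp: sl_regular_def)
  have qd: "is_quasi_deriv p I f (quasi_deriv p I f)"
    using qh unfolding quasi_deriv_def by (rule someI[of "is_quasi_deriv p I f"])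
  have ae: "AE x in lebesgue. x \<in> I \<longrightarrow> quasi_deriv p I f x = h x"
  proof -
    have "AE x in lebesgue. x \<in> I \<longrightarrow> quasi_deriv p I f x = of_real (p x) * vector_derivative f (at x within I)"
      using qd AE_lebesgue_on_iff[OF admissible_interval_props(3)[OF I]] by (simp add: is_quasi_deriv_def)
    with \<open>AE x in lebesgue. x \<in> I \<longrightarrow> h x = of_real (p x) * vector_derivative f (at x within I)\<close>
    show ?thesis by eventually_elim auto
  qed
  have ch: "continuous_on I h" using AC_deriv_continuous_on[OF hd I] .
  have cq: "continuous_on I (quasi_deriv p I f)"
    using qd I by (intro AC_deriv_continuous_on[OF AC_loc_imp_AC_deriv]) (auto simp: is_quasi_deriv_def)
  show eq: "\<And>x. x \<in> I \<Longrightarrow> quasi_deriv p I f x = h x"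
    by (rule continuous_AE_eq[OF I cq ch ae])
  have "AC_deriv I (quasi_deriv p I f) (\<lambda>x. \<beta> l x * f x - W x * g x)"
    by (rule AC_deriv_cong[OF hd]) (auto simp: eq)
  from AC_deriv_vector_derivative[OF this I] w_nz
  show "AE x in lebesgue. x \<in> I \<longrightarrow> op_shift (sl_expr w p q I) l f x = g x"
    by eventually_elim (auto simp: op_shift_def sl_expr_def \<beta>_def W_def field_simps)
qed

section \<open>Fundamental solutions, variation of constants and the discriminant\<close>

definition \<phi> where "\<phi> l = sl_phi w p q l"
definition \<psi> where "\<psi> l = sl_psi w p q l"
definition \<phi>1 where "\<phi>1 l = quasi_deriv p UNIV (\<phi> l)"
definition \<psi>1 where "\<psi>1 l = quasi_deriv p UNIV (\<psi> l)"
abbreviation hom :: "complex \<Rightarrow> (real \<Rightarrow> complex) \<Rightarrow> (real \<Rightarrow> complex) \<Rightarrow> bool" where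
  "hom l \<equiv> lin_sys UNIV \<alpha> (\<beta> l) (\<lambda>_. 0)"

lemma sl_solution_iff_hom:
  "sl_solution w p q l u \<longleftrightarrow> hom l u (quasi_deriv p UNIV u)"
proof
  assume u: "sl_solution w p q l u"
  then have s: "lin_sys UNIV \<alpha> (\<beta> l) (\<lambda>x. W x * op_shift (sl_expr w p q UNIV) l u x) u (quasi_deriv p UNIV u)"
    by (intro sl_regular_imp_lin_sys) (auto simp: sl_solution_def)
  have "AE x in lebesgue. sl_expr w p q UNIV u x = l * u x" using u by (simp add: sl_solution_def)
  then have "AE x in lebesgue. x \<in> UNIV \<longrightarrow> \<beta> l x * u x - W x * op_shift (sl_expr w p q UNIV) l u x = \<beta> l x * u x - 0"
    by eventually_elim (simp add: op_shift_def)
  from AC_deriv_cong_AE[OF conjunct2[OF s[unfolded lin_sys_def]] this refl]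
  have "AC_deriv UNIV (quasi_deriv p UNIV u) (\<lambda>x. \<beta> l x * u x - 0)" .
  with s show "hom l u (quasi_deriv p UNIV u)" by (simp add: lin_sys_def)
next
  assume h: "hom l u (quasi_deriv p UNIV u)"
  then have "lin_sys UNIV \<alpha> (\<beta> l) (\<lambda>x. W x * 0) u (quasi_deriv p UNIV u)" by simp
  from lin_sys_imp_sl_regular[OF admissible_interval_UNIV this]
  show "sl_solution w p q l u" by (auto simp: sl_solution_def op_shift_def)
qed

lemma hom_quasi_deriv: "hom l u v \<Longrightarrow> quasi_deriv p UNIV u = v"
  using lin_sys_imp_sl_regular(2)[of UNIV l "\<lambda>_. 0" u v] by auto

lemma hom_wronskian_const:
  assumes "hom l u v" "hom l u' v'"
  shows "u x * v' x - v x * u' x = u 0 * v' 0 - v 0 * u' 0"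
  using AC_deriv_zero_imp_const[of UNIV "\<lambda>x. u x * v' x - v x * u' x" x 0] lin_sys_wronskian[OF assms] by simp

text \<open>Existence gives uniqueness: the constant Wronskians of (u, v) with one fundamental
  system of Wronskian 1 recover (u, v) at every point from its values at 0.\<close>

lemma hom_unique:
  assumes 1: "hom l u v" and 2: "hom l u' v'" and 0: "u 0 = u' 0" "v 0 = v' 0"
  shows "u = u'" "v = v'"
proof -
  obtain f h where f: "hom l f h" "f 0 = 1" "h 0 = 0"
    using lin_sys_exists[OF loc_integrable_coeff(1,3)] by blast
  obtain g k where g: "hom l g k" "g 0 = 0" "k 0 = 1"
    using lin_sys_exists[OF loc_integrable_coeff(1,3)] by blast
  have W: "f x * k x - h x * g x = 1" for x
    using hom_wronskian_const[OF f(1) g(1), of x] f g by simp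
  have rep: "u x = u 0 * f x + v 0 * g x \<and> v x = u 0 * h x + v 0 * k x" if u: "hom l u v" for u v x
  proof -
    have 1: "u x * k x - v x * g x = u 0" "u x * h x - v x * f x = - v 0"
      using hom_wronskian_const[OF u g(1), of x] hom_wronskian_const[OF u f(1), of x] f g by simp_all
    have "u x = (u x * k x - v x * g x) * f x - (u x * h x - v x * f x) * g x"
      using W[of x] by algebra
    moreover have "v x = (u x * k x - v x * g x) * h x - (u x * h x - v x * f x) * k x"
      using W[of x] by algebra
    ultimately show ?thesis unfolding 1 by (simp add: algebra_simps)
  qed
  show "u = u'" "v = v'"
  proof -
    have "u x = u' x \<and> v x = v' x" for x using rep[OF 1, of x] rep[OF 2, of x] 0 by simp
    then show "u = u'" "v = v'" by auto
  qed
qed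

lemma sl_ivp_hom:
  "hom l (sl_ivp w p q l c d) (quasi_deriv p UNIV (sl_ivp w p q l c d))"
  "sl_ivp w p q l c d 0 = c" "quasi_deriv p UNIV (sl_ivp w p q l c d) 0 = d"
proof -
  obtain f h where f: "hom l f h" "f 0 = c" "h 0 = d"
    using lin_sys_exists[OF loc_integrable_coeff(1,3), of l c d] by blast
  have q: "quasi_deriv p UNIV f = h" by (rule hom_quasi_deriv[OF f(1)])
  let ?P = "\<lambda>u. sl_solution w p q l u \<and> u 0 = c \<and> quasi_deriv p UNIV u 0 = d"
  have "?P f" using f q by (simp add: sl_solution_iff_hom)
  moreover have "u = f" if "?P u" for u
    using that f q hom_unique(1)[of l u "quasi_deriv p UNIV u" f h] by (auto simp: sl_solution_iff_hom)
  ultimately have "?P (sl_ivp w p q l c d)"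
    unfolding sl_ivp_def by (rule theI)
  then show "hom l (sl_ivp w p q l c d) (quasi_deriv p UNIV (sl_ivp w p q l c d))"
    "sl_ivp w p q l c d 0 = c" "quasi_deriv p UNIV (sl_ivp w p q l c d) 0 = d"
    by (auto simp: sl_solution_iff_hom)
qed

lemma fundamental:
  "hom l (\<phi> l) (\<phi>1 l)" "hom l (\<psi> l) (\<psi>1 l)"
  "\<phi> l 0 = 1" "\<phi>1 l 0 = 0" "\<psi> l 0 = 0" "\<psi>1 l 0 = 1"
  unfolding \<phi>_def \<psi>_def \<phi>1_def \<psi>1_def sl_phi_def sl_psi_def by (rule sl_ivp_hom)+

lemma wronskian: "\<phi> l x * \<psi>1 l x - \<phi>1 l x * \<psi> l x = 1"
  using hom_wronskian_const[OF fundamental(1,2), of l x] fundamental(3-6)[of l] by simp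

lemma continuous_fundamental:
  "continuous_on UNIV (\<phi> l)" "continuous_on UNIV (\<psi> l)" "continuous_on UNIV (\<phi>1 l)" "continuous_on UNIV (\<psi>1 l)"
  using fundamental(1,2)[of l] by (auto simp: lin_sys_def intro: AC_deriv_continuous_on)

text \<open>The coefficients are the Wronskians with \<psi> and \<phi>, so that only the
  inhomogeneity enters their derivatives, and the representation is an algebraic consequence of the
  Wronskian of \<phi> and \<psi> being 1.\<close>

lemma variation_of_constants:
  assumes "lin_sys I \<alpha> (\<beta> l) \<gamma> f h"
  defines "A \<equiv> \<lambda>x. f x * \<psi>1 l x - h x * \<psi> l x" and "B \<equiv> \<lambda>x. f x * \<phi>1 l x - h x * \<phi> l x"
  shows "AC_deriv I A (\<lambda>x. \<gamma> x * \<psi> l x)" "AC_deriv I B (\<lambda>x. \<gamma> x * \<phi> l x)"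
    "f x = A x * \<phi> l x - B x * \<psi> l x" "h x = A x * \<phi>1 l x - B x * \<psi>1 l x"
proof -
  have "lin_sys I \<alpha> (\<beta> l) (\<lambda>_. 0) (\<phi> l) (\<phi>1 l)" "lin_sys I \<alpha> (\<beta> l) (\<lambda>_. 0) (\<psi> l) (\<psi>1 l)"
    using fundamental(1,2)[of l] by (auto intro: lin_sys_subset)
  with assms(1) show "AC_deriv I A (\<lambda>x. \<gamma> x * \<psi> l x)" "AC_deriv I B (\<lambda>x. \<gamma> x * \<phi> l x)"
    unfolding A_def B_def by (auto intro: lin_sys_wronskian)
  show "f x = A x * \<phi> l x - B x * \<psi> l x" "h x = A x * \<phi>1 l x - B x * \<psi>1 l x"
    unfolding A_def B_def using wronskian[of l x] by algebra+
qed

lemma variation_of_constants_conv: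
  assumes A: "AC_deriv I A (\<lambda>x. \<gamma> x * \<psi> l x)" and B: "AC_deriv I B (\<lambda>x. \<gamma> x * \<phi> l x)"
  shows "lin_sys I \<alpha> (\<beta> l) \<gamma> (\<lambda>x. A x * \<phi> l x - B x * \<psi> l x) (\<lambda>x. A x * \<phi>1 l x - B x * \<psi>1 l x)"
proof -
  have F: "AC_deriv I (\<phi> l) (\<lambda>x. \<alpha> x * \<phi>1 l x)" "AC_deriv I (\<phi>1 l) (\<lambda>x. \<beta> l x * \<phi> l x)"
     "AC_deriv I (\<psi> l) (\<lambda>x. \<alpha> x * \<psi>1 l x)" "AC_deriv I (\<psi>1 l) (\<lambda>x. \<beta> l x * \<psi> l x)"
    using fundamental(1,2)[of l] by (auto simp: lin_sys_def intro: AC_deriv_subset)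
  have 1: "AC_deriv I (\<lambda>x. A x * \<phi> l x - B x * \<psi> l x)
     (\<lambda>x. (\<gamma> x * \<psi> l x * \<phi> l x + A x * (\<alpha> x * \<phi>1 l x)) - (\<gamma> x * \<phi> l x * \<psi> l x + B x * (\<alpha> x * \<psi>1 l x)))"
    using F A B by (intro AC_deriv_diff AC_deriv_mult)
  have 2: "AC_deriv I (\<lambda>x. A x * \<phi>1 l x - B x * \<psi>1 l x)
     (\<lambda>x. (\<gamma> x * \<psi> l x * \<phi>1 l x + A x * (\<beta> l x * \<phi> l x)) - (\<gamma> x * \<phi> l x * \<psi>1 l x + B x * (\<beta> l x * \<psi> l x)))"
    using F A B by (intro AC_deriv_diff AC_deriv_mult)
  show ?thesis
    unfolding lin_sys_def
  proof
    show "AC_deriv I (\<lambda>x. A x * \<phi> l x - B x * \<psi> l x) (\<lambda>x. \<alpha> x * (A x * \<phi>1 l x - B x * \<psi>1 l x))"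
      by (rule AC_deriv_cong[OF 1]) (auto simp: algebra_simps)
    show "AC_deriv I (\<lambda>x. A x * \<phi>1 l x - B x * \<psi>1 l x) (\<lambda>x. \<beta> l x * (A x * \<phi> l x - B x * \<psi> l x) - \<gamma> x)"
    proof (rule AC_deriv_cong[OF 2])
      fix x
      show "(\<gamma> x * \<psi> l x * \<phi>1 l x + A x * (\<beta> l x * \<phi> l x)) - (\<gamma> x * \<phi> l x * \<psi>1 l x + B x * (\<beta> l x * \<psi> l x))
        = \<beta> l x * (A x * \<phi> l x - B x * \<psi> l x) - \<gamma> x"
        using wronskian[of l x] by algebra
    qed simp
  qed
qed

lemma hom_rep:
  assumes "hom l u v"
  shows "u x = u 0 * \<phi> l x + v 0 * \<psi> l x" "v x = u 0 * \<phi>1 l x + v 0 * \<psi>1 l x"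
proof -
  have "AC_deriv UNIV (\<lambda>x. u x * \<psi>1 l x - v x * \<psi> l x) (\<lambda>_. 0)" "AC_deriv UNIV (\<lambda>x. u x * \<phi>1 l x - v x * \<phi> l x) (\<lambda>_. 0)"
    using variation_of_constants(1,2)[OF assms] by simp_all
  from AC_deriv_zero_imp_const[OF this(1), of x 0] AC_deriv_zero_imp_const[OF this(2), of x 0]
  have e: "u x * \<psi>1 l x - v x * \<psi> l x = u 0" "u x * \<phi>1 l x - v x * \<phi> l x = - v 0"
    using fundamental(3-6)[of l] by simp_all
  show "u x = u 0 * \<phi> l x + v 0 * \<psi> l x" "v x = u 0 * \<phi>1 l x + v 0 * \<psi>1 l x"
    using variation_of_constants(3,4)[OF assms, of x] unfolding e by (simp_all add: algebra_simps)
qed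

lemma hom_lincomb: "hom l u v \<Longrightarrow> hom l u' v' \<Longrightarrow> hom l (\<lambda>x. c * u x + d * u' x) (\<lambda>x. c * v x + d * v' x)"
  using lin_sys_lincomb[of UNIV \<alpha> "\<beta> l" "\<lambda>_. 0" u v "\<lambda>_. 0" u' v' c d] by simp

lemma coeff_per [simp]: "\<alpha> (x + a) = \<alpha> x" "W (x + a) = W x" "\<beta> l (x + a) = \<beta> l x"
  by (simp_all add: \<alpha>_def W_def \<beta>_def p_per w_per q_per)

lemma lin_sys_translate:
  assumes "lin_sys UNIV \<alpha> (\<beta> l) \<gamma> u v"
  shows "lin_sys UNIV \<alpha> (\<beta> l) (\<lambda>x. \<gamma> (x + a)) (\<lambda>x. u (x + a)) (\<lambda>x. v (x + a))"
  using AC_deriv_translate[of u "\<lambda>x. \<alpha> x * v x" a] AC_deriv_translate[of v "\<lambda>x. \<beta> l x * u x - \<gamma> x" a] assms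
  by (simp add: lin_sys_def)

definition D :: "complex \<Rightarrow> complex" where "D l = \<phi> l a + \<psi>1 l a"

lemma D_eq: "D l = floquet_discriminant w p q a l"
  by (simp add: D_def floquet_discriminant_def \<phi>_def \<psi>1_def \<psi>_def)

text \<open>Cayley-Hamilton for the monodromy matrix, whose trace is D and whose determinant is 1.
  Checked at x = 0, the identity extends to all x by periodicity of the coefficients and
  uniqueness.\<close>

lemma hom_three_term:
  assumes u: "hom l u v"
  shows "u (x + 2 * a) = D l * u (x + a) - u x" "v (x + 2 * a) = D l * v (x + a) - v x"
proof -
  have u1: "hom l (\<lambda>x. u (x + a)) (\<lambda>x. v (x + a))" using lin_sys_translate[OF u] by simp
  have u2: "hom l (\<lambda>x. u (x + 2 * a)) (\<lambda>x. v (x + 2 * a))" using lin_sys_translate[OF u1] by (simp add: algebra_simps)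
  have r: "hom l (\<lambda>x. D l * u (x + a) + (-1) * u x) (\<lambda>x. D l * v (x + a) + (-1) * v x)"
    by (rule hom_lincomb[OF u1 u])
  have e2: "u (2 * a) = u a * \<phi> l a + v a * \<psi> l a" "v (2 * a) = u a * \<phi>1 l a + v a * \<psi>1 l a"
    using hom_rep[OF u1, of a] by simp_all
  have e1: "u a = u 0 * \<phi> l a + v 0 * \<psi> l a" "v a = u 0 * \<phi>1 l a + v 0 * \<psi>1 l a"
    using hom_rep[OF u, of a] by simp_all
  have "u (2 * a) = D l * u a - u 0" "v (2 * a) = D l * v a - v 0"
    unfolding e2 unfolding e1 D_def using wronskian[of l a] by algebra+
  then have "(\<lambda>x. u (x + 2 * a)) = (\<lambda>x. D l * u (x + a) + (-1) * u x)"
    "(\<lambda>x. v (x + 2 * a)) = (\<lambda>x. D l * v (x + a) + (-1) * v x)"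
    by (intro hom_unique[OF u2 r]; simp)+
  then show "u (x + 2 * a) = D l * u (x + a) - u x" "v (x + 2 * a) = D l * v (x + a) - v x"
    by (simp_all add: fun_eq_iff)
qed

end

section \<open>The weighted spaces\<close>

lemma sigma_finite_lebesgue: "sigma_finite_measure (lebesgue :: real measure)"
proof
  show "\<exists>A. countable A \<and> A \<subseteq> sets lebesgue \<and> \<Union>A = space lebesgue \<and> (\<forall>a\<in>A. emeasure lebesgue (a::real set) \<noteq> \<infinity>)"
  proof (intro exI[of _ "range (\<lambda>n::nat. {- real n..real n})"] conjI)
    have "\<exists>n::nat. x \<in> {- real n..real n}" for x :: real
    proof -
      obtain n :: nat where "\<bar>x\<bar> < real n" using reals_Archimedean2 by blast
      then show ?thesis by (intro exI[of _ n]) auto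
    qed
    then show "\<Union> (range (\<lambda>n::nat. {- real n..real n})) = space lebesgue" by auto
  qed auto
qed

text \<open>The optimal parameter is s = X/A. For A = 0 a large s contradicts X > 0, and (B + 1)/X
  is large enough.\<close>

lemma quadratic_bound_imp_square_le:
  fixes A B X :: real
  assumes "A \<ge> 0" "B \<ge> 0" "X \<ge> 0" and le: "\<And>s. s > 0 \<Longrightarrow> X \<le> (s * A + B / s) / 2"
  shows "X\<^sup>2 \<le> A * B"
proof (cases "X = 0")
  case False
  then have X: "X > 0" using assms by simp
  show ?thesis
  proof (cases "A = 0")
    case True
    have "X \<le> (B / ((B + 1) / X)) / 2" using le[of "(B + 1) / X"] True X assms by simp
    then have "X * (2 * (B + 1)) \<le> B * X" using assms by (simp add: field_simps)
    then have "2 * (B + 1) \<le> B" using X by (simp add: mult.commute)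
    then show ?thesis using assms by simp
  next
    case False
    then have A: "A > 0" using assms by simp
    have "X \<le> (X / A * A + B / (X / A)) / 2" using le[of "X / A"] X A by simp
    then show ?thesis using X A by (simp add: field_simps power2_eq_square)
  qed
qed (use assms in simp)

text \<open>Integrate Young's inequality v \<le> s/2 + v^2/(2 s) against \<open>k\<close> and
  optimize in s. The version in \<open>ennreal\<close> needs no integrability in advance.\<close>

lemma nn_Cauchy_Schwarz:
  fixes k v :: "'a \<Rightarrow> real"
  assumes [measurable]: "k \<in> borel_measurable M" "(\<lambda>x. k x * v x) \<in> borel_measurable M" "(\<lambda>x. k x * (v x)\<^sup>2) \<in> borel_measurable M"
    and k0: "\<And>x. 0 \<le> k x" and v0: "\<And>x. 0 \<le> v x"
  shows "(\<integral>\<^sup>+x. ennreal (k x * v x) \<partial>M)\<^sup>2 \<le> (\<integral>\<^sup>+x. ennreal (k x) \<partial>M) * (\<integral>\<^sup>+x. ennreal (k x * (v x)\<^sup>2) \<partial>M)"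
    (is "?X\<^sup>2 \<le> ?A * ?B")
proof -
  have ineq: "?X \<le> ennreal (s / 2) * ?A + ennreal (1 / (2 * s)) * ?B" if s: "s > 0" for s :: real
  proof -
    have "?X \<le> (\<integral>\<^sup>+x. ennreal (s / 2) * ennreal (k x) + ennreal (1 / (2 * s)) * ennreal (k x * (v x)\<^sup>2) \<partial>M)"
    proof (rule nn_integral_mono)
      fix x
      have "0 \<le> (s - v x)\<^sup>2 / (2 * s)" using s by simp
      also have "\<dots> = s / 2 + (v x)\<^sup>2 / (2 * s) - v x" using s by (simp add: power2_eq_square field_simps)
      finally have "k x * v x \<le> k x * (s / 2 + (v x)\<^sup>2 / (2 * s))" using k0[of x] by (intro mult_left_mono) auto
      also have "\<dots> = s / 2 * k x + 1 / (2 * s) * (k x * (v x)\<^sup>2)" by (simp add: algebra_simps)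
      finally show "ennreal (k x * v x) \<le> ennreal (s / 2) * ennreal (k x) + ennreal (1 / (2 * s)) * ennreal (k x * (v x)\<^sup>2)"
        using s k0 by (simp add: ennreal_mult[symmetric] ennreal_plus[symmetric] ennreal_leI del: ennreal_plus)
    qed
    also have "\<dots> = ennreal (s / 2) * ?A + ennreal (1 / (2 * s)) * ?B"
      by (simp add: nn_integral_add nn_integral_cmult)
    finally show ?thesis .
  qed
  show ?thesis
  proof (cases "?A = \<infinity> \<or> ?B = \<infinity>")
    case False
    define A B X where "A = enn2real ?A" and "B = enn2real ?B" and "X = enn2real ?X"
    have A: "?A = ennreal A" "A \<ge> 0" and B: "?B = ennreal B" "B \<ge> 0"
      using False by (auto simp: A_def B_def less_top)
    define c where "c = ennreal (1 / 2)"
    have c: "c \<noteq> top" unfolding c_def by (rule ennreal_neq_top)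
    have "?X \<le> c * ?A + c * ?B" using ineq[of 1] by (simp add: c_def)
    also have "\<dots> < \<infinity>" using False c by (simp add: ennreal_mult_less_top less_top)
    finally have X: "?X = ennreal X" "X \<ge> 0" by (auto simp: X_def)
    have "X \<le> (s * A + B / s) / 2" if "s > 0" for s
    proof -
      have "ennreal X \<le> ennreal (s / 2 * A + 1 / (2 * s) * B)"
        using ineq[OF that] that A B X by (simp add: ennreal_mult[symmetric] ennreal_plus[symmetric] del: ennreal_plus)
      then have "X \<le> s / 2 * A + 1 / (2 * s) * B" using A B that by (subst (asm) ennreal_le_iff) auto
      then show ?thesis by (simp add: field_simps)
    qed
    then have "X\<^sup>2 \<le> A * B" using A B X by (intro quadratic_bound_imp_square_le)
    then show ?thesis unfolding A B X using X A B by (simp add: ennreal_mult[symmetric] power2_eq_square ennreal_leI)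
  next
    case True
    show ?thesis
    \<comment> \<open>One factor is infinite here; as 0 times infinity is 0, a vanishing other
      factor must be shown to make the left side vanish.\<close>
    proof (cases "?A = 0 \<or> ?B = 0")
      case True
      then have "AE x in M. k x * v x = 0"
      proof
        assume "?A = 0"
        then have "AE x in M. ennreal (k x) = 0" by (subst (asm) nn_integral_0_iff_AE) auto
        then show ?thesis using k0 by (auto elim!: eventually_mono simp: ennreal_eq_0_iff intro: antisym)
      next
        assume "?B = 0"
        then have "AE x in M. ennreal (k x * (v x)\<^sup>2) = 0" by (subst (asm) nn_integral_0_iff_AE) auto
        then show ?thesis
          using k0 v0 by (auto elim!: eventually_mono simp: ennreal_eq_0_iff mult_le_0_iff not_le[symmetric] intro: antisym)
      qed
      then have "?X = 0" by (subst nn_integral_0_iff_AE) (auto elim!: eventually_mono)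
      then show ?thesis by simp
    next
      case False
      then show ?thesis using True by (auto simp: ennreal_mult_eq_top_iff)
    qed
  qed
qed

context sl_periodic
begin

abbreviation L2w :: "real set \<Rightarrow> (real \<Rightarrow> complex) set" where
  "L2w I \<equiv> L2_space (weight_measure w I)"

text \<open>The squared norm of L2(|w|) over \<open>I\<close> as an extended real, so that estimates
  can be chained before finiteness is known.\<close>

definition E :: "real set \<Rightarrow> (real \<Rightarrow> complex) \<Rightarrow> ennreal" where
  "E I f = (\<integral>\<^sup>+x. ennreal (indicator I x * (\<bar>w x\<bar> * (norm (f x))\<^sup>2)) \<partial>lebesgue)"

definition meas :: "real set \<Rightarrow> (real \<Rightarrow> complex) \<Rightarrow> bool" where
  "meas I f \<longleftrightarrow> (\<lambda>x. indicator I x *\<^sub>R f x) \<in> borel_measurable lebesgue"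

lemma meas_weight:
  assumes "meas I f"
  shows "(\<lambda>x. indicator I x * (\<bar>w x\<bar> * (norm (f x))\<^sup>2)) \<in> borel_measurable lebesgue"
proof -
  have "(\<lambda>x. \<bar>w x\<bar> * (norm (indicator I x *\<^sub>R f x))\<^sup>2) \<in> borel_measurable lebesgue"
    using assms w_meas unfolding meas_def by measurable
  moreover have "(\<lambda>x. \<bar>w x\<bar> * (norm (indicator I x *\<^sub>R f x))\<^sup>2) = (\<lambda>x. indicator I x * (\<bar>w x\<bar> * (norm (f x))\<^sup>2))"
    by (auto simp: indicator_def)
  ultimately show ?thesis by simp
qed

lemma meas_iff: "I \<in> sets lebesgue \<Longrightarrow> meas I f \<longleftrightarrow> f \<in> borel_measurable (lebesgue_on I)"
  unfolding meas_def by (subst borel_measurable_restrict_space_iff) auto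

lemma L2w_iff:
  assumes I: "I \<in> sets lebesgue"
  shows "f \<in> L2w I \<longleftrightarrow> meas I f \<and> E I f < \<infinity>"
proof (cases "meas I f")
  case True
  then have m: "f \<in> borel_measurable (lebesgue_on I)" using meas_iff[OF I] by simp
  have wm: "w \<in> borel_measurable (lebesgue_on I)" using w_meas by (rule measurable_restrict_space1)
  have "integrable (weight_measure w I) (\<lambda>x. (norm (f x))\<^sup>2) \<longleftrightarrow> integrable (lebesgue_on I) (\<lambda>x. \<bar>w x\<bar> *\<^sub>R (norm (f x))\<^sup>2)"
    unfolding weight_measure_def using m wm by (intro integrable_density) auto
  also have "\<dots> \<longleftrightarrow> integrable lebesgue (\<lambda>x. indicator I x * (\<bar>w x\<bar> * (norm (f x))\<^sup>2))"
    using I by (subst integrable_restrict_space) auto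
  also have "\<dots> \<longleftrightarrow> E I f < \<infinity>"
    unfolding E_def integrable_iff_bounded using meas_weight[OF True] by (auto simp: abs_mult)
  finally show ?thesis using True m by (simp add: L2_space_def weight_measure_def)
next
  case False
  then show ?thesis using meas_iff[OF I] by (simp add: L2_space_def weight_measure_def)
qed

lemma L2_norm_E:
  assumes I: "I \<in> sets lebesgue" and f: "meas I f"
  shows "L2_norm (weight_measure w I) f = sqrt (enn2real (E I f))"
proof -
  have m: "f \<in> borel_measurable (lebesgue_on I)" using meas_iff[OF I] f by simp
  have wm: "w \<in> borel_measurable (lebesgue_on I)" using w_meas by (rule measurable_restrict_space1)
  have "(\<integral>x. (norm (f x))\<^sup>2 \<partial>weight_measure w I) = (\<integral>x. \<bar>w x\<bar> *\<^sub>R (norm (f x))\<^sup>2 \<partial>lebesgue_on I)"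
    unfolding weight_measure_def using m wm by (intro integral_density) auto
  also have "\<dots> = (\<integral>x. indicator I x * (\<bar>w x\<bar> * (norm (f x))\<^sup>2) \<partial>lebesgue)"
    using I by (subst integral_restrict_space) auto
  also have "\<dots> = enn2real (E I f)"
    unfolding E_def using meas_weight[OF f] by (intro integral_eq_nn_integral) (auto simp: indicator_def)
  finally show ?thesis by (simp add: L2_norm_def)
qed

lemma AE_weight:
  assumes I: "I \<in> sets lebesgue"
  shows "(AE x in weight_measure w I. P x) \<longleftrightarrow> (AE x in lebesgue. x \<in> I \<longrightarrow> P x)"
proof -
  have wm: "w \<in> borel_measurable (lebesgue_on I)" using w_meas by (rule measurable_restrict_space1)
  have "(AE x in weight_measure w I. P x) \<longleftrightarrow> (AE x in lebesgue_on I. 0 < ennreal \<bar>w x\<bar> \<longrightarrow> P x)"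
    unfolding weight_measure_def using wm by (intro AE_density) auto
  also have "\<dots> \<longleftrightarrow> (AE x in lebesgue. x \<in> I \<longrightarrow> 0 < ennreal \<bar>w x\<bar> \<longrightarrow> P x)"
    by (rule AE_lebesgue_on_iff[OF I])
  also have "\<dots> \<longleftrightarrow> (AE x in lebesgue. x \<in> I \<longrightarrow> P x)"
  proof
    assume "AE x in lebesgue. x \<in> I \<longrightarrow> 0 < ennreal \<bar>w x\<bar> \<longrightarrow> P x"
    with w_nz show "AE x in lebesgue. x \<in> I \<longrightarrow> P x" by eventually_elim auto
  qed (auto elim!: eventually_mono)
  finally show ?thesis .
qed

lemma meas_lincomb: "meas I f \<Longrightarrow> meas I g \<Longrightarrow> meas I (\<lambda>x. c * f x + d * g x)"
proof -
  assume "meas I f" "meas I g"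
  then have "(\<lambda>x. c * (indicator I x *\<^sub>R f x) + d * (indicator I x *\<^sub>R g x)) \<in> borel_measurable lebesgue"
    unfolding meas_def by measurable
  then show ?thesis unfolding meas_def by (simp add: scaleR_right_distrib)
qed

lemma E_lincomb:
  assumes "meas I f" "meas I g"
  shows "E I (\<lambda>x. c * f x + d * g x) \<le> ennreal (2 * (norm c)\<^sup>2) * E I f + ennreal (2 * (norm d)\<^sup>2) * E I g"
proof -
  have "E I (\<lambda>x. c * f x + d * g x) \<le> (\<integral>\<^sup>+x. ennreal (2 * (norm c)\<^sup>2) * ennreal (indicator I x * (\<bar>w x\<bar> * (norm (f x))\<^sup>2)) +
      ennreal (2 * (norm d)\<^sup>2) * ennreal (indicator I x * (\<bar>w x\<bar> * (norm (g x))\<^sup>2)) \<partial>lebesgue)"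
    unfolding E_def
  proof (rule nn_integral_mono)
    fix x
    have "norm (c * f x + d * g x) \<le> norm (c * f x) + norm (d * g x)" by (rule norm_triangle_ineq)
    then have "(norm (c * f x + d * g x))\<^sup>2 \<le> (norm (c * f x) + norm (d * g x))\<^sup>2" by (intro power_mono) auto
    also have "\<dots> \<le> 2 * (norm (c * f x))\<^sup>2 + 2 * (norm (d * g x))\<^sup>2"
      using sum_squares_bound[of "norm (c * f x)" "norm (d * g x)"] by (simp add: power2_sum)
    finally have "indicator I x * (\<bar>w x\<bar> * (norm (c * f x + d * g x))\<^sup>2) \<le> indicator I x * (\<bar>w x\<bar> * (2 * (norm (c * f x))\<^sup>2 + 2 * (norm (d * g x))\<^sup>2))"
      by (intro mult_left_mono) auto
    also have "\<dots> = 2 * (norm c)\<^sup>2 * (indicator I x * (\<bar>w x\<bar> * (norm (f x))\<^sup>2)) + 2 * (norm d)\<^sup>2 * (indicator I x * (\<bar>w x\<bar> * (norm (g x))\<^sup>2))"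
      by (simp add: norm_mult power_mult_distrib algebra_simps)
    finally show "ennreal (indicator I x * (\<bar>w x\<bar> * (norm (c * f x + d * g x))\<^sup>2)) \<le> ennreal (2 * (norm c)\<^sup>2) * ennreal (indicator I x * (\<bar>w x\<bar> * (norm (f x))\<^sup>2)) +
      ennreal (2 * (norm d)\<^sup>2) * ennreal (indicator I x * (\<bar>w x\<bar> * (norm (g x))\<^sup>2))"
      by (simp add: ennreal_mult[symmetric] ennreal_plus[symmetric] ennreal_leI del: ennreal_plus)
  qed
  also have "\<dots> = ennreal (2 * (norm c)\<^sup>2) * E I f + ennreal (2 * (norm d)\<^sup>2) * E I g"
    unfolding E_def using meas_weight[OF assms(1)] meas_weight[OF assms(2)]
    by (subst nn_integral_add) (auto simp: nn_integral_cmult)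
  finally show ?thesis .
qed

lemma L2w_lincomb:
  assumes I: "I \<in> sets lebesgue" and "f \<in> L2w I" "g \<in> L2w I"
  shows "(\<lambda>x. c * f x + d * g x) \<in> L2w I"
proof -
  have f: "meas I f" "E I f < \<infinity>" and g: "meas I g" "E I g < \<infinity>" using assms L2w_iff[OF I] by auto
  have "E I (\<lambda>x. c * f x + d * g x) \<le> ennreal (2 * (norm c)\<^sup>2) * E I f + ennreal (2 * (norm d)\<^sup>2) * E I g"
    using f g by (intro E_lincomb)
  also have "\<dots> < \<infinity>" using f g by (simp add: ennreal_mult_less_top)
  finally show ?thesis using meas_lincomb[OF f(1) g(1)] L2w_iff[OF I] by simp
qed

lemma E_cong_AE:
  assumes "AE x in lebesgue. x \<in> I \<longrightarrow> f x = g x"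
  shows "E I f = E I g"
  unfolding E_def using assms by (intro nn_integral_cong_AE) (auto elim!: eventually_mono simp: indicator_def)

lemma meas_cong_AE:
  assumes "meas I f" "AE x in lebesgue. x \<in> I \<longrightarrow> f x = g x"
  shows "meas I g"
  unfolding meas_def
  by (rule borel_measurable_AE[OF assms(1)[unfolded meas_def]])
    (use assms(2) in \<open>auto elim!: eventually_mono simp: indicator_def\<close>)

lemma L2w_cong_AE:
  assumes "I \<in> sets lebesgue" "f \<in> L2w I" "AE x in lebesgue. x \<in> I \<longrightarrow> f x = g x"
  shows "g \<in> L2w I"
  using assms meas_cong_AE[OF _ assms(3)] E_cong_AE[OF assms(3)] by (auto simp: L2w_iff)

lemma E_mono: "I \<subseteq> J \<Longrightarrow> E I f \<le> E J f"
  unfolding E_def by (intro nn_integral_mono ennreal_leI) (auto simp: indicator_def)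

lemma meas_subset: "meas J f \<Longrightarrow> I \<subseteq> J \<Longrightarrow> I \<in> sets lebesgue \<Longrightarrow> meas I f"
proof -
  assume "meas J f" "I \<subseteq> J" "I \<in> sets lebesgue"
  then have "(\<lambda>x. indicator I x *\<^sub>R (indicator J x *\<^sub>R f x)) \<in> borel_measurable lebesgue"
    unfolding meas_def by (intro borel_measurable_scaleR[OF borel_measurable_indicator[OF \<open>I \<in> sets lebesgue\<close>]])
  moreover have "(\<lambda>x. indicator I x *\<^sub>R (indicator J x *\<^sub>R f x)) = (\<lambda>x. indicator I x *\<^sub>R f x)"
    using \<open>I \<subseteq> J\<close> by (intro ext) (auto split: split_indicator)
  ultimately show ?thesis by (simp add: meas_def)
qed

lemma w_translate_nat: "w (x + real n * a) = w x"
proof (induction n)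
  case (Suc n)
  then show ?case using w_per[of "x + real n * a"] by (simp add: algebra_simps)
qed simp

lemma w_translate_nat_minus: "w (x - real n * a) = w x"
  using w_translate_nat[of "x - real n * a" n] by simp

lemma E_translate:
  assumes f: "meas I f" and s: "\<And>x. w (x + s) = w x"
  shows "E ((\<lambda>x. x + s) -` I) (\<lambda>x. f (x + s)) = E I f"
proof -
  have "E I f = (\<integral>\<^sup>+x. ennreal (indicator I (s + 1 * x) * (\<bar>w (s + 1 * x)\<bar> * (norm (f (s + 1 * x)))\<^sup>2)) \<partial>lebesgue)"
    unfolding E_def using meas_weight[OF f] by (subst nn_integral_real_affine_lebesgue[of _ 1 s]) auto
  also have "\<dots> = E ((\<lambda>x. x + s) -` I) (\<lambda>x. f (x + s))"
    unfolding E_def using s by (intro nn_integral_cong) (auto simp: indicator_def add.commute)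
  finally show ?thesis by simp
qed

lemma meas_translate:
  assumes f: "meas I f"
  shows "meas ((\<lambda>x. x + s) -` I) (\<lambda>x. f (x + s))"
proof -
  have "(\<lambda>x. indicator I (s + 1 * x) *\<^sub>R f (s + 1 * x)) \<in> borel_measurable lebesgue"
    using borel_measurable_affine[of "\<lambda>x. indicator I x *\<^sub>R f x" 1 s] f unfolding meas_def by simp
  moreover have "(\<lambda>x. indicator I (s + 1 * x) *\<^sub>R f (s + 1 * x)) = (\<lambda>x. indicator ((\<lambda>x. x + s) -` I) x *\<^sub>R f (x + s))"
    by (auto simp: indicator_def add.commute)
  ultimately show ?thesis by (simp add: meas_def)
qed

definition L1w :: "real set \<Rightarrow> (real \<Rightarrow> complex) \<Rightarrow> ennreal" where
  "L1w I f = (\<integral>\<^sup>+x. ennreal (indicator I x * (\<bar>w x\<bar> * norm (f x))) \<partial>lebesgue)"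

lemma meas_weight1:
  assumes "meas I f"
  shows "(\<lambda>x. indicator I x * (\<bar>w x\<bar> * norm (f x))) \<in> borel_measurable lebesgue"
proof -
  have "(\<lambda>x. \<bar>w x\<bar> * norm (indicator I x *\<^sub>R f x)) \<in> borel_measurable lebesgue"
    using assms w_meas unfolding meas_def by measurable
  moreover have "(\<lambda>x. \<bar>w x\<bar> * norm (indicator I x *\<^sub>R f x)) = (\<lambda>x. indicator I x * (\<bar>w x\<bar> * norm (f x)))"
    by (auto simp: indicator_def)
  ultimately show ?thesis by simp
qed

text \<open>On a compact interval |w| has finite mass, so L2(|w|) embeds into L1(|w|); the solution
  formulas contain integrals of w g and are controlled by the latter norm.\<close>

lemma L1w_square_le:
  assumes "meas I f" "I \<in> sets lebesgue"
  shows "(L1w I f)\<^sup>2 \<le> E I (\<lambda>_. 1) * E I f"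
proof -
  have [measurable]: "w \<in> borel_measurable lebesgue" "indicator I \<in> borel_measurable lebesgue" using w_meas assms by auto
  have "(\<integral>\<^sup>+x. ennreal ((indicator I x * \<bar>w x\<bar>) * norm (f x)) \<partial>lebesgue)\<^sup>2
      \<le> (\<integral>\<^sup>+x. ennreal (indicator I x * \<bar>w x\<bar>) \<partial>lebesgue) * (\<integral>\<^sup>+x. ennreal ((indicator I x * \<bar>w x\<bar>) * (norm (f x))\<^sup>2) \<partial>lebesgue)"
    using meas_weight[OF assms(1)] meas_weight1[OF assms(1)]
    by (intro nn_Cauchy_Schwarz) (auto simp: mult.assoc)
  then show ?thesis by (simp add: L1w_def E_def mult.assoc)
qed

lemma E_one_finite: "E {c..d} (\<lambda>_. 1) < \<infinity>"
proof -
  have "set_integrable lebesgue {c..d} W" using loc_integrable_coeff(2) by (simp add: loc_integrable_def)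
  then have "(\<integral>\<^sup>+x. ennreal (norm (indicator {c..d} x *\<^sub>R W x)) \<partial>lebesgue) < \<infinity>"
    unfolding set_integrable_def integrable_iff_bounded by simp
  moreover have n: "norm (indicator {c..d} x *\<^sub>R W x) = indicator {c..d} x * (\<bar>w x\<bar> * (norm (1::complex))\<^sup>2)" for x
    by (auto simp: W_def split: split_indicator)
  ultimately show ?thesis unfolding E_def n by simp
qed

lemma set_integrable_W_mult:
  assumes f: "f \<in> L2w I" and I: "I \<in> sets lebesgue" and s: "{c..d} \<subseteq> I"
  shows "set_integrable lebesgue {c..d} (\<lambda>x. W x * f x)"
proof -
  have m: "meas {c..d} f" and e: "E {c..d} f < \<infinity>"
    using f L2w_iff[OF I] meas_subset[OF _ s] E_mono[OF s, of f] by (auto simp: le_less_trans)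
  have "(L1w {c..d} f)\<^sup>2 \<le> E {c..d} (\<lambda>_. 1) * E {c..d} f" by (rule L1w_square_le[OF m]) simp
  also have "\<dots> < \<infinity>" using E_one_finite e by (simp add: ennreal_mult_less_top)
  finally have l1: "L1w {c..d} f < \<infinity>" by (auto simp: power2_eq_square ennreal_mult_less_top)
  have mW: "(\<lambda>x. W x * (indicator {c..d} x *\<^sub>R f x)) \<in> borel_measurable lebesgue"
    using m w_meas unfolding meas_def W_def by measurable
  have eq: "(\<lambda>x. W x * (indicator {c..d} x *\<^sub>R f x)) = (\<lambda>x. indicator {c..d} x *\<^sub>R (W x * f x))" by auto
  have n: "norm (indicator {c..d} x *\<^sub>R (W x * f x)) = indicator {c..d} x * (\<bar>w x\<bar> * norm (f x))" for x
    by (auto simp: W_def norm_mult indicator_def)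
  show ?thesis
    unfolding set_integrable_def integrable_iff_bounded n
    using mW l1 unfolding eq L1w_def by simp
qed

lemma norm_set_integral_le_L1w:
  assumes "set_integrable lebesgue {c..d} (\<lambda>x. W x * f x * u x)" and K: "\<And>x. x \<in> {c..d} \<Longrightarrow> norm (u x) \<le> K" and s: "{c..d} \<subseteq> I" and "0 \<le> K" and m: "meas I f"
  shows "ennreal (norm (LINT x:{c..d}|lebesgue. W x * f x * u x)) \<le> ennreal K * L1w I f"
proof -
  have "ennreal (norm (LINT x:{c..d}|lebesgue. W x * f x * u x)) \<le> (\<integral>\<^sup>+x. ennreal (norm (indicator {c..d} x *\<^sub>R (W x * f x * u x))) \<partial>lebesgue)"
    unfolding set_lebesgue_integral_def using assms(1) unfolding set_integrable_def by (rule integral_norm_bound_ennreal)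
  also have "\<dots> \<le> (\<integral>\<^sup>+x. ennreal K * ennreal (indicator I x * (\<bar>w x\<bar> * norm (f x))) \<partial>lebesgue)"
  proof (rule nn_integral_mono)
    fix x
    have "norm (indicator {c..d} x *\<^sub>R (W x * f x * u x)) \<le> K * (indicator I x * (\<bar>w x\<bar> * norm (f x)))"
    proof (cases "x \<in> {c..d}")
      case True
      then have "\<bar>w x\<bar> * norm (f x) * norm (u x) \<le> \<bar>w x\<bar> * norm (f x) * K" using K by (intro mult_left_mono) auto
      then show ?thesis using True s by (auto simp: W_def norm_mult indicator_def mult.commute)
    qed (use \<open>0 \<le> K\<close> in auto)
    then show "ennreal (norm (indicator {c..d} x *\<^sub>R (W x * f x * u x))) \<le> ennreal K * ennreal (indicator I x * (\<bar>w x\<bar> * norm (f x)))"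
      using \<open>0 \<le> K\<close> by (simp add: ennreal_mult[symmetric] ennreal_leI)
  qed
  also have "\<dots> = ennreal K * L1w I f" unfolding L1w_def using meas_weight1[OF m] by (intro nn_integral_cmult) auto
  finally show ?thesis .
qed

lemma meas_continuous: "continuous_on {c..d} f \<Longrightarrow> meas {c..d} f"
  unfolding meas_def using borel_measurable_continuous_on_indicator[of "{c..d}" f]
  by (intro measurable_completion) (simp add: measurable_lborel1)

lemma meas_continuous_UNIV: "continuous_on UNIV f \<Longrightarrow> meas UNIV f"
  unfolding meas_def using borel_measurable_continuous_onI[of f]
  by (intro measurable_completion) (simp add: measurable_lborel1)

lemma E_bounded:
  assumes K: "\<And>x. x \<in> I \<Longrightarrow> norm (f x) \<le> K" and I: "I \<in> sets lebesgue"
  shows "E I f \<le> ennreal (K\<^sup>2) * E I (\<lambda>_. 1)"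
proof -
  have "E I f \<le> (\<integral>\<^sup>+x. ennreal (K\<^sup>2) * ennreal (indicator I x * (\<bar>w x\<bar> * (norm (1::complex))\<^sup>2)) \<partial>lebesgue)"
    unfolding E_def
  proof (rule nn_integral_mono)
    fix x
    have "(norm (f x))\<^sup>2 \<le> K\<^sup>2" if "x \<in> I" using K[OF that] by (intro power_mono) auto
    then have "indicator I x * (\<bar>w x\<bar> * (norm (f x))\<^sup>2) \<le> K\<^sup>2 * (indicator I x * (\<bar>w x\<bar> * (norm (1::complex))\<^sup>2))"
      using mult_left_mono[of "(norm (f x))\<^sup>2" "K\<^sup>2" "\<bar>w x\<bar>"] by (auto simp: indicator_def mult.commute)
    then show "ennreal (indicator I x * (\<bar>w x\<bar> * (norm (f x))\<^sup>2)) \<le> ennreal (K\<^sup>2) * ennreal (indicator I x * (\<bar>w x\<bar> * (norm (1::complex))\<^sup>2))"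
      by (simp add: ennreal_mult[symmetric] ennreal_leI)
  qed
  also have "\<dots> = ennreal (K\<^sup>2) * E I (\<lambda>_. 1)"
    unfolding E_def using meas_weight[of I "\<lambda>_. 1"] I by (intro nn_integral_cmult) (auto simp: meas_def)
  finally show ?thesis .
qed

lemma L2w_continuous:
  assumes "continuous_on {c..d} f"
  shows "f \<in> L2w {c..d}"
proof -
  have "bounded (f ` {c..d})" using assms by (intro compact_imp_bounded compact_continuous_image) auto
  then obtain K where K: "\<And>x. x \<in> {c..d} \<Longrightarrow> norm (f x) \<le> K" unfolding bounded_iff by blast
  have "E {c..d} f \<le> ennreal (K\<^sup>2) * E {c..d} (\<lambda>_. 1)" by (rule E_bounded[OF K]) auto
  also have "\<dots> < \<infinity>" using E_one_finite by (simp add: ennreal_mult_less_top)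
  finally show ?thesis using meas_continuous[OF assms] by (simp add: L2w_iff)
qed

lemma max_dom_imp:
  assumes I: "admissible_interval I" and f: "f \<in> sl_max_dom w p q I"
  shows "lin_sys I \<alpha> (\<beta> l) (\<lambda>x. W x * op_shift (sl_expr w p q I) l f x) f (quasi_deriv p I f)"
    "f \<in> L2w I" "op_shift (sl_expr w p q I) l f \<in> L2w I"
proof -
  have f': "f \<in> L2w I" "sl_regular p I f" "sl_expr w p q I f \<in> L2w I" using f by (auto simp: sl_max_dom_def)
  show "lin_sys I \<alpha> (\<beta> l) (\<lambda>x. W x * op_shift (sl_expr w p q I) l f x) f (quasi_deriv p I f)"
    using sl_regular_imp_lin_sys[OF I f'(2)] .
  show "f \<in> L2w I" by fact
  show "op_shift (sl_expr w p q I) l f \<in> L2w I"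
    using L2w_lincomb[OF admissible_interval_props(3)[OF I] f'(3,1), of 1 "-l"] by (simp add: op_shift_def)
qed

text \<open>The interface for constructing domain elements: a square integrable solution of the
  system with square integrable data. The expression itself is then almost everywhere g + l f, hence
  square integrable.\<close>

lemma max_dom_intro:
  assumes I: "admissible_interval I" and s: "lin_sys I \<alpha> (\<beta> l) (\<lambda>x. W x * g x) f h"
    and f: "f \<in> L2w I" and g: "g \<in> L2w I"
  shows "f \<in> sl_max_dom w p q I" "AE x in lebesgue. x \<in> I \<longrightarrow> op_shift (sl_expr w p q I) l f x = g x"
    "\<And>x. x \<in> I \<Longrightarrow> quasi_deriv p I f x = h x"
proof -
  note r = lin_sys_imp_sl_regular[OF I s]
  show ae: "AE x in lebesgue. x \<in> I \<longrightarrow> op_shift (sl_expr w p q I) l f x = g x" by (rule r(3))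
  show "\<And>x. x \<in> I \<Longrightarrow> quasi_deriv p I f x = h x" by (rule r(2))
  have "AE x in lebesgue. x \<in> I \<longrightarrow> 1 * g x + l * f x = sl_expr w p q I f x"
    using ae by eventually_elim (auto simp: op_shift_def algebra_simps)
  from L2w_cong_AE[OF admissible_interval_props(3)[OF I] L2w_lincomb[OF admissible_interval_props(3)[OF I] g f] this]
  have "sl_expr w p q I f \<in> L2w I" .
  then show "f \<in> sl_max_dom w p q I" using f r(1) by (simp add: sl_max_dom_def)
qed

end

section \<open>Quasi-periodic boundary value problems\<close>

lemma op_injectiveD:
  "op_injective M D T \<Longrightarrow> f \<in> D \<Longrightarrow> g \<in> D \<Longrightarrow> AE x in M. T f x = T g x \<Longrightarrow> AE x in M. f x = g x"
  by (simp add: op_injective_def)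

context sl_periodic
begin

lemma fundamental_bounded:
  obtains C where "C > 0" "\<And>x. x \<in> {c..d} \<Longrightarrow> norm (\<phi> l x) \<le> C \<and> norm (\<psi> l x) \<le> C \<and> norm (\<phi>1 l x) \<le> C \<and> norm (\<psi>1 l x) \<le> C"
proof -
  have B: "\<exists>K. \<forall>x\<in>{c..d}. norm (f x) \<le> K" if "continuous_on UNIV f" for f :: "real \<Rightarrow> complex"
  proof -
    have "bounded (f ` {c..d})"
      using continuous_on_subset[OF that] by (intro compact_imp_bounded compact_continuous_image) auto
    then show ?thesis unfolding bounded_iff by auto
  qed
  obtain C1 C2 C3 C4 where C: "\<forall>x\<in>{c..d}. norm (\<phi> l x) \<le> C1" "\<forall>x\<in>{c..d}. norm (\<psi> l x) \<le> C2"
    "\<forall>x\<in>{c..d}. norm (\<phi>1 l x) \<le> C3" "\<forall>x\<in>{c..d}. norm (\<psi>1 l x) \<le> C4"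
    using B[OF continuous_fundamental(1)[of l]] B[OF continuous_fundamental(2)[of l]]
      B[OF continuous_fundamental(3)[of l]] B[OF continuous_fundamental(4)[of l]] by blast
  show thesis
  proof (rule that[of "\<bar>C1\<bar> + \<bar>C2\<bar> + \<bar>C3\<bar> + \<bar>C4\<bar> + 1"])
    fix x assume "x \<in> {c..d}"
    with C have "norm (\<phi> l x) \<le> C1" "norm (\<psi> l x) \<le> C2" "norm (\<phi>1 l x) \<le> C3" "norm (\<psi>1 l x) \<le> C4" by auto
    then show "norm (\<phi> l x) \<le> \<bar>C1\<bar> + \<bar>C2\<bar> + \<bar>C3\<bar> + \<bar>C4\<bar> + 1 \<and> norm (\<psi> l x) \<le> \<bar>C1\<bar> + \<bar>C2\<bar> + \<bar>C3\<bar> + \<bar>C4\<bar> + 1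
       \<and> norm (\<phi>1 l x) \<le> \<bar>C1\<bar> + \<bar>C2\<bar> + \<bar>C3\<bar> + \<bar>C4\<bar> + 1 \<and> norm (\<psi>1 l x) \<le> \<bar>C1\<bar> + \<bar>C2\<bar> + \<bar>C3\<bar> + \<bar>C4\<bar> + 1" by linarith
  qed linarith
qed

lemma L1w_cong_AE:
  assumes "AE x in lebesgue. x \<in> I \<longrightarrow> f x = g x"
  shows "L1w I f = L1w I g"
  unfolding L1w_def using assms by (intro nn_integral_cong_AE) (auto elim!: eventually_mono simp: indicator_def)

lemma L1w_finite:
  assumes "g \<in> L2w {c..d}"
  shows "L1w {c..d} g < \<infinity>"
proof -
  have m: "meas {c..d} g" "E {c..d} g < \<infinity>" using assms by (auto simp: L2w_iff)
  have "(L1w {c..d} g)\<^sup>2 \<le> E {c..d} (\<lambda>_. 1) * E {c..d} g" by (rule L1w_square_le[OF m(1)]) simp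
  also have "\<dots> < \<infinity>" using E_one_finite m by (simp add: ennreal_mult_less_top)
  finally show ?thesis by (auto simp: power2_eq_square ennreal_mult_less_top)
qed

text \<open>Under the boundary conditions, variation of constants leaves two linear equations for
  the coefficients at 0, whose determinant is 1 - D \<zeta> + \<zeta>^2. Cramer's rule bounds the
  coefficients, and hence \<open>f\<close> uniformly, by the L1 norm of the data.\<close>

lemma bvp_estimate:
  assumes \<Delta>: "1 - D l * \<zeta> + \<zeta>\<^sup>2 \<noteq> 0"
  obtains K where "K \<ge> 0" "\<And>g f h x. lin_sys {0..a} \<alpha> (\<beta> l) (\<lambda>x. W x * g x) f h \<Longrightarrow> g \<in> L2w {0..a} \<Longrightarrow>
     f a = \<zeta> * f 0 \<Longrightarrow> h a = \<zeta> * h 0 \<Longrightarrow> x \<in> {0..a} \<Longrightarrow> norm (f x) \<le> K * enn2real (L1w {0..a} g)"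
proof -
  obtain C where C: "C > 0" "\<And>x. x \<in> {0..a} \<Longrightarrow> norm (\<phi> l x) \<le> C \<and> norm (\<psi> l x) \<le> C \<and> norm (\<phi>1 l x) \<le> C \<and> norm (\<psi>1 l x) \<le> C"
    using fundamental_bounded[of 0 a l] by blast
  define \<delta> where "\<delta> = (\<phi> l a - \<zeta>) * (\<psi>1 l a - \<zeta>) - \<psi> l a * \<phi>1 l a"
  have \<delta>: "\<delta> \<noteq> 0"
  proof -
    have "\<delta> = 1 - D l * \<zeta> + \<zeta>\<^sup>2" unfolding \<delta>_def D_def using wronskian[of l a] by algebra
    with \<Delta> show ?thesis by simp
  qed
  \<comment> \<open>The right-hand sides \<open>s1\<close>, \<open>s2\<close> are at most 2 C^2
    times the L1 norm; Cramer's rule multiplies them by matrix entries bounded by C and C +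
    |\<zeta>| and divides by the determinant.\<close>
  define K0 where "K0 = 2 * C * C * (2 * C + norm \<zeta>) / norm \<delta>"
  have K0: "K0 \<ge> 0" using C by (simp add: K0_def)
  show thesis
  proof (rule that[of "2 * C * (K0 + C)"])
    show "2 * C * (K0 + C) \<ge> 0" using C K0 by simp
    fix g f h x assume s: "lin_sys {0..a} \<alpha> (\<beta> l) (\<lambda>x. W x * g x) f h" and g: "g \<in> L2w {0..a}"
      and bf: "f a = \<zeta> * f 0" and bh: "h a = \<zeta> * h 0" and x: "x \<in> {0..a}"
    define L where "L = enn2real (L1w {0..a} g)"
    have L0: "L \<ge> 0" by (simp add: L_def)
    have gm: "meas {0..a} g" using g by (simp add: L2w_iff)
    define A where "A x = f x * \<psi>1 l x - h x * \<psi> l x" for x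
    define B where "B x = f x * \<phi>1 l x - h x * \<phi> l x" for x
    note vc = variation_of_constants[OF s, folded A_def B_def]
    have Ad: "AC_deriv {0..a} A (\<lambda>x. W x * g x * \<psi> l x)" and Bd: "AC_deriv {0..a} B (\<lambda>x. W x * g x * \<phi> l x)"
      using vc(1,2) unfolding A_def[abs_def] B_def[abs_def] by simp_all
    have A0: "A 0 = f 0" "B 0 = - h 0" using fundamental(3-6)[of l] by (simp_all add: A_def B_def)
    define r1 r2 where "r1 y = A y - A 0" and "r2 y = B y - B 0" for y
    have r: "norm (r1 y) \<le> C * L" "norm (r2 y) \<le> C * L" if "y \<in> {0..a}" for y
    proof -
      have y: "0 \<le> y" "{0..y} \<subseteq> {0..a}" using that by auto
      have 1: "ennreal (norm (LINT t:{0..y}|lebesgue. W t * g t * \<psi> l t)) \<le> ennreal C * L1w {0..a} g"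
        using C y by (intro norm_set_integral_le_L1w[OF AC_derivD(1)[OF Ad y] _ y(2) _ gm]) auto
      have 2: "ennreal (norm (LINT t:{0..y}|lebesgue. W t * g t * \<phi> l t)) \<le> ennreal C * L1w {0..a} g"
        using C y by (intro norm_set_integral_le_L1w[OF AC_derivD(1)[OF Bd y] _ y(2) _ gm]) auto
      have "ennreal C * L1w {0..a} g = ennreal (C * L)"
        using L1w_finite[OF g] C(1) by (simp add: L_def ennreal_mult less_top)
      with 1 2 show "norm (r1 y) \<le> C * L" "norm (r2 y) \<le> C * L"
        unfolding AC_derivD(2)[OF Ad y] AC_derivD(2)[OF Bd y] r1_def r2_def using C(1) L0 by simp_all
    qed
    define s1 s2 where "s1 = r1 a * \<phi> l a - r2 a * \<psi> l a" and "s2 = r1 a * \<phi>1 l a - r2 a * \<psi>1 l a"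
    have aI: "a \<in> {0..a}" using a_pos by simp
    have nm: "norm (u * v) \<le> c * d" if "norm u \<le> c" "norm v \<le> d" for u v :: complex and c d
      unfolding norm_mult using that order_trans[OF norm_ge_zero that(1)] by (intro mult_mono) auto
    have nd: "norm (u - v) \<le> c + d" if "norm u \<le> c" "norm v \<le> d" for u v :: complex and c d
      using norm_triangle_ineq4[of u v] that by linarith
    have s12: "norm s1 \<le> 2 * C * C * L" "norm s2 \<le> 2 * C * C * L"
      unfolding s1_def s2_def using r[OF aI] C(2)[OF aI]
      by (auto intro!: order.trans[OF nd[OF nm nm]] simp: algebra_simps)
    have fa: "f a = A a * \<phi> l a - B a * \<psi> l a" "h a = A a * \<phi>1 l a - B a * \<psi>1 l a" using vc(3,4)[of a] unfolding A_def B_def by simp_all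
    have e1: "A 0 * (\<phi> l a - \<zeta>) - B 0 * \<psi> l a = - s1" and e2: "A 0 * \<phi>1 l a - B 0 * (\<psi>1 l a - \<zeta>) = - s2"
      using fa bf bh A0 unfolding s1_def s2_def r1_def r2_def by (simp_all add: algebra_simps)
    have cr: "A 0 * \<delta> = s2 * \<psi> l a - s1 * (\<psi>1 l a - \<zeta>)" "B 0 * \<delta> = s2 * (\<phi> l a - \<zeta>) - s1 * \<phi>1 l a"
      using e1 e2 unfolding \<delta>_def by algebra+
    have cb: "norm (A 0 * \<delta>) \<le> 2 * C * C * L * (2 * C + norm \<zeta>)" "norm (B 0 * \<delta>) \<le> 2 * C * C * L * (2 * C + norm \<zeta>)"
    proof -
      have "norm (A 0 * \<delta>) \<le> 2 * C * C * L * C + 2 * C * C * L * (C + norm \<zeta>)"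
        unfolding cr using s12 C(2)[OF aI] by (intro nd nm) auto
      then show "norm (A 0 * \<delta>) \<le> 2 * C * C * L * (2 * C + norm \<zeta>)" by (simp add: algebra_simps)
      have "norm (B 0 * \<delta>) \<le> 2 * C * C * L * (C + norm \<zeta>) + 2 * C * C * L * C"
        unfolding cr using s12 C(2)[OF aI] by (intro nd nm) auto
      then show "norm (B 0 * \<delta>) \<le> 2 * C * C * L * (2 * C + norm \<zeta>)" by (simp add: algebra_simps)
    qed
    have AB0: "norm (A 0) \<le> K0 * L" "norm (B 0) \<le> K0 * L"
      using cb \<delta> by (simp_all add: K0_def norm_mult field_simps)
    have ABx: "norm (A x) \<le> K0 * L + C * L" "norm (B x) \<le> K0 * L + C * L"
      using r[OF x] AB0 norm_triangle_ineq[of "r1 x" "A 0"] norm_triangle_ineq[of "r2 x" "B 0"] by (auto simp: r1_def r2_def)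
    have fx: "f x = A x * \<phi> l x - B x * \<psi> l x" using vc(3)[of x] unfolding A_def B_def by simp
    have "norm (f x) \<le> (K0 * L + C * L) * C + (K0 * L + C * L) * C"
      unfolding fx using ABx C(2)[OF x] by (intro nd nm) auto
    then show "norm (f x) \<le> 2 * C * (K0 + C) * enn2real (L1w {0..a} g)"
      unfolding L_def[symmetric] by (simp add: algebra_simps)
  qed
qed

lemma bvp_exists:
  assumes \<Delta>: "1 - D l * \<zeta> + \<zeta>\<^sup>2 \<noteq> 0" and g: "g \<in> L2w {0..a}"
  obtains f h where "lin_sys {0..a} \<alpha> (\<beta> l) (\<lambda>x. W x * g x) f h" "f a = \<zeta> * f 0" "h a = \<zeta> * h 0"
proof -
  \<comment> \<open>The data are extended by 0 so that the primitives from 0, defined on the whole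
    line, can be used.\<close>
  define \<gamma> where "\<gamma> x = indicator {0..a} x *\<^sub>R (W x * g x)" for x
  have \<gamma>: "loc_integrable \<gamma>"
  proof -
    have "integrable lebesgue \<gamma>"
      using set_integrable_W_mult[OF g, of 0 a] unfolding set_integrable_def \<gamma>_def by simp
    then show ?thesis unfolding loc_integrable_def set_integrable_def by (auto intro: integrable_mult_indicator)
  qed
  have i: "loc_integrable (\<lambda>x. \<gamma> x * \<psi> l x)" "loc_integrable (\<lambda>x. \<gamma> x * \<phi> l x)"
    using continuous_fundamental[of l] \<gamma> by (auto intro: loc_integrable_mult_continuous)
  define r1 r2 where "r1 = oint (\<lambda>x. \<gamma> x * \<psi> l x)" and "r2 = oint (\<lambda>x. \<gamma> x * \<phi> l x)"
  define \<delta> where "\<delta> = (\<phi> l a - \<zeta>) * (\<psi>1 l a - \<zeta>) - \<psi> l a * \<phi>1 l a"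
  have \<delta>: "\<delta> \<noteq> 0"
  proof -
    have "\<delta> = 1 - D l * \<zeta> + \<zeta>\<^sup>2" unfolding \<delta>_def D_def using wronskian[of l a] by algebra
    with \<Delta> show ?thesis by simp
  qed
  define s1 s2 where "s1 = r1 a * \<phi> l a - r2 a * \<psi> l a" and "s2 = r1 a * \<phi>1 l a - r2 a * \<psi>1 l a"
  define A0 B0 where "A0 = (s2 * \<psi> l a - s1 * (\<psi>1 l a - \<zeta>)) / \<delta>" and "B0 = (s2 * (\<phi> l a - \<zeta>) - s1 * \<phi>1 l a) / \<delta>"
  have AB0: "A0 * \<delta> = s2 * \<psi> l a - s1 * (\<psi>1 l a - \<zeta>)" "B0 * \<delta> = s2 * (\<phi> l a - \<zeta>) - s1 * \<phi>1 l a"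
    using \<delta> by (simp_all add: A0_def B0_def)
  have "AC_deriv UNIV (\<lambda>x. A0 + r1 x) (\<lambda>x. 0 + \<gamma> x * \<psi> l x)" "AC_deriv UNIV (\<lambda>x. B0 + r2 x) (\<lambda>x. 0 + \<gamma> x * \<phi> l x)"
    unfolding r1_def r2_def using i by (auto intro!: AC_deriv_add AC_deriv_const AC_deriv_oint simp del: add_0)
  then have "lin_sys UNIV \<alpha> (\<beta> l) \<gamma> (\<lambda>x. (A0 + r1 x) * \<phi> l x - (B0 + r2 x) * \<psi> l x) (\<lambda>x. (A0 + r1 x) * \<phi>1 l x - (B0 + r2 x) * \<psi>1 l x)" (is "lin_sys _ _ _ _ ?f ?h")
    by (intro variation_of_constants_conv) simp_all
  then have s: "lin_sys {0..a} \<alpha> (\<beta> l) \<gamma> ?f ?h" by (rule lin_sys_subset) simp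
  then have "lin_sys {0..a} \<alpha> (\<beta> l) (\<lambda>x. W x * g x) ?f ?h"
    unfolding lin_sys_def
    by (intro conjI AC_deriv_cong[OF conjunct1[OF s[unfolded lin_sys_def]]] AC_deriv_cong[OF conjunct2[OF s[unfolded lin_sys_def]]])
      (simp_all add: \<gamma>_def)
  moreover have "\<delta> * (?f a - \<zeta> * ?f 0) = 0" "\<delta> * (?h a - \<zeta> * ?h 0) = 0"
  proof -
    have z: "r1 0 = 0" "r2 0 = 0" by (simp_all add: r1_def r2_def)
    have "\<delta> * (?f a - \<zeta> * ?f 0) = (A0 * \<delta>) * (\<phi> l a - \<zeta>) - (B0 * \<delta>) * \<psi> l a + \<delta> * s1"
      using fundamental(3-6)[of l] z by (simp add: s1_def algebra_simps)
    also have "\<dots> = 0" unfolding AB0 unfolding \<delta>_def by algebra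
    finally show "\<delta> * (?f a - \<zeta> * ?f 0) = 0" .
    have "\<delta> * (?h a - \<zeta> * ?h 0) = (A0 * \<delta>) * \<phi>1 l a - (B0 * \<delta>) * (\<psi>1 l a - \<zeta>) + \<delta> * s2"
      using fundamental(3-6)[of l] z by (simp add: s2_def algebra_simps)
    also have "\<dots> = 0" unfolding AB0 unfolding \<delta>_def by algebra
    finally show "\<delta> * (?h a - \<zeta> * ?h 0) = 0" .
  qed
  then have "?f a = \<zeta> * ?f 0" "?h a = \<zeta> * ?h 0" using \<delta> by auto
  ultimately show thesis by (rule that)
qed

text \<open>The kernel vector of the singular matrix "monodromy minus \<zeta>" is read off from a
  nonzero row; if both rows vanish, any vector will do.\<close>

lemma floquet_eigenvector:
  assumes "1 - D l * \<zeta> + \<zeta>\<^sup>2 = 0"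
  obtains u v where "hom l u v" "u 0 \<noteq> 0 \<or> v 0 \<noteq> 0" "u a = \<zeta> * u 0" "v a = \<zeta> * v 0"
proof -
  have det: "(\<phi> l a - \<zeta>) * (\<psi>1 l a - \<zeta>) = \<psi> l a * \<phi>1 l a"
    using assms wronskian[of l a] unfolding D_def by algebra
  have "\<exists>c d. (c \<noteq> 0 \<or> d \<noteq> 0) \<and> c * (\<phi> l a - \<zeta>) + d * \<psi> l a = 0 \<and> c * \<phi>1 l a + d * (\<psi>1 l a - \<zeta>) = 0"
  proof (cases "\<psi> l a \<noteq> 0 \<or> \<phi> l a \<noteq> \<zeta>")
    case True
    then show ?thesis
      by (intro exI[of _ "\<psi> l a"] exI[of _ "- (\<phi> l a - \<zeta>)"]) (use det in \<open>auto simp: algebra_simps\<close>)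
  next
    case False
    show ?thesis
    proof (cases "\<phi>1 l a \<noteq> 0 \<or> \<psi>1 l a \<noteq> \<zeta>")
      case True
      then show ?thesis using False
        by (intro exI[of _ "\<psi>1 l a - \<zeta>"] exI[of _ "- \<phi>1 l a"]) (auto simp: algebra_simps)
    next
      case 2: False
      then show ?thesis using False by (intro exI[of _ 1] exI[of _ 0]) auto
    qed
  qed
  then obtain c d where cd: "c \<noteq> 0 \<or> d \<noteq> 0" "c * (\<phi> l a - \<zeta>) + d * \<psi> l a = 0" "c * \<phi>1 l a + d * (\<psi>1 l a - \<zeta>) = 0" by blast
  show thesis
  proof (rule that[OF hom_lincomb[OF fundamental(1,2), of l c d]])
    show "c * \<phi> l 0 + d * \<psi> l 0 \<noteq> 0 \<or> c * \<phi>1 l 0 + d * \<psi>1 l 0 \<noteq> 0" using cd fundamental(3-6)[of l] by simp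
    show "c * \<phi> l a + d * \<psi> l a = \<zeta> * (c * \<phi> l 0 + d * \<psi> l 0)" "c * \<phi>1 l a + d * \<psi>1 l a = \<zeta> * (c * \<phi>1 l 0 + d * \<psi>1 l 0)"
      using cd(2,3) fundamental(3-6)[of l] by (simp_all add: algebra_simps)
  qed
qed

lemma lin_sys_zero_AE_imp_zero:
  assumes I: "admissible_interval I" and s: "lin_sys I \<alpha> (\<beta> l) \<gamma> u v" and z: "AE x in lebesgue. x \<in> I \<longrightarrow> u x = 0" and x: "x \<in> I"
  shows "u x = 0" "v x = 0"
proof -
  have uc: "continuous_on I u" "continuous_on I v" and ud: "AC_deriv I u (\<lambda>x. \<alpha> x * v x)"
    using s AC_deriv_continuous_on[OF _ I] by (auto simp: lin_sys_def)
  have u0: "u x = 0" if "x \<in> I" for x by (rule continuous_AE_eq[OF I uc(1) continuous_on_const z that])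
  then show "u x = 0" using x by simp
  have "AC_deriv I (\<lambda>_. 0) (\<lambda>x. \<alpha> x * v x)" by (rule AC_deriv_cong[OF ud]) (auto simp: u0)
  from AC_deriv_AE[OF this I] AC_deriv_AE[OF AC_deriv_const[of I 0] I] p_pos
  have "AE x in lebesgue. x \<in> I \<longrightarrow> v x = 0"
  proof eventually_elim
    case (elim x)
    show ?case
    proof
      assume xI: "x \<in> I"
      have "\<alpha> x * v x = 0"
        using elim xI vector_derivative_within[OF admissible_interval_at_neq_bot[OF I xI]] by metis
      then show "v x = 0" using elim(3) by (auto simp: \<alpha>_def)
    qed
  qed
  then show "v x = 0" by (rule continuous_AE_eq[OF I uc(2) continuous_on_const _ x])
qed

text \<open>With \<zeta> = exp(i t) the determinant 1 - D \<zeta> + \<zeta>^2 vanishes exactly if D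
  = \<zeta> + 1/\<zeta> = 2 cos t. At a zero a quasi-periodic solution destroys injectivity;
  otherwise the boundary value problem is uniquely solvable with a bound.\<close>

lemma sigma_At_eq: "sigma_At w p q a t = {l. D l = 2 * complex_of_real (cos t)}"
proof -
  let ?\<zeta> = "exp (\<i> * of_real t)" and ?I = "{0..a}"
  let ?T = "sl_expr w p q ?I" and ?M = "weight_measure w ?I" and ?F = "floquet_dom w p q a t"
  have I: "admissible_interval ?I" using a_pos by simp
  have Is: "?I \<in> sets lebesgue" by simp
  have z: "?\<zeta> \<noteq> 0" by simp
  have cos: "2 * complex_of_real (cos t) = ?\<zeta> + 1 / ?\<zeta>"
    by (simp add: cos_of_real[symmetric] cos_exp_eq exp_minus field_simps)
  have char: "1 - D l * ?\<zeta> + ?\<zeta>\<^sup>2 = 0 \<longleftrightarrow> D l = 2 * complex_of_real (cos t)" for l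
    unfolding cos using z by (auto simp: field_simps power2_eq_square)
  have dom: "lin_sys ?I \<alpha> (\<beta> l) (\<lambda>x. W x * op_shift ?T l f x) f (quasi_deriv p ?I f) \<and> f \<in> L2w ?I \<and> op_shift ?T l f \<in> L2w ?I \<and>
     f a = ?\<zeta> * f 0 \<and> quasi_deriv p ?I f a = ?\<zeta> * quasi_deriv p ?I f 0" if "f \<in> ?F" for f l
    using that max_dom_imp(1)[OF I, of f l] max_dom_imp(2)[OF I, of f] max_dom_imp(3)[OF I, of f l] by (auto simp: floquet_dom_def)
  have intro: "f \<in> ?F \<and> (AE x in ?M. op_shift ?T l f x = g x)"
    if s: "lin_sys ?I \<alpha> (\<beta> l) (\<lambda>x. W x * g x) f h" and g: "g \<in> L2w ?I" and b: "f a = ?\<zeta> * f 0" "h a = ?\<zeta> * h 0" for f h g l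
  proof -
    have "f \<in> L2w ?I" using s I by (intro L2w_continuous AC_deriv_continuous_on) (auto simp: lin_sys_def)
    from max_dom_intro[OF I s this g] b a_pos show ?thesis
      by (auto simp: floquet_dom_def AE_weight[OF Is])
  qed
  have "l \<in> resolvent_set ?M ?F ?T \<longleftrightarrow> 1 - D l * ?\<zeta> + ?\<zeta>\<^sup>2 \<noteq> 0" for l
  proof
    assume l: "l \<in> resolvent_set ?M ?F ?T"
    show "1 - D l * ?\<zeta> + ?\<zeta>\<^sup>2 \<noteq> 0"
    proof
      assume "1 - D l * ?\<zeta> + ?\<zeta>\<^sup>2 = 0"
      then obtain u v where u: "hom l u v" "u 0 \<noteq> 0 \<or> v 0 \<noteq> 0" "u a = ?\<zeta> * u 0" "v a = ?\<zeta> * v 0"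
        using floquet_eigenvector by blast
      have zL: "(\<lambda>_. 0) \<in> L2w ?I" by (rule L2w_continuous) simp
      have us: "lin_sys ?I \<alpha> (\<beta> l) (\<lambda>_. 0) u v" using u(1) by (rule lin_sys_subset) simp
      have 1: "u \<in> ?F \<and> (AE x in ?M. op_shift ?T l u x = 0)"
        by (rule intro[of l "\<lambda>_. 0" u v]) (use us u zL in auto)
      have "lin_sys ?I \<alpha> (\<beta> l) (\<lambda>_. 0) (\<lambda>_. 0) (\<lambda>_. 0)" using AC_deriv_const[of ?I 0] by (simp add: lin_sys_def)
      then have 2: "(\<lambda>_. 0) \<in> ?F \<and> (AE x in ?M. op_shift ?T l (\<lambda>_. 0) x = 0)"
        by (intro intro[of l "\<lambda>_. 0" "\<lambda>_. 0" "\<lambda>_. 0"]) (use zL in auto)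
      have "AE x in ?M. op_shift ?T l u x = op_shift ?T l (\<lambda>_. 0) x"
        using conjunct2[OF 1] conjunct2[OF 2] by eventually_elim simp
      then have "AE x in ?M. u x = 0"
      proof -
        have "op_injective ?M ?F (op_shift ?T l)" using l by (simp add: resolvent_set_def)
        from op_injectiveD[OF this conjunct1[OF 1] conjunct1[OF 2] \<open>AE x in ?M. op_shift ?T l u x = op_shift ?T l (\<lambda>_. 0) x\<close>]
        show ?thesis .
      qed
      then have "AE x in lebesgue. x \<in> ?I \<longrightarrow> u x = 0" by (simp add: AE_weight[OF Is])
      from lin_sys_zero_AE_imp_zero[OF I us this, of 0] u(2) a_pos show False by auto
    qed
  next
    assume \<Delta>: "1 - D l * ?\<zeta> + ?\<zeta>\<^sup>2 \<noteq> 0"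
    obtain K where K: "K \<ge> 0" "\<And>g f h x. lin_sys ?I \<alpha> (\<beta> l) (\<lambda>x. W x * g x) f h \<Longrightarrow> g \<in> L2w ?I \<Longrightarrow>
     f a = ?\<zeta> * f 0 \<Longrightarrow> h a = ?\<zeta> * h 0 \<Longrightarrow> x \<in> ?I \<Longrightarrow> norm (f x) \<le> K * enn2real (L1w ?I g)"
      by (rule bvp_estimate[OF \<Delta>]) blast
    have "op_injective ?M ?F (op_shift ?T l)"
      unfolding op_injective_def
    proof (intro ballI impI)
      fix f1 f2 assume f: "f1 \<in> ?F" "f2 \<in> ?F" and eq: "AE x in ?M. op_shift ?T l f1 x = op_shift ?T l f2 x"
      let ?g = "\<lambda>x. 1 * op_shift ?T l f1 x + (-1) * op_shift ?T l f2 x"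
      have s: "lin_sys ?I \<alpha> (\<beta> l) (\<lambda>x. W x * ?g x) (\<lambda>x. 1 * f1 x + (-1) * f2 x)
         (\<lambda>x. 1 * quasi_deriv p ?I f1 x + (-1) * quasi_deriv p ?I f2 x)"
        using lin_sys_lincomb[OF conjunct1[OF dom[OF f(1), of l]] conjunct1[OF dom[OF f(2), of l]], of 1 "-1"]
        by (simp add: algebra_simps)
      have gL: "?g \<in> L2w ?I" using dom[OF f(1), of l] dom[OF f(2), of l] by (intro L2w_lincomb[OF Is]) auto
      have ae: "AE x in lebesgue. x \<in> ?I \<longrightarrow> ?g x = 0" using eq unfolding AE_weight[OF Is] by eventually_elim auto
      have L: "L1w ?I ?g = 0" using L1w_cong_AE[OF ae] by (simp add: L1w_def)
      have "f1 x = f2 x" if "x \<in> ?I" for x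
      proof -
        have "norm (1 * f1 x + (-1) * f2 x) \<le> K * enn2real (L1w ?I ?g)"
          by (rule K(2)[OF s gL _ _ that]) (use dom[OF f(1), of l] dom[OF f(2), of l] in \<open>auto simp: algebra_simps\<close>)
        then show ?thesis unfolding L by simp
      qed
      then show "AE x in ?M. f1 x = f2 x" by (simp add: AE_weight[OF Is])
    qed
    moreover have "op_surjective ?M ?F (op_shift ?T l)"
      unfolding op_surjective_def
    proof
      fix g assume g: "g \<in> L2w ?I"
      obtain f h where "lin_sys ?I \<alpha> (\<beta> l) (\<lambda>x. W x * g x) f h" "f a = ?\<zeta> * f 0" "h a = ?\<zeta> * h 0"
        using bvp_exists[OF \<Delta> g] by blast
      from intro[OF this(1) g this(2,3)] show "\<exists>f\<in>?F. AE x in ?M. op_shift ?T l f x = g x" by blast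
    qed
    moreover have "op_bounded_inverse ?M ?F (op_shift ?T l)"
    proof -
      \<comment> \<open>\<open>e1\<close> is the square root of the mass of |w| over a period. It
        enters twice: from L2 to L1 for the data, and from the uniform bound back to L2 for the
        solution.\<close>
      define e1 where "e1 = sqrt (enn2real (E ?I (\<lambda>_. 1)))"
      show ?thesis unfolding op_bounded_inverse_def
      proof (intro exI[of _ "K * e1 * e1"] ballI)
        fix f assume f: "f \<in> ?F"
        let ?g = "op_shift ?T l f"
        note d = dom[OF f, of l]
        have gm: "meas ?I ?g" "E ?I ?g < \<infinity>" and fm: "meas ?I f" using d by (auto simp: L2w_iff)
        have L: "enn2real (L1w ?I ?g) \<le> e1 * sqrt (enn2real (E ?I ?g))"
        proof -
          have "(L1w ?I ?g)\<^sup>2 \<le> E ?I (\<lambda>_. 1) * E ?I ?g" by (rule L1w_square_le[OF gm(1)]) simp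
          then have "enn2real ((L1w ?I ?g)\<^sup>2) \<le> enn2real (E ?I (\<lambda>_. 1) * E ?I ?g)"
            using E_one_finite gm(2) by (intro enn2real_mono) (auto simp: ennreal_mult_less_top)
          then have "(enn2real (L1w ?I ?g))\<^sup>2 \<le> enn2real (E ?I (\<lambda>_. 1)) * enn2real (E ?I ?g)"
            by (simp add: enn2real_mult power2_eq_square)
          then have "sqrt ((enn2real (L1w ?I ?g))\<^sup>2) \<le> sqrt (enn2real (E ?I (\<lambda>_. 1)) * enn2real (E ?I ?g))"
            by (rule real_sqrt_le_mono)
          then show ?thesis by (simp add: e1_def real_sqrt_mult)
        qed
        define B where "B = K * (e1 * sqrt (enn2real (E ?I ?g)))"
        have B0: "B \<ge> 0" using K(1) by (simp add: B_def e1_def)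
        have fB: "norm (f x) \<le> B" if "x \<in> ?I" for x
        proof -
          have "norm (f x) \<le> K * enn2real (L1w ?I ?g)" using K(2)[of ?g f "quasi_deriv p ?I f" x] d that by blast
          also have "\<dots> \<le> B" unfolding B_def using L K(1) by (intro mult_left_mono)
          finally show ?thesis .
        qed
        have "E ?I f \<le> ennreal (B\<^sup>2) * E ?I (\<lambda>_. 1)" by (rule E_bounded[OF fB]) auto
        then have "enn2real (E ?I f) \<le> enn2real (ennreal (B\<^sup>2) * E ?I (\<lambda>_. 1))"
          using E_one_finite by (intro enn2real_mono) (auto simp: ennreal_mult_less_top)
        also have "\<dots> = B\<^sup>2 * enn2real (E ?I (\<lambda>_. 1))" by (simp add: enn2real_mult)
        finally have "sqrt (enn2real (E ?I f)) \<le> sqrt (B\<^sup>2 * enn2real (E ?I (\<lambda>_. 1)))" by (rule real_sqrt_le_mono)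
        also have "\<dots> = B * e1" using B0 by (simp add: real_sqrt_mult e1_def)
        finally show "L2_norm ?M f \<le> K * e1 * e1 * L2_norm ?M ?g"
          unfolding L2_norm_E[OF Is fm] L2_norm_E[OF Is gm(1)] B_def by (simp add: mult_ac)
      qed
    qed
    ultimately show "l \<in> resolvent_set ?M ?F ?T" by (simp add: resolvent_set_def)
  qed
  then show ?thesis
    unfolding sigma_At_def op_spectrum_def using char by blast
qed

end

section \<open>Square integrable solutions\<close>

lemma periodic_int:
  fixes F :: "real \<Rightarrow> 'a"
  assumes "\<And>x. F (x + a) = F x"
  shows "F (x + of_int n * a) = F x"
proof -
  have nat: "F (x + real n * a) = F x" for x and n :: nat
  proof (induction n)
    case (Suc n)
    then show ?case using assms[of "x + real n * a"] by (simp add: algebra_simps)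
  qed simp
  show ?thesis
  proof (cases "n \<ge> 0")
    case True
    then show ?thesis using nat[of x "nat n"] by simp
  next
    case False
    then show ?thesis using nat[of "x + of_int n * a" "nat (- n)"] by simp
  qed
qed

lemma periodic_continuous_bounded:
  fixes F :: "real \<Rightarrow> real"
  assumes a: "a > 0" and per: "\<And>x. F (x + a) = F x" and c: "continuous_on UNIV F"
  obtains C where "C > 0" "\<And>x. F x \<le> C"
proof -
  have "bounded (F ` {0..a})"
    using continuous_on_subset[OF c] by (intro compact_imp_bounded compact_continuous_image) auto
  then obtain C where "\<forall>y\<in>F ` {0..a}. norm y \<le> C" unfolding bounded_iff by blast
  then have C: "\<And>x. x \<in> {0..a} \<Longrightarrow> norm (F x) \<le> C" by blast
  show thesis
  proof (rule that[of "\<bar>C\<bar> + 1"])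
    fix x
    define y where "y = x - of_int \<lfloor>x / a\<rfloor> * a"
    have "of_int \<lfloor>x / a\<rfloor> \<le> x / a" "x / a < of_int \<lfloor>x / a\<rfloor> + 1" by linarith+
    then have "of_int \<lfloor>x / a\<rfloor> * a \<le> x" "x < (of_int \<lfloor>x / a\<rfloor> + 1) * a" using a by (simp_all only: pos_le_divide_eq pos_divide_less_eq)
    then have y: "y \<in> {0..a}" by (auto simp: y_def algebra_simps)
    have "F x = F y" using periodic_int[of F a y "\<lfloor>x / a\<rfloor>", OF per] by (simp add: y_def)
    then show "F x \<le> \<bar>C\<bar> + 1" using C[OF y] by auto
  qed simp
qed

lemma exists_multiplier:
  fixes D :: complex
  obtains \<rho> where "\<rho> \<noteq> 0" "\<rho> + 1 / \<rho> = D"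
proof -
  define \<rho> where "\<rho> = (D + csqrt (D\<^sup>2 - 4)) / 2"
  have "4 * (\<rho> * (D - \<rho>)) = D\<^sup>2 - (csqrt (D\<^sup>2 - 4))\<^sup>2"
    unfolding \<rho>_def by (simp add: field_simps power2_eq_square)
  then have r: "\<rho> * (D - \<rho>) = 1" by (simp only: power2_csqrt) simp
  then have "\<rho> \<noteq> 0" by auto
  then show thesis using r by (intro that) (auto simp: field_simps)
qed

lemma multiplier_norm:
  fixes \<rho> :: complex
  assumes "norm \<rho> = 1"
  shows "\<rho> + 1 / \<rho> \<in> complex_of_real ` {-2..2}"
proof -
  have "1 / \<rho> = cnj \<rho>"
  proof -
    have "\<rho> * cnj \<rho> = 1" using complex_norm_square[of \<rho>] assms by simp
    moreover have "\<rho> \<noteq> 0" using assms by auto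
    ultimately show ?thesis by (simp add: field_simps)
  qed
  then have "\<rho> + 1 / \<rho> = complex_of_real (2 * Re \<rho>)" by (simp add: complex_add_cnj)
  moreover have "\<bar>Re \<rho>\<bar> \<le> 1" using abs_Re_le_cmod[of \<rho>] assms by simp
  ultimately show ?thesis by (intro image_eqI[of _ _ "2 * Re \<rho>"]) auto
qed

lemma multiplier_norm_conv:
  fixes \<rho> :: complex
  assumes "\<rho> \<noteq> 0" "\<rho> + 1 / \<rho> = complex_of_real s" "s \<in> {-2..2}"
  shows "norm \<rho> = 1"
proof -
  define t where "t = arccos (s / 2)"
  have c: "cos t = s / 2" unfolding t_def using assms(3) by (intro cos_arccos) auto
  define \<zeta> where "\<zeta> = cis t"
  have "\<zeta> * \<zeta> + 1 = complex_of_real s * \<zeta>"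
  proof -
    have "complex_of_real s = \<zeta> + cnj \<zeta>" using c by (simp add: complex_eq_iff \<zeta>_def)
    moreover have "\<zeta> * cnj \<zeta> = 1" by (simp add: \<zeta>_def cis_cnj cis_mult)
    ultimately show ?thesis by (simp add: algebra_simps)
  qed
  moreover have "\<rho> * \<rho> + 1 = complex_of_real s * \<rho>" using assms(1,2) by (simp add: field_simps)
  \<comment> \<open>The quadratic with coefficient s has the roots \<zeta> and 1/\<zeta>, both on
    the unit circle, and \<rho> must be one of them.\<close>
  ultimately have "(\<rho> - \<zeta>) * (\<rho> * \<zeta> - 1) = 0" by algebra
  then have "\<rho> = \<zeta> \<or> \<rho> * \<zeta> = 1" by simp
  then show ?thesis
  proof
    assume "\<rho> * \<zeta> = 1"
    then have "norm \<rho> * norm \<zeta> = 1" by (metis norm_mult norm_one)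
    then show ?thesis by (simp add: \<zeta>_def)
  qed (simp add: \<zeta>_def)
qed

context sl_periodic
begin

lemma floquet_solution:
  assumes "\<zeta> \<noteq> 0" "\<zeta> + 1 / \<zeta> = D l"
  obtains u v where "hom l u v" "u 0 \<noteq> 0 \<or> v 0 \<noteq> 0" "\<And>x. u (x + a) = \<zeta> * u x" "\<And>x. v (x + a) = \<zeta> * v x"
proof -
  have "1 - D l * \<zeta> + \<zeta>\<^sup>2 = 0"
    unfolding assms(2)[symmetric] using assms(1) by (simp add: field_simps power2_eq_square)
  then obtain u v where u: "hom l u v" "u 0 \<noteq> 0 \<or> v 0 \<noteq> 0" "u a = \<zeta> * u 0" "v a = \<zeta> * v 0"
    using floquet_eigenvector by blast
  have h1: "hom l (\<lambda>x. u (x + a)) (\<lambda>x. v (x + a))" using lin_sys_translate[OF u(1)] by simp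
  have h2: "hom l (\<lambda>x. \<zeta> * u x + 0 * u x) (\<lambda>x. \<zeta> * v x + 0 * v x)" by (rule hom_lincomb[OF u(1) u(1)])
  have "(\<lambda>x. u (x + a)) = (\<lambda>x. \<zeta> * u x + 0 * u x)" "(\<lambda>x. v (x + a)) = (\<lambda>x. \<zeta> * v x + 0 * v x)"
    by (rule hom_unique[OF h1 h2]; use u in simp)+
  then show thesis using u by (intro that[of u v]) (auto simp: fun_eq_iff)
qed

text \<open>Both sides satisfy the recursion of the three-term relation in n; the factor is twice a
  Chebyshev polynomial in D/2. The identity holds for every solution, whether or not the monodromy
  matrix is diagonalizable.\<close>

lemma hom_chebyshev:
  assumes u: "hom l u v" and \<rho>: "\<rho> \<noteq> 0" "\<rho> + 1 / \<rho> = D l"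
  shows "u (x + real n * a) + u (x - real n * a) = (\<rho> ^ n + (1 / \<rho>) ^ n) * u x"
proof -
  let ?c = "\<lambda>n. \<rho> ^ n + (1 / \<rho>) ^ n"
  have t: "u (y + a) + u (y - a) = D l * u y" for y
    using hom_three_term(1)[OF u, of "y - a"] by (simp add: algebra_simps)
  have c: "?c (Suc (Suc n)) = D l * ?c (Suc n) - ?c n" for n
  proof -
    define \<sigma> where "\<sigma> = 1 / \<rho>"
    have "\<rho> * \<sigma> = 1" using \<rho>(1) by (simp add: \<sigma>_def)
    then have "\<rho> * (\<rho> * X) + \<sigma> * (\<sigma> * Y) = (\<rho> + \<sigma>) * (\<rho> * X + \<sigma> * Y) - (X + Y)" for X Y
      by algebra
    then have "\<rho> ^ Suc (Suc n) + \<sigma> ^ Suc (Suc n) = (\<rho> + \<sigma>) * (\<rho> ^ Suc n + \<sigma> ^ Suc n) - (\<rho> ^ n + \<sigma> ^ n)"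
      unfolding power_Suc .
    then show ?thesis using \<rho>(2) by (simp add: \<sigma>_def)
  qed
  show ?thesis
  proof (induction n rule: induct_nat_012)
    case (ge2 n)
    have "u (x + real (Suc (Suc n)) * a) = D l * u (x + real (Suc n) * a) - u (x + real n * a)"
      using t[of "x + real (Suc n) * a"] by (simp add: algebra_simps)
    moreover have "u (x - real (Suc (Suc n)) * a) = D l * u (x - real (Suc n) * a) - u (x - real n * a)"
      using t[of "x - real (Suc n) * a"] by (simp add: algebra_simps)
    ultimately have "u (x + real (Suc (Suc n)) * a) + u (x - real (Suc (Suc n)) * a) =
       D l * (u (x + real (Suc n) * a) + u (x - real (Suc n) * a)) - (u (x + real n * a) + u (x - real n * a))"
      by (simp add: algebra_simps)
    then show ?case unfolding ge2 c by (simp add: algebra_simps)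
  qed (use t[of x] \<rho> in auto)
qed

lemma sum_E_disjoint_le:
  assumes "finite S" and m: "\<And>n. n \<in> S \<Longrightarrow> A n \<in> sets lebesgue" and d: "disjoint_family_on A S" and f: "meas UNIV f"
  shows "(\<Sum>n\<in>S. E (A n) f) \<le> E UNIV f"
proof -
  have mf: "(\<lambda>x. \<bar>w x\<bar> * (norm (f x))\<^sup>2) \<in> borel_measurable lebesgue" using meas_weight[OF f] by simp
  have "(\<Sum>n\<in>S. E (A n) f) = (\<integral>\<^sup>+x. (\<Sum>n\<in>S. ennreal (indicator (A n) x * (\<bar>w x\<bar> * (norm (f x))\<^sup>2))) \<partial>lebesgue)"
    unfolding E_def using m mf by (intro nn_integral_sum[symmetric]) auto
  also have "\<dots> \<le> E UNIV f"
    unfolding E_def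
  proof (rule nn_integral_mono)
    fix x
    have "(\<Sum>n\<in>S. indicator (A n) x :: real) = indicator (\<Union>n\<in>S. A n) x"
      using assms(1) d by (subst indicator_UN_disjoint) auto
    also have "\<dots> \<le> 1" by (simp add: indicator_def)
    finally have le: "(\<Sum>n\<in>S. indicator (A n) x :: real) \<le> 1" .
    have "(\<Sum>n\<in>S. ennreal (indicator (A n) x * (\<bar>w x\<bar> * (norm (f x))\<^sup>2))) = ennreal ((\<Sum>n\<in>S. indicator (A n) x) * (\<bar>w x\<bar> * (norm (f x))\<^sup>2))"
      by (simp add: sum_ennreal sum_distrib_right)
    also have "\<dots> \<le> ennreal (indicator UNIV x * (\<bar>w x\<bar> * (norm (f x))\<^sup>2))"
      using le by (intro ennreal_leI mult_right_mono) auto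
    finally show "(\<Sum>n\<in>S. ennreal (indicator (A n) x * (\<bar>w x\<bar> * (norm (f x))\<^sup>2))) \<le> ennreal (indicator UNIV x * (\<bar>w x\<bar> * (norm (f x))\<^sup>2))" .
  qed
  finally show ?thesis .
qed

text \<open>If c_m is the factor with exponent m, then c_(2m) = c_m^2 - 2, so |c_m| < 1 implies
  |c_(2m)| \<ge> 1: one of m and 2m always qualifies.\<close>

lemma infinite_chebyshev_large:
  fixes \<rho> :: complex
  assumes "\<rho> \<noteq> 0"
  shows "infinite {n. norm (\<rho> ^ n + (1 / \<rho>) ^ n) \<ge> 1}"
  unfolding infinite_nat_iff_unbounded_le
proof
  fix m :: nat
  let ?c = "\<lambda>n. \<rho> ^ n + (1 / \<rho>) ^ n"
  show "\<exists>n\<ge>m. n \<in> {n. norm (?c n) \<ge> 1}"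
  proof (cases "norm (?c m) \<ge> 1")
    case False
    have "?c (2 * m) = (?c m)\<^sup>2 - 2"
    proof -
      have "\<rho> ^ m * (1 / \<rho>) ^ m = 1" using assms by (simp add: power_mult_distrib[symmetric])
      moreover have "X\<^sup>2 + Y\<^sup>2 = (X + Y)\<^sup>2 - 2" if "X * Y = 1" for X Y :: complex using that by algebra
      ultimately show ?thesis unfolding power_even_eq by blast
    qed
    moreover have "norm ((?c m)\<^sup>2) \<le> 1" using False by (simp add: norm_power power_le_one)
    moreover have "norm ((?c m)\<^sup>2 - 2) \<ge> norm (2::complex) - norm ((?c m)\<^sup>2)"
      by (metis norm_minus_commute norm_triangle_ineq2)
    ultimately have "norm (?c (2 * m)) \<ge> 1" by simp
    then show ?thesis by (intro exI[of _ "2 * m"]) auto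
  qed auto
qed

lemma hom_E_cell_zero:
  assumes u: "hom l u v" and m: "meas {0..<a} u" and z: "E {0..<a} u = 0"
  shows "u 0 = 0 \<and> v 0 = 0"
proof -
  have "AE x in lebesgue. ennreal (indicator {0..<a} x * (\<bar>w x\<bar> * (norm (u x))\<^sup>2)) = 0"
    using z meas_weight[OF m] unfolding E_def by (subst (asm) nn_integral_0_iff_AE) auto
  moreover have "AE x in lebesgue. x \<notin> {a}" by (intro AE_not_in negligible_iff_null_sets[THEN iffD1]) auto
  ultimately have "AE x in lebesgue. x \<in> {0..a} \<longrightarrow> u x = 0"
    using w_nz
  proof eventually_elim
    case (elim x)
    then show ?case by (auto simp: ennreal_eq_0_iff mult_le_0_iff indicator_def)
  qed
  from lin_sys_zero_AE_imp_zero[OF admissible_interval_Icc[OF a_pos] lin_sys_subset[OF u] this, of 0] a_pos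
  show ?thesis by auto
qed

text \<open>Whenever |c_n| \<ge> 1, the energy of \<open>u\<close> on the base cell is at most twice
  its energy on the cells n and -n together. Infinitely many such n with disjoint cells would make
  the total energy infinite unless \<open>u\<close> vanishes on the base cell.\<close>

lemma hom_L2_imp_zero:
  assumes u: "hom l u v" and L: "u \<in> L2w UNIV"
  shows "u x = 0" "v x = 0"
proof -
  obtain \<rho> where \<rho>: "\<rho> \<noteq> 0" "\<rho> + 1 / \<rho> = D l" by (rule exists_multiplier)
  let ?c = "\<lambda>n. \<rho> ^ n + (1 / \<rho>) ^ n"
  let ?I = "{0..<a}"
  have um: "meas UNIV u" "E UNIV u < \<infinity>" using L by (auto simp: L2w_iff)
  have mI: "meas J u" if "J \<in> sets lebesgue" for J using um(1) that by (auto intro: meas_subset)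
  have step: "E ?I u \<le> 2 * E {real n * a..<real (Suc n) * a} u + 2 * E {- (real n * a)..<a - real n * a} u" if n: "norm (?c n) \<ge> 1" for n
  proof -
    have t1: "E ?I (\<lambda>x. u (x + real n * a)) = E {real n * a..<real (Suc n) * a} u"
      "meas ?I (\<lambda>x. u (x + real n * a))"
    proof -
      have v: "(\<lambda>x. x + real n * a) -` {real n * a..<real (Suc n) * a} = ?I" by (auto simp: algebra_simps)
      show "E ?I (\<lambda>x. u (x + real n * a)) = E {real n * a..<real (Suc n) * a} u"
        using E_translate[OF mI, of "{real n * a..<real (Suc n) * a}" "real n * a"] w_translate_nat unfolding v by simp
      show "meas ?I (\<lambda>x. u (x + real n * a))"
        using meas_translate[OF mI, of "{real n * a..<real (Suc n) * a}" "real n * a"] unfolding v by simp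
    qed
    have t2: "E ?I (\<lambda>x. u (x - real n * a)) = E {- (real n * a)..<a - real n * a} u"
      "meas ?I (\<lambda>x. u (x - real n * a))"
    proof -
      have v: "(\<lambda>x. x + - (real n * a)) -` {- (real n * a)..<a - real n * a} = ?I" by auto
      show "E ?I (\<lambda>x. u (x - real n * a)) = E {- (real n * a)..<a - real n * a} u"
        using E_translate[OF mI, of "{- (real n * a)..<a - real n * a}" "- (real n * a)"] w_translate_nat_minus unfolding v by simp
      show "meas ?I (\<lambda>x. u (x - real n * a))"
        using meas_translate[OF mI, of "{- (real n * a)..<a - real n * a}" "- (real n * a)"] unfolding v by simp
    qed
    have "E ?I u \<le> E ?I (\<lambda>x. ?c n * u x)"
      unfolding E_def
    proof (intro nn_integral_mono ennreal_leI mult_left_mono)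
      fix x
      have "1 * norm (u x) \<le> norm (?c n) * norm (u x)" using n by (intro mult_right_mono) auto
      then have "norm (u x) \<le> norm (?c n * u x)" by (simp add: norm_mult)
      then show "(norm (u x))\<^sup>2 \<le> (norm (?c n * u x))\<^sup>2" by (intro power_mono) auto
    qed auto
    also have "\<dots> = E ?I (\<lambda>x. 1 * u (x + real n * a) + 1 * u (x - real n * a))"
      using hom_chebyshev[OF u \<rho>, of _ n] by simp
    also have "\<dots> \<le> 2 * E ?I (\<lambda>x. u (x + real n * a)) + 2 * E ?I (\<lambda>x. u (x - real n * a))"
      using E_lincomb[OF t1(2) t2(2), of 1 1] by simp
    finally show ?thesis unfolding t1(1) t2(1) .
  qed
  have "E ?I u = 0"
  proof (rule ccontr)
    assume "E ?I u \<noteq> 0"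
    moreover have "E ?I u < \<infinity>" using E_mono[of ?I UNIV u] um(2) by (auto simp: le_less_trans)
    ultimately have e: "enn2real (E ?I u) > 0" by (simp add: enn2real_positive_iff zero_less_iff_neq_zero)
    have fin: "card S * enn2real (E ?I u) \<le> 4 * enn2real (E UNIV u)" if S: "finite S" "S \<subseteq> {n. norm (?c n) \<ge> 1}" for S
    proof -
      have "of_nat (card S) * E ?I u = (\<Sum>n\<in>S. E ?I u)" by simp
      also have "\<dots> \<le> (\<Sum>n\<in>S. 2 * E {real n * a..<real (Suc n) * a} u + 2 * E {- (real n * a)..<a - real n * a} u)"
        using S step by (intro sum_mono) auto
      also have "\<dots> = 2 * (\<Sum>n\<in>S. E {real n * a..<real (Suc n) * a} u) + 2 * (\<Sum>n\<in>S. E {- (real n * a)..<a - real n * a} u)"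
        by (simp add: sum.distrib sum_distrib_left)
      also have "\<dots> \<le> 2 * E UNIV u + 2 * E UNIV u"
      proof (intro add_mono mult_left_mono sum_E_disjoint_le S(1) um(1))
        have lt: "real (Suc i) * a \<le> real j * a" if "i < j" for i j :: nat
          using that a_pos by (intro mult_right_mono) auto
        show "disjoint_family_on (\<lambda>n. {real n * a..<real (Suc n) * a}) S"
          unfolding disjoint_family_on_def
        proof (intro ballI impI)
          fix i j :: nat assume "i \<noteq> j"
          then consider "i < j" | "j < i" by linarith
          then show "{real i * a..<real (Suc i) * a} \<inter> {real j * a..<real (Suc j) * a} = {}"
            by cases (use lt[of i j] lt[of j i] in auto)
        qed
        show "disjoint_family_on (\<lambda>n. {- (real n * a)..<a - real n * a}) S"
          unfolding disjoint_family_on_def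
        proof (intro ballI impI)
          fix i j :: nat assume "i \<noteq> j"
          then consider "i < j" | "j < i" by linarith
          then show "{- (real i * a)..<a - real i * a} \<inter> {- (real j * a)..<a - real j * a} = {}"
            by cases (use lt[of i j] lt[of j i] in \<open>auto simp: algebra_simps\<close>)
        qed
      qed auto
      finally have "of_nat (card S) * E ?I u \<le> 4 * E UNIV u" by (simp add: distrib_right[symmetric])
      then have "enn2real (of_nat (card S) * E ?I u) \<le> enn2real (4 * E UNIV u)"
        using um(2) by (intro enn2real_mono) (auto simp: ennreal_mult_less_top)
      then show ?thesis by (simp add: enn2real_mult)
    qed
    obtain N :: nat where N: "4 * enn2real (E UNIV u) / enn2real (E ?I u) < real N" using reals_Archimedean2 by blast
    obtain S where S: "finite S" "card S = N" "S \<subseteq> {n. norm (?c n) \<ge> 1}"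
      using infinite_arbitrarily_large[OF infinite_chebyshev_large[OF \<rho>(1)], of N] by auto
    show False using fin[OF S(1,3)] N e S(2) by (simp add: field_simps)
  qed
  with hom_E_cell_zero[OF u mI] have "u 0 = 0" "v 0 = 0" by auto
  with hom_rep[OF u, of x] show "u x = 0" "v x = 0" by auto
qed

lemma op_injective_max: "op_injective (weight_measure w UNIV) (sl_max_dom w p q UNIV) (op_shift (sl_expr w p q UNIV) l)"
  unfolding op_injective_def
proof (intro ballI impI)
  let ?T = "sl_expr w p q UNIV"
  fix f1 f2 assume f: "f1 \<in> sl_max_dom w p q UNIV" "f2 \<in> sl_max_dom w p q UNIV"
    and eq: "AE x in weight_measure w UNIV. op_shift ?T l f1 x = op_shift ?T l f2 x"
  let ?u = "\<lambda>x. 1 * f1 x + (-1) * f2 x" and ?v = "\<lambda>x. 1 * quasi_deriv p UNIV f1 x + (-1) * quasi_deriv p UNIV f2 x"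
  have s: "lin_sys UNIV \<alpha> (\<beta> l) (\<lambda>x. 1 * (W x * op_shift ?T l f1 x) + (-1) * (W x * op_shift ?T l f2 x)) ?u ?v"
    using f by (intro lin_sys_lincomb max_dom_imp) auto
  have "AE x in lebesgue. x \<in> UNIV \<longrightarrow> \<beta> l x * ?u x - (1 * (W x * op_shift ?T l f1 x) + (-1) * (W x * op_shift ?T l f2 x)) = \<beta> l x * ?u x - 0"
  proof -
    have "AE x in lebesgue. x \<in> UNIV \<longrightarrow> op_shift ?T l f1 x = op_shift ?T l f2 x" using eq AE_weight[of UNIV] by simp
    then show ?thesis by eventually_elim auto
  qed
  from AC_deriv_cong_AE[OF conjunct2[OF s[unfolded lin_sys_def]] this refl] s
  have "hom l ?u ?v" unfolding lin_sys_def by blast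
  moreover have "?u \<in> L2w UNIV" using f by (intro L2w_lincomb max_dom_imp) auto
  ultimately have "?u x = 0" for x by (rule hom_L2_imp_zero(1))
  then show "AE x in weight_measure w UNIV. f1 x = f2 x" by simp
qed

end

section \<open>The resolvent\<close>

lemma set_integral_AE_eq_set:
  fixes f :: "real \<Rightarrow> 'a::{banach,second_countable_topology}"
  assumes "set_integrable lebesgue A f" "set_integrable lebesgue B f" "AE t in lebesgue. t \<in> A \<longleftrightarrow> t \<in> B"
  shows "(LINT t:A|lebesgue. f t) = (LINT t:B|lebesgue. f t)"
  using assms unfolding set_lebesgue_integral_def set_integrable_def
  by (intro integral_cong_AE) (auto elim!: eventually_mono simp: indicator_def)

lemma AC_deriv_left_tail:
  assumes f: "\<And>x. set_integrable lebesgue {..x} f"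
  shows "AC_deriv UNIV (\<lambda>x. LINT t:{..x}|lebesgue. f t) f"
  unfolding AC_deriv_def
proof (intro allI impI)
  fix x y :: real assume xy: "x \<le> y \<and> {x..y} \<subseteq> UNIV"
  have i: "set_integrable lebesgue {x<..y} f" "set_integrable lebesgue {x..y} f"
    by (auto intro: set_integrable_subset[OF f[of y]])
  have un: "{..y} = {..x} \<union> {x<..y}" using xy by auto
  have "(LINT t:{..y}|lebesgue. f t) = (LINT t:{..x}|lebesgue. f t) + (LINT t:{x<..y}|lebesgue. f t)"
    unfolding un by (rule set_integral_Un) (use f i in auto)
  moreover have "AE t in lebesgue. t \<notin> {x}" by (intro AE_not_in negligible_iff_null_sets[THEN iffD1]) auto
  then have "AE t in lebesgue. t \<in> {x<..y} \<longleftrightarrow> t \<in> {x..y}" by eventually_elim auto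
  then have "(LINT t:{x<..y}|lebesgue. f t) = (LINT t:{x..y}|lebesgue. f t)" by (rule set_integral_AE_eq_set[OF i])
  ultimately show "set_integrable lebesgue {x..y} f \<and> (LINT t:{x..y}|lebesgue. f t) = (LINT t:{..y}|lebesgue. f t) - (LINT t:{..x}|lebesgue. f t)"
    using i by simp
qed

lemma AC_deriv_right_tail:
  assumes f: "\<And>x. set_integrable lebesgue {x..} f"
  shows "AC_deriv UNIV (\<lambda>x. LINT t:{x..}|lebesgue. f t) (\<lambda>x. (-1) * f x)"
  unfolding AC_deriv_def
proof (intro allI impI)
  fix x y :: real assume xy: "x \<le> y \<and> {x..y} \<subseteq> UNIV"
  have i: "set_integrable lebesgue {x..<y} f" "set_integrable lebesgue {x..y} f"
    by (auto intro: set_integrable_subset[OF f[of x]])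
  have un: "{x..} = {x..<y} \<union> {y..}" using xy by auto
  have "(LINT t:{x..}|lebesgue. f t) = (LINT t:{x..<y}|lebesgue. f t) + (LINT t:{y..}|lebesgue. f t)"
    unfolding un by (rule set_integral_Un) (use f i in auto)
  moreover have "AE t in lebesgue. t \<notin> {y}" by (intro AE_not_in negligible_iff_null_sets[THEN iffD1]) auto
  then have "AE t in lebesgue. t \<in> {x..<y} \<longleftrightarrow> t \<in> {x..y}" by eventually_elim auto
  then have "(LINT t:{x..<y}|lebesgue. f t) = (LINT t:{x..y}|lebesgue. f t)" by (rule set_integral_AE_eq_set[OF i])
  moreover have "set_integrable lebesgue {x..y} (\<lambda>x. (-1) * f x)" using i by (intro set_integrable_mult_right) auto
  ultimately show "set_integrable lebesgue {x..y} (\<lambda>x. (-1) * f x) \<and>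
      (LINT t:{x..y}|lebesgue. (-1) * f t) = (LINT t:{y..}|lebesgue. f t) - (LINT t:{x..}|lebesgue. f t)"
    using i by (subst set_integral_mult_right) auto
qed

context sl_periodic
begin

text \<open>A shift by a multiple of the period moves the window into [0, 2a], which makes the bound
  independent of s.\<close>

lemma E_window_le: "E {s..s + a} (\<lambda>_. 1) \<le> E {0..2 * a} (\<lambda>_. 1)"
proof -
  define k where "k = \<lfloor>s / a\<rfloor>"
  have "of_int k \<le> s / a" "s / a < of_int k + 1" unfolding k_def by linarith+
  then have "of_int k * a \<le> s" "s < (of_int k + 1) * a" using a_pos by (simp_all only: pos_le_divide_eq pos_divide_less_eq)
  then have r: "0 \<le> s - of_int k * a" "s - of_int k * a \<le> a" by (auto simp: algebra_simps)
  have "(\<lambda>x. x + of_int k * a) -` {s..s + a} = {s - of_int k * a..s - of_int k * a + a}" by auto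
  moreover have "meas {s..s + a} (\<lambda>_. 1)" by (rule meas_continuous) simp
  ultimately have "E {s..s + a} (\<lambda>_. 1) = E {s - of_int k * a..s - of_int k * a + a} (\<lambda>_. 1)"
    using E_translate[of "{s..s + a}" "\<lambda>_. 1" "of_int k * a"] periodic_int[of w a, OF w_per] by simp
  also have "\<dots> \<le> E {0..2 * a} (\<lambda>_. 1)" using r by (intro E_mono) auto
  finally show ?thesis .
qed

text \<open>The hypothesis of the Schur test for the kernel exp(-\<eta> |x - y|) and the measure |w|
  dy. Cells at distance n a on either side of x contribute q^n times a uniform mass, and the
  geometric series converges.\<close>

lemma kernel_bound:
  assumes \<eta>: "\<eta> > 0"
  obtains K where "K \<ge> 0" "\<And>x. (\<integral>\<^sup>+y. ennreal (exp (- \<eta> * \<bar>x - y\<bar>) * \<bar>w y\<bar>) \<partial>lebesgue) \<le> ennreal K"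
proof -
  define q where "q = exp (- \<eta> * a)"
  have q: "0 < q" "q < 1" using \<eta> a_pos by (auto simp: q_def)
  define e where "e = enn2real (E {0..2 * a} (\<lambda>_. 1))"
  have e: "E {0..2 * a} (\<lambda>_. 1) = ennreal e" using E_one_finite[of 0 "2 * a"] by (simp add: e_def)
  have e0: "e \<ge> 0" by (simp add: e_def)
  have S: "(\<lambda>n. q ^ n * (2 * e)) sums (1 / (1 - q) * (2 * e))"
    using q by (intro sums_mult2 geometric_sums) auto
  show thesis
  proof (rule that[of "1 / (1 - q) * (2 * e)"])
    show "0 \<le> 1 / (1 - q) * (2 * e)" using q e0 by simp
    fix x
    let ?I = "\<lambda>n::nat. {x + real n * a..x + real n * a + a}" and ?J = "\<lambda>n::nat. {x - real n * a - a..x - real n * a - a + a}"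
    let ?t = "\<lambda>I y. ennreal (indicator I y * (\<bar>w y\<bar> * (norm (1::complex))\<^sup>2))"
    have tm: "?t {c..d} \<in> borel_measurable lebesgue" for c d
      using meas_weight[OF meas_continuous[OF continuous_on_const], of c d 1] by measurable
    have "(\<integral>\<^sup>+y. ennreal (exp (- \<eta> * \<bar>x - y\<bar>) * \<bar>w y\<bar>) \<partial>lebesgue)
      \<le> (\<integral>\<^sup>+y. (\<Sum>n. ennreal (q ^ n) * (?t (?I n) y + ?t (?J n) y)) \<partial>lebesgue)"
    proof (rule nn_integral_mono)
      fix y
      define n where "n = nat \<lfloor>\<bar>x - y\<bar> / a\<rfloor>"
      have "0 \<le> \<bar>x - y\<bar> / a" using a_pos by simp
      then have "real n \<le> \<bar>x - y\<bar> / a" "\<bar>x - y\<bar> / a < real n + 1" unfolding n_def by linarith+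
      then have "real n * a \<le> \<bar>x - y\<bar>" "\<bar>x - y\<bar> < (real n + 1) * a"
        using a_pos by (simp_all only: pos_le_divide_eq pos_divide_less_eq)
      then have n: "real n * a \<le> \<bar>x - y\<bar>" "\<bar>x - y\<bar> \<le> real n * a + a" by (auto simp: algebra_simps)
      have "exp (- \<eta> * \<bar>x - y\<bar>) \<le> exp (real n * (- \<eta> * a))"
        using n(1) \<eta> by simp
      also have "\<dots> = q ^ n" by (simp only: q_def exp_of_nat_mult)
      finally have le: "exp (- \<eta> * \<bar>x - y\<bar>) * \<bar>w y\<bar> \<le> q ^ n * \<bar>w y\<bar>" by (rule mult_right_mono) simp
      have "y \<in> ?I n \<or> y \<in> ?J n" using n by (cases "x \<le> y") auto
      then have "ennreal (exp (- \<eta> * \<bar>x - y\<bar>) * \<bar>w y\<bar>) \<le> ennreal (q ^ n) * (?t (?I n) y + ?t (?J n) y)"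
      proof
        assume "y \<in> ?I n"
        then have "ennreal (exp (- \<eta> * \<bar>x - y\<bar>) * \<bar>w y\<bar>) \<le> ennreal (q ^ n) * ?t (?I n) y"
          using le q by (simp add: ennreal_mult[symmetric] ennreal_leI)
        also have "\<dots> \<le> ennreal (q ^ n) * (?t (?I n) y + ?t (?J n) y)" by (intro mult_left_mono) auto
        finally show ?thesis .
      next
        assume "y \<in> ?J n"
        then have "ennreal (exp (- \<eta> * \<bar>x - y\<bar>) * \<bar>w y\<bar>) \<le> ennreal (q ^ n) * ?t (?J n) y"
          using le q by (simp add: ennreal_mult[symmetric] ennreal_leI)
        also have "\<dots> \<le> ennreal (q ^ n) * (?t (?I n) y + ?t (?J n) y)" by (intro mult_left_mono) auto
        finally show ?thesis .
      qed
      also have "\<dots> \<le> (\<Sum>n. ennreal (q ^ n) * (?t (?I n) y + ?t (?J n) y))"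
        using sum_le_suminf[of "\<lambda>n. ennreal (q ^ n) * (?t (?I n) y + ?t (?J n) y)" "{n}"] by (simp add: summableI)
      finally show "ennreal (exp (- \<eta> * \<bar>x - y\<bar>) * \<bar>w y\<bar>) \<le> (\<Sum>n. ennreal (q ^ n) * (?t (?I n) y + ?t (?J n) y))" .
    qed
    also have "\<dots> = (\<Sum>n. (\<integral>\<^sup>+y. ennreal (q ^ n) * (?t (?I n) y + ?t (?J n) y) \<partial>lebesgue))"
      using tm by (intro nn_integral_suminf borel_measurable_times_ennreal borel_measurable_add) auto
    also have "\<dots> \<le> (\<Sum>n. ennreal (q ^ n * (2 * e)))"
    proof (rule suminf_le)
      fix n
      have "(\<integral>\<^sup>+y. ennreal (q ^ n) * (?t (?I n) y + ?t (?J n) y) \<partial>lebesgue) = ennreal (q ^ n) * (E (?I n) (\<lambda>_. 1) + E (?J n) (\<lambda>_. 1))"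
        unfolding E_def using tm by (subst nn_integral_cmult) (auto simp: nn_integral_add)
      also have "\<dots> \<le> ennreal (q ^ n) * (ennreal e + ennreal e)"
        unfolding e[symmetric] by (intro mult_left_mono add_mono E_window_le) auto
      also have "\<dots> = ennreal (q ^ n * (2 * e))"
        using q e0 by (simp add: ennreal_plus[symmetric] ennreal_mult[symmetric] del: ennreal_plus)
      finally show "(\<integral>\<^sup>+y. ennreal (q ^ n) * (?t (?I n) y + ?t (?J n) y) \<partial>lebesgue) \<le> ennreal (q ^ n * (2 * e))" .
    qed (auto intro: summableI)
    also have "\<dots> = ennreal (1 / (1 - q) * (2 * e))"
      using S q e0 by (intro suminf_ennreal_eq) auto
    finally show "(\<integral>\<^sup>+y. ennreal (exp (- \<eta> * \<bar>x - y\<bar>) * \<bar>w y\<bar>) \<partial>lebesgue) \<le> ennreal (1 / (1 - q) * (2 * e))" .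
  qed
qed

text \<open>Up to a constant, a pointwise majorant of the Green operator applied to
  \<open>g\<close>.\<close>

definition conv :: "real \<Rightarrow> (real \<Rightarrow> complex) \<Rightarrow> real \<Rightarrow> ennreal" where
  "conv \<eta> g x = (\<integral>\<^sup>+y. ennreal (exp (- \<eta> * \<bar>x - y\<bar>) * (\<bar>w y\<bar> * norm (g y))) \<partial>lebesgue)"

lemma meas_UNIV: "meas UNIV g \<longleftrightarrow> g \<in> borel_measurable lebesgue"
  by (simp add: meas_def)

lemma borel_measurable_id_lebesgue: "(\<lambda>x::real. x) \<in> borel_measurable lebesgue"
  by (rule measurable_completion) simp

text \<open>The Schur test: Cauchy-Schwarz in y with the kernel as weight gives one factor K, and
  after exchanging the integrals the symmetry of the kernel gives the other.\<close>

lemma conv_bounds: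
  assumes \<eta>: "\<eta> > 0" and K0: "K \<ge> 0" and K: "\<And>x. (\<integral>\<^sup>+y. ennreal (exp (- \<eta> * \<bar>x - y\<bar>) * \<bar>w y\<bar>) \<partial>lebesgue) \<le> ennreal K"
    and g: "g \<in> L2w UNIV"
  shows "conv \<eta> g x < \<infinity>"
    "(\<integral>\<^sup>+x. ennreal \<bar>w x\<bar> * (conv \<eta> g x)\<^sup>2 \<partial>lebesgue) \<le> ennreal (K\<^sup>2) * E UNIV g"
proof -
  have [measurable]: "w \<in> borel_measurable lebesgue" "g \<in> borel_measurable lebesgue" "(\<lambda>x::real. x) \<in> borel_measurable lebesgue"
    using w_meas g by (auto simp: L2w_iff meas_UNIV borel_measurable_id_lebesgue)
  have fin: "E UNIV g < \<infinity>" using g by (simp add: L2w_iff)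
  define G where "G x = (\<integral>\<^sup>+y. ennreal (exp (- \<eta> * \<bar>x - y\<bar>) * \<bar>w y\<bar> * (norm (g y))\<^sup>2) \<partial>lebesgue)" for x
  have sq: "(conv \<eta> g x)\<^sup>2 \<le> ennreal K * G x" for x
  proof -
    have "(conv \<eta> g x)\<^sup>2 \<le> (\<integral>\<^sup>+y. ennreal (exp (- \<eta> * \<bar>x - y\<bar>) * \<bar>w y\<bar>) \<partial>lebesgue) * G x"
      unfolding conv_def G_def mult.assoc[symmetric] by (rule nn_Cauchy_Schwarz) auto
    also have "\<dots> \<le> ennreal K * G x" by (intro mult_right_mono K) simp
    finally show ?thesis .
  qed
  have "G x \<le> E UNIV g"
    unfolding G_def E_def
  proof (intro nn_integral_mono ennreal_leI)
    fix y
    have "exp (- \<eta> * \<bar>x - y\<bar>) \<le> 1" using \<eta> by simp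
    then have "exp (- \<eta> * \<bar>x - y\<bar>) * (\<bar>w y\<bar> * (norm (g y))\<^sup>2) \<le> 1 * (\<bar>w y\<bar> * (norm (g y))\<^sup>2)" by (intro mult_right_mono) auto
    then show "exp (- \<eta> * \<bar>x - y\<bar>) * \<bar>w y\<bar> * (norm (g y))\<^sup>2 \<le> indicator UNIV y * (\<bar>w y\<bar> * (norm (g y))\<^sup>2)" by (simp add: mult.assoc)
  qed
  then have "G x < \<infinity>" using fin by (rule le_less_trans)
  then have "ennreal K * G x < \<infinity>" by (simp add: ennreal_mult_less_top)
  with sq[of x] have "(conv \<eta> g x)\<^sup>2 < \<infinity>" by (rule le_less_trans)
  then show "conv \<eta> g x < \<infinity>" by (auto simp: power2_eq_square ennreal_mult_less_top)
  interpret L: sigma_finite_measure "lebesgue :: real measure" by (rule sigma_finite_lebesgue)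
  interpret P: pair_sigma_finite "lebesgue :: real measure" "lebesgue :: real measure" ..
  let ?F = "\<lambda>x y. ennreal (\<bar>w x\<bar> * (exp (- \<eta> * \<bar>x - y\<bar>) * \<bar>w y\<bar> * (norm (g y))\<^sup>2))"
  have Fm: "case_prod ?F \<in> borel_measurable (lebesgue \<Otimes>\<^sub>M lebesgue)" by measurable
  have "(\<integral>\<^sup>+x. ennreal \<bar>w x\<bar> * (conv \<eta> g x)\<^sup>2 \<partial>lebesgue) \<le> (\<integral>\<^sup>+x. ennreal K * (\<integral>\<^sup>+y. ?F x y \<partial>lebesgue) \<partial>lebesgue)"
  proof (rule nn_integral_mono)
    fix x
    have "ennreal \<bar>w x\<bar> * (conv \<eta> g x)\<^sup>2 \<le> ennreal \<bar>w x\<bar> * (ennreal K * G x)" by (intro mult_left_mono sq) simp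
    also have "\<dots> = ennreal K * (ennreal \<bar>w x\<bar> * G x)" by (simp add: ac_simps)
    also have "ennreal \<bar>w x\<bar> * G x = (\<integral>\<^sup>+y. ?F x y \<partial>lebesgue)"
      unfolding G_def by (subst nn_integral_cmult[symmetric]) (auto simp: ennreal_mult intro!: nn_integral_cong)
    finally show "ennreal \<bar>w x\<bar> * (conv \<eta> g x)\<^sup>2 \<le> ennreal K * (\<integral>\<^sup>+y. ?F x y \<partial>lebesgue)" .
  qed
  also have "\<dots> = ennreal K * (\<integral>\<^sup>+x. \<integral>\<^sup>+y. ?F x y \<partial>lebesgue \<partial>lebesgue)"
    using L.borel_measurable_nn_integral[OF Fm] by (intro nn_integral_cmult) simp
  also have "(\<integral>\<^sup>+x. \<integral>\<^sup>+y. ?F x y \<partial>lebesgue \<partial>lebesgue) = (\<integral>\<^sup>+y. \<integral>\<^sup>+x. ?F x y \<partial>lebesgue \<partial>lebesgue)"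
    using P.Fubini'[OF Fm] by simp
  also have "\<dots> \<le> (\<integral>\<^sup>+y. ennreal K * ennreal (indicator UNIV y * (\<bar>w y\<bar> * (norm (g y))\<^sup>2)) \<partial>lebesgue)"
  proof (rule nn_integral_mono)
    fix y
    have "(\<integral>\<^sup>+x. ?F x y \<partial>lebesgue) = (\<integral>\<^sup>+x. ennreal (\<bar>w y\<bar> * (norm (g y))\<^sup>2) * ennreal (exp (- \<eta> * \<bar>y - x\<bar>) * \<bar>w x\<bar>) \<partial>lebesgue)"
      by (intro nn_integral_cong) (simp add: ennreal_mult[symmetric] abs_minus_commute mult_ac)
    also have "\<dots> = ennreal (\<bar>w y\<bar> * (norm (g y))\<^sup>2) * (\<integral>\<^sup>+x. ennreal (exp (- \<eta> * \<bar>y - x\<bar>) * \<bar>w x\<bar>) \<partial>lebesgue)"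
      by (intro nn_integral_cmult) measurable
    also have "\<dots> \<le> ennreal (\<bar>w y\<bar> * (norm (g y))\<^sup>2) * ennreal K" by (intro mult_left_mono K) simp
    finally show "(\<integral>\<^sup>+x. ?F x y \<partial>lebesgue) \<le> ennreal K * ennreal (indicator UNIV y * (\<bar>w y\<bar> * (norm (g y))\<^sup>2))"
      by (simp add: mult.commute)
  qed
  also have "\<dots> = ennreal K * E UNIV g" unfolding E_def by (intro nn_integral_cmult) measurable
  finally show "(\<integral>\<^sup>+x. ennreal \<bar>w x\<bar> * (conv \<eta> g x)\<^sup>2 \<partial>lebesgue) \<le> ennreal (K\<^sup>2) * E UNIV g"
    using K0 by (simp add: power2_eq_square ennreal_mult mult.assoc mult_left_mono)
qed

text \<open>The constant \<open>C\<close> may depend on x. In the application it contains exp(\<eta>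
  x) or exp(-\<eta> x), which turns the growth of a Floquet solution into the kernel seen from
  x.\<close>

lemma conv_tail:
  assumes fin: "conv \<eta> g x < \<infinity>" and m: "g \<in> borel_measurable lebesgue" and u: "continuous_on UNIV u" and A: "A \<in> sets lebesgue"
    and C: "C \<ge> 0" and le: "\<And>y. y \<in> A \<Longrightarrow> norm (u y) \<le> C * exp (- \<eta> * \<bar>x - y\<bar>)"
  shows "set_integrable lebesgue A (\<lambda>y. W y * g y * u y)"
    "ennreal (norm (LINT y:A|lebesgue. W y * g y * u y)) \<le> ennreal C * conv \<eta> g x"
proof -
  have [measurable]: "w \<in> borel_measurable lebesgue" "g \<in> borel_measurable lebesgue" "(\<lambda>x::real. x) \<in> borel_measurable lebesgue" "u \<in> borel_measurable lebesgue"
    using w_meas m meas_continuous_UNIV[OF u] by (auto simp: meas_UNIV borel_measurable_id_lebesgue)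
  have mm: "(\<lambda>y. indicator A y *\<^sub>R (W y * g y * u y)) \<in> borel_measurable lebesgue"
    using A unfolding W_def by measurable
  have b: "(\<integral>\<^sup>+y. ennreal (norm (indicator A y *\<^sub>R (W y * g y * u y))) \<partial>lebesgue) \<le> ennreal C * conv \<eta> g x"
  proof -
    have "(\<integral>\<^sup>+y. ennreal (norm (indicator A y *\<^sub>R (W y * g y * u y))) \<partial>lebesgue)
      \<le> (\<integral>\<^sup>+y. ennreal C * ennreal (exp (- \<eta> * \<bar>x - y\<bar>) * (\<bar>w y\<bar> * norm (g y))) \<partial>lebesgue)"
    proof (rule nn_integral_mono)
      fix y
      have "norm (indicator A y *\<^sub>R (W y * g y * u y)) \<le> C * (exp (- \<eta> * \<bar>x - y\<bar>) * (\<bar>w y\<bar> * norm (g y)))"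
      proof (cases "y \<in> A")
        case True
        have "\<bar>w y\<bar> * norm (g y) * norm (u y) \<le> \<bar>w y\<bar> * norm (g y) * (C * exp (- \<eta> * \<bar>x - y\<bar>))"
          by (intro mult_left_mono le True) auto
        then show ?thesis using True by (simp add: W_def norm_mult mult_ac)
      qed (use C in auto)
      then show "ennreal (norm (indicator A y *\<^sub>R (W y * g y * u y))) \<le> ennreal C * ennreal (exp (- \<eta> * \<bar>x - y\<bar>) * (\<bar>w y\<bar> * norm (g y)))"
        using C by (simp add: ennreal_mult[symmetric] ennreal_leI)
    qed
    also have "\<dots> = ennreal C * conv \<eta> g x" unfolding conv_def by (intro nn_integral_cmult) measurable
    finally show ?thesis .
  qed
  also have "ennreal C * conv \<eta> g x < \<infinity>" using fin by (simp add: ennreal_mult_less_top)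
  finally show i: "set_integrable lebesgue A (\<lambda>y. W y * g y * u y)"
    unfolding set_integrable_def integrable_iff_bounded using mm by simp
  have "ennreal (norm (LINT y:A|lebesgue. W y * g y * u y)) \<le> (\<integral>\<^sup>+y. ennreal (norm (indicator A y *\<^sub>R (W y * g y * u y))) \<partial>lebesgue)"
    unfolding set_lebesgue_integral_def using i unfolding set_integrable_def by (rule integral_norm_bound_ennreal)
  then show "ennreal (norm (LINT y:A|lebesgue. W y * g y * u y)) \<le> ennreal C * conv \<eta> g x" by (rule order_trans[OF _ b])
qed

text \<open>As D is outside [-2, 2], the multipliers are off the unit circle. Dividing a Floquet
  solution by its exponential factor leaves a function of periodic modulus, which is bounded; one of
  the two solutions is rescaled to make the Wronskian 1.\<close>

lemma green_basis:
  assumes "D l \<notin> complex_of_real ` {-2..2}"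
  obtains \<eta> C up vp um vm where "\<eta> > 0" "C > 0" "hom l up vp" "hom l um vm"
    "\<And>x. norm (up x) \<le> C * exp (- \<eta> * x)" "\<And>x. norm (um x) \<le> C * exp (\<eta> * x)" "\<And>x. up x * vm x - vp x * um x = 1"
proof -
  obtain \<rho>0 where \<rho>0: "\<rho>0 \<noteq> 0" "\<rho>0 + 1 / \<rho>0 = D l" by (rule exists_multiplier)
  define \<rho> where "\<rho> = (if norm \<rho>0 < 1 then \<rho>0 else 1 / \<rho>0)"
  have "norm \<rho>0 \<noteq> 1" using multiplier_norm \<rho>0(2) assms by metis
  then have \<rho>: "\<rho> \<noteq> 0" "\<rho> + 1 / \<rho> = D l" "norm \<rho> < 1"
    using \<rho>0 by (auto simp: \<rho>_def norm_divide field_simps split: if_splits)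
  \<comment> \<open>The rate is chosen so that exp(-\<eta> a) = |\<rho>|, the decay over one
    period.\<close>
  define \<eta> where "\<eta> = - ln (norm \<rho>) / a"
  have \<eta>: "\<eta> > 0" using \<rho> a_pos by (auto simp: \<eta>_def divide_neg_pos ln_less_zero)
  have "\<eta> * a = - ln (norm \<rho>)" using a_pos by (simp add: \<eta>_def)
  then have ea: "exp (\<eta> * a) = 1 / norm \<rho>" "exp (- \<eta> * a) = norm \<rho>" using \<rho>(1) by (simp_all add: exp_minus field_simps)
  obtain up vp where up: "hom l up vp" "up 0 \<noteq> 0 \<or> vp 0 \<noteq> 0" "\<And>x. up (x + a) = \<rho> * up x" "\<And>x. vp (x + a) = \<rho> * vp x"
    using floquet_solution[OF \<rho>(1,2)] by blast
  have "1 / \<rho> \<noteq> 0" "1 / \<rho> + 1 / (1 / \<rho>) = D l" using \<rho> by (simp_all add: add.commute)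
  then obtain um vm where um: "hom l um vm" "um 0 \<noteq> 0 \<or> vm 0 \<noteq> 0" "\<And>x. um (x + a) = 1 / \<rho> * um x" "\<And>x. vm (x + a) = 1 / \<rho> * vm x"
    using floquet_solution by blast
  have cont: "continuous_on UNIV up" "continuous_on UNIV um"
    using up(1) um(1) by (auto simp: lin_sys_def intro: AC_deriv_continuous_on)
  have "norm (up (x + a)) * exp (\<eta> * (x + a)) = norm (up x) * exp (\<eta> * x)" for x
    using \<rho>(1) ea by (simp add: up norm_mult distrib_left exp_add)
  then obtain C1 where C1: "C1 > 0" "\<And>x. norm (up x) * exp (\<eta> * x) \<le> C1"
    using cont by (auto intro: periodic_continuous_bounded[of a "\<lambda>x. norm (up x) * exp (\<eta> * x)", OF a_pos] intro!: continuous_intros)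
  have "norm (um (x + a)) * exp (- \<eta> * (x + a)) = norm (um x) * exp (- \<eta> * x)" for x
  proof -
    have "exp (- \<eta> * (x + a)) = exp (- \<eta> * x) * norm \<rho>" unfolding ea(2)[symmetric] by (simp add: exp_add[symmetric] algebra_simps)
    then show ?thesis using \<rho>(1) by (simp add: um norm_mult norm_divide)
  qed
  then obtain C2 where C2: "C2 > 0" "\<And>x. norm (um x) * exp (- \<eta> * x) \<le> C2"
    using cont by (auto intro: periodic_continuous_bounded[of a "\<lambda>x. norm (um x) * exp (- \<eta> * x)", OF a_pos] intro!: continuous_intros)
  define \<kappa> where "\<kappa> = up 0 * vm 0 - vp 0 * um 0"
  have Wr: "up x * vm x - vp x * um x = \<kappa>" for x unfolding \<kappa>_def by (rule hom_wronskian_const[OF up(1) um(1)])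
  have \<kappa>: "\<kappa> \<noteq> 0"
  proof
    \<comment> \<open>Linear dependence would give both solutions the same multiplier, so \<rho>^2 =
      1, contradicting |\<rho>| < 1.\<close>
    assume z: "\<kappa> = 0"
    have "\<exists>c. um 0 = c * up 0 \<and> vm 0 = c * vp 0"
    proof (cases "up 0 = 0")
      case True
      then show ?thesis using z up(2) by (intro exI[of _ "vm 0 / vp 0"]) (auto simp: \<kappa>_def)
    next
      case False
      then show ?thesis using z by (intro exI[of _ "um 0 / up 0"]) (auto simp: \<kappa>_def field_simps)
    qed
    then obtain c where c: "um 0 = c * up 0" "vm 0 = c * vp 0" by blast
    have h2: "hom l (\<lambda>x. c * up x + 0 * up x) (\<lambda>x. c * vp x + 0 * vp x)" by (rule hom_lincomb[OF up(1) up(1)])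
    have "um = (\<lambda>x. c * up x + 0 * up x)" "vm = (\<lambda>x. c * vp x + 0 * vp x)"
      by (rule hom_unique[OF um(1) h2]; use c in simp)+
    then have e: "um a = c * up a" "vm a = c * vp a" by (simp_all add: fun_eq_iff)
    have "1 / \<rho> * um 0 = \<rho> * um 0" "1 / \<rho> * vm 0 = \<rho> * vm 0"
      using e um(3,4)[of 0] up(3,4)[of 0] c by (simp_all add: mult_ac)
    with um(2) have "1 / \<rho> = \<rho>" by (metis mult_right_cancel)
    then have "\<rho> * \<rho> = 1" using \<rho>(1) by (simp add: field_simps)
    then have "norm \<rho> * norm \<rho> = 1" by (metis norm_mult norm_one)
    moreover have "norm \<rho> * norm \<rho> < 1" using \<rho>(3) by (metis mult_strict_mono' mult_1 norm_ge_zero)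
    ultimately show False by simp
  qed
  define C where "C = max C1 (C2 / norm \<kappa>)"
  have C: "C > 0" using C1(1) by (simp add: C_def)
  show thesis
  proof (rule that[OF \<eta> C up(1)])
    show "hom l (\<lambda>x. (1 / \<kappa>) * um x + 0 * um x) (\<lambda>x. (1 / \<kappa>) * vm x + 0 * vm x)" by (rule hom_lincomb[OF um(1) um(1)])
    show "norm (up x) \<le> C * exp (- \<eta> * x)" for x
    proof -
      have "norm (up x) \<le> C1 * exp (- \<eta> * x)" using C1(2)[of x] by (simp add: exp_minus field_simps)
      also have "\<dots> \<le> C * exp (- \<eta> * x)" by (intro mult_right_mono) (auto simp: C_def)
      finally show ?thesis .
    qed
    show "norm ((1 / \<kappa>) * um x + 0 * um x) \<le> C * exp (\<eta> * x)" for x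
    proof -
      have "norm (um x) \<le> C2 * exp (\<eta> * x)" using C2(2)[of x] by (simp add: exp_minus field_simps)
      then have "norm ((1 / \<kappa>) * um x + 0 * um x) \<le> C2 / norm \<kappa> * exp (\<eta> * x)" using \<kappa> by (simp add: norm_divide divide_right_mono)
      also have "\<dots> \<le> C * exp (\<eta> * x)" by (intro mult_right_mono) (auto simp: C_def)
      finally show ?thesis .
    qed
    show "up x * ((1 / \<kappa>) * vm x + 0 * vm x) - vp x * ((1 / \<kappa>) * um x + 0 * um x) = 1" for x
      using Wr[of x] \<kappa> by (simp add: field_simps)
  qed
qed

lemma resolvent_outside:
  assumes D: "D l \<notin> complex_of_real ` {-2..2}"
  shows "l \<in> rho_A w p q"
proof -
  let ?T = "sl_expr w p q UNIV" and ?M = "weight_measure w UNIV" and ?F = "sl_max_dom w p q UNIV"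
  have U: "(UNIV :: real set) \<in> sets lebesgue" by simp
  obtain \<eta> C up vp um vm where b: "\<eta> > 0" "C > 0" "hom l up vp" "hom l um vm"
    "\<And>x. norm (up x) \<le> C * exp (- \<eta> * x)" "\<And>x. norm (um x) \<le> C * exp (\<eta> * x)" "\<And>x. up x * vm x - vp x * um x = 1"
    using green_basis[OF D] by blast
  obtain K where K: "K \<ge> 0" "\<And>x. (\<integral>\<^sup>+y. ennreal (exp (- \<eta> * \<bar>x - y\<bar>) * \<bar>w y\<bar>) \<partial>lebesgue) \<le> ennreal K"
    using kernel_bound[OF b(1)] by blast
  have cont: "continuous_on UNIV up" "continuous_on UNIV um"
    using b(3,4) by (auto simp: lin_sys_def intro: AC_deriv_continuous_on)
  \<comment> \<open>The Green formula has two terms; in each the growing and the decaying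
    exponential at x cancel and leave C^2.\<close>
  define M where "M = 2 * C * C"
  have M0: "M \<ge> 0" using b(2) by (simp add: M_def)
  have green: "\<exists>f\<in>?F. (AE x in ?M. op_shift ?T l f x = g x) \<and> E UNIV f \<le> ennreal ((M * K)\<^sup>2) * E UNIV g" if g: "g \<in> L2w UNIV" for g
  proof -
    have gm: "g \<in> borel_measurable lebesgue" using g by (simp add: L2w_iff meas_UNIV)
    note cv = conv_bounds[OF b(1) K g]
    define P where "P x = (LINT y:{..x}|lebesgue. W y * g y * um y)" for x
    define Q where "Q x = (LINT y:{x..}|lebesgue. W y * g y * up y)" for x
    have Cx: "C * exp (\<eta> * x) \<ge> 0" "C * exp (- \<eta> * x) \<ge> 0" for x using b(2) by auto
    have lem: "norm (um y) \<le> C * exp (\<eta> * x) * exp (- \<eta> * \<bar>x - y\<bar>)" if "y \<in> {..x}" for x y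
    proof -
      have "exp (\<eta> * x) * exp (- \<eta> * \<bar>x - y\<bar>) = exp (\<eta> * y)" using that by (simp add: exp_add[symmetric] algebra_simps)
      then show ?thesis using b(6)[of y] by (simp add: mult.assoc)
    qed
    have lep: "norm (up y) \<le> C * exp (- \<eta> * x) * exp (- \<eta> * \<bar>x - y\<bar>)" if "y \<in> {x..}" for x y
    proof -
      have "exp (- \<eta> * x) * exp (- \<eta> * \<bar>x - y\<bar>) = exp (- \<eta> * y)" using that by (simp add: exp_add[symmetric] algebra_simps)
      then show ?thesis using b(5)[of y] by (simp add: mult.assoc)
    qed
    note tm = conv_tail[OF cv(1) gm cont(2) _ Cx(1) lem] and tp = conv_tail[OF cv(1) gm cont(1) _ Cx(2) lep]
    have Pd: "AC_deriv UNIV P (\<lambda>y. W y * g y * um y)" unfolding P_def[abs_def] by (rule AC_deriv_left_tail) (rule tm(1), auto)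
    have Qd: "AC_deriv UNIV Q (\<lambda>y. (-1) * (W y * g y * up y))" unfolding Q_def[abs_def] by (rule AC_deriv_right_tail) (rule tp(1), auto)
    \<comment> \<open>The Green function: each variable side of the kernel carries the solution that
      is controlled there. The two boundary terms from differentiating \<open>P\<close> and
      \<open>Q\<close> cancel in f, and in h they leave -W g because the Wronskian is 1.\<close>
    define f where "f x = up x * P x + um x * Q x" for x
    define h where "h x = vp x * P x + vm x * Q x" for x
    have F: "AC_deriv UNIV up (\<lambda>x. \<alpha> x * vp x)" "AC_deriv UNIV vp (\<lambda>x. \<beta> l x * up x)"
      "AC_deriv UNIV um (\<lambda>x. \<alpha> x * vm x)" "AC_deriv UNIV vm (\<lambda>x. \<beta> l x * um x)"
      using b(3,4) by (auto simp: lin_sys_def)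
    have s: "lin_sys UNIV \<alpha> (\<beta> l) (\<lambda>x. W x * g x) f h"
      unfolding lin_sys_def
    proof
      have "AC_deriv UNIV f (\<lambda>x. (\<alpha> x * vp x * P x + up x * (W x * g x * um x)) + (\<alpha> x * vm x * Q x + um x * ((-1) * (W x * g x * up x))))"
        unfolding f_def[abs_def] by (intro AC_deriv_add AC_deriv_mult F Pd Qd)
      then show "AC_deriv UNIV f (\<lambda>x. \<alpha> x * h x)" by (rule AC_deriv_cong) (auto simp: h_def algebra_simps)
      have 2: "AC_deriv UNIV h (\<lambda>x. (\<beta> l x * up x * P x + vp x * (W x * g x * um x)) + (\<beta> l x * um x * Q x + vm x * ((-1) * (W x * g x * up x))))"
        unfolding h_def[abs_def] by (intro AC_deriv_add AC_deriv_mult F Pd Qd)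
      show "AC_deriv UNIV h (\<lambda>x. \<beta> l x * f x - W x * g x)"
      proof (rule AC_deriv_cong[OF 2])
        fix x
        show "(\<beta> l x * up x * P x + vp x * (W x * g x * um x)) + (\<beta> l x * um x * Q x + vm x * ((-1) * (W x * g x * up x))) = \<beta> l x * f x - W x * g x"
          using b(7)[of x] unfolding f_def by algebra
      qed simp
    qed
    have fle: "ennreal (norm (f x)) \<le> ennreal M * conv \<eta> g x" for x
    proof -
      have e1: "exp (- \<eta> * x) * exp (\<eta> * x) = 1" by (simp add: exp_add[symmetric])
      have "ennreal (norm (up x * P x)) \<le> ennreal (C * exp (- \<eta> * x)) * (ennreal (C * exp (\<eta> * x)) * conv \<eta> g x)"
        unfolding norm_mult P_def using b(5)[of x] tm(2)[of "{..x}" x]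
        by (subst ennreal_mult) (auto intro!: mult_mono ennreal_leI)
      also have "\<dots> = ennreal ((C * exp (- \<eta> * x)) * (C * exp (\<eta> * x))) * conv \<eta> g x"
        using Cx[of x] by (subst ennreal_mult) (auto simp: mult.assoc)
      also have "(C * exp (- \<eta> * x)) * (C * exp (\<eta> * x)) = C * C" using e1 by (simp add: mult_ac)
      finally have 1: "ennreal (norm (up x * P x)) \<le> ennreal (C * C) * conv \<eta> g x" .
      have "ennreal (norm (um x * Q x)) \<le> ennreal (C * exp (\<eta> * x)) * (ennreal (C * exp (- \<eta> * x)) * conv \<eta> g x)"
        unfolding norm_mult Q_def using b(6)[of x] tp(2)[of "{x..}" x]
        by (subst ennreal_mult) (auto intro!: mult_mono ennreal_leI)
      also have "\<dots> = ennreal ((C * exp (\<eta> * x)) * (C * exp (- \<eta> * x))) * conv \<eta> g x"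
        using Cx[of x] by (subst ennreal_mult) (auto simp: mult.assoc)
      also have "(C * exp (\<eta> * x)) * (C * exp (- \<eta> * x)) = C * C" using e1 by (simp add: mult_ac)
      finally have 2: "ennreal (norm (um x * Q x)) \<le> ennreal (C * C) * conv \<eta> g x" .
      have "ennreal (norm (f x)) \<le> ennreal (norm (up x * P x) + norm (um x * Q x))"
        unfolding f_def by (intro ennreal_leI norm_triangle_ineq)
      also have "\<dots> = ennreal (norm (up x * P x)) + ennreal (norm (um x * Q x))" by (rule ennreal_plus) auto
      also have "\<dots> \<le> ennreal (C * C) * conv \<eta> g x + ennreal (C * C) * conv \<eta> g x" by (intro add_mono 1 2)
      also have "\<dots> = (ennreal (C * C) + ennreal (C * C)) * conv \<eta> g x" by (simp only: distrib_right)
      also have "ennreal (C * C) + ennreal (C * C) = ennreal M"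
        using b(2) by (subst ennreal_plus[symmetric]) (auto simp: M_def)
      finally show ?thesis .
    qed
    have "E UNIV f \<le> (\<integral>\<^sup>+x. ennreal (M\<^sup>2) * (ennreal \<bar>w x\<bar> * (conv \<eta> g x)\<^sup>2) \<partial>lebesgue)"
      unfolding E_def
    proof (rule nn_integral_mono)
      fix x
      have "(ennreal (norm (f x)))\<^sup>2 \<le> (ennreal M * conv \<eta> g x)\<^sup>2" by (intro power_mono fle) simp
      then have "ennreal \<bar>w x\<bar> * (ennreal (norm (f x)))\<^sup>2 \<le> ennreal \<bar>w x\<bar> * (ennreal M * conv \<eta> g x)\<^sup>2" by (intro mult_left_mono) auto
      also have "\<dots> = ennreal (M\<^sup>2) * (ennreal \<bar>w x\<bar> * (conv \<eta> g x)\<^sup>2)"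
        using M0 by (simp add: power_mult_distrib ennreal_power mult_ac)
      finally show "ennreal (indicator UNIV x * (\<bar>w x\<bar> * (norm (f x))\<^sup>2)) \<le> ennreal (M\<^sup>2) * (ennreal \<bar>w x\<bar> * (conv \<eta> g x)\<^sup>2)"
        by (simp add: ennreal_mult ennreal_power)
    qed
    also have "\<dots> \<le> ennreal (M\<^sup>2) * (\<integral>\<^sup>+x. ennreal \<bar>w x\<bar> * (conv \<eta> g x)\<^sup>2 \<partial>lebesgue)"
    proof -
      interpret L: sigma_finite_measure "lebesgue :: real measure" by (rule sigma_finite_lebesgue)
      have [measurable]: "w \<in> borel_measurable lebesgue" "g \<in> borel_measurable lebesgue" "(\<lambda>x::real. x) \<in> borel_measurable lebesgue"
        using w_meas gm by (auto simp: borel_measurable_id_lebesgue)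
      have "(\<lambda>(x, y). ennreal (exp (- \<eta> * \<bar>x - y\<bar>) * (\<bar>w y\<bar> * norm (g y)))) \<in> borel_measurable (lebesgue \<Otimes>\<^sub>M lebesgue)" by measurable
      then have [measurable]: "conv \<eta> g \<in> borel_measurable lebesgue"
        unfolding conv_def[abs_def] using L.borel_measurable_nn_integral by blast
      show ?thesis by (subst nn_integral_cmult) auto
    qed
    also have "\<dots> \<le> ennreal (M\<^sup>2) * (ennreal (K\<^sup>2) * E UNIV g)" by (intro mult_left_mono cv(2)) simp
    also have "\<dots> = ennreal ((M * K)\<^sup>2) * E UNIV g" by (simp add: power_mult_distrib ennreal_mult mult.assoc)
    finally have Ef: "E UNIV f \<le> ennreal ((M * K)\<^sup>2) * E UNIV g" .
    also have "\<dots> < \<infinity>" using g by (simp add: L2w_iff ennreal_mult_less_top)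
    finally have fin: "E UNIV f < \<infinity>" .
    have "meas UNIV f" using s by (intro meas_continuous_UNIV AC_deriv_continuous_on) (auto simp: lin_sys_def)
    with fin have fL: "f \<in> L2w UNIV" by (simp add: L2w_iff)
    from max_dom_intro[OF admissible_interval_UNIV s fL g] Ef show ?thesis by (auto simp: AE_weight[OF U])
  qed
  have inj: "op_injective ?M ?F (op_shift ?T l)" by (rule op_injective_max)
  moreover have "op_surjective ?M ?F (op_shift ?T l)" unfolding op_surjective_def using green by blast
  moreover have "op_bounded_inverse ?M ?F (op_shift ?T l)"
    unfolding op_bounded_inverse_def
  proof (intro exI[of _ "M * K"] ballI)
    fix f0 assume f0: "f0 \<in> ?F"
    let ?g = "op_shift ?T l f0"
    have f0L: "f0 \<in> L2w UNIV" and gL: "?g \<in> L2w UNIV" using f0 by (auto intro: max_dom_imp)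
    obtain f where f: "f \<in> ?F" "AE x in ?M. op_shift ?T l f x = ?g x" "E UNIV f \<le> ennreal ((M * K)\<^sup>2) * E UNIV ?g"
      using green[OF gL] by blast
    \<comment> \<open>By injectivity an arbitrary domain element is the constructed preimage of its
      own image and inherits the bound.\<close>
    have "AE x in ?M. f x = f0 x" by (rule op_injectiveD[OF inj f(1) f0 f(2)])
    then have "E UNIV f = E UNIV f0" by (intro E_cong_AE) (simp add: AE_weight[OF U])
    then have "enn2real (E UNIV f0) \<le> enn2real (ennreal ((M * K)\<^sup>2) * E UNIV ?g)"
      using f(3) gL by (intro enn2real_mono) (auto simp: L2w_iff ennreal_mult_less_top)
    then have "sqrt (enn2real (E UNIV f0)) \<le> sqrt ((M * K)\<^sup>2 * enn2real (E UNIV ?g))"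
      by (simp add: enn2real_mult del: real_sqrt_le_iff) (rule real_sqrt_le_mono)
    also have "\<dots> = M * K * sqrt (enn2real (E UNIV ?g))" using M0 K(1) by (simp add: real_sqrt_mult)
    finally show "L2_norm ?M f0 \<le> M * K * L2_norm ?M ?g"
      using f0L gL by (simp add: L2_norm_E L2w_iff)
  qed
  ultimately show ?thesis by (simp add: rho_A_def resolvent_set_def)
qed

end

section \<open>Density of the range\<close>

context sl_periodic
begin

text \<open>A bilinear pairing with the signed weight and without conjugation. For compactly
  supported data, vanishing moments against \<phi> and \<psi> are the condition for a compactly
  supported preimage.\<close>

definition mom :: "(real \<Rightarrow> complex) \<Rightarrow> (real \<Rightarrow> complex) \<Rightarrow> complex" where
  "mom g u = (\<integral>x. W x * g x * u x \<partial>lebesgue)"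

lemma compact_support_integrable:
  assumes g: "g \<in> L2w UNIV" and s: "\<And>x. R < \<bar>x\<bar> \<Longrightarrow> g x = 0" and u: "continuous_on UNIV u"
  shows "integrable lebesgue (\<lambda>x. W x * g x * u x)"
proof -
  have "set_integrable lebesgue {-R..R} (\<lambda>x. W x * g x * u x)"
    by (intro set_integrable_mult_continuous set_integrable_W_mult[OF g] continuous_on_subset[OF u]) auto
  moreover have "indicator {-R..R} x *\<^sub>R (W x * g x * u x) = W x * g x * u x" for x
    using s[of x] by (cases "R < \<bar>x\<bar>") (auto simp: indicator_def)
  ultimately show ?thesis by (simp add: set_integrable_def)
qed

text \<open>Variation of constants integrated from the left: nothing happens before the support of
  \<open>g\<close>, and beyond it the coefficients are frozen at the two moments.\<close>

lemma causal_solution: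
  assumes g: "g \<in> L2w UNIV" and s: "\<And>x. R < \<bar>x\<bar> \<Longrightarrow> g x = 0"
  obtains f h where "lin_sys UNIV \<alpha> (\<beta> l) (\<lambda>x. W x * g x) f h" "\<And>x. x < - R \<Longrightarrow> f x = 0"
    "\<And>x. R < x \<Longrightarrow> f x = mom g (\<psi> l) * \<phi> l x - mom g (\<phi> l) * \<psi> l x"
proof -
  note c = continuous_fundamental(1,2)[of l]
  have i: "integrable lebesgue (\<lambda>x. W x * g x * \<phi> l x)" "integrable lebesgue (\<lambda>x. W x * g x * \<psi> l x)"
    using compact_support_integrable[OF g s] c by auto
  have si: "set_integrable lebesgue {..x} (\<lambda>x. W x * g x * \<phi> l x)" "set_integrable lebesgue {..x} (\<lambda>x. W x * g x * \<psi> l x)" for x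
    using i unfolding set_integrable_def by (auto intro!: integrable_mult_indicator)
  define A where "A x = (LINT t:{..x}|lebesgue. W t * g t * \<psi> l t)" for x
  define B where "B x = (LINT t:{..x}|lebesgue. W t * g t * \<phi> l t)" for x
  have Ad: "AC_deriv UNIV A (\<lambda>x. W x * g x * \<psi> l x)" and Bd: "AC_deriv UNIV B (\<lambda>x. W x * g x * \<phi> l x)"
    unfolding A_def[abs_def] B_def[abs_def] by (intro AC_deriv_left_tail si)+
  have left: "(LINT t:{..x}|lebesgue. W t * g t * u t) = 0" if "x < - R" for x u
  proof -
    have z: "indicator {..x} t *\<^sub>R (W t * g t * u t) = 0" for t
      using s[of t] that by (cases "R < \<bar>t\<bar>") (auto simp: indicator_def)
    show ?thesis unfolding set_lebesgue_integral_def z by simp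
  qed
  have right: "(LINT t:{..x}|lebesgue. W t * g t * u t) = mom g u" if "R < x" for x u
  proof -
    have "indicator {..x} t *\<^sub>R (W t * g t * u t) = W t * g t * u t" for t
      using s[of t] that by (cases "R < \<bar>t\<bar>") (auto simp: indicator_def)
    then show ?thesis by (simp add: set_lebesgue_integral_def mom_def)
  qed
  show thesis
  proof (rule that[OF variation_of_constants_conv[OF Ad Bd]])
    show "A x * \<phi> l x - B x * \<psi> l x = 0" if "x < - R" for x using left[OF that] by (simp add: A_def B_def)
    show "A x * \<phi> l x - B x * \<psi> l x = mom g (\<psi> l) * \<phi> l x - mom g (\<phi> l) * \<psi> l x" if "R < x" for x
      using right[OF that] by (simp add: A_def B_def)
  qed
qed

lemma compact_support_L2w:
  assumes f: "continuous_on UNIV f" and s: "\<And>x. R < \<bar>x\<bar> \<Longrightarrow> f x = 0"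
  shows "f \<in> L2w UNIV"
proof -
  have "f \<in> L2w {-R..R}" by (rule L2w_continuous[OF continuous_on_subset[OF f]]) simp
  moreover have "E UNIV f = E {-R..R} f"
    unfolding E_def
  proof (intro nn_integral_cong arg_cong[where f = ennreal])
    fix x show "indicator UNIV x * (\<bar>w x\<bar> * (norm (f x))\<^sup>2) = indicator {-R..R} x * (\<bar>w x\<bar> * (norm (f x))\<^sup>2)"
      using s[of x] by (cases "R < \<bar>x\<bar>") (auto simp: indicator_def)
  qed
  ultimately show ?thesis using meas_continuous_UNIV[OF f] by (simp add: L2w_iff)
qed

lemma compact_preimage:
  assumes g: "g \<in> L2w UNIV" and s: "\<And>x. R < \<bar>x\<bar> \<Longrightarrow> g x = 0" and m: "mom g (\<phi> l) = 0" "mom g (\<psi> l) = 0"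
  obtains f where "f \<in> sl_max_dom w p q UNIV" "AE x in lebesgue. op_shift (sl_expr w p q UNIV) l f x = g x"
proof -
  obtain f h where f: "lin_sys UNIV \<alpha> (\<beta> l) (\<lambda>x. W x * g x) f h" "\<And>x. x < - R \<Longrightarrow> f x = 0"
    "\<And>x. R < x \<Longrightarrow> f x = mom g (\<psi> l) * \<phi> l x - mom g (\<phi> l) * \<psi> l x"
    using causal_solution[OF g s, where l = l] by blast
  have "continuous_on UNIV f" using f(1) by (auto simp: lin_sys_def intro: AC_deriv_continuous_on)
  then have "f \<in> L2w UNIV"
    by (rule compact_support_L2w[of f R]) (use f(2,3) m in \<open>auto simp: abs_if split: if_splits\<close>)
  from max_dom_intro[OF admissible_interval_UNIV f(1) this g] show thesis by (intro that) auto
qed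

lemma E_sum_disjoint:
  assumes S: "finite S" and m: "\<And>i. i \<in> S \<Longrightarrow> meas UNIV (f i)"
    and d: "\<And>x i j. i \<in> S \<Longrightarrow> j \<in> S \<Longrightarrow> i \<noteq> j \<Longrightarrow> f i x = 0 \<or> f j x = 0"
  shows "E UNIV (\<lambda>x. \<Sum>i\<in>S. f i x) = (\<Sum>i\<in>S. E UNIV (f i))"
proof -
  have sq: "(norm (\<Sum>i\<in>S. f i x))\<^sup>2 = (\<Sum>i\<in>S. (norm (f i x))\<^sup>2)" for x
  proof (cases "\<exists>i\<in>S. f i x \<noteq> 0")
    case True
    then obtain i where i: "i \<in> S" "f i x \<noteq> 0" by blast
    then have z: "f j x = 0" if "j \<in> S - {i}" for j using d[of i j x] that by auto
    show ?thesis
      using z by (simp add: sum.remove[OF S i(1)])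
  qed simp
  show ?thesis
    unfolding E_def sq using meas_weight[OF m]
    by (subst nn_integral_sum[symmetric]) (auto simp: sum_distrib_left sum_ennreal intro!: nn_integral_cong)
qed

lemma mom_translate:
  assumes s: "\<And>x. w (x + s) = w x"
  shows "mom (\<lambda>x. g (x + s)) u = mom g (\<lambda>x. u (x - s))"
proof -
  have "mom g (\<lambda>x. u (x - s)) = (\<integral>x. W (s + 1 * x) * g (s + 1 * x) * u (s + 1 * x - s) \<partial>lebesgue)"
    unfolding mom_def by (subst lebesgue_integral_real_affine[of 1 _ s]) auto
  also have "\<dots> = mom (\<lambda>x. g (x + s)) u"
    unfolding mom_def using s by (simp add: W_def add.commute)
  finally show ?thesis by simp
qed

lemma E_translate_UNIV:
  assumes "meas UNIV f" "\<And>x. w (x + s) = w x"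
  shows "E UNIV (\<lambda>x. f (x + s)) = E UNIV f" "meas UNIV (\<lambda>x. f (x + s))"
  using E_translate[OF assms] meas_translate[OF assms(1), of s] by simp_all

text \<open>A moment against a solution sees g(x + t_n) + g(x - t_n) as c_n times g. With weights
  d_n = conj(c_n)/Z, Z the sum of |c_n|^2, the moments are reproduced, while the energy of disjoint
  translates scales with the sum of |d_n|^2 = 1/Z \<le> 1/N.\<close>

lemma moment_preserving_small:
  assumes g: "g \<in> L2w UNIV" and s: "\<And>x. R < \<bar>x\<bar> \<Longrightarrow> g x = 0" and N: "N > 0"
  obtains k R' where "k \<in> L2w UNIV" "\<And>x. R' < \<bar>x\<bar> \<Longrightarrow> k x = 0" "\<And>u v. hom l u v \<Longrightarrow> mom k u = mom g u"
    "ennreal (real N) * E UNIV k \<le> 4 * E UNIV g"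
proof -
  obtain \<rho> where \<rho>: "\<rho> \<noteq> 0" "\<rho> + 1 / \<rho> = D l" by (rule exists_multiplier)
  \<comment> \<open>Translating by multiples of m periods exceeds the diameter of the support, so
    translates to the same side are disjoint; the multiplier becomes \<rho>^m.\<close>
  obtain m :: nat where "(2 * \<bar>R\<bar> + 1) / a < real m" using reals_Archimedean2 by blast
  then have m: "2 * \<bar>R\<bar> + 1 < real m * a" using a_pos by (simp add: pos_divide_less_eq)
  let ?c = "\<lambda>n::nat. (\<rho> ^ m) ^ n + (1 / \<rho> ^ m) ^ n"
  have rm: "\<rho> ^ m \<noteq> 0" using \<rho> by simp
  obtain S where S: "finite S" "card S = N" "S \<subseteq> {n. norm (?c n) \<ge> 1}"
    using infinite_arbitrarily_large[OF infinite_chebyshev_large[OF rm], of N] by auto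
  define t where "t n = real (m * n) * a" for n :: nat
  define Z where "Z = (\<Sum>n\<in>S. (norm (?c n))\<^sup>2)"
  have ZN: "real N \<le> Z"
  proof -
    have "(\<Sum>n\<in>S. 1) \<le> Z" unfolding Z_def using S by (intro sum_mono) (auto simp: one_le_power)
    then show ?thesis using S by simp
  qed
  have Z0: "Z > 0" using ZN N by linarith
  define d where "d n = cnj (?c n) / complex_of_real Z" for n
  \<comment> \<open>The summand \<open>0 * g x\<close> puts the multiple into the shape of
    \<open>meas_lincomb\<close>.\<close>
  define k1 where "k1 n x = d n * g (x + t n) + 0 * g x" for n x
  define k2 where "k2 n x = d n * g (x + - t n) + 0 * g x" for n x
  have gm: "meas UNIV g" "E UNIV g < \<infinity>" using g by (auto simp: L2w_iff)
  have wt: "w (x + t n) = w x" "w (x + - t n) = w x" for x n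
    using w_translate_nat[of x "m * n"] w_translate_nat_minus[of x "m * n"] by (simp_all add: t_def)
  have tg: "meas UNIV (\<lambda>x. g (x + t n))" "E UNIV (\<lambda>x. g (x + t n)) = E UNIV g"
      "meas UNIV (\<lambda>x. g (x + - t n))" "E UNIV (\<lambda>x. g (x + - t n)) = E UNIV g" for n
    using E_translate_UNIV[of g "t n"] E_translate_UNIV[of g "- t n"] gm wt by auto
  have km: "meas UNIV (k1 n)" "meas UNIV (k2 n)" for n
    unfolding k1_def[abs_def] k2_def[abs_def] by (intro meas_lincomb tg gm)+
  have Ecm: "E UNIV (\<lambda>x. c * f x + 0 * g x) = ennreal ((norm c)\<^sup>2) * E UNIV f" if "meas UNIV f" for c f
    unfolding E_def using meas_weight[OF that]
    by (subst nn_integral_cmult[symmetric]) (auto simp: norm_mult power_mult_distrib ennreal_mult[symmetric] mult_ac intro!: nn_integral_cong)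
  have kE: "E UNIV (k1 n) = ennreal ((norm (d n))\<^sup>2) * E UNIV g" "E UNIV (k2 n) = ennreal ((norm (d n))\<^sup>2) * E UNIV g" for n
    unfolding k1_def[abs_def] k2_def[abs_def] by (simp_all only: Ecm tg)
  have tdiff: "\<bar>t i - t j\<bar> > 2 * \<bar>R\<bar>" if "i \<noteq> j" for i j
  proof -
    have "real m * a * 1 \<le> real m * a * \<bar>real i - real j\<bar>"
    proof (rule mult_left_mono)
      show "1 \<le> \<bar>real i - real j\<bar>" using that by linarith
    qed (use a_pos in auto)
    also have "\<dots> = \<bar>t i - t j\<bar>"
    proof -
      have "t i - t j = real m * a * (real i - real j)" by (simp add: t_def algebra_simps)
      then show ?thesis using a_pos by (simp add: abs_mult)
    qed
    finally show ?thesis using m by linarith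
  qed
  have dis: "k1 i x = 0 \<or> k1 j x = 0" "k2 i x = 0 \<or> k2 j x = 0" if "i \<noteq> j" for i j x
  proof -
    have "R < \<bar>x + t i\<bar> \<or> R < \<bar>x + t j\<bar>" using tdiff[OF that] by linarith
    then show "k1 i x = 0 \<or> k1 j x = 0" using s by (auto simp: k1_def)
    have "R < \<bar>x + - t i\<bar> \<or> R < \<bar>x + - t j\<bar>" using tdiff[OF that] by linarith
    then show "k2 i x = 0 \<or> k2 j x = 0" using s by (auto simp: k2_def)
  qed
  define K1 where "K1 x = (\<Sum>n\<in>S. k1 n x)" for x
  define K2 where "K2 x = (\<Sum>n\<in>S. k2 n x)" for x
  have dsum: "(\<Sum>n\<in>S. (norm (d n))\<^sup>2) = 1 / Z"
  proof -
    have "(norm (d n))\<^sup>2 = (norm (?c n))\<^sup>2 / Z\<^sup>2" for n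
      unfolding d_def norm_divide complex_mod_cnj norm_of_real power_divide power2_abs ..
    then have "(\<Sum>n\<in>S. (norm (d n))\<^sup>2) = Z / Z\<^sup>2" by (simp only: sum_divide_distrib[symmetric] Z_def[symmetric])
    then show ?thesis using Z0 by (simp add: power2_eq_square)
  qed
  have EK: "E UNIV K1 = ennreal (1 / Z) * E UNIV g" "E UNIV K2 = ennreal (1 / Z) * E UNIV g"
    unfolding K1_def[abs_def] K2_def[abs_def] using E_sum_disjoint[of S k1] E_sum_disjoint[of S k2] S(1) km dis
    by (simp_all add: kE sum_distrib_right[symmetric] sum_ennreal dsum)
  have mK: "meas UNIV K1" "meas UNIV K2"
    using km unfolding meas_UNIV K1_def[abs_def] K2_def[abs_def] by (auto intro: borel_measurable_sum)
  \<comment> \<open>Left and right translates may overlap, so they are separated into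
    \<open>K1\<close> and \<open>K2\<close>; adding them costs the factor 4 in the
    conclusion.\<close>
  define k where "k x = 1 * K1 x + 1 * K2 x" for x
  have mk: "meas UNIV k" unfolding k_def[abs_def] by (rule meas_lincomb[OF mK])
  have "E UNIV k \<le> 2 * E UNIV K1 + 2 * E UNIV K2" unfolding k_def[abs_def] using E_lincomb[OF mK, of 1 1] by simp
  also have "\<dots> = ennreal (4 / Z) * E UNIV g"
  proof -
    have "ennreal (4 / Z) = (2 + 2) * ennreal (1 / Z)" using Z0 ennreal_mult[of 4 "1 / Z"] by simp
    moreover have "2 * y + 2 * y = 4 * y" for y :: ennreal by (simp add: distrib_right[symmetric])
    ultimately show ?thesis unfolding EK by (simp add: mult.assoc)
  qed
  finally have Ek: "E UNIV k \<le> ennreal (4 / Z) * E UNIV g" .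
  show thesis
  proof (rule that[of k "\<bar>R\<bar> + (\<Sum>n\<in>S. t n)"])
    have "ennreal (4 / Z) * E UNIV g < \<infinity>" using gm by (simp add: ennreal_mult_less_top)
    with Ek have "E UNIV k < \<infinity>" by (rule le_less_trans)
    then show "k \<in> L2w UNIV" using mk by (simp add: L2w_iff)
    show "k x = 0" if x: "\<bar>R\<bar> + (\<Sum>n\<in>S. t n) < \<bar>x\<bar>" for x
    proof -
      have t0: "t n \<ge> 0" for n using a_pos by (simp add: t_def)
      have "k1 n x = 0 \<and> k2 n x = 0" if "n \<in> S" for n
      proof -
        have "t n \<le> (\<Sum>n\<in>S. t n)" using member_le_sum[OF that, of t] t0 S(1) by auto
        then have "R < \<bar>x + t n\<bar>" "R < \<bar>x + - t n\<bar>" using x t0[of n] by linarith+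
        then show ?thesis using s by (simp add: k1_def k2_def)
      qed
      then show ?thesis by (simp add: k_def K1_def K2_def)
    qed
    show "ennreal (real N) * E UNIV k \<le> 4 * E UNIV g"
    proof -
      have "ennreal (real N) * E UNIV k \<le> ennreal (real N) * (ennreal (4 / Z) * E UNIV g)" by (intro mult_left_mono Ek) simp
      also have "\<dots> = ennreal (real N * (4 / Z)) * E UNIV g"

      proof -
        have e: "ennreal (real N * (4 / Z)) = ennreal (real N) * ennreal (4 / Z)" using Z0 by (intro ennreal_mult) auto
        show ?thesis unfolding e mult.assoc ..
      qed
      also have "\<dots> \<le> ennreal 4 * E UNIV g"
        using ZN Z0 by (intro mult_right_mono ennreal_leI) (auto simp: field_simps)
      finally show ?thesis by simp
    qed
    fix u v assume u: "hom l u v"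
    have uc: "continuous_on UNIV u" using u by (auto simp: lin_sys_def intro: AC_deriv_continuous_on)
    have gs: "(\<lambda>x. g (x + c)) \<in> L2w UNIV" "\<And>x. \<bar>R\<bar> + \<bar>c\<bar> < \<bar>x\<bar> \<Longrightarrow> g (x + c) = 0" if "\<And>x. w (x + c) = w x" for c
    proof -
      show "(\<lambda>x. g (x + c)) \<in> L2w UNIV" using E_translate_UNIV[of g c] that gm by (simp add: L2w_iff)
      fix x assume "\<bar>R\<bar> + \<bar>c\<bar> < \<bar>x\<bar>"
      then show "g (x + c) = 0" by (intro s) linarith
    qed
    have int: "integrable lebesgue (\<lambda>x. W x * g (x + c) * u x)" if "\<And>x. w (x + c) = w x" for c
      by (rule compact_support_integrable[OF gs[OF that] uc])
    have "mom k u = (\<integral>x. (\<Sum>n\<in>S. d n * (W x * g (x + t n) * u x) + d n * (W x * g (x + - t n) * u x)) \<partial>lebesgue)"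
      unfolding mom_def k_def K1_def K2_def k1_def k2_def
      by (intro Bochner_Integration.integral_cong) (simp_all add: sum_distrib_left sum_distrib_right sum.distrib algebra_simps)
    also have "\<dots> = (\<Sum>n\<in>S. d n * mom (\<lambda>x. g (x + t n)) u + d n * mom (\<lambda>x. g (x + - t n)) u)"
      unfolding mom_def using int[OF wt(1)] int[OF wt(2)]
      by (subst Bochner_Integration.integral_sum) (auto intro!: sum.cong Bochner_Integration.integrable_add integrable_mult_right)
    also have "\<dots> = (\<Sum>n\<in>S. d n * (mom g (\<lambda>x. u (x - t n)) + mom g (\<lambda>x. u (x + t n))))"
      using mom_translate[of "t _" g u] mom_translate[of "- t _" g u] wt by (simp add: distrib_left)
    also have "\<dots> = (\<Sum>n\<in>S. d n * (?c n * mom g u))"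
    proof (intro sum.cong refl arg_cong2[where f = "(*)"])
      fix n
      have ch: "u (x - t n) + u (x + t n) = ?c n * u x" for x
        using hom_chebyshev[OF u \<rho>, of x "m * n"] by (simp add: t_def power_mult power_one_over add.commute)
      have tc: "continuous_on UNIV (\<lambda>x. u (x - t n))" "continuous_on UNIV (\<lambda>x. u (x + t n))"
        by (auto intro!: continuous_on_compose2[OF uc] continuous_intros)
      have "mom g (\<lambda>x. u (x - t n)) + mom g (\<lambda>x. u (x + t n)) = (\<integral>x. W x * g x * u (x - t n) + W x * g x * u (x + t n) \<partial>lebesgue)"
        unfolding mom_def using compact_support_integrable[OF g s] tc by (subst Bochner_Integration.integral_add) auto
      also have "\<dots> = (\<integral>x. ?c n * (W x * g x * u x) \<partial>lebesgue)"
      proof (intro Bochner_Integration.integral_cong refl)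
        fix x show "W x * g x * u (x - t n) + W x * g x * u (x + t n) = ?c n * (W x * g x * u x)"
          unfolding distrib_left[symmetric] ch by (simp add: mult_ac)
      qed
      also have "\<dots> = ?c n * mom g u" unfolding mom_def by simp
      finally show "mom g (\<lambda>x. u (x - t n)) + mom g (\<lambda>x. u (x + t n)) = ?c n * mom g u" .
    qed
    also have "\<dots> = (\<Sum>n\<in>S. d n * ?c n) * mom g u" by (simp add: sum_distrib_right mult.assoc)
    also have "(\<Sum>n\<in>S. d n * ?c n) = 1"
    proof -
      have "d n * ?c n = complex_of_real ((norm (?c n))\<^sup>2) / complex_of_real Z" for n
        unfolding d_def complex_norm_square by (simp add: mult.commute)
      then show ?thesis using Z0 by (simp add: sum_divide_distrib[symmetric] Z_def del: of_real_power flip: of_real_sum)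
    qed
    finally show "mom k u = mom g u" by simp
  qed
qed

lemma truncation:
  assumes h: "h \<in> L2w UNIV" and e: "e > 0"
  obtains R where "E UNIV (\<lambda>x. 1 * (indicator {-R..R} x *\<^sub>R h x) + (-1) * h x) < ennreal e"
    "(\<lambda>x. indicator {-R..R} x *\<^sub>R h x) \<in> L2w UNIV"
proof -
  have hm: "meas UNIV h" "E UNIV h < \<infinity>" using h by (auto simp: L2w_iff)
  let ?F = "\<lambda>x. \<bar>w x\<bar> * (norm (h x))\<^sup>2"
  have Fm: "?F \<in> borel_measurable lebesgue" using meas_weight[OF hm(1)] by simp
  have Fi: "integrable lebesgue ?F" using hm Fm by (simp add: integrable_iff_bounded E_def abs_mult)
  have "(\<lambda>n::nat. \<integral>x. indicator (- {- real n..real n}) x * ?F x \<partial>lebesgue) \<longlonglongrightarrow> (\<integral>x. 0 \<partial>(lebesgue :: real measure))"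
  proof (rule integral_dominated_convergence[OF _ _ Fi])
    show "AE x in lebesgue. (\<lambda>n::nat. indicator (- {- real n..real n}) x * ?F x) \<longlonglongrightarrow> 0"
    proof (rule AE_I2)
      fix x
      have "\<forall>\<^sub>F n in sequentially. \<bar>x\<bar> \<le> real n"
        using filterlim_real_sequentially by (simp add: filterlim_at_top)
      then have "\<forall>\<^sub>F n in sequentially. indicator (- {- real n..real n}) x * ?F x = 0"
        by eventually_elim (auto simp: indicator_def)
      then show "(\<lambda>n::nat. indicator (- {- real n..real n}) x * ?F x) \<longlonglongrightarrow> 0" by (rule tendsto_eventually)
    qed
    show "AE x in lebesgue. norm (indicator (- {- real n..real n}) x * ?F x) \<le> ?F x" for n :: nat
      by (auto simp: indicator_def abs_mult intro!: AE_I2)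
    show "(\<lambda>x. indicator (- {- real n..real n}) x * ?F x) \<in> borel_measurable lebesgue" for n :: nat
      by (rule borel_measurable_times[OF borel_measurable_indicator Fm]) simp
  qed simp
  then have "\<forall>\<^sub>F n in sequentially. (\<integral>x. indicator (- {- real n..real n}) x * ?F x \<partial>lebesgue) < e"
    using e by (intro order_tendstoD(2)) auto
  then obtain n :: nat where n: "(\<integral>x. indicator (- {- real n..real n}) x * ?F x \<partial>lebesgue) < e"
    by (auto simp: eventually_sequentially)
  show thesis
  proof (rule that[of "real n"])
    have i: "integrable lebesgue (\<lambda>x. indicator (- {- real n..real n}) x * ?F x)"
      using Fi integrable_mult_indicator[of "- {- real n..real n}" lebesgue ?F] by simp
    have "E UNIV (\<lambda>x. 1 * (indicator {- real n..real n} x *\<^sub>R h x) + (-1) * h x) = (\<integral>\<^sup>+x. ennreal (indicator (- {- real n..real n}) x * ?F x) \<partial>lebesgue)"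
      unfolding E_def by (intro nn_integral_cong arg_cong[where f = ennreal]) (auto simp: indicator_def)
    also have "\<dots> = ennreal (\<integral>x. indicator (- {- real n..real n}) x * ?F x \<partial>lebesgue)"
      by (intro nn_integral_eq_integral i) (auto simp: indicator_def)
    also have "\<dots> < ennreal e" using n e by (intro ennreal_lessI)
    finally show "E UNIV (\<lambda>x. 1 * (indicator {- real n..real n} x *\<^sub>R h x) + (-1) * h x) < ennreal e" .
    have "meas {- real n..real n} h" using hm(1) by (rule meas_subset) auto
    then have 1: "meas UNIV (\<lambda>x. indicator {- real n..real n} x *\<^sub>R h x)" unfolding meas_def by simp
    have "E UNIV (\<lambda>x. indicator {- real n..real n} x *\<^sub>R h x) \<le> E UNIV h"
      unfolding E_def by (intro nn_integral_mono ennreal_leI) (auto simp: indicator_def)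
    with hm(2) 1 show "(\<lambda>x. indicator {- real n..real n} x *\<^sub>R h x) \<in> L2w UNIV" by (auto simp: L2w_iff le_less_trans)
  qed
qed

lemma op_dense_range_max:
  "op_dense_range (weight_measure w UNIV) (sl_max_dom w p q UNIV) (op_shift (sl_expr w p q UNIV) l)"
  unfolding op_dense_range_def
proof (intro ballI allI impI)
  let ?T = "sl_expr w p q UNIV" and ?M = "weight_measure w UNIV"
  have U: "(UNIV :: real set) \<in> sets lebesgue" by simp
  fix h and \<epsilon> :: real assume h: "h \<in> L2w UNIV" and \<epsilon>: "0 < \<epsilon>"
  \<comment> \<open>Two errors occur, from cutting off \<open>h\<close> and from the correction
    \<open>k\<close>. \<open>E_lincomb\<close> doubles each of the two energies, so 2 e + 2 e must
    equal \<epsilon>^2.\<close>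
  define e where "e = \<epsilon>\<^sup>2 / 4"
  have e: "e > 0" using \<epsilon> by (simp add: e_def)
  obtain R where R: "E UNIV (\<lambda>x. 1 * (indicator {-R..R} x *\<^sub>R h x) + (-1) * h x) < ennreal e"
    "(\<lambda>x. indicator {-R..R} x *\<^sub>R h x) \<in> L2w UNIV" by (rule truncation[OF h e])
  define g where "g x = indicator {-R..R} x *\<^sub>R h x" for x
  have g: "g \<in> L2w UNIV" using R(2) by (simp add: g_def[abs_def])
  have gs: "g x = 0" if "R < \<bar>x\<bar>" for x using that by (auto simp: g_def indicator_def)
  define eg where "eg = enn2real (E UNIV g)"
  have eg: "E UNIV g = ennreal eg" "eg \<ge> 0" using g by (auto simp: eg_def L2w_iff)
  \<comment> \<open>The correction has energy at most 4/N times that of \<open>g\<close>, which this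
    N pushes below e.\<close>
  obtain N :: nat where "max 1 (4 * eg / e) < real N" using reals_Archimedean2 by blast
  then have N: "N > 0" "4 * eg < e * real N" using e by (auto simp: field_simps)
  obtain k R' where k: "k \<in> L2w UNIV" "\<And>x. R' < \<bar>x\<bar> \<Longrightarrow> k x = 0" "\<And>u v. hom l u v \<Longrightarrow> mom k u = mom g u"
    "ennreal (real N) * E UNIV k \<le> 4 * E UNIV g"
    using moment_preserving_small[OF g gs N(1), where l = l] by blast
  have Ek: "E UNIV k < ennreal e"
  proof -
    have fin: "E UNIV k < \<infinity>" using k by (simp add: L2w_iff)
    have "ennreal (real N * enn2real (E UNIV k)) \<le> ennreal (4 * eg)"
      using k(4) fin eg by (simp add: ennreal_mult less_top)
    then have "real N * enn2real (E UNIV k) \<le> 4 * eg" using eg(2) by simp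
    then have "real N * enn2real (E UNIV k) < real N * e" using N(2) by (simp add: mult.commute)
    then have "enn2real (E UNIV k) < e" using N(1) by simp
    then show ?thesis using fin e by (metis ennreal_enn2real ennreal_lessI infinity_ennreal_def)
  qed
  define g' where "g' x = 1 * g x + (-1) * k x" for x
  have g': "g' \<in> L2w UNIV" unfolding g'_def[abs_def] by (rule L2w_lincomb[OF U g k(1)])
  have gs': "g' x = 0" if "max R R' < \<bar>x\<bar>" for x using that gs k(2) by (auto simp: g'_def)
  have mz: "mom g' u = 0" if u: "hom l u v" for u v
  proof -
    have uc: "continuous_on UNIV u" using u by (auto simp: lin_sys_def intro: AC_deriv_continuous_on)
    have "mom g' u = (\<integral>x. W x * g x * u x - W x * k x * u x \<partial>lebesgue)"
      unfolding mom_def g'_def by (intro Bochner_Integration.integral_cong) (auto simp: algebra_simps)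
    also have "\<dots> = mom g u - mom k u"
      unfolding mom_def using compact_support_integrable[OF g gs uc] compact_support_integrable[OF k(1,2) uc]
      by (rule Bochner_Integration.integral_diff)
    finally show ?thesis using k(3)[OF u] by simp
  qed
  obtain f where f: "f \<in> sl_max_dom w p q UNIV" "AE x in lebesgue. op_shift ?T l f x = g' x"
    using compact_preimage[OF g' gs' mz[OF fundamental(1)] mz[OF fundamental(2)]] by blast
  define r where "r x = op_shift ?T l f x - h x" for x
  have "op_shift ?T l f \<in> L2w UNIV" using f(1) by (auto intro: max_dom_imp)
  from L2w_lincomb[OF U this h, of 1 "-1"] have rL: "r \<in> L2w UNIV" by (simp add: r_def[abs_def])
  have "E UNIV r = E UNIV (\<lambda>x. 1 * (1 * g x + (-1) * h x) + (-1) * k x)"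
    by (rule E_cong_AE) (use f(2) in \<open>eventually_elim, auto simp: r_def g'_def\<close>)
  also have "\<dots> \<le> ennreal (2 * (norm (1::complex))\<^sup>2) * E UNIV (\<lambda>x. 1 * g x + (-1) * h x) + ennreal (2 * (norm (-1::complex))\<^sup>2) * E UNIV k"
    using g h k(1) by (intro E_lincomb meas_lincomb) (auto simp: L2w_iff)
  also have "\<dots> = 2 * E UNIV (\<lambda>x. 1 * g x + (-1) * h x) + 2 * E UNIV k" by simp
  also have "\<dots> \<le> 2 * E UNIV (\<lambda>x. 1 * g x + (-1) * h x) + 2 * ennreal e"
    using Ek by (intro add_left_mono mult_left_mono) auto
  also have "\<dots> < 2 * ennreal e + 2 * ennreal e"
  proof -
    have "E UNIV (\<lambda>x. 1 * g x + (-1) * h x) < ennreal e" using R(1) by (simp add: g_def)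
    then have "2 * E UNIV (\<lambda>x. 1 * g x + (-1) * h x) < 2 * ennreal e" by (intro ennreal_mult_strict_left_mono) auto
    moreover have "2 * ennreal e \<noteq> top" by (simp add: ennreal_mult_eq_top_iff)
    ultimately show ?thesis by (simp add: ennreal_add_left_cancel_less add.commute)
  qed
  also have "\<dots> = ennreal (\<epsilon>\<^sup>2)"
    using ennreal_mult[of 4 e] e by (simp add: e_def distrib_right[symmetric])
  finally have "E UNIV r < ennreal (\<epsilon>\<^sup>2)" .
  then have "enn2real (E UNIV r) < \<epsilon>\<^sup>2" using rL by (subst enn2real_less_iff) (auto simp: L2w_iff)
  then have "sqrt (enn2real (E UNIV r)) < \<epsilon>" using \<epsilon> by (intro real_less_lsqrt) auto
  then have "L2_norm ?M r < \<epsilon>" using rL by (simp add: L2_norm_E L2w_iff)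
  then show "\<exists>f\<in>sl_max_dom w p q UNIV. L2_norm ?M (\<lambda>x. op_shift ?T l f x - h x) < \<epsilon>"
    using f(1) by (auto simp: r_def[abs_def])
qed

end

section \<open>Unboundedness of the inverse\<close>

context sl_periodic
begin

lemma lin_sys_translate_nat:
  assumes "lin_sys UNIV \<alpha> (\<beta> l) \<gamma> u v"
  shows "lin_sys UNIV \<alpha> (\<beta> l) (\<lambda>x. \<gamma> (x + real n * a)) (\<lambda>x. u (x + real n * a)) (\<lambda>x. v (x + real n * a))"
proof (induction n)
  case (Suc n)
  have e: "x + a + real n * a = x + real (Suc n) * a" for x by (simp add: algebra_simps)
  show ?case using lin_sys_translate[OF Suc] unfolding e .
qed (use assms in simp)

lemma W_translate_nat: "W (x + real n * a) = W x"
  by (simp add: W_def w_translate_nat)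

text \<open>A building block for truncations that remain in the domain. With a rough
  \<open>p\<close> a smooth cutoff factor may destroy the absolute continuity of p f', so the
  transition from 0 to a Floquet solution is produced by solving the equation with compactly
  supported data.\<close>

lemma half_line_floquet:
  assumes D: "D l \<in> complex_of_real ` {-2..2}"
  obtains e eh g R u v \<zeta> where "lin_sys UNIV \<alpha> (\<beta> l) (\<lambda>x. W x * g x) e eh" "g \<in> L2w UNIV"
    "\<And>x. R < \<bar>x\<bar> \<Longrightarrow> g x = 0" "\<And>x. x < - R \<Longrightarrow> e x = 0" "\<And>x. R < x \<Longrightarrow> e x = u x" "hom l u v" "u 0 \<noteq> 0 \<or> v 0 \<noteq> 0" "norm \<zeta> = 1"
    "\<And>x. u (x + a) = \<zeta> * u x"
proof -
  obtain \<rho> where \<rho>: "\<rho> \<noteq> 0" "\<rho> + 1 / \<rho> = D l" by (rule exists_multiplier)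
  have n\<rho>: "norm \<rho> = 1" using D multiplier_norm_conv[OF \<rho>(1)] \<rho>(2) by auto
  \<comment> \<open>Chosen so that w g \<phi> = |w| |\<phi>|^2 on the cell. Its integral is
    positive, hence the solution \<open>u\<close> emitted to the right is nonzero.\<close>
  define g where "g x = indicator {0..a} x *\<^sub>R (of_real (sgn (w x)) * cnj (\<phi> l x))" for x
  have [measurable]: "w \<in> borel_measurable lebesgue" "\<phi> l \<in> borel_measurable lebesgue"
    using w_meas meas_continuous_UNIV[OF continuous_fundamental(1)[of l]] by (auto simp: meas_UNIV)
  have \<phi>m: "meas I (\<phi> l)" if "I \<in> sets lebesgue" for I
    using meas_subset[OF meas_continuous_UNIV[OF continuous_fundamental(1)[of l]]] that by auto
  have gm: "meas UNIV g"
  proof -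
    have "(\<lambda>x. cnj (\<phi> l x)) \<in> borel_measurable lebesgue"
      using meas_continuous_UNIV[OF continuous_on_cnj[OF continuous_fundamental(1)[of l]]] by (simp add: meas_UNIV)
    moreover have "(\<lambda>x. sgn (w x)) \<in> borel_measurable lebesgue" unfolding sgn_if by measurable
    ultimately have "(\<lambda>x. of_real (sgn (w x)) * cnj (\<phi> l x)) \<in> borel_measurable lebesgue" by measurable
    from borel_measurable_scaleR[OF borel_measurable_indicator this, of "{0..a}"] show ?thesis
      unfolding meas_UNIV g_def by simp
  qed
  have gs: "g x = 0" if "a < \<bar>x\<bar>" for x using that by (auto simp: g_def indicator_def)
  obtain C where C: "C > 0" "\<And>x. x \<in> {0..a} \<Longrightarrow> norm (\<phi> l x) \<le> C \<and> norm (\<psi> l x) \<le> C \<and> norm (\<phi>1 l x) \<le> C \<and> norm (\<psi>1 l x) \<le> C"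
    using fundamental_bounded[of 0 a l] by blast
  have "E UNIV g = E {0..a} g"
    unfolding E_def by (intro nn_integral_cong arg_cong[where f = ennreal]) (auto simp: g_def indicator_def)
  also have "\<dots> \<le> ennreal (C\<^sup>2) * E {0..a} (\<lambda>_. 1)"
  proof (rule E_bounded)
    fix x assume x: "x \<in> {0..a}"
    have "norm (of_real (sgn (w x)) * cnj (\<phi> l x)) \<le> 1 * C"
      unfolding norm_mult using C(2)[OF x] by (intro mult_mono) (auto simp: sgn_if)
    then show "norm (g x) \<le> C" using x by (simp add: g_def)
  qed simp
  also have "\<dots> < \<infinity>" using E_one_finite by (simp add: ennreal_mult_less_top)
  finally have gL: "g \<in> L2w UNIV" using gm by (simp add: L2w_iff)
  have mom: "mom g (\<phi> l) \<noteq> 0"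
  proof
    assume z: "mom g (\<phi> l) = 0"
    let ?F = "\<lambda>x. indicator {0..a} x * (\<bar>w x\<bar> * (norm (\<phi> l x))\<^sup>2)"
    have "W x * g x * \<phi> l x = complex_of_real (?F x)" for x
    proof -
      have "W x * (of_real (sgn (w x)) * cnj (\<phi> l x)) * \<phi> l x = complex_of_real (w x * sgn (w x)) * (\<phi> l x * cnj (\<phi> l x))"
        by (simp add: W_def)
      also have "\<dots> = complex_of_real (\<bar>w x\<bar> * (norm (\<phi> l x))\<^sup>2)"
        unfolding complex_norm_square[symmetric] by (simp add: linordered_idom_class.abs_sgn)
      finally show ?thesis by (cases "x \<in> {0..a}") (simp_all add: g_def)
    qed
    then have eq: "(\<lambda>x. Re (W x * g x * \<phi> l x)) = ?F" by auto
    have "(\<integral>x. ?F x \<partial>lebesgue) = Re (mom g (\<phi> l))"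
      unfolding mom_def eq[symmetric]
      by (rule integral_Re[OF compact_support_integrable[OF gL gs continuous_fundamental(1)]])
    then have "(\<integral>x. ?F x \<partial>lebesgue) = 0" using z by simp
    moreover have "(\<integral>x. ?F x \<partial>lebesgue) = enn2real (E {0..a} (\<phi> l))"
      unfolding E_def using meas_weight[OF \<phi>m, of "{0..a}"] by (intro integral_eq_nn_integral) auto
    moreover have "E {0..a} (\<phi> l) < \<infinity>"
      using L2w_continuous[OF continuous_on_subset[OF continuous_fundamental(1)[of l]], of 0 a] by (simp add: L2w_iff)
    ultimately have "E {0..a} (\<phi> l) = 0" by (auto simp: enn2real_eq_0_iff)
    moreover have "E {0..<a} (\<phi> l) \<le> E {0..a} (\<phi> l)" by (rule E_mono) auto
    ultimately have "E {0..<a} (\<phi> l) = 0" by simp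
    then have "\<phi> l 0 = 0" using hom_E_cell_zero[OF fundamental(1) \<phi>m] by simp
    then show False by (simp add: fundamental)
  qed
  obtain e eh where e: "lin_sys UNIV \<alpha> (\<beta> l) (\<lambda>x. W x * g x) e eh" "\<And>x. x < - a \<Longrightarrow> e x = 0"
    "\<And>x. a < x \<Longrightarrow> e x = mom g (\<psi> l) * \<phi> l x - mom g (\<phi> l) * \<psi> l x"
    using causal_solution[OF gL gs, where l = l] by blast
  define u where "u x = mom g (\<psi> l) * \<phi> l x + (- mom g (\<phi> l)) * \<psi> l x" for x
  define v where "v x = mom g (\<psi> l) * \<phi>1 l x + (- mom g (\<phi> l)) * \<psi>1 l x" for x
  have uh: "hom l u v" unfolding u_def[abs_def] v_def[abs_def] by (rule hom_lincomb[OF fundamental(1,2)])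
  have v0: "v 0 \<noteq> 0" using mom by (simp add: v_def fundamental)
  have eu: "e x = u x" if "a < x" for x using e(3)[OF that] by (simp add: u_def)
  \<comment> \<open>The emitted solution need not be Floquet. By the three-term relation, shift
    minus 1/\<rho> maps it to a solution with multiplier \<rho>; if the result vanishes,
    \<open>u\<close> itself has multiplier 1/\<rho>.\<close>
  define y where "y x = 1 * u (x + a) + (- (1 / \<rho>)) * u x" for x
  define z where "z x = 1 * v (x + a) + (- (1 / \<rho>)) * v x" for x
  have uh1: "hom l (\<lambda>x. u (x + a)) (\<lambda>x. v (x + a))" using lin_sys_translate[OF uh] by simp
  have yh: "hom l y z" unfolding y_def[abs_def] z_def[abs_def] by (rule hom_lincomb[OF uh1 uh])
  show thesis
  proof (cases "y 0 = 0 \<and> z 0 = 0")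
    case True
    have "y x = 0" for x using hom_rep(1)[OF yh, of x] True by simp
    then have "u (x + a) = (1 / \<rho>) * u x" for x by (simp add: y_def)
    then show thesis
      using n\<rho> by (intro that[OF e(1) gL gs e(2) eu uh _ _, where \<zeta> = "1 / \<rho>"]) (use v0 in \<open>auto simp: norm_divide\<close>)
  next
    case False
    have yr: "y (x + a) = \<rho> * y x" for x
    proof -
      have "y (x + a) = (D l - 1 / \<rho>) * u (x + a) - u x"
        using hom_three_term(1)[OF uh, of x] by (simp add: y_def algebra_simps)
      also have "D l - 1 / \<rho> = \<rho>" using \<rho>(2) by (simp add: algebra_simps)
      also have "\<rho> * u (x + a) - u x = \<rho> * y x" using \<rho>(1) by (simp add: y_def algebra_simps)
      finally show ?thesis .
    qed
    define g' where "g' x = 1 * g (x + a) + (- (1 / \<rho>)) * g x" for x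
    have gt: "(\<lambda>x. g (x + a)) \<in> L2w UNIV" using E_translate_UNIV[OF gm, of a] w_per gL by (simp add: L2w_iff)
    have g'L: "g' \<in> L2w UNIV" unfolding g'_def[abs_def] by (rule L2w_lincomb[OF _ gt gL]) simp
    have "lin_sys UNIV \<alpha> (\<beta> l) (\<lambda>x. 1 * (W (x + a) * g (x + a)) + (- (1 / \<rho>)) * (W x * g x))
      (\<lambda>x. 1 * e (x + a) + (- (1 / \<rho>)) * e x) (\<lambda>x. 1 * eh (x + a) + (- (1 / \<rho>)) * eh x)"
      by (rule lin_sys_lincomb[OF lin_sys_translate[OF e(1)] e(1)])
    moreover have "1 * (W (x + a) * g (x + a)) + (- (1 / \<rho>)) * (W x * g x) = W x * g' x" for x
      unfolding coeff_per by (simp add: g'_def algebra_simps)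
    ultimately have e': "lin_sys UNIV \<alpha> (\<beta> l) (\<lambda>x. W x * g' x)
      (\<lambda>x. 1 * e (x + a) + (- (1 / \<rho>)) * e x) (\<lambda>x. 1 * eh (x + a) + (- (1 / \<rho>)) * eh x)" by simp
    show thesis
    proof (rule that[OF e' g'L _ _ _ yh _ n\<rho> yr, of "2 * a"])
      show "g' x = 0" if "2 * a < \<bar>x\<bar>" for x
      proof -
        have "a < \<bar>x + a\<bar>" "a < \<bar>x\<bar>" using that a_pos by linarith+
        then show ?thesis by (simp add: g'_def gs)
      qed
      show "1 * e (x + a) + (- (1 / \<rho>)) * e x = 0" if "x < - (2 * a)" for x
        using e(2)[of x] e(2)[of "x + a"] that a_pos by simp
      show "1 * e (x + a) + (- (1 / \<rho>)) * e x = y x" if "2 * a < x" for x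
        using eu[of x] eu[of "x + a"] that a_pos by (simp add: y_def)
    qed (use False in auto)
  qed
qed

text \<open>Subtracting \<zeta>^N times \<open>e\<close> from its translate by N periods cancels the
  tails on the right. The image keeps energy at most 4 E(g) independently of N, while the function
  has the modulus of \<open>u\<close> on nearly N cells, so no bound for the inverse can
  hold.\<close>

lemma spectrum_inside:
  assumes D: "D l \<in> complex_of_real ` {-2..2}"
  shows "l \<notin> rho_A w p q"
proof
  let ?T = "sl_expr w p q UNIV" and ?M = "weight_measure w UNIV"
  have U: "(UNIV :: real set) \<in> sets lebesgue" by simp
  assume "l \<in> rho_A w p q"
  then obtain C where C: "\<And>f. f \<in> sl_max_dom w p q UNIV \<Longrightarrow> L2_norm ?M f \<le> C * L2_norm ?M (op_shift ?T l f)"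
    unfolding rho_A_def resolvent_set_def op_bounded_inverse_def by auto
  obtain e eh g R u v \<zeta> where e: "lin_sys UNIV \<alpha> (\<beta> l) (\<lambda>x. W x * g x) e eh" and gL: "g \<in> L2w UNIV"
    and gs: "\<And>x. R < \<bar>x\<bar> \<Longrightarrow> g x = 0" and e0: "\<And>x. x < - R \<Longrightarrow> e x = 0" and eu: "\<And>x. R < x \<Longrightarrow> e x = u x"
    and uh: "hom l u v" and u0: "u 0 \<noteq> 0 \<or> v 0 \<noteq> 0" and \<zeta>: "norm \<zeta> = 1" and uz: "\<And>x. u (x + a) = \<zeta> * u x"
    by (rule half_line_floquet[OF D]) (rule that)
  have uc: "continuous_on UNIV u" using uh by (auto simp: lin_sys_def intro: AC_deriv_continuous_on)
  have um: "meas I u" if "I \<in> sets lebesgue" for I using meas_subset[OF meas_continuous_UNIV[OF uc]] that by auto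
  have un: "u (x + real n * a) = \<zeta> ^ n * u x" for x n
  proof (induction n)
    case (Suc n)
    have "u (x + real (Suc n) * a) = u (x + real n * a + a)" by (simp add: algebra_simps)
    then show ?case by (simp add: uz Suc)
  qed simp
  have nun: "norm (u (x + real n * a)) = norm (u x)" for x n by (simp add: un norm_mult norm_power \<zeta>)
  define \<epsilon> where "\<epsilon> = E {0..<a} u"
  have \<epsilon>0: "\<epsilon> \<noteq> 0" using hom_E_cell_zero[OF uh um] u0 unfolding \<epsilon>_def by auto
  have cell: "E {- (real k * a)..<a - real k * a} u = \<epsilon>" for k
  proof -
    have v: "(\<lambda>x. x + - (real k * a)) -` {- (real k * a)..<a - real k * a} = {0..<a}" by auto
    have "E {- (real k * a)..<a - real k * a} u = E {0..<a} (\<lambda>x. u (x - real k * a))"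
      using E_translate[OF um, of "{- (real k * a)..<a - real k * a}" "- (real k * a)"] w_translate_nat_minus unfolding v by simp
    also have "\<dots> = \<epsilon>" unfolding \<epsilon>_def E_def using nun[of "_ - real k * a" k] by simp
    finally show ?thesis .
  qed
  have gm: "meas UNIV g" "E UNIV g < \<infinity>" using gL by (auto simp: L2w_iff)
  obtain r :: nat where "R / a < real r" using reals_Archimedean2 by blast
  then have r: "R < real r * a" using a_pos by (simp add: pos_divide_less_eq)
  have bound: "of_nat n * \<epsilon> \<le> ennreal (C\<^sup>2) * (4 * E UNIV g)" for n
  proof -
    \<comment> \<open>The transition regions may occupy r cells at either end; exactly n full cells
      remain.\<close>
    define N where "N = n + 2 * r"
    define f where "f x = 1 * e (x + real N * a) + (- (\<zeta> ^ N)) * e x" for x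
    define fh where "fh x = 1 * eh (x + real N * a) + (- (\<zeta> ^ N)) * eh x" for x
    define G where "G x = 1 * g (x + real N * a) + (- (\<zeta> ^ N)) * g x" for x
    have "lin_sys UNIV \<alpha> (\<beta> l) (\<lambda>x. 1 * (W (x + real N * a) * g (x + real N * a)) + (- (\<zeta> ^ N)) * (W x * g x)) f fh"
      unfolding f_def[abs_def] fh_def[abs_def] by (rule lin_sys_lincomb[OF lin_sys_translate_nat[OF e] e])
    moreover have "1 * (W (x + real N * a) * g (x + real N * a)) + (- (\<zeta> ^ N)) * (W x * g x) = W x * G x" for x
      unfolding W_translate_nat by (simp add: G_def algebra_simps)
    ultimately have fs: "lin_sys UNIV \<alpha> (\<beta> l) (\<lambda>x. W x * G x) f fh" by simp
    have tg: "meas UNIV (\<lambda>x. g (x + real N * a))" "E UNIV (\<lambda>x. g (x + real N * a)) = E UNIV g"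
      using E_translate_UNIV[OF gm(1), of "real N * a"] w_translate_nat by auto
    have EG: "E UNIV G \<le> 4 * E UNIV g"
    proof -
      have "E UNIV G \<le> ennreal (2 * (norm (1::complex))\<^sup>2) * E UNIV (\<lambda>x. g (x + real N * a)) + ennreal (2 * (norm (- (\<zeta> ^ N)))\<^sup>2) * E UNIV g"
        unfolding G_def[abs_def] by (rule E_lincomb[OF tg(1) gm(1)])
      also have "\<dots> = 2 * E UNIV g + 2 * E UNIV g" by (simp add: tg(2) norm_power \<zeta>)
      also have "\<dots> = 4 * E UNIV g" by (simp add: distrib_right[symmetric])
      finally show ?thesis .
    qed
    have Gm: "meas UNIV G" unfolding G_def[abs_def] by (rule meas_lincomb[OF tg(1) gm(1)])
    have "4 * E UNIV g < \<infinity>" using gm(2) by (simp add: ennreal_mult_less_top)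
    with EG have "E UNIV G < \<infinity>" by (rule le_less_trans)
    with Gm have GL: "G \<in> L2w UNIV" by (simp add: L2w_iff)
    have fc: "continuous_on UNIV f" using fs by (auto simp: lin_sys_def intro: AC_deriv_continuous_on)
    have Na: "real N * a \<ge> 0" using a_pos by simp
    have fL: "f \<in> L2w UNIV"
    proof (rule compact_support_L2w[OF fc])
      fix x assume x: "\<bar>R\<bar> + real N * a < \<bar>x\<bar>"
      show "f x = 0"
      proof (cases "x > 0")
        case True
        then have "R < x" "R < x + real N * a" using x Na by linarith+
        then show ?thesis by (simp add: f_def eu un)
      next
        case False
        then have "x < - R" "x + real N * a < - R" using x Na by linarith+
        then show ?thesis by (simp add: f_def e0)
      qed
    qed
    note fd = max_dom_intro[OF admissible_interval_UNIV fs fL GL]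
    have oL: "op_shift ?T l f \<in> L2w UNIV" using fd(1) by (auto intro: max_dom_imp)
    have "E UNIV (op_shift ?T l f) = E UNIV G" by (rule E_cong_AE) (use fd(2) in simp)
    then have "sqrt (enn2real (E UNIV f)) \<le> C * sqrt (enn2real (E UNIV G))"
      using C[OF fd(1)] fL oL by (simp add: L2_norm_E L2w_iff)
    then have "(sqrt (enn2real (E UNIV f)))\<^sup>2 \<le> (C * sqrt (enn2real (E UNIV G)))\<^sup>2" by (intro power_mono) auto
    then have "enn2real (E UNIV f) \<le> C\<^sup>2 * enn2real (E UNIV G)" by (simp add: power_mult_distrib)
    then have "ennreal (enn2real (E UNIV f)) \<le> ennreal (C\<^sup>2 * enn2real (E UNIV G))" by (rule ennreal_leI)
    then have Ef: "E UNIV f \<le> ennreal (C\<^sup>2) * E UNIV G" using fL GL by (simp add: ennreal_mult L2w_iff)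
    let ?S = "{r + 1..N - r}"
    have "of_nat n * \<epsilon> = (\<Sum>k\<in>?S. \<epsilon>)" by (simp add: N_def)
    also have "\<dots> = (\<Sum>k\<in>?S. E {- (real k * a)..<a - real k * a} f)"
    proof (intro sum.cong refl)
      fix k assume k: "k \<in> ?S"
      have "E {- (real k * a)..<a - real k * a} f = E {- (real k * a)..<a - real k * a} u"
        unfolding E_def
      proof (intro nn_integral_cong arg_cong[where f = ennreal])
        fix x
        show "indicator {- (real k * a)..<a - real k * a} x * (\<bar>w x\<bar> * (norm (f x))\<^sup>2) = indicator {- (real k * a)..<a - real k * a} x * (\<bar>w x\<bar> * (norm (u x))\<^sup>2)"
        proof (cases "x \<in> {- (real k * a)..<a - real k * a}")
          case True
          have "real r * a + a \<le> real k * a" using k a_pos mult_right_mono[of "real (r + 1)" "real k" a] by (simp add: algebra_simps)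
          moreover have "r + k \<le> N" using k by (auto simp: N_def)
          then have "real (r + k) * a \<le> real N * a" using a_pos by (intro mult_right_mono) auto
          then have "real r * a + real k * a \<le> real N * a" by (simp add: algebra_simps)
          ultimately have "x < - R" "R < x + real N * a" using True r by auto
          then have "f x = u (x + real N * a)" by (simp add: f_def e0 eu)
          then show ?thesis by (simp add: nun)
        qed simp
      qed
      then show "\<epsilon> = E {- (real k * a)..<a - real k * a} f" using cell by simp
    qed
    also have "\<dots> \<le> E UNIV f"
    proof (rule sum_E_disjoint_le)
      have lt: "real (Suc i) * a \<le> real j * a" if "i < j" for i j :: nat
        using that a_pos by (intro mult_right_mono) auto
      show "disjoint_family_on (\<lambda>k. {- (real k * a)..<a - real k * a}) ?S"
        unfolding disjoint_family_on_def
      proof (intro ballI impI)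
        fix i j :: nat assume "i \<noteq> j"
        then consider "i < j" | "j < i" by linarith
        then show "{- (real i * a)..<a - real i * a} \<inter> {- (real j * a)..<a - real j * a} = {}"
          by cases (use lt[of i j] lt[of j i] in \<open>auto simp: algebra_simps\<close>)
      qed
    qed (use fL in \<open>auto simp: L2w_iff\<close>)
    also have "\<dots> \<le> ennreal (C\<^sup>2) * (4 * E UNIV g)" by (rule order_trans[OF Ef mult_left_mono[OF EG]]) simp
    finally show ?thesis .
  qed
  have fin: "ennreal (C\<^sup>2) * (4 * E UNIV g) < \<infinity>" using gm(2) by (simp add: ennreal_mult_less_top)
  have "of_nat 1 * \<epsilon> < \<infinity>" using bound[of 1] fin by (rule le_less_trans)
  then have "\<epsilon> < \<infinity>" by simp
  with \<epsilon>0 have ep: "enn2real \<epsilon> > 0" by (simp add: enn2real_positive_iff zero_less_iff_neq_zero)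
  obtain n :: nat where n: "enn2real (ennreal (C\<^sup>2) * (4 * E UNIV g)) / enn2real \<epsilon> < real n" using reals_Archimedean2 by blast
  have "enn2real (of_nat n * \<epsilon>) \<le> enn2real (ennreal (C\<^sup>2) * (4 * E UNIV g))" using bound[of n] fin by (intro enn2real_mono) auto
  then have "real n * enn2real \<epsilon> \<le> enn2real (ennreal (C\<^sup>2) * (4 * E UNIV g))" by (simp add: enn2real_mult)
  then show False using n ep by (simp add: pos_divide_less_eq)
qed

lemma rho_A_eq: "rho_A w p q = {l. D l \<notin> complex_of_real ` {-2..2}}"
  using resolvent_outside spectrum_inside by blast

lemma sigma_A_eq: "sigma_A w p q = {l. D l \<in> complex_of_real ` {-2..2}}"
  using rho_A_eq unfolding sigma_A_def rho_A_def op_spectrum_def by blast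

lemma sigma_c_A_eq: "sigma_c_A w p q = sigma_A w p q"
  unfolding sigma_c_A_def sigma_A_def continuous_spectrum_def using op_injective_max op_dense_range_max by blast

end

section \<open>Dependence on the spectral parameter\<close>

lemma has_field_derivative_quadratic_bound:
  fixes f :: "complex \<Rightarrow> complex"
  assumes "\<delta> > 0" "\<And>\<mu>. norm (\<mu> - l) < \<delta> \<Longrightarrow> norm (f \<mu> - f l - (\<mu> - l) * d) \<le> K * (norm (\<mu> - l))\<^sup>2"
  shows "(f has_field_derivative d) (at l)"
  unfolding has_field_derivative_def has_derivative_at_alt
proof (intro conjI allI impI bounded_linear_mult_right)
  fix e :: real assume e: "0 < e"
  show "\<exists>d'>0. \<forall>y. norm (y - l) < d' \<longrightarrow> norm (f y - f l - d * (y - l)) \<le> e * norm (y - l)"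
  proof (intro exI[of _ "min \<delta> (e / (\<bar>K\<bar> + 1))"] conjI allI impI)
    show "0 < min \<delta> (e / (\<bar>K\<bar> + 1))" using assms(1) e by simp
    fix y assume y: "norm (y - l) < min \<delta> (e / (\<bar>K\<bar> + 1))"
    then have "norm (y - l) * (\<bar>K\<bar> + 1) \<le> e" by (simp add: pos_less_divide_eq less_imp_le)
    moreover have "K * norm (y - l) \<le> norm (y - l) * (\<bar>K\<bar> + 1)"
    proof -
      have "K * norm (y - l) \<le> \<bar>K\<bar> * norm (y - l)" by (intro mult_right_mono) auto
      then show ?thesis using norm_ge_zero[of "y - l"] unfolding distrib_left mult.commute[of "norm (y - l)"] by linarith
    qed
    ultimately have "K * norm (y - l) \<le> e" by linarith
    then have "K * norm (y - l) * norm (y - l) \<le> e * norm (y - l)" by (intro mult_right_mono) auto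
    then show "norm (f y - f l - d * (y - l)) \<le> e * norm (y - l)"
      using assms(2)[of y] y by (simp add: power2_eq_square mult.commute mult.left_commute)
  qed
qed

lemma AC_deriv_cnj:
  assumes "AC_deriv I f g"
  shows "AC_deriv I (\<lambda>x. cnj (f x)) (\<lambda>x. cnj (g x))"
  unfolding AC_deriv_def
proof (intro allI impI)
  fix x y assume xy: "x \<le> y \<and> {x..y} \<subseteq> I"
  have i: "integrable lebesgue (\<lambda>t. indicator {x..y} t *\<^sub>R g t)" "(\<integral>t. indicator {x..y} t *\<^sub>R g t \<partial>lebesgue) = f y - f x"
    using AC_derivD[OF assms, of x y] xy by (auto simp: set_integrable_def set_lebesgue_integral_def)
  have e: "cnj (indicator {x..y} t *\<^sub>R g t) = indicator {x..y} t *\<^sub>R cnj (g t)" for t by simp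
  have "integrable lebesgue (\<lambda>t. cnj (indicator {x..y} t *\<^sub>R g t))" "(\<integral>t. cnj (indicator {x..y} t *\<^sub>R g t) \<partial>lebesgue) = cnj (f y - f x)"
    using i by (auto simp del: complex_cnj_scaleR)
  then show "set_integrable lebesgue {x..y} (\<lambda>x. cnj (g x)) \<and> (LINT t:{x..y}|lebesgue. cnj (g t)) = cnj (f y) - cnj (f x)"
    unfolding e set_integrable_def set_lebesgue_integral_def by simp
qed

context sl_periodic
begin

definition wbar :: real where "wbar = enn2real (L1w {0..a} (\<lambda>_. 1))"

lemma wbar_nonneg: "wbar \<ge> 0" by (simp add: wbar_def)

lemma W_integral_bound:
  assumes u: "continuous_on UNIV u" and K: "\<And>x. x \<in> {0..a} \<Longrightarrow> norm (u x) \<le> K" and x: "x \<in> {0..a}"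
  shows "norm (LINT t:{0..x}|lebesgue. W t * u t) \<le> K * wbar"
proof -
  have K0: "0 \<le> K" using K[OF x] norm_ge_zero[of "u x"] by linarith
  have "set_integrable lebesgue {0..x} (\<lambda>t. W t * 1 * u t)"
    using loc_integrable_mult_continuous[OF loc_integrable_coeff(2) u] by (simp add: loc_integrable_def)
  moreover have "meas {0..a} (\<lambda>_. 1)" by (rule meas_continuous) simp
  ultimately have "ennreal (norm (LINT t:{0..x}|lebesgue. W t * 1 * u t)) \<le> ennreal K * L1w {0..a} (\<lambda>_. 1)"
    using x K K0 by (intro norm_set_integral_le_L1w) auto
  also have "L1w {0..a} (\<lambda>_. 1) = ennreal wbar"
    using L1w_finite[OF L2w_continuous[OF continuous_on_const], of 0 a 1] by (simp add: wbar_def)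
  also have "ennreal K * ennreal wbar = ennreal (K * wbar)" using K0 by (simp add: ennreal_mult wbar_nonneg)
  finally show ?thesis using K0 wbar_nonneg by simp
qed

text \<open>A solution at \<mu> solves the inhomogeneous equation at l with data (\<mu> - l) W u, so
  variation of constants at l compares the two.\<close>

lemma perturbation_formula:
  assumes u: "hom \<mu> u v" and ul: "hom l ul vl" and i: "u 0 = ul 0" "v 0 = vl 0" and x: "0 \<le> x"
  shows "u x = ul x + (\<mu> - l) * ((LINT t:{0..x}|lebesgue. W t * (u t * \<psi> l t)) * \<phi> l x - (LINT t:{0..x}|lebesgue. W t * (u t * \<phi> l t)) * \<psi> l x)"
    "v x = vl x + (\<mu> - l) * ((LINT t:{0..x}|lebesgue. W t * (u t * \<psi> l t)) * \<phi>1 l x - (LINT t:{0..x}|lebesgue. W t * (u t * \<phi> l t)) * \<psi>1 l x)"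
proof -
  have s: "lin_sys UNIV \<alpha> (\<beta> l) (\<lambda>x. (\<mu> - l) * (W x * u x)) u v"
    unfolding lin_sys_def
  proof
    show "AC_deriv UNIV u (\<lambda>x. \<alpha> x * v x)" using u by (simp add: lin_sys_def)
    have "AC_deriv UNIV v (\<lambda>x. \<beta> \<mu> x * u x - 0)" using u by (simp add: lin_sys_def)
    then show "AC_deriv UNIV v (\<lambda>x. \<beta> l x * u x - (\<mu> - l) * (W x * u x))"
      by (rule AC_deriv_cong) (auto simp: \<beta>_def algebra_simps)
  qed
  note vc = variation_of_constants[OF s]
  have f0: "\<phi> l 0 = 1" "\<phi>1 l 0 = 0" "\<psi> l 0 = 0" "\<psi>1 l 0 = 1" by (rule fundamental)+
  have e: "(\<mu> - l) * (W t * u t) * f t = (\<mu> - l) * (W t * (u t * f t))" for t f by (simp add: mult.assoc)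
  have A: "u x * \<psi>1 l x - v x * \<psi> l x = ul 0 + (\<mu> - l) * (LINT t:{0..x}|lebesgue. W t * (u t * \<psi> l t))"
    using AC_derivD(2)[OF vc(1) x, unfolded e set_integral_mult_right] f0 i by (simp add: algebra_simps)
  have B: "u x * \<phi>1 l x - v x * \<phi> l x = - vl 0 + (\<mu> - l) * (LINT t:{0..x}|lebesgue. W t * (u t * \<phi> l t))"
    using AC_derivD(2)[OF vc(2) x, unfolded e set_integral_mult_right] f0 i by (simp add: algebra_simps)
  show "u x = ul x + (\<mu> - l) * ((LINT t:{0..x}|lebesgue. W t * (u t * \<psi> l t)) * \<phi> l x - (LINT t:{0..x}|lebesgue. W t * (u t * \<phi> l t)) * \<psi> l x)"
    using vc(3)[of x] unfolding A B hom_rep(1)[OF ul, of x] by (simp add: algebra_simps)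
  show "v x = vl x + (\<mu> - l) * ((LINT t:{0..x}|lebesgue. W t * (u t * \<psi> l t)) * \<phi>1 l x - (LINT t:{0..x}|lebesgue. W t * (u t * \<phi> l t)) * \<psi>1 l x)"
    using vc(4)[of x] unfolding A B hom_rep(2)[OF ul, of x] by (simp add: algebra_simps)
qed

lemma hom_continuous: "hom l u v \<Longrightarrow> continuous_on UNIV u" "hom l u v \<Longrightarrow> continuous_on UNIV v"
  by (auto simp: lin_sys_def intro: AC_deriv_continuous_on)

lemma norm_lincomb_le:
  fixes x y f g :: complex
  assumes "norm x \<le> X" "norm y \<le> X" "norm f \<le> C" "norm g \<le> C"
  shows "norm (x * f - y * g) \<le> 2 * (X * C)"
proof -
  have X0: "0 \<le> X" using order_trans[OF norm_ge_zero assms(1)] .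
  have "norm (x * f - y * g) \<le> norm x * norm f + norm y * norm g"
    by (metis norm_mult norm_triangle_ineq4)
  also have "\<dots> \<le> X * C + X * C" using assms X0 by (intro add_mono mult_mono) auto
  also have "\<dots> = 2 * (X * C)" by simp
  finally show ?thesis .
qed

text \<open>The formula is implicit, since U \<mu> also stands on the right. At the point where |U
  \<mu>| is maximal, this term is absorbed into the left side once |\<mu> - l| k \<le> 1/2, which
  gives a bound uniform in \<mu>.\<close>

lemma perturbation:
  assumes U: "\<And>\<mu>. hom \<mu> (U \<mu>) (V \<mu>)" and U0: "\<And>\<mu>. U \<mu> 0 = c" "\<And>\<mu>. V \<mu> 0 = d"
  obtains \<delta> K where "\<delta> > 0" "K \<ge> 0"
    "\<And>\<mu> x. norm (\<mu> - l) < \<delta> \<Longrightarrow> x \<in> {0..a} \<Longrightarrow> norm (U \<mu> x - U l x) \<le> K * norm (\<mu> - l) \<and> norm (V \<mu> x - V l x) \<le> K * norm (\<mu> - l)"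
proof -
  obtain C where C: "C > 0" "\<And>x. x \<in> {0..a} \<Longrightarrow> norm (\<phi> l x) \<le> C \<and> norm (\<psi> l x) \<le> C \<and> norm (\<phi>1 l x) \<le> C \<and> norm (\<psi>1 l x) \<le> C"
    using fundamental_bounded[of 0 a l] by blast
  define k where "k = 2 * (C * wbar * C)"
  have k0: "k \<ge> 0" using C wbar_nonneg by (simp add: k_def)
  define M1 where "M1 = 2 * ((norm c + norm d) * C)"
  have M10: "M1 \<ge> 0" using C by (simp add: M1_def)
  have B: "norm (U \<mu> x - U l x) \<le> norm (\<mu> - l) * (M * k) \<and> norm (V \<mu> x - V l x) \<le> norm (\<mu> - l) * (M * k)"
    if M: "\<And>x. x \<in> {0..a} \<Longrightarrow> norm (U \<mu> x) \<le> M" and x: "x \<in> {0..a}" for \<mu> x M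
  proof -
    have M0: "M \<ge> 0" using M[OF x] norm_ge_zero order_trans by blast
    have I: "norm (LINT t:{0..x}|lebesgue. W t * (U \<mu> t * f t)) \<le> M * C * wbar" if "continuous_on UNIV f" "\<And>x. x \<in> {0..a} \<Longrightarrow> norm (f x) \<le> C" for f
      using M M0 that hom_continuous(1)[OF U]
      by (intro W_integral_bound x continuous_intros) (auto simp: norm_mult intro!: mult_mono)
    have I12: "norm (LINT t:{0..x}|lebesgue. W t * (U \<mu> t * \<psi> l t)) \<le> M * C * wbar" "norm (LINT t:{0..x}|lebesgue. W t * (U \<mu> t * \<phi> l t)) \<le> M * C * wbar"
      using C(2) continuous_fundamental by (auto intro!: I)
    have x0: "0 \<le> x" using x by simp
    note pf = perturbation_formula[OF U U _ _ x0, of \<mu> l]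
    have "norm (U \<mu> x - U l x) = norm (\<mu> - l) * norm ((LINT t:{0..x}|lebesgue. W t * (U \<mu> t * \<psi> l t)) * \<phi> l x - (LINT t:{0..x}|lebesgue. W t * (U \<mu> t * \<phi> l t)) * \<psi> l x)"
      by (subst pf(1)) (simp_all add: U0 norm_mult)
    also have "\<dots> \<le> norm (\<mu> - l) * (2 * (M * C * wbar * C))"
      using C(2)[OF x] I12 by (intro mult_left_mono norm_lincomb_le) auto
    finally have 1: "norm (U \<mu> x - U l x) \<le> norm (\<mu> - l) * (M * k)" by (simp add: k_def mult_ac)
    have "norm (V \<mu> x - V l x) = norm (\<mu> - l) * norm ((LINT t:{0..x}|lebesgue. W t * (U \<mu> t * \<psi> l t)) * \<phi>1 l x - (LINT t:{0..x}|lebesgue. W t * (U \<mu> t * \<phi> l t)) * \<psi>1 l x)"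
      by (subst pf(2)) (simp_all add: U0 norm_mult)
    also have "\<dots> \<le> norm (\<mu> - l) * (2 * (M * C * wbar * C))"
      using C(2)[OF x] I12 by (intro mult_left_mono norm_lincomb_le) auto
    finally show ?thesis using 1 by (simp add: k_def mult_ac)
  qed
  show thesis
  \<comment> \<open>The radius 1/(2 k + 1) ensures |\<mu> - l| k \<le> 1/2 and stays positive for k
    = 0; absorbing the term doubles the bound for U l, whence \<open>M1\<close>.\<close>
  proof (rule that[of "1 / (2 * k + 1)" "M1 * k"])
    show "1 / (2 * k + 1) > 0" "M1 * k \<ge> 0" using k0 M10 by auto
    fix \<mu> x assume \<mu>: "norm (\<mu> - l) < 1 / (2 * k + 1)" and x: "x \<in> {0..a}"
    have "norm (\<mu> - l) * (2 * k + 1) < 1" using \<mu> k0 by (simp add: pos_less_divide_eq)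
    then have small: "norm (\<mu> - l) * k \<le> 1 / 2" using norm_ge_zero[of "\<mu> - l"] unfolding distrib_left by linarith
    have "continuous_on {0..a} (\<lambda>x. norm (U \<mu> x))"
      using hom_continuous(1)[OF U] by (intro continuous_intros continuous_on_subset[OF hom_continuous(1)[OF U]]) auto
    then obtain x0 where x0: "x0 \<in> {0..a}" "\<And>y. y \<in> {0..a} \<Longrightarrow> norm (U \<mu> y) \<le> norm (U \<mu> x0)"
      using continuous_attains_sup[of "{0..a}" "\<lambda>x. norm (U \<mu> x)"] a_pos by auto
    have "norm (U l x0) \<le> norm c * norm (\<phi> l x0) + norm d * norm (\<psi> l x0)"
      using hom_rep(1)[OF U, of l x0] norm_triangle_ineq[of "c * \<phi> l x0" "d * \<psi> l x0"] by (simp add: U0 norm_mult)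
    also have "\<dots> \<le> norm c * C + norm d * C" using C(2)[OF x0(1)] by (intro add_mono mult_left_mono) auto
    finally have Ul: "norm (U l x0) \<le> (norm c + norm d) * C" by (simp add: algebra_simps)
    have "norm (U \<mu> x0) \<le> norm (U l x0) + norm (U \<mu> x0 - U l x0)" by (metis norm_triangle_sub add.commute)
    also have "norm (U \<mu> x0 - U l x0) \<le> norm (\<mu> - l) * (norm (U \<mu> x0) * k)" using B[OF x0(2) x0(1)] by simp
    also have "\<dots> = norm (\<mu> - l) * k * norm (U \<mu> x0)" by simp
    also have "\<dots> \<le> 1 / 2 * norm (U \<mu> x0)" using small by (intro mult_right_mono) auto
    finally have "norm (U \<mu> x0) \<le> M1" using Ul by (simp add: M1_def)
    then have "norm (U \<mu> y) \<le> M1" if "y \<in> {0..a}" for y using x0(2)[OF that] by linarith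
    from B[OF this x] show "norm (U \<mu> x - U l x) \<le> M1 * k * norm (\<mu> - l) \<and> norm (V \<mu> x - V l x) \<le> M1 * k * norm (\<mu> - l)"
      by (simp add: mult.commute)
  qed
qed

text \<open>Replacing U \<mu> by U l inside the integrals of the perturbation formula changes them
  by O(|\<mu> - l|), hence the difference quotient converges with a quadratic remainder.\<close>

lemma perturbation_derivative:
  assumes U: "\<And>\<mu>. hom \<mu> (U \<mu>) (V \<mu>)" and U0: "\<And>\<mu>. U \<mu> 0 = c" "\<And>\<mu>. V \<mu> 0 = d"
  shows "(\<lambda>\<mu>. U \<mu> a) field_differentiable at l" "(\<lambda>\<mu>. V \<mu> a) field_differentiable at l"
proof -
  obtain C where C: "C > 0" "\<And>x. x \<in> {0..a} \<Longrightarrow> norm (\<phi> l x) \<le> C \<and> norm (\<psi> l x) \<le> C \<and> norm (\<phi>1 l x) \<le> C \<and> norm (\<psi>1 l x) \<le> C"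
    using fundamental_bounded[of 0 a l] by blast
  obtain \<delta> K where K: "\<delta> > 0" "K \<ge> 0"
    "\<And>\<mu> x. norm (\<mu> - l) < \<delta> \<Longrightarrow> x \<in> {0..a} \<Longrightarrow> norm (U \<mu> x - U l x) \<le> K * norm (\<mu> - l) \<and> norm (V \<mu> x - V l x) \<le> K * norm (\<mu> - l)"
    using perturbation[OF U U0, where l = l] by blast
  define I where "I \<mu> f = (LINT t:{0..a}|lebesgue. W t * (U \<mu> t * f t))" for \<mu> f
  have aI: "a \<in> {0..a}" "0 \<le> a" using a_pos by auto
  have Id: "norm (I \<mu> f - I l f) \<le> K * norm (\<mu> - l) * C * wbar"
    if f: "continuous_on UNIV f" "\<And>x. x \<in> {0..a} \<Longrightarrow> norm (f x) \<le> C" and \<mu>: "norm (\<mu> - l) < \<delta>" for f \<mu>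
  proof -
    have int: "set_integrable lebesgue {0..a} (\<lambda>t. W t * (U \<nu> t * f t))" for \<nu>
      using loc_integrable_mult_continuous[OF loc_integrable_coeff(2), of "\<lambda>t. U \<nu> t * f t"] hom_continuous(1)[OF U] f
      by (auto simp: loc_integrable_def intro!: continuous_intros)
    have "I \<mu> f - I l f = (LINT t:{0..a}|lebesgue. W t * (U \<mu> t * f t) - W t * (U l t * f t))"
      unfolding I_def using set_integral_diff(2)[OF int[of \<mu>] int[of l]] by simp
    also have "\<dots> = (LINT t:{0..a}|lebesgue. W t * ((U \<mu> t - U l t) * f t))" by (simp add: algebra_simps)
    also have "norm \<dots> \<le> K * norm (\<mu> - l) * C * wbar"
    proof (rule W_integral_bound[OF _ _ aI(1)])
      show "continuous_on UNIV (\<lambda>t. (U \<mu> t - U l t) * f t)" using hom_continuous(1)[OF U] f by (intro continuous_intros)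
      fix x assume x: "x \<in> {0..a}"
      show "norm ((U \<mu> x - U l x) * f x) \<le> K * norm (\<mu> - l) * C"
        unfolding norm_mult using K(2) K(3)[OF \<mu> x] f(2)[OF x] by (intro mult_mono) auto
    qed
    finally show ?thesis .
  qed
  have gen: "F field_differentiable at l"
    if F: "\<And>\<mu>. F \<mu> = F l + (\<mu> - l) * (I \<mu> (\<psi> l) * f - I \<mu> (\<phi> l) * g)" and fg: "norm f \<le> C" "norm g \<le> C" for F f g
  proof -
    have "(F has_field_derivative (I l (\<psi> l) * f - I l (\<phi> l) * g)) (at l)"
    proof (rule has_field_derivative_quadratic_bound[OF K(1)])
      fix \<mu> assume \<mu>: "norm (\<mu> - l) < \<delta>"
      have i: "norm (I \<mu> (\<psi> l) - I l (\<psi> l)) \<le> K * norm (\<mu> - l) * C * wbar" "norm (I \<mu> (\<phi> l) - I l (\<phi> l)) \<le> K * norm (\<mu> - l) * C * wbar"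
        using C(2) continuous_fundamental \<mu> by (auto intro!: Id)
      have eq: "F \<mu> - F l - (\<mu> - l) * (I l (\<psi> l) * f - I l (\<phi> l) * g) = (\<mu> - l) * ((I \<mu> (\<psi> l) - I l (\<psi> l)) * f - (I \<mu> (\<phi> l) - I l (\<phi> l)) * g)"
        unfolding F[of \<mu>] by (simp add: algebra_simps)
      have "norm (F \<mu> - F l - (\<mu> - l) * (I l (\<psi> l) * f - I l (\<phi> l) * g)) \<le> norm (\<mu> - l) * (2 * (K * norm (\<mu> - l) * C * wbar * C))"
        unfolding eq norm_mult[of "\<mu> - l"] by (rule mult_left_mono[OF norm_lincomb_le[OF i fg]]) simp
      then show "norm (F \<mu> - F l - (\<mu> - l) * (I l (\<psi> l) * f - I l (\<phi> l) * g)) \<le> (2 * K * C * wbar * C) * (norm (\<mu> - l))\<^sup>2"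
        by (simp only: power2_eq_square mult_ac)
    qed
    then show ?thesis by (auto simp: field_differentiable_def)
  qed
  show "(\<lambda>\<mu>. U \<mu> a) field_differentiable at l"
    by (rule gen[of _ "\<phi> l a" "\<psi> l a"]) (use perturbation_formula(1)[OF U U _ _ aI(2)] U0 C(2)[OF aI(1)] in \<open>auto simp: I_def\<close>)
  show "(\<lambda>\<mu>. V \<mu> a) field_differentiable at l"
    by (rule gen[of _ "\<phi>1 l a" "\<psi>1 l a"]) (use perturbation_formula(2)[OF U U _ _ aI(2)] U0 C(2)[OF aI(1)] in \<open>auto simp: I_def\<close>)
qed

lemma D_holomorphic: "D holomorphic_on A"
proof -
  have "D field_differentiable at l" for l
    unfolding D_def[abs_def]
    using perturbation_derivative(1)[of \<phi> \<phi>1 1 0 l] perturbation_derivative(2)[of \<psi> \<psi>1 0 1 l]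
    by (intro field_differentiable_add) (auto simp: fundamental)
  then show ?thesis by (simp add: holomorphic_on_def field_differentiable_at_within)
qed

lemma hom_cnj:
  assumes "hom l u v"
  shows "hom (cnj l) (\<lambda>x. cnj (u x)) (\<lambda>x. cnj (v x))"
proof -
  have 1: "AC_deriv UNIV (\<lambda>x. cnj (u x)) (\<lambda>x. cnj (\<alpha> x * v x))" and 2: "AC_deriv UNIV (\<lambda>x. cnj (v x)) (\<lambda>x. cnj (\<beta> l x * u x - 0))"
    using assms by (auto simp: lin_sys_def intro!: AC_deriv_cnj simp del: complex_cnj_mult)
  show ?thesis unfolding lin_sys_def
    by (intro conjI AC_deriv_cong[OF 1] AC_deriv_cong[OF 2]) (auto simp: \<alpha>_def \<beta>_def W_def)
qed

text \<open>Conjugation preserves the equation at real l and the initial values, so uniqueness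
  applies.\<close>

lemma fundamental_real:
  fixes s :: real
  shows "Im (\<phi> s x) = 0" "Im (\<psi> s x) = 0" "Im (\<phi>1 s x) = 0" "Im (\<psi>1 s x) = 0"
proof -
  have 1: "(\<lambda>x. cnj (\<phi> s x)) = \<phi> s" "(\<lambda>x. cnj (\<phi>1 s x)) = \<phi>1 s"
    using hom_unique[OF hom_cnj[OF fundamental(1), of "of_real s"], of "\<phi> s" "\<phi>1 s"] fundamental by auto
  have 2: "(\<lambda>x. cnj (\<psi> s x)) = \<psi> s" "(\<lambda>x. cnj (\<psi>1 s x)) = \<psi>1 s"
    using hom_unique[OF hom_cnj[OF fundamental(2), of "of_real s"], of "\<psi> s" "\<psi>1 s"] fundamental by auto
  show "Im (\<phi> s x) = 0" "Im (\<psi> s x) = 0" "Im (\<phi>1 s x) = 0" "Im (\<psi>1 s x) = 0"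
    using fun_cong[OF 1(1), of x] fun_cong[OF 1(2), of x] fun_cong[OF 2(1), of x] fun_cong[OF 2(2), of x]
    by (auto simp: complex_eq_iff)
qed

lemma D_real: "D (complex_of_real s) = complex_of_real (Re (D (complex_of_real s)))"
  using fundamental_real[of s a] by (simp add: D_def complex_eq_iff)

text \<open>Continuity in x at a fixed parameter combines with the Lipschitz bound in the parameter,
  which is uniform in x. It is used to choose an angle continuously in both variables.\<close>

lemma psi_jointly_continuous:
  "continuous_on ({0..a} \<times> UNIV) (\<lambda>(x, s::real). \<psi> s x)" "continuous_on ({0..a} \<times> UNIV) (\<lambda>(x, s::real). \<psi>1 s x)"
proof -
  have gen: "continuous_on ({0..a} \<times> UNIV) (\<lambda>(x, s::real). F (of_real s) x)"
    if c: "\<And>l. continuous_on UNIV (F l)"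
      and p: "\<And>l. \<exists>\<delta>>0. \<exists>K\<ge>0. \<forall>\<mu> x. norm (\<mu> - l) < \<delta> \<longrightarrow> x \<in> {0..a} \<longrightarrow> norm (F \<mu> x - F l x) \<le> K * norm (\<mu> - l)"
    for F :: "complex \<Rightarrow> real \<Rightarrow> complex"
    unfolding continuous_on_iff
  proof (intro ballI allI impI)
    fix z :: "real \<times> real" and e :: real assume z: "z \<in> {0..a} \<times> UNIV" and e: "0 < e"
    obtain x0 s0 where z0: "z = (x0, s0)" by (cases z)
    obtain \<delta> K where K: "\<delta> > 0" "K \<ge> 0" "\<And>\<mu> x. norm (\<mu> - of_real s0) < \<delta> \<Longrightarrow> x \<in> {0..a} \<Longrightarrow> norm (F \<mu> x - F (of_real s0) x) \<le> K * norm (\<mu> - of_real s0)"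
      using p[of "of_real s0"] by blast
    have "e / 2 > 0" using e by simp
    then obtain d where d: "d > 0" "\<And>x. dist x x0 < d \<Longrightarrow> dist (F (of_real s0) x) (F (of_real s0) x0) < e / 2"
      using c[of "of_real s0"] unfolding continuous_on_iff by (metis UNIV_I)
    show "\<exists>d>0. \<forall>x'\<in>{0..a} \<times> UNIV. dist x' z < d \<longrightarrow> dist (case x' of (x, s) \<Rightarrow> F (of_real s) x) (case z of (x, s) \<Rightarrow> F (of_real s) x) < e"
    proof (intro exI[of _ "min d (min \<delta> (e / (2 * (K + 1))))"] conjI ballI impI)
      show "0 < min d (min \<delta> (e / (2 * (K + 1))))" using d K e by simp
      fix y :: "real \<times> real" assume y: "y \<in> {0..a} \<times> UNIV" and yz: "dist y z < min d (min \<delta> (e / (2 * (K + 1))))"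
      obtain x s where y0: "y = (x, s)" by (cases y)
      have dx: "dist x x0 \<le> dist y z" and ds: "dist s s0 \<le> dist y z"
        using dist_fst_le[of y z] dist_snd_le[of y z] by (simp_all add: y0 z0)
      have ns: "norm (complex_of_real s - of_real s0) = dist s s0"
        by (simp add: dist_real_def flip: of_real_diff)
      have "norm (F (of_real s) x - F (of_real s0) x) \<le> K * dist s s0"
        using K(3)[of "of_real s" x] ns ds yz y y0 by auto
      also have "\<dots> \<le> (K + 1) * dist s s0" by (intro mult_right_mono) auto
      also have "\<dots> < e / 2"
      proof -
        have "dist s s0 < e / (2 * (K + 1))" using ds yz by linarith
        then show ?thesis using K(2) by (simp add: field_simps)
      qed
      finally have "norm (F (of_real s) x - F (of_real s0) x) < e / 2" .
      moreover have "dist (F (of_real s0) x) (F (of_real s0) x0) < e / 2" using d(2) dx yz by auto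
      ultimately have "dist (F (of_real s) x) (F (of_real s0) x0) < e"
        using dist_triangle[of "F (of_real s) x" "F (of_real s0) x0" "F (of_real s0) x"] by (simp add: dist_norm)
      then show "dist (case y of (x, s) \<Rightarrow> F (of_real s) x) (case z of (x, s) \<Rightarrow> F (of_real s) x) < e" by (simp add: y0 z0)
    qed
  qed
  have p: "\<exists>\<delta>>0. \<exists>K\<ge>0. \<forall>\<mu> x. norm (\<mu> - l) < \<delta> \<longrightarrow> x \<in> {0..a} \<longrightarrow> norm (\<psi> \<mu> x - \<psi> l x) \<le> K * norm (\<mu> - l) \<and> norm (\<psi>1 \<mu> x - \<psi>1 l x) \<le> K * norm (\<mu> - l)" for l
  proof -
    obtain \<delta> K where "\<delta> > 0" "K \<ge> 0"
      "\<And>\<mu> x. norm (\<mu> - l) < \<delta> \<Longrightarrow> x \<in> {0..a} \<Longrightarrow> norm (\<psi> \<mu> x - \<psi> l x) \<le> K * norm (\<mu> - l) \<and> norm (\<psi>1 \<mu> x - \<psi>1 l x) \<le> K * norm (\<mu> - l)"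
      by (rule perturbation[of \<psi> \<psi>1 0 1 l]) (auto simp: fundamental)
    then show ?thesis by blast
  qed
  show "continuous_on ({0..a} \<times> UNIV) (\<lambda>(x, s::real). \<psi> s x)" "continuous_on ({0..a} \<times> UNIV) (\<lambda>(x, s::real). \<psi>1 s x)"
    by (rule gen[OF continuous_fundamental(2)], use p in blast) (rule gen[OF continuous_fundamental(4)], use p in blast)
qed

end

section \<open>Oscillation\<close>

text \<open>The reciprocal has some density by domination; differentiating u times 1/u = 1
  identifies it.\<close>

lemma AC_deriv_inverse:
  assumes u: "AC_deriv {c..d} u u'" and cd: "c < d" and nz: "\<And>x. x \<in> {c..d} \<Longrightarrow> u x \<noteq> 0"
  shows "AC_deriv {c..d} (\<lambda>x. 1 / u x) (\<lambda>x. - u' x / (u x)\<^sup>2)"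
proof -
  have I: "admissible_interval {c..d}" using cd by simp
  have ac: "AC_Icc c d u" using AC_deriv_imp_AC_loc[OF u] cd by (auto simp: AC_loc_def)
  have "continuous_on {c..d} (\<lambda>x. norm (u x))" using AC_Icc_imp_continuous_on[OF ac] by (intro continuous_intros)
  then obtain x0 where x0: "x0 \<in> {c..d}" "\<And>y. y \<in> {c..d} \<Longrightarrow> norm (u x0) \<le> norm (u y)"
    using continuous_attains_inf[of "{c..d}" "\<lambda>x. norm (u x)"] cd by auto
  define m where "m = norm (u x0)"
  have m: "m > 0" using nz[OF x0(1)] by (simp add: m_def)
  have "AC_Icc c d (\<lambda>x. 1 / u x)"
  proof (rule AC_Icc_bound[OF ac ac])
    show "1 / m\<^sup>2 > 0" using m by simp
    fix x y assume xy: "c \<le> x" "x \<le> y" "y \<le> d"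
    then have x: "x \<in> {c..d}" and y: "y \<in> {c..d}" by auto
    have "1 / u y - 1 / u x = (u x - u y) / (u x * u y)" using nz[OF x] nz[OF y] by (simp add: field_simps)
    then have "norm (1 / u y - 1 / u x) = norm (u y - u x) / (norm (u x) * norm (u y))"
      by (simp add: norm_divide norm_mult norm_minus_commute)
    also have "\<dots> \<le> norm (u y - u x) / m\<^sup>2"
      using x0(2)[OF x] x0(2)[OF y] m unfolding power2_eq_square m_def by (intro divide_left_mono mult_mono mult_pos_pos) auto
    also have "\<dots> \<le> 1 / m\<^sup>2 * (norm (u y - u x) + norm (u y - u x))"
      using m by (simp add: field_simps)
    finally show "norm (1 / u y - 1 / u x) \<le> 1 / m\<^sup>2 * (norm (u y - u x) + norm (u y - u x))" .
  qed
  then obtain g where g: "AC_deriv {c..d} (\<lambda>x. 1 / u x) g" using AC_Icc_imp_AC_deriv[of c d] cd by fastforce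
  have 1: "AC_deriv {c..d} (\<lambda>x. u x * (1 / u x)) (\<lambda>x. u' x * (1 / u x) + u x * g x)" by (rule AC_deriv_mult[OF u g])
  have "AC_deriv {c..d} (\<lambda>x. 1) (\<lambda>x. u' x * (1 / u x) + u x * g x)" by (rule AC_deriv_cong[OF 1]) (auto simp: nz)
  from AC_deriv_AE[OF this I] AC_deriv_AE[OF AC_deriv_const[of "{c..d}" 1] I]
  have "AE x in lebesgue. x \<in> {c..d} \<longrightarrow> g x = - u' x / (u x)\<^sup>2"
  proof eventually_elim
    case (elim x)
    show ?case
    proof
      assume x: "x \<in> {c..d}"
      have z: "u' x * (1 / u x) + u x * g x = 0"
        using elim x vector_derivative_within[OF admissible_interval_at_neq_bot[OF I x]] by metis
      have "u x * (u' x * (1 / u x) + u x * g x) = u' x + (u x)\<^sup>2 * g x"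
        using nz[OF x] by (simp add: algebra_simps power2_eq_square)
      with z have "(u x)\<^sup>2 * g x = - u' x" by (simp add: eq_neg_iff_add_eq_0 add.commute)
      then show "g x = - u' x / (u x)\<^sup>2" using nz[OF x] by (simp add: field_simps)
    qed
  qed
  then show ?thesis by (rule AC_deriv_cong_AE[OF g]) simp
qed

text \<open>
  The equation \<open>u' = v / p\<close> enters only through \<open>mono\<close>: \<open>u\<close> increases where \<open>v > 0\<close>
  and decreases where \<open>v < 0\<close>.
\<close>

locale pruefer =
  fixes a :: real and \<theta> r u v :: "real \<Rightarrow> real"
  assumes a0: "a > 0" and \<theta>c: "continuous_on {0..a} \<theta>" and vc: "continuous_on {0..a} v"
    and r0: "\<And>x. x \<in> {0..a} \<Longrightarrow> r x > 0"
    and u_eq: "\<And>x. x \<in> {0..a} \<Longrightarrow> u x = r x * cos (\<theta> x)"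
    and v_eq: "\<And>x. x \<in> {0..a} \<Longrightarrow> v x = r x * sin (\<theta> x)"
    and mono: "\<And>\<sigma> x y. \<sigma> = 1 \<or> \<sigma> = - 1 \<Longrightarrow> 0 \<le> x \<Longrightarrow> x < y \<Longrightarrow> y \<le> a \<Longrightarrow>
      (\<And>t. t \<in> {x..y} \<Longrightarrow> \<sigma> * v t > 0) \<Longrightarrow> \<sigma> * u x < \<sigma> * u y"
begin

text \<open>At such a point v has the sign \<sigma> of sin \<theta>, so \<sigma> u increases through
  0. Since \<sigma> u = -r sin(\<theta> - \<theta>(t0)), the angle decreases. No derivative of the
  angle is taken.\<close>

lemma crossing:
  assumes t0: "t0 \<in> {0..a}" and c0: "cos (\<theta> t0) = 0"
  obtains \<eta> where "\<eta> > 0" "\<And>x. x \<in> {0..a} \<Longrightarrow> t0 < x \<Longrightarrow> x < t0 + \<eta> \<Longrightarrow> \<theta> x < \<theta> t0"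
    "\<And>x. x \<in> {0..a} \<Longrightarrow> x < t0 \<Longrightarrow> t0 - \<eta> < x \<Longrightarrow> \<theta> x > \<theta> t0"
proof -
  define \<sigma> where "\<sigma> = sin (\<theta> t0)"
  have "\<sigma>\<^sup>2 = 1" using sin_cos_squared_add[of "\<theta> t0"] c0 by (simp add: \<sigma>_def)
  then have \<sigma>: "\<sigma> = 1 \<or> \<sigma> = -1" by (simp add: power2_eq_1_iff)
  have \<sigma>2: "\<sigma> * \<sigma> = 1" using \<sigma> by auto
  have v0: "\<sigma> * v t0 > 0" using r0[OF t0] \<sigma> v_eq[OF t0] by (auto simp: \<sigma>_def[symmetric])
  have "continuous_on {0..a} (\<lambda>x. \<sigma> * v x)" using vc by (intro continuous_intros)
  then obtain d1 where d1: "d1 > 0" "\<And>x. x \<in> {0..a} \<Longrightarrow> dist x t0 < d1 \<Longrightarrow> dist (\<sigma> * v x) (\<sigma> * v t0) < \<sigma> * v t0"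
    unfolding continuous_on_iff using t0 v0 by blast
  \<comment> \<open>Staying within \<pi> of the level lets the sign of the sine decide the sign of
    the difference of angles.\<close>
  obtain d2 where d2: "d2 > 0" "\<And>x. x \<in> {0..a} \<Longrightarrow> dist x t0 < d2 \<Longrightarrow> dist (\<theta> x) (\<theta> t0) < pi"
    using \<theta>c[unfolded continuous_on_iff] t0 pi_gt_zero by blast
  have pos: "\<sigma> * v x > 0" if "x \<in> {0..a}" "dist x t0 < d1" for x
    using d1(2)[OF that] by (auto simp: dist_real_def abs_less_iff)
  have \<sigma>u: "\<sigma> * u x = - (r x * sin (\<theta> x - \<theta> t0))" if "x \<in> {0..a}" for x
  proof -
    have "sin (\<theta> x - \<theta> t0) = - (\<sigma> * cos (\<theta> x))" using c0 by (simp add: sin_diff \<sigma>_def)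
    then show ?thesis using u_eq[OF that] by (simp add: algebra_simps)
  qed
  have ut0: "\<sigma> * u t0 = 0" using u_eq[OF t0] c0 by simp
  show thesis
  proof (rule that[of "min d1 d2"])
    show "min d1 d2 > 0" using d1 d2 by simp
    fix x assume x: "x \<in> {0..a}"
    {
      assume tx: "t0 < x" "x < t0 + min d1 d2"
      have "\<sigma> * u t0 < \<sigma> * u x"
        using \<sigma> t0 x tx by (intro mono pos) (auto simp: dist_real_def)
      then have "r x * sin (\<theta> x - \<theta> t0) < 0" using \<sigma>u[OF x] ut0 by simp
      then have s: "sin (\<theta> x - \<theta> t0) < 0" using r0[OF x] by (simp add: mult_less_0_iff)
      have "\<bar>\<theta> x - \<theta> t0\<bar> < pi" using d2(2)[OF x] tx by (simp add: dist_real_def)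
      then show "\<theta> x < \<theta> t0" using s sin_ge_zero[of "\<theta> x - \<theta> t0"] by linarith
    }
    {
      assume tx: "x < t0" "t0 - min d1 d2 < x"
      have "\<sigma> * u x < \<sigma> * u t0"
        using \<sigma> t0 x tx by (intro mono pos) (auto simp: dist_real_def)
      then have "r x * sin (\<theta> x - \<theta> t0) > 0" using \<sigma>u[OF x] ut0 by simp
      then have s: "sin (\<theta> x - \<theta> t0) > 0" using r0[OF x] by (simp add: zero_less_mult_iff)
      have "\<bar>\<theta> x - \<theta> t0\<bar> < pi" using d2(2)[OF x] tx by (simp add: dist_real_def)
      moreover have "sin (\<theta> t0 - \<theta> x) < 0" using s sin_minus[of "\<theta> x - \<theta> t0"] by simp
      ultimately show "\<theta> x > \<theta> t0" using sin_ge_zero[of "\<theta> t0 - \<theta> x"] by linarith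
    }
  qed
qed

text \<open>At the first return to the level the angle would come from below, but a crossing there
  must come from above.\<close>

lemma barrier:
  assumes x0: "x0 \<in> {0..a}" and x1: "x1 \<in> {0..a}" "x0 < x1" and c0: "cos (\<theta> x0) = 0"
  shows "\<theta> x1 < \<theta> x0"
proof (rule ccontr)
  assume "\<not> \<theta> x1 < \<theta> x0"
  obtain \<eta> where \<eta>: "\<eta> > 0" "\<And>x. x \<in> {0..a} \<Longrightarrow> x0 < x \<Longrightarrow> x < x0 + \<eta> \<Longrightarrow> \<theta> x < \<theta> x0"
    by (rule crossing[OF x0 c0]) (rule that)
  define y where "y = min (x0 + \<eta> / 2) x1"
  have y: "x0 < y" "y \<le> x1" "y \<in> {0..a}" using \<eta>(1) x0 x1 by (auto simp: y_def min_def)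
  define T where "T = {y..x1} \<inter> \<theta> -` {\<theta> x0..}"
  have "closed T" unfolding T_def
    using continuous_on_subset[OF \<theta>c, of "{y..x1}"] y x1
    by (intro continuous_closed_preimage closed_atLeastAtMost closed_atLeast) auto
  have "x1 \<in> T" using \<open>\<not> \<theta> x1 < \<theta> x0\<close> y by (auto simp: T_def)
  have bdd: "bdd_below T" by (auto simp: T_def bdd_below_def)
  define t where "t = Inf T"
  have tT: "t \<in> T" unfolding t_def using \<open>closed T\<close> \<open>x1 \<in> T\<close> bdd by (intro closed_contains_Inf) auto
  then have t: "t \<in> {0..a}" "\<theta> t \<ge> \<theta> x0" "y \<le> t" "t \<le> x1" using y x1 by (auto simp: T_def)
  have below: "\<theta> x < \<theta> x0" if "x0 < x" "x < t" for x
  proof (cases "x < y")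
    case True
    then show ?thesis using \<eta>(2)[of x] that x0 t by (auto simp: y_def)
  next
    case False
    have "x \<notin> T" using that cInf_lower[OF _ bdd, of x] by (auto simp: t_def)
    then show ?thesis using False that t by (auto simp: T_def)
  qed
  have x0t: "x0 < t" using y t by linarith
  have "\<theta> t \<le> \<theta> x0"
  proof (rule tendsto_upperbound)
    have "continuous (at t within {0..a}) \<theta>" using \<theta>c t by (simp add: continuous_on_eq_continuous_within)
    then have "continuous (at t within {x0<..<t}) \<theta>" using x0 t by (elim continuous_within_subset) auto
    then show "(\<theta> \<longlongrightarrow> \<theta> t) (at t within {x0<..<t})" by (simp add: continuous_within)
    show "\<forall>\<^sub>F x in at t within {x0<..<t}. \<theta> x \<le> \<theta> x0"
      using below by (auto simp: eventually_at_filter intro!: always_eventually less_imp_le)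
    show "at t within {x0<..<t} \<noteq> bot" using x0t by (simp add: trivial_limit_within islimpt_greaterThanLessThan2)
  qed
  with t have eq: "\<theta> t = \<theta> x0" by simp
  then have "cos (\<theta> t) = 0" using c0 by simp
  then obtain \<eta>' where \<eta>': "\<eta>' > 0" "\<And>x. x \<in> {0..a} \<Longrightarrow> x < t \<Longrightarrow> t - \<eta>' < x \<Longrightarrow> \<theta> x > \<theta> t"
    by (rule crossing[OF t(1)]) (rule that)
  define z where "z = max (t - \<eta>' / 2) ((x0 + t) / 2)"
  have z: "x0 < z" "z < t" "t - \<eta>' < z" using x0t \<eta>'(1) by (auto simp: z_def less_max_iff_disj)
  then have "\<theta> z > \<theta> t" using x0 t by (intro \<eta>'(2)) auto
  with below[OF z(1,2)] eq show False by simp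
qed

text \<open>At a zero of \<open>u\<close> the angle is an odd multiple of \<pi>/2. By the barrier it
  strictly decreases from zero to zero, hence by at least \<pi> each time.\<close>

lemma zeros_count:
  assumes Z: "finite Z" "Z \<subseteq> {0<..a}" "\<And>z. z \<in> Z \<Longrightarrow> u z = 0" and c0: "cos (\<theta> 0) = 0"
  shows "\<theta> a \<le> \<theta> 0 - real (card Z) * pi"
proof -
  have "\<exists>m\<in>{0..a}. (\<forall>z\<in>Z. z \<le> m) \<and> (m = 0 \<or> m \<in> Z) \<and> cos (\<theta> m) = 0 \<and> \<theta> m \<le> \<theta> 0 - real (card Z) * pi"
    using Z
  proof (induction Z rule: finite_linorder_max_induct)
    case empty
    then show ?case using a0 c0 by (intro bexI[of _ 0]) auto
  next
    case (insert b Z)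
    then have "\<exists>m\<in>{0..a}. (\<forall>z\<in>Z. z \<le> m) \<and> (m = 0 \<or> m \<in> Z) \<and> cos (\<theta> m) = 0 \<and> \<theta> m \<le> \<theta> 0 - real (card Z) * pi"
      by blast
    then obtain m where m: "m \<in> {0..a}" "m = 0 \<or> m \<in> Z" "cos (\<theta> m) = 0" "\<theta> m \<le> \<theta> 0 - real (card Z) * pi"
      by blast
    have b: "b \<in> {0..a}" "0 < b" using insert(4) by auto
    have mb: "m < b" using m(2) insert(2) b by blast
    have "u b = 0" using insert(5) by blast
    then have cb: "cos (\<theta> b) = 0" using u_eq[OF b(1)] r0[OF b(1)] by simp
    have lt: "\<theta> b < \<theta> m" by (rule barrier[OF m(1) b(1) mb m(3)])
    obtain i :: int where i: "odd i" "\<theta> b = of_int i * (pi / 2)" using cb unfolding cos_zero_iff_int by blast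
    obtain j :: int where j: "odd j" "\<theta> m = of_int j * (pi / 2)" using m(3) unfolding cos_zero_iff_int by blast
    have "of_int i * (pi / 2) < of_int j * (pi / 2)" using lt unfolding i(2) j(2) .
    then have "i < j" using mult_right_less_imp_less[of "of_int i" "pi / 2" "of_int j"] by simp
    then have "i + 2 \<le> j" using i(1) j(1) by presburger
    then have "real_of_int (i + 2) \<le> real_of_int j" by (simp only: of_int_le_iff)
    then have "real_of_int (i + 2) * (pi / 2) \<le> real_of_int j * (pi / 2)" by (rule mult_right_mono) simp
    then have "(real_of_int i + 2) * (pi / 2) \<le> \<theta> m" unfolding j(2) by simp
    then have "\<theta> b + pi \<le> \<theta> m" unfolding i(2) by (simp add: distrib_right)
    moreover have "b \<notin> Z" using insert(2) by blast
    then have "card (insert b Z) = Suc (card Z)" by (rule card_insert_disjoint[OF insert(1)])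
    then have "real (card (insert b Z)) = 1 + real (card Z)" by (simp only: of_nat_Suc)
    then have "real (card (insert b Z)) * pi = pi + real (card Z) * pi" by (simp only: distrib_right mult_1)
    ultimately have "\<theta> b \<le> \<theta> 0 - real (card (insert b Z)) * pi" using m(4) by linarith
    moreover have "\<forall>z\<in>insert b Z. z \<le> b" using insert(2) less_imp_le by blast
    ultimately show ?case using b(1) cb by blast
  qed
  then obtain m where m: "m \<in> {0..a}" "cos (\<theta> m) = 0" "\<theta> m \<le> \<theta> 0 - real (card Z) * pi" by blast
  have "\<theta> a \<le> \<theta> m" using barrier[OF m(1) _ _ m(2), of a] m(1) a0 by (cases "m = a") auto
  with m(3) show ?thesis by simp
qed

end

section \<open>Positivity of integrals against 1/p, and Picone's identity\<close>

context sl_periodic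
begin

lemma integral_alpha:
  fixes g :: "real \<Rightarrow> real"
  assumes g: "continuous_on {x..y} g"
  shows "integrable lebesgue (\<lambda>t. indicator {x..y} t * (inverse (p t) * g t))"
    "(LINT t:{x..y}|lebesgue. \<alpha> t * of_real (g t)) = complex_of_real (\<integral>t. indicator {x..y} t * (inverse (p t) * g t) \<partial>lebesgue)"
proof -
  let ?F = "\<lambda>t. indicator {x..y} t * (inverse (p t) * g t)"
  have eq: "indicator {x..y} t *\<^sub>R (\<alpha> t * of_real (g t)) = complex_of_real (?F t)" for t
    by (cases "t \<in> {x..y}") (simp_all add: \<alpha>_def)
  have "set_integrable lebesgue {x..y} \<alpha>" using loc_integrable_coeff(1) unfolding loc_integrable_def by blast
  moreover have "continuous_on {x..y} (\<lambda>t. complex_of_real (g t))" using g by (intro continuous_on_of_real)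
  ultimately have "set_integrable lebesgue {x..y} (\<lambda>t. \<alpha> t * of_real (g t))" by (rule set_integrable_mult_continuous)
  then have i: "integrable lebesgue (\<lambda>t. complex_of_real (?F t))"
    unfolding set_integrable_def eq .
  from integrable_Re[OF this] show "integrable lebesgue ?F" by (simp only: Re_complex_of_real)
  show "(LINT t:{x..y}|lebesgue. \<alpha> t * of_real (g t)) = complex_of_real (\<integral>t. ?F t \<partial>lebesgue)"
    unfolding set_lebesgue_integral_def eq by (rule integral_complex_of_real)
qed

lemma integral_alpha_pos:
  fixes g :: "real \<Rightarrow> real"
  assumes g: "continuous_on {x..y} g" and xy: "x < y" and pos: "\<And>t. t \<in> {x..y} \<Longrightarrow> g t > 0"
  shows "Re (LINT t:{x..y}|lebesgue. \<alpha> t * of_real (g t)) > 0"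
proof -
  let ?F = "\<lambda>t. indicator {x..y} t * (inverse (p t) * g t)"
  have nn: "AE t in lebesgue. 0 \<le> ?F t"
    using p_pos
  proof eventually_elim
    case (elim t)
    then show ?case using pos[of t] by (cases "t \<in> {x..y}") simp_all
  qed
  have "(\<integral>t. ?F t \<partial>lebesgue) \<noteq> 0"
  proof
    assume "(\<integral>t. ?F t \<partial>lebesgue) = 0"
    then have "AE t in lebesgue. ?F t = 0"
      by (rule integral_nonneg_eq_0_iff_AE[THEN iffD1, OF integral_alpha(1)[OF g] nn])
    with p_pos have "AE t in lebesgue. t \<notin> {x..y}"
    proof eventually_elim
      case (elim t)
      show ?case
      proof
        assume "t \<in> {x..y}"
        with elim pos[of t] show False by simp
      qed
    qed
    then have "{x..y} \<in> null_sets lebesgue" by (subst (asm) AE_iff_null_sets[symmetric]) auto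
    then have "emeasure lebesgue {x..y} = 0" by (rule null_setsD1)
    then show False using xy by simp
  qed
  moreover have "(\<integral>t. ?F t \<partial>lebesgue) \<ge> 0" using nn by (rule integral_nonneg_AE)
  ultimately show ?thesis unfolding integral_alpha(2)[OF g] by simp
qed

text \<open>Here S = p f'. Where \<psi> has no zero, p f'^2 + (q - s w) f^2 equals the derivative of
  f^2 (p \<psi>')/\<psi> plus the square (S - f p \<psi>'/\<psi>)^2 / p, and the boundary terms
  vanish with f. A test function with negative form therefore forces a zero of \<psi>.\<close>

lemma picone:
  fixes f S :: "real \<Rightarrow> real" and s :: real
  assumes cd: "c < d" and f: "AC_deriv {c..d} (\<lambda>x. complex_of_real (f x)) (\<lambda>x. \<alpha> x * complex_of_real (S x))"
    and S: "continuous_on {c..d} S" and bc: "f c = 0" "f d = 0" and nz: "\<And>x. x \<in> {c..d} \<Longrightarrow> \<psi> s x \<noteq> 0"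
  shows "0 \<le> Re (LINT t:{c..d}|lebesgue. \<alpha> t * of_real ((S t)\<^sup>2) + \<beta> s t * of_real ((f t)\<^sup>2))"
proof -
  have h: "AC_deriv {c..d} (\<psi> s) (\<lambda>x. \<alpha> x * \<psi>1 s x)" "AC_deriv {c..d} (\<psi>1 s) (\<lambda>x. \<beta> s x * \<psi> s x)"
    using fundamental(2)[of s] by (auto simp: lin_sys_def intro: AC_deriv_subset)
  define k where "k x = Re (\<psi>1 s x) / Re (\<psi> s x)" for x
  have re: "\<psi> s x = complex_of_real (Re (\<psi> s x))" "\<psi>1 s x = complex_of_real (Re (\<psi>1 s x))" for x
    using fundamental_real[of s x] by (simp_all add: complex_eq_iff)
  have rnz: "Re (\<psi> s x) \<noteq> 0" if "x \<in> {c..d}" for x using nz[OF that] re(1)[of x] by auto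
  have kc: "complex_of_real (k x) = \<psi>1 s x * (1 / \<psi> s x)" for x
  proof -
    have "\<psi>1 s x * (1 / \<psi> s x) = complex_of_real (Re (\<psi>1 s x)) * (1 / complex_of_real (Re (\<psi> s x)))"
      by (simp only: re[symmetric])
    then show ?thesis by (simp add: k_def)
  qed
  have fc: "continuous_on {c..d} f"
  proof -
    have "continuous_on {c..d} (\<lambda>x. Re (complex_of_real (f x)))"
      by (rule continuous_on_Re[OF AC_deriv_continuous_on[OF f]]) (use cd in simp)
    then show ?thesis by (simp only: Re_complex_of_real)
  qed
  have kcont: "continuous_on {c..d} k"
    unfolding k_def
    by (rule continuous_on_divide[OF continuous_on_Re continuous_on_Re])
      (use rnz cd in \<open>simp_all add: AC_deriv_continuous_on[OF h(1)] AC_deriv_continuous_on[OF h(2)]\<close>)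
  let ?F = "\<lambda>x. complex_of_real (f x) * complex_of_real (f x) * (\<psi>1 s x * (1 / \<psi> s x))"
  let ?F' = "\<lambda>x. (\<alpha> x * complex_of_real (S x) * complex_of_real (f x) + complex_of_real (f x) * (\<alpha> x * complex_of_real (S x))) * (\<psi>1 s x * (1 / \<psi> s x))
     + complex_of_real (f x) * complex_of_real (f x) * (\<beta> s x * \<psi> s x * (1 / \<psi> s x) + \<psi>1 s x * (- (\<alpha> x * \<psi>1 s x) / (\<psi> s x)\<^sup>2))"
  have Fd: "AC_deriv {c..d} ?F ?F'"
    by (rule AC_deriv_mult[OF AC_deriv_mult[OF f f] AC_deriv_mult[OF h(2) AC_deriv_inverse[OF h(1) cd nz]]])
  have cdl: "c \<le> d" "{c..d} \<subseteq> {c..d}" using cd by auto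
  have F0: "set_integrable lebesgue {c..d} ?F'" "(LINT t:{c..d}|lebesgue. ?F' t) = 0"
    using AC_derivD[OF Fd cdl] bc by simp_all
  let ?R = "\<lambda>t. \<alpha> t * of_real ((S t - f t * k t)\<^sup>2)"
  have Rc: "continuous_on {c..d} (\<lambda>t. (S t - f t * k t)\<^sup>2)" using S fc kcont by (intro continuous_intros)
  have Ri: "set_integrable lebesgue {c..d} ?R"
    using loc_integrable_coeff(1) unfolding loc_integrable_def
    by (intro set_integrable_mult_continuous continuous_on_of_real Rc) simp
  have eq: "\<alpha> t * of_real ((S t)\<^sup>2) + \<beta> s t * of_real ((f t)\<^sup>2) = ?F' t + ?R t" if "t \<in> {c..d}" for t
  proof -
    have "?R t = \<alpha> t * (complex_of_real (S t) - complex_of_real (f t) * (\<psi>1 s t * (1 / \<psi> s t)))\<^sup>2"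
      by (simp add: kc)
    \<comment> \<open>The pointwise identity in generic complex variables; writing W for 1/U reduces
      it to a polynomial identity.\<close>
    moreover have "A * S'\<^sup>2 + B * F\<^sup>2 = (A * S' * F + F * (A * S')) * (V * (1 / U))
        + F * F * (B * U * (1 / U) + V * (- (A * V) / U\<^sup>2)) + A * (S' - F * (V * (1 / U)))\<^sup>2"
      if "U \<noteq> 0" for A S' B F V U :: complex
    proof -
      obtain W where W: "W = 1 / U" by simp
      have "V * (- (A * V) / U\<^sup>2) = - A * V * V * W * W" "B * U * (1 / U) = B"
        using that by (simp_all add: W power2_eq_square)
      then show ?thesis unfolding W[symmetric] by (simp only: power2_eq_square) (simp add: algebra_simps)
    qed
    ultimately show ?thesis using nz[OF that] by (simp only: of_real_power)
  qed
  have "(LINT t:{c..d}|lebesgue. \<alpha> t * of_real ((S t)\<^sup>2) + \<beta> s t * of_real ((f t)\<^sup>2)) = (LINT t:{c..d}|lebesgue. ?F' t + ?R t)"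
    using eq by (intro set_lebesgue_integral_cong) auto
  also have "\<dots> = (LINT t:{c..d}|lebesgue. ?F' t) + (LINT t:{c..d}|lebesgue. ?R t)"
    by (rule set_integral_add(2)[OF F0(1) Ri])
  also have "\<dots> = complex_of_real (\<integral>t. indicator {c..d} t * (inverse (p t) * (S t - f t * k t)\<^sup>2) \<partial>lebesgue)"
    unfolding F0 integral_alpha(2)[OF Rc] by simp
  finally have E: "Re (LINT t:{c..d}|lebesgue. \<alpha> t * of_real ((S t)\<^sup>2) + \<beta> s t * of_real ((f t)\<^sup>2)) = (\<integral>t. indicator {c..d} t * (inverse (p t) * (S t - f t * k t)\<^sup>2) \<partial>lebesgue)"
    by simp
  have "AE t in lebesgue. 0 \<le> indicator {c..d} t * (inverse (p t) * (S t - f t * k t)\<^sup>2)"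
    using p_pos by eventually_elim (auto simp: indicator_def)
  then show ?thesis unfolding E by (rule integral_nonneg_AE)
qed

end

lemma inverse_plus_self_ge_2: "2 \<le> 1 / x + x" if "x > 0" for x :: real
proof -
  have "0 \<le> (x - 1)\<^sup>2 / x" using that by simp
  also have "\<dots> = 1 / x + x - 2" using that by (simp add: field_simps power2_eq_square)
  finally show ?thesis by simp
qed

lemma AC_deriv_Re:
  assumes "AC_deriv I f g"
  shows "AC_deriv I (\<lambda>x. complex_of_real (Re (f x))) (\<lambda>x. complex_of_real (Re (g x)))"
proof -
  have eq: "complex_of_real (Re z) = 1 / 2 * (z + cnj z)" for z by (simp add: complex_add_cnj)
  show ?thesis unfolding eq by (rule AC_deriv_cmult[OF AC_deriv_add[OF assms AC_deriv_cnj[OF assms]]])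
qed

lemma AC_deriv_alpha_power:
  fixes g G :: "real \<Rightarrow> real" and \<alpha> :: "real \<Rightarrow> complex"
  assumes g: "AC_deriv I (\<lambda>x. complex_of_real (g x)) (\<lambda>x. \<alpha> x * complex_of_real (G x))"
    and c: "continuous_on I g" "continuous_on I G"
  shows "\<exists>H. continuous_on I H \<and> AC_deriv I (\<lambda>x. complex_of_real (g x ^ n)) (\<lambda>x. \<alpha> x * complex_of_real (H x))"
proof (induction n)
  case 0
  have "AC_deriv I (\<lambda>x. complex_of_real (g x ^ 0)) (\<lambda>x. \<alpha> x * complex_of_real 0)"
    by (rule AC_deriv_cong[OF AC_deriv_const[of I 1]]) simp_all
  then show ?case by (intro exI[of _ "\<lambda>_. 0"] conjI continuous_on_const)
next
  case (Suc n)
  then obtain H where H: "continuous_on I H" "AC_deriv I (\<lambda>x. complex_of_real (g x ^ n)) (\<lambda>x. \<alpha> x * complex_of_real (H x))"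
    by blast
  have "AC_deriv I (\<lambda>x. complex_of_real (g x ^ Suc n)) (\<lambda>x. \<alpha> x * complex_of_real (G x * g x ^ n + g x * H x))"
    by (rule AC_deriv_cong[OF AC_deriv_mult[OF g H(2)]]) (simp_all add: algebra_simps)
  moreover have "continuous_on I (\<lambda>x. G x * g x ^ n + g x * H x)" by (intro continuous_intros c H(1))
  ultimately show ?case by (intro exI[of _ "\<lambda>x. G x * g x ^ n + g x * H x"] conjI)
qed

section \<open>Zeros of psi for large parameters and the oscillation of D\<close>

context sl_periodic
begin

text \<open>The functions 1 - g^n vanish at the endpoints and tend to 1 inside, so they approximate
  the constant 1 by functions with finite energy.\<close>

lemma test_functions:
  assumes cd: "c < d"
  obtains g :: "real \<Rightarrow> real" where "continuous_on {c..d} g" "g c = 1" "g d = 1"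
    "\<And>x. x \<in> {c..d} \<Longrightarrow> 0 \<le> g x \<and> g x \<le> 1" "\<And>x. c < x \<Longrightarrow> x < d \<Longrightarrow> g x < 1"
    "\<And>n. \<exists>H. continuous_on {c..d} H \<and> AC_deriv {c..d} (\<lambda>x. complex_of_real (1 - g x ^ n)) (\<lambda>x. \<alpha> x * complex_of_real (H x))"
proof -
  \<comment> \<open>The variable P, a primitive of 1/p, replaces x: a polynomial f in P has p f'
    again a polynomial in P, hence continuous for arbitrary \<open>p\<close>.\<close>
  define P where "P x = Re (oint \<alpha> x)" for x
  have P: "AC_deriv {c..d} (\<lambda>x. complex_of_real (P x)) \<alpha>"
    by (rule AC_deriv_cong[OF AC_deriv_subset[OF AC_deriv_Re[OF AC_deriv_oint[OF loc_integrable_coeff(1)]]]])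
      (simp_all add: P_def \<alpha>_def del: of_real_inverse)
  have Pc: "continuous_on {c..d} P"
    using continuous_on_Re[OF AC_deriv_continuous_on[OF P]] cd by (simp only: Re_complex_of_real) simp
  have mono: "P x < P y" if "x < y" for x y
  proof -
    have "Re (LINT t:{x..y}|lebesgue. \<alpha> t * of_real 1) > 0" by (rule integral_alpha_pos) (use that in auto)
    then show ?thesis
      using AC_derivD(2)[OF AC_deriv_oint[OF loc_integrable_coeff(1)], of x y] that by (simp add: P_def)
  qed
  have mono': "P x \<le> P y" if "x \<le> y" for x y using mono[of x y] that by (cases "x = y") auto
  define L where "L = P d - P c"
  have L: "L > 0" using mono[OF cd] by (simp add: L_def)
  define g where "g x = 1 - (P x - P c) * (P d - P x) / L\<^sup>2" for x
  define G where "G x = - ((P d - P x) - (P x - P c)) / L\<^sup>2" for x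
  have gc: "continuous_on {c..d} g" "continuous_on {c..d} G"
    unfolding g_def G_def using Pc L by (auto intro!: continuous_intros)
  have d1: "AC_deriv {c..d} (\<lambda>x. complex_of_real (P x) - of_real (P c)) (\<lambda>x. \<alpha> x - 0)"
    by (rule AC_deriv_diff[OF P AC_deriv_const])
  have d2: "AC_deriv {c..d} (\<lambda>x. complex_of_real (P d) - of_real (P x)) (\<lambda>x. 0 - \<alpha> x)"
    by (rule AC_deriv_diff[OF AC_deriv_const P])
  have gd: "AC_deriv {c..d} (\<lambda>x. complex_of_real (g x)) (\<lambda>x. \<alpha> x * complex_of_real (G x))"
    by (rule AC_deriv_cong[OF AC_deriv_diff[OF AC_deriv_const[of _ 1] AC_deriv_cmult[OF AC_deriv_mult[OF d1 d2], of "1 / of_real (L\<^sup>2)"]]])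
      (use L in \<open>simp_all add: g_def G_def field_simps\<close>)
  show thesis
  proof (rule that[of g])
    show "continuous_on {c..d} g" by (rule gc)
    show "g c = 1" "g d = 1" by (simp_all add: g_def)
    show "0 \<le> g x \<and> g x \<le> 1" if "x \<in> {c..d}" for x
    proof -
      have p: "0 \<le> P x - P c" "P x - P c \<le> L" "0 \<le> P d - P x" "P d - P x \<le> L"
        using mono'[of c x] mono'[of x d] that by (auto simp: L_def)
      then have "(P x - P c) * (P d - P x) \<le> L * L" by (intro mult_mono) auto
      then have "(P x - P c) * (P d - P x) / L\<^sup>2 \<le> 1" using L by (simp add: power2_eq_square)
      moreover have "0 \<le> (P x - P c) * (P d - P x) / L\<^sup>2" using p by simp
      ultimately show ?thesis by (simp add: g_def)
    qed
    show "g x < 1" if "c < x" "x < d" for x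
      using mono[OF that(1)] mono[OF that(2)] L by (simp add: g_def)
    show "\<exists>H. continuous_on {c..d} H \<and> AC_deriv {c..d} (\<lambda>x. complex_of_real (1 - g x ^ n)) (\<lambda>x. \<alpha> x * complex_of_real (H x))" for n
    proof -
      obtain H where H: "continuous_on {c..d} H" "AC_deriv {c..d} (\<lambda>x. complex_of_real (g x ^ n)) (\<lambda>x. \<alpha> x * complex_of_real (H x))"
        using AC_deriv_alpha_power[OF gd gc, of n] by blast
      have "AC_deriv {c..d} (\<lambda>x. complex_of_real (1 - g x ^ n)) (\<lambda>x. \<alpha> x * complex_of_real (- H x))"
        by (rule AC_deriv_cong[OF AC_deriv_diff[OF AC_deriv_const[of _ 1] H(2)]]) simp_all
      moreover have "continuous_on {c..d} (\<lambda>x. - H x)" by (intro continuous_intros H(1))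
      ultimately show ?thesis by (intro exI[of _ "\<lambda>x. - H x"] conjI)
    qed
  qed
qed

text \<open>As n grows, the integral of w (1 - g^n)^2 tends to that of w, so some fixed n makes it a
  positive number K. The quadratic form of this test function is Q - s K, negative for s > Q/K, and
  Picone's identity applies.\<close>

lemma eventually_zero:
  assumes cd: "c < d" and pos: "Re (LINT t:{c..d}|lebesgue. W t) > 0"
  shows "\<forall>\<^sub>F s::real in at_top. \<exists>x\<in>{c..d}. \<psi> s x = 0"
proof -
  obtain g where g: "continuous_on {c..d} g" "g c = 1" "g d = 1"
    "\<And>x. x \<in> {c..d} \<Longrightarrow> 0 \<le> g x \<and> g x \<le> 1" "\<And>x. c < x \<Longrightarrow> x < d \<Longrightarrow> g x < 1"
    "\<And>n. \<exists>H. continuous_on {c..d} H \<and> AC_deriv {c..d} (\<lambda>x. complex_of_real (1 - g x ^ n)) (\<lambda>x. \<alpha> x * complex_of_real (H x))"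
    by (rule test_functions[OF cd]) (rule that)
  have Wi: "set_integrable lebesgue {c..d} W" "set_integrable lebesgue {c..d} \<alpha>" "set_integrable lebesgue {c..d} (\<beta> l)" for l
    using loc_integrable_coeff by (simp_all add: loc_integrable_def)
  have fi: "set_integrable lebesgue {c..d} (\<lambda>t. W t * of_real ((1 - g t ^ n)\<^sup>2))" for n
    by (intro set_integrable_mult_continuous Wi continuous_intros g(1))
  have AEcd: "AE x in lebesgue. x \<notin> {c, d}"
    by (rule AE_not_in) (simp add: negligible_iff_null_sets[symmetric])
  have lim: "(\<lambda>n. LINT t:{c..d}|lebesgue. W t * of_real ((1 - g t ^ n)\<^sup>2)) \<longlonglongrightarrow> (LINT t:{c..d}|lebesgue. W t)"
    unfolding set_lebesgue_integral_def
  proof (rule integral_dominated_convergence[where w = "\<lambda>x. norm (indicator {c..d} x *\<^sub>R W x)"])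
    show "(\<lambda>x. indicator {c..d} x *\<^sub>R W x) \<in> borel_measurable lebesgue"
      "integrable lebesgue (\<lambda>x. norm (indicator {c..d} x *\<^sub>R W x))"
      using borel_measurable_integrable[OF Wi(1)[unfolded set_integrable_def]] integrable_norm[OF Wi(1)[unfolded set_integrable_def]] .
    show "(\<lambda>x. indicator {c..d} x *\<^sub>R (W x * of_real ((1 - g x ^ n)\<^sup>2))) \<in> borel_measurable lebesgue" for n
      using fi[of n] unfolding set_integrable_def by (rule borel_measurable_integrable)
    show "AE x in lebesgue. (\<lambda>n. indicator {c..d} x *\<^sub>R (W x * of_real ((1 - g x ^ n)\<^sup>2))) \<longlonglongrightarrow> indicator {c..d} x *\<^sub>R W x"
      using AEcd
    proof eventually_elim
      case (elim x)
      show ?case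
      proof (cases "x \<in> {c..d}")
        case True
        then have "norm (g x) < 1" using g(4)[of x] g(5)[of x] elim by auto
        then have l0: "(\<lambda>n. g x ^ n) \<longlonglongrightarrow> 0" by (rule LIMSEQ_power_zero)
        have "(\<lambda>n. indicator {c..d} x *\<^sub>R (W x * of_real ((1 - g x ^ n)\<^sup>2))) \<longlonglongrightarrow> indicator {c..d} x *\<^sub>R (W x * of_real ((1 - 0)\<^sup>2))"
          by (intro tendsto_scaleR tendsto_mult tendsto_const tendsto_of_real tendsto_power tendsto_diff l0)
        then show ?thesis by simp
      qed simp
    qed
    show "AE x in lebesgue. norm (indicator {c..d} x *\<^sub>R (W x * of_real ((1 - g x ^ n)\<^sup>2))) \<le> norm (indicator {c..d} x *\<^sub>R W x)" for n
    proof (rule AE_I2)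
      fix x
      show "norm (indicator {c..d} x *\<^sub>R (W x * of_real ((1 - g x ^ n)\<^sup>2))) \<le> norm (indicator {c..d} x *\<^sub>R W x)"
      proof (cases "x \<in> {c..d}")
        case True
        have "0 \<le> 1 - g x ^ n" "1 - g x ^ n \<le> 1" using g(4)[OF True] by (auto intro: power_le_one)
        then have "(1 - g x ^ n)\<^sup>2 \<le> 1" by (rule power_le_one)
        then have "norm (W x) * (1 - g x ^ n)\<^sup>2 \<le> norm (W x)" by (intro mult_left_le) auto
        with True show ?thesis by (simp only: norm_scaleR norm_mult norm_of_real) simp
      qed simp
    qed
  qed
  have "(\<lambda>n. Re (LINT t:{c..d}|lebesgue. W t * of_real ((1 - g t ^ n)\<^sup>2))) \<longlonglongrightarrow> Re (LINT t:{c..d}|lebesgue. W t)"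
    by (rule tendsto_Re[OF lim])
  then have "\<forall>\<^sub>F n in sequentially. Re (LINT t:{c..d}|lebesgue. W t * of_real ((1 - g t ^ n)\<^sup>2)) > 0"
    using pos by (rule order_tendstoD(1))
  then obtain n where n: "Re (LINT t:{c..d}|lebesgue. W t * of_real ((1 - g t ^ n)\<^sup>2)) > 0" "n \<noteq> 0"
    using eventually_conj[OF _ eventually_ge_at_top[of 1]] eventually_happens'[OF sequentially_bot] by fastforce
  define K where "K = Re (LINT t:{c..d}|lebesgue. W t * of_real ((1 - g t ^ n)\<^sup>2))"
  obtain H where H: "continuous_on {c..d} H" "AC_deriv {c..d} (\<lambda>x. complex_of_real (1 - g x ^ n)) (\<lambda>x. \<alpha> x * complex_of_real (H x))"
    using g(6)[of n] by blast
  let ?Q = "\<lambda>t. \<alpha> t * of_real ((H t)\<^sup>2) + \<beta> 0 t * of_real ((1 - g t ^ n)\<^sup>2)"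
  define Q where "Q = Re (LINT t:{c..d}|lebesgue. ?Q t)"
  have Qi: "set_integrable lebesgue {c..d} ?Q"
    by (intro set_integral_add(1) set_integrable_mult_continuous Wi continuous_intros g(1) H(1))
  have zero: "\<exists>x\<in>{c..d}. \<psi> s x = 0" if s: "s > Q / K" for s :: real
  proof (rule ccontr)
    assume "\<not> (\<exists>x\<in>{c..d}. \<psi> s x = 0)"
    then have "0 \<le> Re (LINT t:{c..d}|lebesgue. \<alpha> t * of_real ((H t)\<^sup>2) + \<beta> s t * of_real ((1 - g t ^ n)\<^sup>2))"
      using n(2) g(2,3) by (intro picone[OF cd H(2,1)]) auto
    also have "(\<lambda>t. \<alpha> t * of_real ((H t)\<^sup>2) + \<beta> s t * of_real ((1 - g t ^ n)\<^sup>2))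
      = (\<lambda>t. ?Q t - of_real s * (W t * of_real ((1 - g t ^ n)\<^sup>2)))"
      by (simp add: \<beta>_def algebra_simps)
    also have "(LINT t:{c..d}|lebesgue. ?Q t - of_real s * (W t * of_real ((1 - g t ^ n)\<^sup>2)))
      = (LINT t:{c..d}|lebesgue. ?Q t) - of_real s * (LINT t:{c..d}|lebesgue. W t * of_real ((1 - g t ^ n)\<^sup>2))"
      by (subst set_integral_diff(2)[OF Qi set_integrable_mult_right[OF fi]]) simp
    also have "Re \<dots> = Q - s * K" by (simp add: Q_def K_def)
    finally have "s * K \<le> Q" by simp
    moreover have "K > 0" using n(1) by (simp add: K_def)
    ultimately show False using s by (simp add: divide_less_eq)
  qed
  show ?thesis by (rule eventually_mono[OF eventually_gt_at_top zero])
qed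

lemma integral_W: "set_integrable lebesgue {c..d} w" "(LINT t:{c..d}|lebesgue. W t) = of_real (LINT t:{c..d}|lebesgue. w t)"
proof -
  have "set_integrable lebesgue {c..d} W" using loc_integrable_coeff by (simp add: loc_integrable_def)
  then have "integrable lebesgue (\<lambda>x. Re (indicator {c..d} x *\<^sub>R W x))" unfolding set_integrable_def by (rule integrable_Re)
  then show "set_integrable lebesgue {c..d} w" by (simp add: set_integrable_def W_def)
  then show "(LINT t:{c..d}|lebesgue. W t) = of_real (LINT t:{c..d}|lebesgue. w t)"
    unfolding W_def by (rule set_integral_complex_of_real')
qed

text \<open>Lebesgue differentiation turns a point with w > 0 into small intervals around it with
  positive integral of w. There are infinitely many such points, so n of them with disjoint
  intervals can be selected, and each interval eventually contains a zero.\<close>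

lemma eventually_many_zeros:
  assumes pos: "\<not> (AE x in lebesgue_on {0<..<a}. w x < 0)"
  shows "\<forall>\<^sub>F s::real in at_top. \<exists>Z. finite Z \<and> card Z = n \<and> Z \<subseteq> {0<..a} \<and> (\<forall>z\<in>Z. \<psi> s z = 0)"
proof -
  define good where "good x \<longleftrightarrow> (\<forall>e>0. \<exists>\<delta>>0. \<forall>c d. c \<le> x \<and> x \<le> d \<and> c < d \<and> d - c < \<delta> \<longrightarrow>
           \<bar>(LINT y:{c..d}|lebesgue. w y) - w x * (d - c)\<bar> \<le> e * (d - c))" for x
  define A where "A = {x. 0 < x \<and> x < a \<and> w x > 0 \<and> good x}"
  have "infinite A"
  proof
    assume "finite A"
    then have "AE x in lebesgue. x \<notin> A"
      by (intro AE_not_in) (simp add: negligible_iff_null_sets[symmetric] negligible_finite)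
    moreover have "AE x in lebesgue. good x" unfolding good_def by (rule AE_average[OF integral_W(1)])
    ultimately have "AE x in lebesgue. x \<in> {0<..<a} \<longrightarrow> w x < 0"
      using w_nz by eventually_elim (auto simp: A_def)
    with pos show False by (simp add: AE_restrict_space_iff)
  qed
  then obtain X where X: "finite X" "card X = n" "X \<subseteq> A" by (meson infinite_arbitrarily_large)
  have 1: "\<forall>\<^sub>F \<eta> in at_right 0. 0 < x - \<eta> \<and> x + \<eta> < a \<and> 0 < Re (LINT t:{x - \<eta>..x + \<eta>}|lebesgue. W t)" if x: "x \<in> X" for x
  proof -
    have xA: "0 < x" "x < a" "w x > 0" "good x" using x X(3) by (auto simp: A_def)
    obtain \<delta> where \<delta>: "\<delta> > 0" "\<And>c d. c \<le> x \<Longrightarrow> x \<le> d \<Longrightarrow> c < d \<Longrightarrow> d - c < \<delta> \<Longrightarrow>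
           \<bar>(LINT y:{c..d}|lebesgue. w y) - w x * (d - c)\<bar> \<le> w x / 2 * (d - c)"
      using xA(4)[unfolded good_def, rule_format, of "w x / 2"] xA(3) by auto
    show ?thesis unfolding eventually_at_right_field
    proof (intro exI[of _ "Min {\<delta> / 2, x, a - x}"] conjI allI impI)
      show "0 < Min {\<delta> / 2, x, a - x}" using \<delta>(1) xA by simp
      fix \<eta> assume \<eta>: "0 < \<eta>" "\<eta> < Min {\<delta> / 2, x, a - x}"
      then have \<eta>': "\<eta> < \<delta> / 2" "\<eta> < x" "\<eta> < a - x" by simp_all
      then show "0 < x - \<eta>" "x + \<eta> < a" by simp_all
      have "\<bar>(LINT y:{x - \<eta>..x + \<eta>}|lebesgue. w y) - w x * (2 * \<eta>)\<bar> \<le> w x / 2 * (2 * \<eta>)"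
        using \<delta>(2)[of "x - \<eta>" "x + \<eta>"] \<eta> \<eta>' by simp
      moreover have "w x * \<eta> > 0" using xA(3) \<eta>(1) by simp
      ultimately show "0 < Re (LINT t:{x - \<eta>..x + \<eta>}|lebesgue. W t)" unfolding integral_W(2) by simp
    qed
  qed
  have 2: "\<forall>\<^sub>F \<eta> in at_right 0. \<forall>y\<in>X. x \<noteq> y \<longrightarrow> 2 * \<eta> < \<bar>x - y\<bar>" for x :: real
  proof (intro eventually_ball_finite X(1) ballI)
    fix y
    show "\<forall>\<^sub>F \<eta> in at_right 0. x \<noteq> y \<longrightarrow> 2 * \<eta> < \<bar>x - y\<bar>"
    proof (cases "x = y")
      case False
      then show ?thesis unfolding eventually_at_right_field by (intro exI[of _ "\<bar>x - y\<bar> / 2"]) auto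
    qed simp
  qed
  have "\<forall>\<^sub>F \<eta> in at_right 0. (\<forall>x\<in>X. 0 < x - \<eta> \<and> x + \<eta> < a \<and> 0 < Re (LINT t:{x - \<eta>..x + \<eta>}|lebesgue. W t)) \<and>
     (\<forall>x\<in>X. \<forall>y\<in>X. x \<noteq> y \<longrightarrow> 2 * \<eta> < \<bar>x - y\<bar>) \<and> 0 < \<eta>"
    by (intro eventually_conj eventually_ball_finite X(1) ballI 1 2 eventually_at_right_less)
  from eventually_happens'[OF trivial_limit_at_right_real this]
  obtain \<eta> where \<eta>0: "\<forall>x\<in>X. 0 < x - \<eta> \<and> x + \<eta> < a \<and> 0 < Re (LINT t:{x - \<eta>..x + \<eta>}|lebesgue. W t)"
     "\<forall>x\<in>X. \<forall>y\<in>X. x \<noteq> y \<longrightarrow> 2 * \<eta> < \<bar>x - y\<bar>" "0 < \<eta>"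
    by (elim exE conjE) (rule that)
  note \<eta> = \<eta>0(1)[rule_format] \<eta>0(2)[rule_format] \<eta>0(3)
  have "\<forall>\<^sub>F s::real in at_top. \<forall>x\<in>X. \<exists>z\<in>{x - \<eta>..x + \<eta>}. \<psi> s z = 0"
    using \<eta> by (intro eventually_ball_finite X(1) ballI eventually_zero) auto
  then show ?thesis
  proof eventually_elim
    case (elim s)
    then have "\<forall>x\<in>X. \<exists>z. z \<in> {x - \<eta>..x + \<eta>} \<and> \<psi> s z = 0" by blast
    from bchoice[OF this] obtain z where "\<forall>x\<in>X. z x \<in> {x - \<eta>..x + \<eta>} \<and> \<psi> (of_real s) (z x) = 0"
      by (elim exE) (rule that)
    note z = this[rule_format]
    have "inj_on z X"
    proof (rule inj_onI, rule ccontr)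
      fix x y assume xy: "x \<in> X" "y \<in> X" "z x = z y" "x \<noteq> y"
      then have "\<bar>x - y\<bar> \<le> 2 * \<eta>" using z[OF xy(1)] z[OF xy(2)] by auto
      with \<eta>(2)[OF xy(1,2,4)] show False by simp
    qed
    then have "card (z ` X) = n" using X(2) by (simp add: card_image)
    moreover have "z ` X \<subseteq> {0<..a}"
    proof
      fix t assume "t \<in> z ` X"
      then obtain x where "x \<in> X" "t = z x" by blast
      then show "t \<in> {0<..a}" using z[of x] \<eta>(1)[of x] by auto
    qed
    moreover have "\<forall>t\<in>z ` X. \<psi> s t = 0" using z by blast
    ultimately show ?case using X(1) by (intro exI[of _ "z ` X"] conjI finite_imageI)
  qed
qed

text \<open>The curve \<psi> + i p \<psi>' never vanishes because of the Wronskian, and the strip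
  [0, a] times the line is contractible, so a continuous logarithm exists; its imaginary part is an
  angle that also depends continuously on s.\<close>

lemma pruefer_angle:
  obtains \<theta> r :: "real \<Rightarrow> real \<Rightarrow> real" where
    "\<And>s. pruefer a (\<theta> s) (r s) (\<lambda>x. Re (\<psi> s x)) (\<lambda>x. Re (\<psi>1 s x))"
    "\<And>s. cos (\<theta> s 0) = 0" "\<And>s. sin (\<theta> s 0) = 1" "continuous_on UNIV (\<lambda>s. \<theta> s a - \<theta> s 0)"
proof -
  define zz where "zz = (\<lambda>(x, s::real). Complex (Re (\<psi> s x)) (Re (\<psi>1 s x)))"
  have zc: "continuous_on ({0..a} \<times> UNIV) zz"
  proof -
    have "continuous_on ({0..a} \<times> UNIV) (\<lambda>z. Complex (Re ((\<lambda>(x, s::real). \<psi> s x) z)) (Re ((\<lambda>(x, s::real). \<psi>1 s x) z)))"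
      unfolding Complex_eq by (intro continuous_intros psi_jointly_continuous)
    then show ?thesis by (rule continuous_on_eq) (auto simp: zz_def)
  qed
  have znz: "zz z \<noteq> 0" for z
  proof
    assume "zz z = 0"
    obtain x s where "z = (x, s)" by fastforce
    with \<open>zz z = 0\<close> have "\<psi> s x = 0" "\<psi>1 s x = 0"
      using fundamental_real[of s x] by (auto simp: zz_def complex_eq_iff)
    then show False using wronskian[of "of_real s" x] by simp
  qed
  have "contractible ({0..a} \<times> (UNIV :: real set))"
    by (intro convex_imp_contractible convex_Times) auto
  then obtain g where g: "continuous_on ({0..a} \<times> UNIV) g" "\<And>z. z \<in> {0..a} \<times> UNIV \<Longrightarrow> zz z = exp (g z)"
    using continuous_logarithm_on_contractible[OF zc _ znz] by metis
  have eq: "Re (\<psi> s x) = exp (Re (g (x, s))) * cos (Im (g (x, s)))" "Re (\<psi>1 s x) = exp (Re (g (x, s))) * sin (Im (g (x, s)))"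
    if "x \<in> {0..a}" for s x
    using arg_cong[OF g(2)[of "(x, s)"], of Re] arg_cong[OF g(2)[of "(x, s)"], of Im] that
    by (simp_all add: zz_def Re_exp Im_exp)
  have gx: "continuous_on {0..a} (\<lambda>x. g (x, s))" for s
    by (rule continuous_on_compose2[OF g(1)]) (auto intro!: continuous_intros)
  have gs: "continuous_on UNIV (\<lambda>s. g (x, s))" if "x \<in> {0..a}" for x
    by (rule continuous_on_compose2[OF g(1)]) (use that in \<open>auto intro!: continuous_intros\<close>)
  have a0: "0 \<in> {0..a}" "a \<in> {0..a}" using a_pos by auto
  show thesis
  proof (rule that[of "\<lambda>s x. Im (g (x, s))" "\<lambda>s x. exp (Re (g (x, s)))"])
    show c: "cos (Im (g (0, s))) = 0" for s using eq(1)[OF a0(1), of s] by (simp add: fundamental)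
    show "sin (Im (g (0, s))) = 1" for s
    proof -
      have "exp (Re (g (0, s))) * sin (Im (g (0, s))) = 1" using eq(2)[OF a0(1), of s] by (simp add: fundamental)
      then have "sin (Im (g (0, s))) > 0" using zero_less_mult_pos[of "exp (Re (g (0, s)))" "sin (Im (g (0, s)))"] by (simp only: exp_gt_zero zero_less_one)
      moreover have "(sin (Im (g (0, s))))\<^sup>2 = 1" using sin_cos_squared_add[of "Im (g (0, s))"] c by simp
      ultimately show ?thesis by (auto simp: power2_eq_1_iff)
    qed
    show "continuous_on UNIV (\<lambda>s. Im (g (a, s)) - Im (g (0, s)))"
      by (rule continuous_on_diff[OF continuous_on_Im[OF gs[OF a0(2)]] continuous_on_Im[OF gs[OF a0(1)]]])
    show "pruefer a (\<lambda>x. Im (g (x, s))) (\<lambda>x. exp (Re (g (x, s)))) (\<lambda>x. Re (\<psi> s x)) (\<lambda>x. Re (\<psi>1 s x))" for s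
    proof
      show "continuous_on {0..a} (\<lambda>x. Im (g (x, s)))" by (rule continuous_on_Im[OF gx])
      show "continuous_on {0..a} (\<lambda>x. Re (\<psi>1 s x))"
        by (rule continuous_on_Re[OF continuous_on_subset[OF continuous_fundamental(4) subset_UNIV]])
      fix \<sigma> x y :: real
      assume \<sigma>: "\<sigma> = 1 \<or> \<sigma> = - 1" and xy: "0 \<le> x" "x < y" "y \<le> a" and pos: "\<And>t. t \<in> {x..y} \<Longrightarrow> \<sigma> * Re (\<psi>1 s t) > 0"
      have "AC_deriv UNIV (\<psi> s) (\<lambda>x. \<alpha> x * \<psi>1 s x)" using fundamental(2)[of s] by (simp add: lin_sys_def)
      from AC_derivD(2)[OF this, of x y] xy have "(LINT t:{x..y}|lebesgue. \<alpha> t * \<psi>1 s t) = \<psi> s y - \<psi> s x" by simp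
      moreover have r: "of_real (Re (\<psi>1 s t)) = \<psi>1 s t" for t using fundamental_real(4)[of s t] by (simp add: complex_eq_iff)
      have "\<alpha> t * of_real (\<sigma> * Re (\<psi>1 s t)) = of_real \<sigma> * (\<alpha> t * \<psi>1 s t)" for t
        by (simp only: of_real_mult r mult.left_commute)
      moreover have "Re (LINT t:{x..y}|lebesgue. \<alpha> t * of_real (\<sigma> * Re (\<psi>1 s t))) > 0"
        by (rule integral_alpha_pos[OF continuous_on_mult[OF continuous_on_const continuous_on_Re[OF continuous_on_subset[OF continuous_fundamental(4) subset_UNIV]]] xy(2) pos])
      ultimately have "Re (of_real \<sigma> * (\<psi> s y - \<psi> s x)) > 0" by (simp only: set_integral_mult_right)
      then show "\<sigma> * Re (\<psi> s x) < \<sigma> * Re (\<psi> s y)" by (simp add: algebra_simps)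
    qed (use a_pos eq in auto)
  qed
qed

text \<open>Where \<psi>(a) = 0 the monodromy matrix is triangular with determinant 1, so D = \<rho>
  + 1/\<rho> with \<rho> = (p \<psi>')(a). The parity of the number of half turns of the angle is
  the sign of \<rho>.\<close>

lemma D_oscillates:
  assumes pos: "\<not> (AE x in lebesgue_on {0<..<a}. w x < 0)"
  shows "\<exists>s\<ge>s0. 2 \<le> (-1) ^ k * Re (D (complex_of_real s))"
proof -
  obtain \<theta> r :: "real \<Rightarrow> real \<Rightarrow> real" where
    \<theta>: "\<And>s. pruefer a (\<theta> s) (r s) (\<lambda>x. Re (\<psi> s x)) (\<lambda>x. Re (\<psi>1 s x))"
    "\<And>s. cos (\<theta> s 0) = 0" "\<And>s. sin (\<theta> s 0) = 1" "continuous_on UNIV (\<lambda>s. \<theta> s a - \<theta> s 0)"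
    by (rule pruefer_angle) (rule that)
  obtain m where m: "- (\<theta> s0 a - \<theta> s0 0) / pi \<le> real m" using real_arch_simple by blast
  \<comment> \<open>The parity of N is that of k, and m is large enough for -N \<pi> to lie below
    the angle increment at s0. Many zeros push the increment below -N \<pi> for large s, so it is
    attained in between.\<close>
  define N where "N = 2 * m + k"
  have N: "- (real N * pi) \<le> \<theta> s0 a - \<theta> s0 0"
  proof -
    have "- (\<theta> s0 a - \<theta> s0 0) / pi \<le> real N" using m unfolding N_def by linarith
    then show ?thesis by (simp add: divide_le_eq)
  qed
  have "\<forall>\<^sub>F s::real in at_top. s \<ge> s0 \<and> (\<exists>Z. finite Z \<and> card Z = N \<and> Z \<subseteq> {0<..a} \<and> (\<forall>z\<in>Z. \<psi> s z = 0))"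
    by (intro eventually_conj eventually_ge_at_top eventually_many_zeros pos)
  from eventually_happens'[OF trivial_limit_at_top_linorder this]
  obtain s Z where s: "s \<ge> s0" "finite Z" "card Z = N" "Z \<subseteq> {0<..a}" "\<forall>z\<in>Z. \<psi> (of_real s) z = 0"
    by (elim exE conjE) (rule that)
  have "\<theta> s a \<le> \<theta> s 0 - real (card Z) * pi"
    by (rule pruefer.zeros_count[OF \<theta>(1) s(2,4) _ \<theta>(2)]) (use s(5) in simp)
  then have "\<theta> s a - \<theta> s 0 \<le> - (real N * pi)" using s(3) by simp
  then have "\<exists>t\<ge>s0. t \<le> s \<and> \<theta> t a - \<theta> t 0 = - (real N * pi)"
    by (rule IVT2'[of "\<lambda>s. \<theta> s a - \<theta> s 0", OF _ N s(1) continuous_on_subset[OF \<theta>(4) subset_UNIV]])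
  then obtain t where t: "s0 \<le> t" "\<theta> t a - \<theta> t 0 = - (real N * pi)" by blast
  interpret T: pruefer a "\<theta> t" "r t" "\<lambda>x. Re (\<psi> t x)" "\<lambda>x. Re (\<psi>1 t x)" by (rule \<theta>(1))
  have aa: "a \<in> {0..a}" using a_pos by simp
  have ta: "\<theta> t a = \<theta> t 0 - real N * pi" using t(2) by simp
  have sc: "cos (real N * pi) = (-1) ^ k" "sin (real N * pi) = 0"
    by (simp_all only: cos_npi sin_npi) (simp add: N_def power_add power_mult)
  have "Re (\<psi> t a) = 0" unfolding T.u_eq[OF aa] ta cos_diff sc by (simp add: \<theta>(2))
  then have 0: "\<psi> t a = 0" using fundamental_real(2)[of t a] by (simp add: complex_eq_iff)
  have v: "Re (\<psi>1 t a) = r t a * (-1) ^ k" unfolding T.v_eq[OF aa] ta sin_diff sc by (simp add: \<theta>(3))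
  have "\<phi> t a * \<psi>1 t a = 1" using wronskian[of "of_real t" a] 0 by simp
  from arg_cong[OF this, of Re] have "Re (\<phi> t a) * Re (\<psi>1 t a) = 1"
    using fundamental_real[of t a] by simp
  then have "((-1) ^ k * Re (\<phi> t a)) * r t a = 1" unfolding v by (simp only: mult.assoc mult.left_commute mult.commute)
  then have x: "(-1) ^ k * Re (\<phi> t a) = 1 / r t a" using T.r0[OF aa] by (subst eq_divide_eq) simp
  have "(-1) ^ k * (-1) ^ k = (1 :: real)" by (simp flip: power_mult_distrib)
  then have y: "(-1) ^ k * Re (\<psi>1 t a) = r t a" unfolding v by (simp only: mult.left_commute[of _ "r t a"] mult_1_right)
  have "(-1) ^ k * Re (D (of_real t)) = 1 / r t a + r t a"
    unfolding D_def by (simp only: plus_complex.sel distrib_left x y)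
  then show ?thesis using t(1) inverse_plus_self_ge_2[OF T.r0[OF aa]] by (intro exI[of _ t] conjI) simp_all
qed

end

section \<open>Level sets of entire functions\<close>

lemma open_contains_nonreal_value:
  assumes D: "D holomorphic_on UNIV" "\<not> D constant_on UNIV" and U: "open U" "U \<noteq> {}"
  shows "\<exists>z\<in>U. Im (D z) \<noteq> 0"
proof (rule ccontr)
  assume *: "\<not> (\<exists>z\<in>U. Im (D z) \<noteq> 0)"
  have "open (D ` U)" by (rule open_mapping_thm[OF D(1) open_UNIV connected_UNIV U(1) subset_UNIV D(2)])
  moreover obtain z where z: "z \<in> U" using U(2) by blast
  ultimately obtain e where e: "e > 0" "ball (D z) e \<subseteq> D ` U" unfolding open_contains_ball by blast
  have "D z + \<i> * of_real (e / 2) \<in> ball (D z) e" using e(1) by (simp add: dist_norm norm_mult)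
  \<comment> \<open>The image contains a disc, so a point shifted vertically by e/2 is also a
    value.\<close>
  then obtain z' where "z' \<in> U" "D z' = D z + \<i> * of_real (e / 2)" using e(2) by force
  then have "Im (D z') = Im (D z) + e / 2" by simp
  with * z \<open>z' \<in> U\<close> e(1) show False by auto
qed

lemma components_unbounded:
  assumes D: "D holomorphic_on UNIV" "\<not> D constant_on UNIV"
    and S: "closed S" "\<And>z. z \<in> S \<Longrightarrow> Im (D z) = 0" and C: "C \<in> components (- S)"
  shows "\<not> bounded C"
proof
  assume bC: "bounded C"
  have fr: "frontier C \<subseteq> S" by (rule frontier_of_components_closed_complement[OF S(1) C])
  have "open C" "C \<noteq> {}" using C open_components[of "- S" C] S(1) by (auto simp: in_components_nonempty open_Compl)
  have exph: "(\<lambda>z. exp (c * D z)) holomorphic_on A" for c A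
    by (intro holomorphic_intros holomorphic_on_subset[OF D(1) subset_UNIV])
  \<comment> \<open>Both exp(i D) and exp(-i D) have modulus 1 on the frontier, so Im D has both
    signs inside, that is, it vanishes.\<close>
  have bound: "Re (c * D z) \<le> 0" if c: "c = \<i> \<or> c = - \<i>" and z: "z \<in> C" for c z
  proof -
    have "norm (exp (c * D z)) \<le> 1"
    proof (rule maximum_modulus_frontier[OF exph _ bC _ z])
      show "continuous_on (closure C) (\<lambda>z. exp (c * D z))" by (rule holomorphic_on_imp_continuous_on[OF exph])
      fix y assume "y \<in> frontier C"
      then have "Im (D y) = 0" using fr S(2) by blast
      with c show "norm (exp (c * D y)) \<le> 1" by auto
    qed
    then show ?thesis by simp
  qed
  have "Im (D z) = 0" if "z \<in> C" for z
    using bound[of \<i> z] bound[of "- \<i>" z] that by simp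
  with open_contains_nonreal_value[OF D \<open>open C\<close> \<open>C \<noteq> {}\<close>] show False by blast
qed

text \<open>With n the order of the first nonvanishing derivative, D - D(l) is the n-th power of a
  function with a simple zero at l, and \<open>k\<close> is the local inverse of that
  function.\<close>

lemma local_power_coordinate:
  assumes D: "D holomorphic_on UNIV" "\<not> D constant_on UNIV"
  obtains k \<delta> n where "0 < \<delta>" "0 < (n::nat)" "k holomorphic_on ball 0 \<delta>" "inj_on k (ball 0 \<delta>)" "k 0 = l"
    "\<And>\<zeta>. \<zeta> \<in> ball 0 \<delta> \<Longrightarrow> D (k \<zeta>) = D l + \<zeta> ^ n"
proof -
  have "\<exists>n>0. (deriv ^^ n) D l \<noteq> 0"
  proof (rule ccontr)
    assume "\<not> (\<exists>n>0. (deriv ^^ n) D l \<noteq> 0)"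
    then have z: "(deriv ^^ n) D l = 0" if "0 < n" for n using that by blast
    have "D z = D l" for z
      by (rule holomorphic_fun_eq_const_on_connected[OF D(1) open_UNIV connected_UNIV z UNIV_I UNIV_I])
    with D(2) show False by (auto simp: constant_on_def)
  qed
  then have ex: "\<exists>n. 0 < n \<and> (deriv ^^ n) D l \<noteq> 0" by blast
  define n where "n = (LEAST n. 0 < n \<and> (deriv ^^ n) D l \<noteq> 0)"
  have n: "0 < n" "(deriv ^^ n) D l \<noteq> 0" using LeastI_ex[OF ex] by (auto simp: n_def)
  have low: "(deriv ^^ i) D l = 0" if "0 < i" "i < n" for i
    using not_less_Least[of i "\<lambda>n. 0 < n \<and> (deriv ^^ n) D l \<noteq> 0"] that by (auto simp: n_def)
  obtain g r where g: "0 < r" "g holomorphic_on ball l r"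
      "\<And>w. w \<in> ball l r \<Longrightarrow> D w - D l = ((w - l) * g w) ^ n" "\<And>w. w \<in> ball l r \<Longrightarrow> g w \<noteq> 0"
    by (rule holomorphic_factor_order_of_zero_strong[OF D(1) open_UNIV UNIV_I n low]; (assumption | (rule that; assumption)))
  define h where "h w = (w - l) * g w" for w
  have hh: "h holomorphic_on ball l r" unfolding h_def by (intro holomorphic_intros g(2))
  have l: "l \<in> ball l r" using g(1) by simp
  have "(h has_field_derivative (1 - 0) * g l + deriv g l * (l - l)) (at l)"
    unfolding h_def using holomorphic_derivI[OF g(2) open_ball l]
    by (intro DERIV_mult DERIV_diff DERIV_ident DERIV_const)
  then have "deriv h l = g l" by (simp add: DERIV_imp_deriv)
  then have dh: "deriv h l \<noteq> 0" using g(4)[OF l] by simp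
  obtain r' where r': "r' > 0" "ball l r' \<subseteq> ball l r" "inj_on h (ball l r')"
    by (rule has_complex_derivative_locally_injective[OF hh l open_ball dh]) (rule that)
  have hr': "h holomorphic_on ball l r'" by (rule holomorphic_on_subset[OF hh r'(2)])
  obtain k where k: "k holomorphic_on (h ` ball l r')" "\<And>z. z \<in> ball l r' \<Longrightarrow> deriv h z * deriv k (h z) = 1"
      "\<And>z. z \<in> ball l r' \<Longrightarrow> k (h z) = z"
    by (rule holomorphic_has_inverse[OF hr' open_ball r'(3)]) (rule that)
  have h0: "h l = 0" by (simp add: h_def)
  have l': "l \<in> ball l r'" using r'(1) by simp
  have "open (h ` ball l r')" by (rule open_mapping_thm3[OF hr' open_ball r'(3)])
  moreover have "0 \<in> h ` ball l r'" using h0 l' by force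
  ultimately obtain \<delta> where \<delta>: "\<delta> > 0" "ball 0 \<delta> \<subseteq> h ` ball l r'" unfolding open_contains_ball by blast
  have hk: "h (k \<zeta>) = \<zeta>" "k \<zeta> \<in> ball l r'" if "\<zeta> \<in> ball 0 \<delta>" for \<zeta>
    using \<delta>(2) that k(3) by auto
  show thesis
  proof (rule that[of \<delta> n k])
    show "k holomorphic_on ball 0 \<delta>" by (rule holomorphic_on_subset[OF k(1) \<delta>(2)])
    show "inj_on k (ball 0 \<delta>)" by (rule inj_onI) (metis hk(1))
    show "k 0 = l" using k(3)[OF l'] h0 by simp
    show "D (k \<zeta>) = D l + \<zeta> ^ n" if "\<zeta> \<in> ball 0 \<delta>" for \<zeta>
    proof -
      have "k \<zeta> \<in> ball l r" using hk(2)[OF that] r'(2) by blast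
      from g(3)[OF this] have "D (k \<zeta>) - D l = h (k \<zeta>) ^ n" by (simp add: h_def)
      then show ?thesis using hk(1)[OF that] by (simp add: algebra_simps)
    qed
  qed (use \<delta> n in auto)
qed

text \<open>The curve is the image under \<open>k\<close> of a ray from 0. On the ray \<zeta>^n is
  real of constant sign, chosen to move the value of D towards 0, so that it remains in [-2, 2] also
  when it starts at an endpoint.\<close>

lemma analytic_curve_through:
  assumes D: "D holomorphic_on UNIV" "\<not> D constant_on UNIV" and l: "D l \<in> complex_of_real ` {-2..2}"
  obtains g \<epsilon> where "0 < (\<epsilon>::real)" "continuous_on {0..\<epsilon>} g" "inj_on g {0..\<epsilon>}" "g 0 = l"
    "\<And>t. t \<in> {0..\<epsilon>} \<Longrightarrow> D (g t) \<in> complex_of_real ` {-2..2}" "\<And>t. t \<in> {0<..<\<epsilon>} \<Longrightarrow> real_analytic_at g t"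
proof -
  obtain k \<delta> n where k: "0 < \<delta>" "0 < (n::nat)" "k holomorphic_on ball 0 \<delta>" "inj_on k (ball 0 \<delta>)" "k 0 = l"
    "\<And>\<zeta>. \<zeta> \<in> ball 0 \<delta> \<Longrightarrow> D (k \<zeta>) = D l + \<zeta> ^ n"
    by (rule local_power_coordinate[OF D]) (rule that)
  obtain d where d: "D l = of_real d" "- 2 \<le> d" "d \<le> 2" using l by auto
  have root: "cis (pi / real n) ^ n = - 1"
  proof -
    have "real n * (pi / real n) = pi" using k(2) by simp
    then show ?thesis by (simp only: Complex.DeMoivre cis_pi)
  qed
  define \<omega> where "\<omega> = (if d \<le> 0 then 1 else cis (pi / real n))"
  define \<sigma> :: real where "\<sigma> = (if d \<le> 0 then 1 else - 1)"
  have \<omega>: "norm \<omega> = 1" "\<omega> ^ n = of_real \<sigma>" "\<sigma> = 1 \<and> d \<le> 0 \<or> \<sigma> = - 1 \<and> d \<ge> 0"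
    by (simp_all add: \<omega>_def \<sigma>_def root)
  \<comment> \<open>The bound 1 keeps t^n at most 1, so a value starting in [-2, 0] or [0, 2] cannot
    leave [-2, 2] at the other end.\<close>
  define \<epsilon> where "\<epsilon> = min 1 (\<delta> / 2)"
  have \<epsilon>: "0 < \<epsilon>" "\<epsilon> \<le> 1" "\<epsilon> < \<delta>" using k(1) by (auto simp: \<epsilon>_def)
  define g where "g t = k (of_real t * \<omega>)" for t :: real
  have inb: "of_real t * \<omega> \<in> ball 0 \<delta>" if "t \<in> {0..\<epsilon>}" for t
    using that \<epsilon> by (simp add: norm_mult \<omega>(1))
  have \<omega>0: "\<omega> \<noteq> 0" using \<omega>(1) by auto
  show thesis
  proof (rule that[of \<epsilon> g])
    show "continuous_on {0..\<epsilon>} g" unfolding g_def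
      by (rule continuous_on_compose2[OF holomorphic_on_imp_continuous_on[OF k(3)]])
        (use inb in \<open>auto intro!: continuous_intros\<close>)
    show "inj_on g {0..\<epsilon>}"
    proof (rule inj_onI)
      fix s t assume st: "s \<in> {0..\<epsilon>}" "t \<in> {0..\<epsilon>}" "g s = g t"
      then have "of_real s * \<omega> = of_real t * \<omega>"
        by (intro inj_onD[OF k(4) _ inb inb]) (simp_all only: g_def)
      then show "s = t" using \<omega>0 by simp
    qed
    show "g 0 = l" by (simp add: g_def k(5))
    show "D (g t) \<in> complex_of_real ` {-2..2}" if t: "t \<in> {0..\<epsilon>}" for t
    proof -
      have "D (g t) = of_real (d + t ^ n * \<sigma>)"
        using k(6)[OF inb[OF t]] by (simp add: g_def d(1) power_mult_distrib \<omega>(2))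
      moreover have "0 \<le> t ^ n" "t ^ n \<le> 1" using t \<epsilon> by (auto intro: power_le_one)
      then have "d + t ^ n * \<sigma> \<in> {-2..2}" using \<omega>(3) d by auto
      ultimately show ?thesis by blast
    qed
    show "real_analytic_at g t" if t: "t \<in> {0<..<\<epsilon>}" for t
      unfolding real_analytic_at_def
    \<comment> \<open>The disc around t \<omega> of radius \<delta> - t still lies in the disc where
      \<open>k\<close> is holomorphic; the Taylor series of \<open>k\<close> restricted to the ray
      gives the real series.\<close>
    proof (intro exI[of _ "\<delta> - t"] conjI exI[of _ "\<lambda>m. (deriv ^^ m) k (of_real t * \<omega>) / fact m * \<omega> ^ m"] allI impI)
      show "0 < \<delta> - t" using t \<epsilon> by simp
      fix s :: real assume s: "\<bar>s - t\<bar> < \<delta> - t"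
      have sub: "ball (of_real t * \<omega>) (\<delta> - t) \<subseteq> ball 0 \<delta>"
        unfolding ball_subset_ball_iff using t by (simp add: norm_mult \<omega>(1))
      have diff: "of_real s * \<omega> - of_real t * \<omega> = of_real (s - t) * \<omega>" by (simp add: algebra_simps)
      have "norm (of_real s * \<omega> - of_real t * \<omega>) = \<bar>s - t\<bar>"
        unfolding diff by (simp only: norm_mult norm_of_real \<omega>(1)) simp
      then have "of_real s * \<omega> \<in> ball (of_real t * \<omega>) (\<delta> - t)"
        using s by (simp add: dist_norm norm_minus_commute)
      from holomorphic_power_series[OF holomorphic_on_subset[OF k(3) sub] this]
      show "(\<lambda>m. (deriv ^^ m) k (of_real t * \<omega>) / fact m * \<omega> ^ m * of_real (s - t) ^ m) sums g s"
        unfolding diff g_def by (simp only: power_mult_distrib mult.assoc mult.commute[of "\<omega> ^ _"])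
    qed
  qed (use \<epsilon> in auto)
qed

lemma level_set_curves:
  assumes D: "D holomorphic_on UNIV" "\<not> D constant_on UNIV"
  defines "\<Sigma> \<equiv> {l. D l \<in> complex_of_real ` {-2..2}}"
  shows "\<not> l isolated_in \<Sigma>" "\<exists>\<Gamma>. (\<forall>S\<in>\<Gamma>. is_analytic_curve S) \<and> \<Sigma> = (\<Union>S\<in>\<Gamma>. closure S)" "interior \<Sigma> = {}" "closed \<Sigma>"
proof -
  have "closed (complex_of_real ` {-2..2})"
    by (intro compact_imp_closed compact_continuous_image continuous_intros) auto
  then have "closed (D -` (complex_of_real ` {-2..2}))"
    by (intro continuous_closed_vimage)
      (use holomorphic_on_imp_continuous_on[OF D(1)] in \<open>simp_all add: continuous_on_eq_continuous_at\<close>)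
  then show cl: "closed \<Sigma>" by (simp add: \<Sigma>_def vimage_def)
  show "interior \<Sigma> = {}"
  proof (rule ccontr)
    assume "interior \<Sigma> \<noteq> {}"
    from open_contains_nonreal_value[OF D open_interior this] obtain z where "z \<in> interior \<Sigma>" "Im (D z) \<noteq> 0" by blast
    moreover from this have "z \<in> \<Sigma>" using interior_subset by blast
    ultimately show False by (auto simp: \<Sigma>_def)
  qed
  show "\<not> l isolated_in \<Sigma>"
  proof
    assume iso: "l isolated_in \<Sigma>"
    then have "D l \<in> complex_of_real ` {-2..2}" by (simp add: isolated_in_def \<Sigma>_def)
    then obtain g \<epsilon> where g: "0 < (\<epsilon>::real)" "continuous_on {0..\<epsilon>} g" "inj_on g {0..\<epsilon>}" "g 0 = l"
      "\<And>t. t \<in> {0..\<epsilon>} \<Longrightarrow> D (g t) \<in> complex_of_real ` {-2..2}"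
      by (rule analytic_curve_through[OF D]) (rule that)
    obtain e where e: "e > 0" "\<And>y. y \<in> \<Sigma> \<Longrightarrow> dist l y < e \<Longrightarrow> y = l"
      using iso[unfolded isolated_in_dist_Ex_iff] by (elim conjE exE) (rule that, auto)
    have z0: "0 \<in> {0..\<epsilon>}" using g(1) by simp
    have "\<exists>\<eta>>0. \<forall>t\<in>{0..\<epsilon>}. dist t 0 < \<eta> \<longrightarrow> dist (g t) (g 0) < e"
      by (rule continuous_on_iff[THEN iffD1, OF g(2), rule_format, OF z0 e(1)])
    then obtain \<eta> where \<eta>0: "\<eta> > 0" "\<forall>t\<in>{0..\<epsilon>}. dist t 0 < \<eta> \<longrightarrow> dist (g t) (g 0) < e"
      by (elim exE conjE) (rule that)
    note \<eta> = \<eta>0(1) \<eta>0(2)[rule_format]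
    define t where "t = min \<epsilon> (\<eta> / 2)"
    have t: "t \<in> {0..\<epsilon>}" "0 < t" "t < \<eta>" using \<eta>(1) g(1) by (auto simp: t_def)
    have "dist (g t) l < e" using \<eta>(2)[OF t(1)] t(2,3) unfolding g(4) by simp
    moreover have "g t \<in> \<Sigma>" using g(5)[OF t(1)] by (simp only: \<Sigma>_def mem_Collect_eq)
    ultimately have "g t = l" by (intro e(2)) (simp_all only: dist_commute)
    then have "t = 0" by (intro inj_onD[OF g(3) _ t(1) z0]) (simp only: g(4))
    with t(2) show False by simp
  qed
  show "\<exists>\<Gamma>. (\<forall>S\<in>\<Gamma>. is_analytic_curve S) \<and> \<Sigma> = (\<Union>S\<in>\<Gamma>. closure S)"
  \<comment> \<open>All analytic curves inside the set are taken. Closedness keeps their closures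
    inside, and every point is the starting point of one of them.\<close>
  proof (intro exI[of _ "{S. is_analytic_curve S \<and> S \<subseteq> \<Sigma>}"] conjI)
    show "\<Sigma> = (\<Union>S\<in>{S. is_analytic_curve S \<and> S \<subseteq> \<Sigma>}. closure S)"
    proof (intro subset_antisym subsetI)
      fix l assume "l \<in> \<Sigma>"
      then have "D l \<in> complex_of_real ` {-2..2}" by (simp add: \<Sigma>_def)
      then obtain g \<epsilon> where g: "0 < (\<epsilon>::real)" "continuous_on {0..\<epsilon>} g" "inj_on g {0..\<epsilon>}" "g 0 = l"
        "\<And>t. t \<in> {0..\<epsilon>} \<Longrightarrow> D (g t) \<in> complex_of_real ` {-2..2}" "\<And>t. t \<in> {0<..<\<epsilon>} \<Longrightarrow> real_analytic_at g t"
        by (rule analytic_curve_through[OF D]) (rule that)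
      have "is_analytic_curve (g ` {0..\<epsilon>})" unfolding is_analytic_curve_def
      proof (intro exI[of _ "{0..\<epsilon>}"] exI[of _ g] conjI ballI refl g(2,3) is_interval_cc)
        show "interior {0..\<epsilon>} \<noteq> {}" using g(1) by simp
        fix t assume "t \<in> interior {0..\<epsilon>}"
        then show "real_analytic_at g t" by (intro g(6)) simp
      qed
      moreover have "g ` {0..\<epsilon>} \<subseteq> \<Sigma>" unfolding \<Sigma>_def using g(5) by blast
      moreover have "l \<in> g ` {0..\<epsilon>}" by (rule image_eqI[of _ _ 0]) (use g(1,4) in simp_all)
      then have "l \<in> closure (g ` {0..\<epsilon>})" by (rule subsetD[OF closure_subset])
      ultimately show "l \<in> (\<Union>S\<in>{S. is_analytic_curve S \<and> S \<subseteq> \<Sigma>}. closure S)"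
        by (intro UN_I[of "g ` {0..\<epsilon>}"] CollectI conjI)
    next
      fix l assume "l \<in> (\<Union>S\<in>{S. is_analytic_curve S \<and> S \<subseteq> \<Sigma>}. closure S)"
      then obtain S where "S \<subseteq> \<Sigma>" "l \<in> closure S" by blast
      then show "l \<in> \<Sigma>" using closure_minimal[OF _ cl, of S] by blast
    qed
  qed simp
qed

section \<open>Reflection of the weight, the real spectrum and nonconstancy of D\<close>

context sl_periodic
begin

lemma neg_weight: "sl_periodic a (\<lambda>x. - w x) p q"
proof
  show "(\<lambda>x. - w x) \<in> borel_measurable lebesgue" using w_meas by simp
  show "set_integrable lebesgue {0<..<a} (\<lambda>x. - w x)" using w_int by (simp add: set_integrable_def)
qed (use a_pos p_meas q_meas w_per p_per q_per q_int p_int w_nz p_pos in auto)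

lemma D_neg_weight: "sl_periodic.D a (\<lambda>x. - w x) p q l = D (- l)"
proof -
  interpret N: sl_periodic a "\<lambda>x. - w x" p q by (rule neg_weight)
  have \<beta>: "N.\<beta> l = \<beta> (- l)" by (rule ext) (simp add: N.\<beta>_def \<beta>_def N.W_def W_def)
  have "N.\<phi> l = \<phi> (- l)" "N.\<phi>1 l = \<phi>1 (- l)"
    using hom_unique[OF _ fundamental(1), of "- l" "N.\<phi> l" "N.\<phi>1 l"] N.fundamental(1)[of l] N.fundamental(3,4)[of l] fundamental(3,4)[of "- l"]
    unfolding \<beta> by simp_all
  moreover have "N.\<psi> l = \<psi> (- l)" "N.\<psi>1 l = \<psi>1 (- l)"
    using hom_unique[OF _ fundamental(2), of "- l" "N.\<psi> l" "N.\<psi>1 l"] N.fundamental(2)[of l] N.fundamental(5,6)[of l] fundamental(5,6)[of "- l"]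
    unfolding \<beta> by simp_all
  ultimately show ?thesis by (simp add: N.D_def D_def)
qed

lemma continuous_Re_D: "continuous_on A (\<lambda>s::real. Re (D (complex_of_real s)))"
  by (intro continuous_on_Re continuous_on_compose2[OF holomorphic_on_imp_continuous_on[OF D_holomorphic[of UNIV]]] continuous_on_of_real continuous_on_id subset_UNIV)

lemma real_spectrum_above:
  assumes pos: "\<not> (AE x in lebesgue_on {0<..<a}. w x < 0)"
  shows "\<exists>s\<ge>s0. D (complex_of_real s) = 0"
proof -
  obtain s1 where s1: "s1 \<ge> s0" "2 \<le> Re (D (of_real s1))" using D_oscillates[OF pos, of s0 0] by auto
  obtain s2 where s2: "s2 \<ge> s1" "Re (D (of_real s2)) \<le> - 2" using D_oscillates[OF pos, of s1 1] by auto
  have "\<exists>s\<ge>s1. s \<le> s2 \<and> Re (D (of_real s)) = 0"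
    by (rule IVT2'[of "\<lambda>s. Re (D (complex_of_real s))", OF _ _ s2(1) continuous_Re_D]) (use s1 s2 in auto)
  then obtain s where "s \<ge> s1" "Re (D (of_real s)) = 0" by blast
  then show ?thesis using s1(1) D_real[of s] by (intro exI[of _ s]) simp
qed

lemma real_spectrum_below:
  assumes neg: "\<not> (AE x in lebesgue_on {0<..<a}. w x > 0)"
  shows "\<exists>s\<le>s0. D (complex_of_real s) = 0"
proof -
  interpret N: sl_periodic a "\<lambda>x. - w x" p q by (rule neg_weight)
  obtain s where "s \<ge> - s0" "N.D (complex_of_real s) = 0" using N.real_spectrum_above[of "- s0"] neg by auto
  then show ?thesis unfolding D_neg_weight by (intro exI[of _ "- s"]) simp
qed

text \<open>If neither w nor -w were positive on a set of positive measure, both would be negative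
  almost everywhere on the cell. So the oscillation result applies to one of them, and D takes
  values at least 2 and at most -2.\<close>

lemma D_nonconstant: "\<not> D constant_on UNIV"
proof
  assume "D constant_on UNIV"
  then obtain c where c: "\<And>l. D l = c" by (auto simp: constant_on_def)
  have nonneg: "AE x in lebesgue_on {0<..<a}. w x < 0"
  proof (rule ccontr)
    assume "\<not> ?thesis"
    from D_oscillates[OF this, of 0 0] D_oscillates[OF this, of 0 1] c show False by auto
  qed
  interpret N: sl_periodic a "\<lambda>x. - w x" p q by (rule neg_weight)
  have "AE x in lebesgue_on {0<..<a}. - w x < 0"
  proof (rule ccontr)
    assume "\<not> ?thesis"
    from N.D_oscillates[OF this, of 0 0] N.D_oscillates[OF this, of 0 1] c show False by (auto simp: D_neg_weight)
  qed
  with nonneg have "AE x in lebesgue_on {0<..<a}. False" by eventually_elim simp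
  then have "AE x in lebesgue. x \<notin> {0<..<a}" by (simp add: AE_restrict_space_iff)
  then have "{0<..<a} \<in> null_sets lebesgue" by (subst (asm) AE_iff_null_sets[symmetric]) auto
  then have "emeasure lebesgue {0<..<a} = 0" by (rule null_setsD1)
  then show False using a_pos by simp
qed

end

theorem theorem2p7:
  fixes a :: real and w p q :: "real \<Rightarrow> real"
  assumes "a > 0"
    and "w \<in> borel_measurable lebesgue"
    and "p \<in> borel_measurable lebesgue"
    and "q \<in> borel_measurable lebesgue"
    and "\<And>x. w (x + a) = w x"
    and "\<And>x. p (x + a) = p x"
    and "\<And>x. q (x + a) = q x"
    and "set_integrable lebesgue {0<..<a} w"
    and "set_integrable lebesgue {0<..<a} q"
    and "set_integrable lebesgue {0<..<a} (\<lambda>x. inverse (p x))"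
    and "AE x in lebesgue. w x \<noteq> 0"
    and "AE x in lebesgue. p x > 0"
  shows "(sigma_A w p q = (\<Union>t\<in>{-pi..pi}. sigma_At w p q a t)
          \<and> (\<Union>t\<in>{-pi..pi}. sigma_At w p q a t) = (\<Union>t\<in>{0..pi}. sigma_At w p q a t)
          \<and> (\<Union>t\<in>{0..pi}. sigma_At w p q a t)
              = {l. floquet_discriminant w p q a l \<in> complex_of_real ` {-2..2}})
    \<and> sigma_A w p q = sigma_c_A w p q
    \<and> (interior (sigma_A w p q) = {} \<and> \<not> (\<exists>l. l isolated_in sigma_A w p q))
    \<and> (\<exists>\<Gamma>. (\<forall>S\<in>\<Gamma>. is_analytic_curve S) \<and> sigma_A w p q = (\<Union>S\<in>\<Gamma>. closure S))
    \<and> (\<forall>C\<in>components (rho_A w p q). \<not> bounded C)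
    \<and> (indefinite_weight a w \<longrightarrow>
          \<not> bdd_above {x::real. complex_of_real x \<in> sigma_A w p q}
          \<and> \<not> bdd_below {x::real. complex_of_real x \<in> sigma_A w p q})"
proof -
  interpret sl_periodic a w p q by unfold_locales (use assms in auto)
  let ?\<Sigma> = "{l. D l \<in> complex_of_real ` {-2..2}}"
  \<comment> \<open>One argument covers both parameter ranges, u = -\<pi> and u = 0, because
    \<open>arccos\<close> takes its values in [0, \<pi>].\<close>
  have fib: "(\<Union>t\<in>{u..pi}. sigma_At w p q a t) = ?\<Sigma>" if u: "u \<le> 0" for u
  proof (intro subset_antisym subsetI)
    fix l assume "l \<in> (\<Union>t\<in>{u..pi}. sigma_At w p q a t)"
    then obtain t where t: "D l = complex_of_real (2 * cos t)" unfolding sigma_At_eq by auto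
    have "2 * cos t \<in> {-2..2}" using cos_ge_minus_one[of t] cos_le_one[of t] by auto
    with t show "l \<in> ?\<Sigma>" by blast
  next
    fix l assume "l \<in> ?\<Sigma>"
    then obtain d where d: "D l = of_real d" "-2 \<le> d" "d \<le> 2" by auto
    have "2 * cos (arccos (d / 2)) = d" using d by (simp add: cos_arccos)
    then have "D l = 2 * of_real (cos (arccos (d / 2)))" using d(1) by (metis of_real_mult of_real_numeral)
    moreover have "arccos (d / 2) \<in> {u..pi}" using d u arccos_bounded[of "d / 2"] by auto
    ultimately show "l \<in> (\<Union>t\<in>{u..pi}. sigma_At w p q a t)" unfolding sigma_At_eq by blast
  qed
  have fl: "floquet_discriminant w p q a l = D l" for l by (rule D_eq[symmetric])
  note D = D_holomorphic D_nonconstant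
  have unb: "\<not> bdd_above {x::real. D (complex_of_real x) \<in> complex_of_real ` {-2..2}}"
    "\<not> bdd_below {x::real. D (complex_of_real x) \<in> complex_of_real ` {-2..2}}" if w: "indefinite_weight a w"
  proof -
    have zero: "0 \<in> complex_of_real ` {-2..2}" by (rule image_eqI[of _ _ 0]) auto
    show "\<not> bdd_above {x::real. D (complex_of_real x) \<in> complex_of_real ` {-2..2}}"
    proof
      assume "bdd_above {x::real. D (complex_of_real x) \<in> complex_of_real ` {-2..2}}"
      then obtain M where M: "\<And>x::real. D (complex_of_real x) \<in> complex_of_real ` {-2..2} \<Longrightarrow> x \<le> M" unfolding bdd_above_def by blast
      obtain s where "s \<ge> M + 1" "D (complex_of_real s) = 0" using real_spectrum_above w unfolding indefinite_weight_def by blast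
      with M[of s] zero show False by simp
    qed
    show "\<not> bdd_below {x::real. D (complex_of_real x) \<in> complex_of_real ` {-2..2}}"
    proof
      assume "bdd_below {x::real. D (complex_of_real x) \<in> complex_of_real ` {-2..2}}"
      then obtain M where M: "\<And>x::real. D (complex_of_real x) \<in> complex_of_real ` {-2..2} \<Longrightarrow> M \<le> x" unfolding bdd_below_def by blast
      obtain s where "s \<le> M - 1" "D (complex_of_real s) = 0" using real_spectrum_below w unfolding indefinite_weight_def by blast
      with M[of s] zero show False by simp
    qed
  qed
  have comp: "\<not> bounded C" if "C \<in> components {l. D l \<notin> complex_of_real ` {-2..2}}" for C
  proof (rule components_unbounded[OF D level_set_curves(4)[OF D]])
    show "C \<in> components (- ?\<Sigma>)" using that by (simp add: Compl_eq)
  qed auto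
  show ?thesis
    unfolding sigma_c_A_eq fl sigma_A_eq rho_A_eq
    using fib[of "- pi"] fib[of 0] level_set_curves(1-3)[OF D] comp unb by (intro conjI) auto
qed

end
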